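(* Let $N\ge1$, $k\ge1$ be integers, $1<p<\infty$, $q=p/(p-1)$, $\kappa_0>0$, $\theta_0\in(0,1]$. Let $\Omega_h$ be a conforming simplicial mesh of $\Omega\subset\mathbb{R}^N$ with $|M_K|\,|M_K^{-1}|\le\kappa_0$ for all $K\in\Omega_h$. Let $\beta$ be constant on each element, $\beta|_K\equiv\beta_K\in\mathbb{R}^N\setminus\{0\}$, with continuous normal component across element interfaces, and satisfying the flow conditions (i) and (ii) of the context. Suppose that either $k=1$, or $|\beta_K\cdot n_i|\ge\theta_0|\beta_K|$ for every $K\in\Omega_h$ and every facet $F_i$ of $K$. Let $Y_h$ be a finite-dimensional space with $V_h\subseteq Y_h\subset Y$, and suppose in addition that $V_h^{++}\subseteq Y_h$. Let $f\in L_p(\Omega)$, $\ell(v)=(f,v)_\Omega$, let $u\in W_{p,0}(\partial_\beta,\Omega)$ be the unique solution of $\beta\cdot\nabla u=f$, $\mathcal u=(u,D_hu)$, let $\mathcal u_h$ be the unique minimizer of $\|\ell-\mathcal b(\mathcal w_h,\cdot)\|_{Y_h'}$ over $\mathcal w_h\in X_h$, and let $\eta=\|\ell-\mathcal b(\mathcal u_h,\cdot)\|_{Y_h'}$. Then $$\eta\le\|\mathcal u-\mathcal u_h\|_{\mathcal E}\le\|\varPi_h^{++}\|\,\eta+\|I-\varPi_h^{++}\|\,\operatorname{osc}(f),$$ where the operator norms (on $(Y,\|\cdot\|_Y)$) satisfy $\|\varPi_h^{++}\|\le C_{\varPi^{++}}$ and $\|I-\varPi_h^{++}\|\le1+C_{\varPi^{++}}$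 with a constant $C_{\varPi^{++}}=C_{\varPi^{++}}(N,k,q,\theta_0,\kappa_0)$ independent of the mesh, and independent of $\theta_0$ when $k=1$. In particular, $\operatorname{osc}(f)=0$ if $f$ is piecewise constant on the mesh.
   Context: $\Omega\subset\mathbb{R}^N$ is a Lipschitz polyhedral domain. $\hat K$ is the unit reference $N$-simplex with vertices $\hat a_0,\dots,\hat a_N$. Each $K\in\Omega_h$, with vertices $a_0,\dots,a_N$, is the image of $\hat K$ under an affine homeomorphism $\Phi_K(\hat x)=M_K\hat x+g_K$ mapping $\hat a_i$ to $a_i$; $h_K=\operatorname{diam}K$; $a_K:=h_K/|\beta_K|$. $|\cdot|$ is the Euclidean norm of vectors and the associated matrix norm. $\lambda_i$ are the barycentric coordinates of $K$, $F_i$ the facet of $K$ opposite $a_i$, $n_i$ the outward unit normal on $F_i$; $n$ is the outward unit normal on $\partial\Omega$. Graph spaces: $W_r(\partial_\beta,D)=\{v\in L_r(D):\beta\cdot\nabla v\in L_r(D)\}$ and $W_r(\partial_\beta,\Omega_h)=\prod_KW_r(\partial_\beta,K)$. $\Gamma_{\rm in}=\{x\in\partial\Omega:\beta\cdot n<0\}$, $\Gamma_{\rm out}=\{x\in\partial\Omega:\beta\cdot n>0\}$. Flow conditions: (i) $\overline\Gamma_{\rm in}$ and $\overline\Gamma_{\rm out}$ are disjoint; (ii) there exist $z_\pm\in L_\infty(\Omega)$ with $\beta\cdot\nabla z_\pm\in L_\infty(\Omega)$ and a constant $c_0>0$ such that $-\beta\cdot\nabla z_\pm=c_0$ in $\Omega$,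 $z_+=0$ on $\Gamma_{\rm out}$, $z_-=0$ on $\Gamma_{\rm in}$. Known facts: under (i), for $1<r<\infty$, functions in $W_r(\partial_\beta,\Omega)$ have traces on $\partial\Omega$ in the $|\beta\cdot n|$-weighted $L_r$ sense; $W_{r,0}(\partial_\beta,\Omega)$ is the subspace of functions whose trace vanishes on $\Gamma_{\rm in}$. Under (i),(ii), for every $f\in L_r(\Omega)$ there is a unique $u\in W_{r,0}(\partial_\beta,\Omega)$ with $\beta\cdot\nabla u=f$. $(f,g)_D=\int_Dfg\,dx$. For $w\in W_p(\partial_\beta,K)$, $v\in W_q(\partial_\beta,K)$: $\langle D_Kw,v\rangle=(\beta\cdot\nabla w,v)_K+(w,\beta\cdot\nabla v)_K$. $Y=W_q(\partial_\beta,\Omega_h)$ with norm $$\|v\|_Y^q=\sum_K\big(a_K^{-q}\|v\|_{L_q(K)}^q+\|\beta\cdot\nabla v\|_{L_q(K)}^q\big).$$ For $z\in W_p(\partial_\beta,\Omega)$, $D_hz\in Y'$ is $\langle D_hz,v\rangle=\sum_K\langle D_K(z|_K),v|_K\rangle$. $\hat X_0=D_h(W_{p,0}(\partial_\beta,\Omega))$, $X=L_p(\Omega)\times\hat X_0$, and for $(w,\mu)\in X$, $v\in Y$: $\mathcal b((w,\mu),v)=\langle\mu,v\rangle-\sum_K(w,\beta\cdot\nabla v)_K$. Energy norm: $\|\mathcal w\|_{\mathcal E}=\sup_{0\ne v\in Y}\mathcal b(\mathcal w,v)/\|v\|_Y$. Discrete dual norm: $\|g\|_{Y_h'}=\sup_{0\ne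 v\in Y_h}g(v)/\|v\|_Y$. $P_j(K)$: polynomials of degree at most $j$ on $K$ ($\{0\}$ if $j<0$); $P_j(\Omega_h)=\prod_KP_j(K)$. $S_{h,0}^k=\{z\in P_k(\Omega_h)\cap C(\overline\Omega):z|_{\Gamma_{\rm in}}=0\}$; $X_h=P_{k-1}(\Omega_h)\times D_h(S_{h,0}^k)\subset X$. $\mathring P_j(K)=\{z\in P_j(K):z|_{\partial K}=0\}$ ($=\{0\}$ for $0\le j\le N$); $P_j^\perp(K)$ is its $L_2(K)$-orthogonal complement in $P_j(K)$. $b=\prod_j\lambda_j$, $b_i=\prod_{j\ne i}\lambda_j$, $s_i=\operatorname{sgn}(\beta_K\cdot n_i)$, $b_s=\sum_is_ib_i$, $V(K)=b_sP_k^\perp(K)+bP_{k-2}(K)$, $V_h=\prod_KV(K)$, $V^{++}(K)=V(K)+P_0(K)+\operatorname{span}\{b\}$, $V_h^{++}=\prod_KV^{++}(K)$. Under the stated hypotheses each $v\in W_q(\partial_\beta,K)$ has a unique $\varPi_Kv\in V(K)$ with $\langle D_Kw,\varPi_Kv-v\rangle=0$ for all $w\in P_k^\perp(K)$ and $(z,\varPi_Kv-v)_K=0$ for all $z\in P_{k-2}(K)$. With $\bar v$ the mean of $v$ over $K$, $\varPi_K^+v=\bar v+\varPi_K(v-\bar v)$, $\varPi_K^{++}v=\varPi_K^+v+\frac{(v-\varPi_K^+v,1)_K}{(b,1)_K}b$, and $(\varPi_h^{++}v)|_K=\varPi_K^{++}(v|_K)$. Oscillation: with $m_k=\max\{k-2,0\}$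 and $Q_j:L_1(K)\to P_j(K)$ defined by $(Q_jv,r)_K=(v,r)_K$ for all $r\in P_j(K)$ on each $K$, $\operatorname{osc}(f)=\big(\sum_Ka_K^p\|f-Q_{m_k}f\|_{L_p(K)}^p\big)^{1/p}$. *)

theory Defs
  imports "HOL-Analysis.Analysis"
begin

text \<open>
  The ambient dimension is \<open>N = CARD('n)\<close>. Elements of Lebesgue and graph spaces are represented by
  functions \<open>real ^ 'n \<Rightarrow> real\<close> whose values off the domain under consideration are irrelevant.
  Function spaces are sets of such representatives, closed under changes on null sets, except
  for spaces of polynomials and of continuous functions.
\<close>

type_synonym 'n scalar = "real ^ 'n \<Rightarrow> real"
type_synonym 'n field = "real ^ 'n \<Rightarrow> real ^ 'n"
type_synonym 'n functional = "(real ^ 'n \<Rightarrow> real) \<Rightarrow> real"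

section \<open>Simplices and meshes\<close>

text \<open>
  A simplex is given by its numbered vertices; the index set \<open>{0, \<dots>, N}\<close> is the type
  \<open>'n option\<close>, with \<open>None\<close> playing the role of \<open>0\<close>.
\<close>

type_synonym 'n vsimplex = "'n option \<Rightarrow> real ^ 'n"

definition ref_simplex :: "'n::finite vsimplex" where
  "ref_simplex i = (case i of None \<Rightarrow> 0 | Some j \<Rightarrow> axis j 1)"

definition elem :: "'n::finite vsimplex \<Rightarrow> (real ^ 'n) set" where
  "elem K = convex hull (range K)"

abbreviation cell :: "'n::finite vsimplex \<Rightarrow> (real ^ 'n) set" where
  "cell K \<equiv> interior (elem K)"

definition nondegenerate :: "'n::finite vsimplex \<Rightarrow> bool" where
  "nondegenerate K \<longleftrightarrow> inj K \<and> \<not> affine_dependent (range K)"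

definition is_ref_map :: "'n::finite vsimplex \<Rightarrow> real ^ 'n ^ 'n \<Rightarrow> real ^ 'n \<Rightarrow> bool" where
  "is_ref_map K M g \<longleftrightarrow> (\<forall>i. M *v ref_simplex i + g = K i)"

definition ref_matrix :: "'n::finite vsimplex \<Rightarrow> real ^ 'n ^ 'n" where
  "ref_matrix K = (THE M. \<exists>g. is_ref_map K M g)"

definition mat_norm :: "real ^ 'n ^ 'n \<Rightarrow> real" where
  "mat_norm A = onorm ((*v) A)"

definition facet :: "'n::finite vsimplex \<Rightarrow> 'n option \<Rightarrow> (real ^ 'n) set" where
  "facet K i = convex hull (K ` (UNIV - {i}))"

definition normal :: "'n::finite vsimplex \<Rightarrow> 'n option \<Rightarrow> real ^ 'n" where
  "normal K i = (THE n. norm n = 1 \<and> (\<forall>x\<in>facet K i. \<forall>y\<in>facet K i. n \<bullet> (x - y) = 0)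
     \<and> (\<forall>x\<in>facet K i. n \<bullet> (K i - x) < 0))"

definition bary :: "'n::finite vsimplex \<Rightarrow> 'n option \<Rightarrow> 'n scalar" where
  "bary K i x = (THE l. (\<Sum>j\<in>UNIV. l j) = 1 \<and> (\<Sum>j\<in>UNIV. l j *\<^sub>R K j) = x) i"

text \<open>
  Surface measure on a facet: the area of a flat set equals the volume of the prism of height
  one erected over it, and on that prism the nearest-point map is the orthogonal projection
  onto the facet. For \<open>N = 1\<close> this is the unit point mass.
\<close>

definition facet_measure :: "'n::finite vsimplex \<Rightarrow> 'n option \<Rightarrow> (real ^ 'n) measure" where
  "facet_measure K i =
     distr (lebesgue_on {x + t *\<^sub>R normal K i | x t. x \<in> facet K i \<and> 0 \<le> t \<and> t \<le> 1})
       borel (closest_point (facet K i))"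

definition lipschitz_domain :: "(real ^ 'n::finite) set \<Rightarrow> bool" where
  "lipschitz_domain \<Omega> \<longleftrightarrow> open \<Omega> \<and> connected \<Omega> \<and> bounded \<Omega> \<and> \<Omega> \<noteq> {} \<and>
     (\<forall>x\<in>frontier \<Omega>. \<exists>U e L \<gamma>. open U \<and> x \<in> U \<and> norm e = 1 \<and>
        L-lipschitz_on {y. y \<bullet> e = 0} (\<gamma> :: 'n scalar) \<and>
        \<Omega> \<inter> U = {y \<in> U. y \<bullet> e < \<gamma> (y - (y \<bullet> e) *\<^sub>R e)})"

definition polyhedral :: "(real ^ 'n::finite) set \<Rightarrow> bool" where
  "polyhedral \<Omega> \<longleftrightarrow> (\<exists>P. finite P \<and> (\<forall>S\<in>P. polytope S) \<and> \<Union>P = closure \<Omega>)"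

definition conforming_mesh :: "(real ^ 'n::finite) set \<Rightarrow> 'n vsimplex set \<Rightarrow> bool" where
  "conforming_mesh \<Omega> \<T> \<longleftrightarrow> finite \<T> \<and> (\<forall>K\<in>\<T>. nondegenerate K) \<and> (\<Union>K\<in>\<T>. elem K) = closure \<Omega> \<and>
     (\<forall>K\<in>\<T>. \<forall>K'\<in>\<T>. K \<noteq> K' \<longrightarrow> range K \<noteq> range K' \<and>
        elem K \<inter> elem K' = convex hull (range K \<inter> range K'))"

section \<open>The advection field\<close>

definition beta_on :: "'n::finite field \<Rightarrow> 'n vsimplex \<Rightarrow> real ^ 'n" where
  "beta_on \<beta> K = (THE c. \<forall>x\<in>cell K. \<beta> x = c)"

definition admissible_field :: "'n::finite vsimplex set \<Rightarrow> 'n field \<Rightarrow> bool" where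
  "admissible_field \<T> \<beta> \<longleftrightarrow>
     (\<forall>K\<in>\<T>. \<exists>c. c \<noteq> 0 \<and> (\<forall>x\<in>cell K. \<beta> x = c)) \<and>
     (\<forall>K\<in>\<T>. \<forall>K'\<in>\<T>. \<forall>i j. facet K i = facet K' j \<longrightarrow>
        beta_on \<beta> K \<bullet> normal K i = beta_on \<beta> K' \<bullet> normal K i)"

abbreviation beta_n :: "'n::finite field \<Rightarrow> 'n vsimplex \<Rightarrow> 'n option \<Rightarrow> real" where
  "beta_n \<beta> K i \<equiv> beta_on \<beta> K \<bullet> normal K i"

definition bdry_facets :: "(real ^ 'n::finite) set \<Rightarrow> 'n vsimplex set \<Rightarrow> ('n vsimplex \<times> 'n option) set" where
  "bdry_facets \<Omega> \<T> = {(K, i). K \<in> \<T> \<and> facet K i \<subseteq> frontier \<Omega>}"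

text \<open>
  On the boundary, \<open>\<beta> \<bullet> n\<close> is defined off the relative boundaries of the boundary facets only.
\<close>

definition Gamma_in :: "(real ^ 'n::finite) set \<Rightarrow> 'n vsimplex set \<Rightarrow> 'n field \<Rightarrow> (real ^ 'n) set" where
  "Gamma_in \<Omega> \<T> \<beta> =
     \<Union> {rel_interior (facet K i) | K i. (K, i) \<in> bdry_facets \<Omega> \<T> \<and> beta_n \<beta> K i < 0}"

definition Gamma_out :: "(real ^ 'n::finite) set \<Rightarrow> 'n vsimplex set \<Rightarrow> 'n field \<Rightarrow> (real ^ 'n) set" where
  "Gamma_out \<Omega> \<T> \<beta> =
     \<Union> {rel_interior (facet K i) | K i. (K, i) \<in> bdry_facets \<Omega> \<T> \<and> beta_n \<beta> K i > 0}"

definition elem_scale :: "'n::finite field \<Rightarrow> 'n vsimplex \<Rightarrow> real" where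
  "elem_scale \<beta> K = diameter (elem K) / norm (beta_on \<beta> K)"

section \<open>Lebesgue spaces, graph spaces and traces\<close>

definition Lsp :: "real \<Rightarrow> (real ^ 'n::finite) set \<Rightarrow> 'n scalar set" where
  "Lsp r D = {v. v \<in> borel_measurable (lebesgue_on D) \<and>
     integrable (lebesgue_on D) (\<lambda>x. \<bar>v x\<bar> powr r)}"

definition Lnorm :: "real \<Rightarrow> (real ^ 'n::finite) set \<Rightarrow> 'n scalar \<Rightarrow> real" where
  "Lnorm r D v = (LINT x|lebesgue_on D. \<bar>v x\<bar> powr r) powr (1 / r)"

definition Linfty :: "(real ^ 'n::finite) set \<Rightarrow> 'n scalar set" where
  "Linfty D = {v. v \<in> borel_measurable (lebesgue_on D) \<and> (\<exists>c. AE x in lebesgue_on D. \<bar>v x\<bar> \<le> c)}"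

definition ip :: "(real ^ 'n::finite) set \<Rightarrow> 'n scalar \<Rightarrow> 'n scalar \<Rightarrow> real" where
  "ip D v w = (LINT x|lebesgue_on D. v x * w x)"

primrec C_diff :: "nat \<Rightarrow> 'n::finite scalar \<Rightarrow> bool" where
  "C_diff 0 \<phi> \<longleftrightarrow> continuous_on UNIV \<phi>"
| "C_diff (Suc m) \<phi> \<longleftrightarrow> (\<forall>x. \<phi> differentiable at x) \<and>
     (\<forall>i. C_diff m (\<lambda>x. frechet_derivative \<phi> (at x) (axis i 1)))"

definition test_functions :: "(real ^ 'n::finite) set \<Rightarrow> 'n scalar set" where
  "test_functions D = {\<phi>. (\<forall>m. C_diff m \<phi>) \<and>
     compact (closure {x. \<phi> x \<noteq> 0}) \<and> closure {x. \<phi> x \<noteq> 0} \<subseteq> D}"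

text \<open>
  \<open>weak_deriv \<beta> D v g\<close> says \<open>\<beta> \<bullet> \<nabla>v = g\<close> in the distributional sense on the open set \<open>D\<close>. The fields
  considered have zero distributional divergence, so \<open>\<beta> \<bullet> \<nabla>v = div (v \<beta>)\<close>.
\<close>

definition weak_deriv :: "'n::finite field \<Rightarrow> (real ^ 'n) set \<Rightarrow> 'n scalar \<Rightarrow> 'n scalar \<Rightarrow> bool" where
  "weak_deriv \<beta> D v g \<longleftrightarrow> (\<forall>\<phi>\<in>test_functions D.
     ip D v (\<lambda>x. frechet_derivative \<phi> (at x) (\<beta> x)) = - ip D g \<phi>)"

definition Wsp :: "real \<Rightarrow> 'n::finite field \<Rightarrow> (real ^ 'n) set \<Rightarrow> 'n scalar set" where
  "Wsp r \<beta> D = {v \<in> Lsp r D. \<exists>g\<in>Lsp r D. weak_deriv \<beta> D v g}"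

text \<open>
  A representative of \<open>\<beta> \<bullet> \<nabla>v\<close>, unique up to null sets. On bounded \<open>D\<close> the space \<open>L_r(D)\<close> is contained
  in \<open>L_1(D)\<close>, so the exponent need not be carried along.
\<close>

definition bgrad :: "'n::finite field \<Rightarrow> (real ^ 'n) set \<Rightarrow> 'n scalar \<Rightarrow> 'n scalar" where
  "bgrad \<beta> D v = (SOME g. g \<in> Lsp 1 D \<and> weak_deriv \<beta> D v g)"

text \<open>
  The trace of \<open>v\<close> in the \<open>|\<beta> \<bullet> n|\<close>-weighted \<open>L_r\<close> sense is determined, where \<open>\<beta> \<bullet> n \<noteq> 0\<close>, by Green's
  formula against restrictions of smooth functions.
\<close>

definition is_trace ::
  "(real ^ 'n::finite) set \<Rightarrow> 'n vsimplex set \<Rightarrow> 'n field \<Rightarrow> real \<Rightarrow> 'n scalar \<Rightarrow> 'n scalar \<Rightarrow> bool" where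
  "is_trace \<Omega> \<T> \<beta> r v g \<longleftrightarrow> g \<in> borel_measurable borel \<and>
     (\<forall>(K, i)\<in>bdry_facets \<Omega> \<T>.
        integrable (facet_measure K i) (\<lambda>x. \<bar>beta_n \<beta> K i\<bar> * \<bar>g x\<bar> powr r)) \<and>
     (\<forall>\<phi>\<in>test_functions UNIV.
        ip \<Omega> (bgrad \<beta> \<Omega> v) \<phi> + ip \<Omega> v (\<lambda>x. frechet_derivative \<phi> (at x) (\<beta> x)) =
        (\<Sum>(K, i)\<in>bdry_facets \<Omega> \<T>. LINT x|facet_measure K i. beta_n \<beta> K i * g x * \<phi> x))"

definition trace_vanishes ::
  "(real ^ 'n::finite) set \<Rightarrow> 'n vsimplex set \<Rightarrow> 'n field \<Rightarrow> real \<Rightarrow> 'n scalar \<Rightarrow> (real ^ 'n) set \<Rightarrow> bool" where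
  "trace_vanishes \<Omega> \<T> \<beta> r v G \<longleftrightarrow> (\<exists>g. is_trace \<Omega> \<T> \<beta> r v g \<and>
     (\<forall>(K, i)\<in>bdry_facets \<Omega> \<T>. AE x in facet_measure K i. x \<in> G \<longrightarrow> g x = 0))"

definition W0sp ::
  "(real ^ 'n::finite) set \<Rightarrow> 'n vsimplex set \<Rightarrow> 'n field \<Rightarrow> real \<Rightarrow> 'n scalar set" where
  "W0sp \<Omega> \<T> \<beta> r = {v \<in> Wsp r \<beta> \<Omega>. trace_vanishes \<Omega> \<T> \<beta> r v (Gamma_in \<Omega> \<T> \<beta>)}"

definition flow_condition_i :: "(real ^ 'n::finite) set \<Rightarrow> 'n vsimplex set \<Rightarrow> 'n field \<Rightarrow> bool" where
  "flow_condition_i \<Omega> \<T> \<beta> \<longleftrightarrow>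
     closure (Gamma_in \<Omega> \<T> \<beta>) \<inter> closure (Gamma_out \<Omega> \<T> \<beta>) = {}"

text \<open>
  The functions below lie in \<open>W_r(\<partial>\<^sub>\<beta>, \<Omega>)\<close> for every finite \<open>r\<close> and their traces do not depend
  on \<open>r\<close>, so it is immaterial which exponent \<open>r > 1\<close> is used.
\<close>

definition flow_condition_ii :: "(real ^ 'n::finite) set \<Rightarrow> 'n vsimplex set \<Rightarrow> 'n field \<Rightarrow> bool" where
  "flow_condition_ii \<Omega> \<T> \<beta> \<longleftrightarrow> (\<exists>zp\<in>Linfty \<Omega>. \<exists>zm\<in>Linfty \<Omega>. \<exists>c0>0.
     weak_deriv \<beta> \<Omega> zp (\<lambda>_. - c0) \<and> weak_deriv \<beta> \<Omega> zm (\<lambda>_. - c0) \<and>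
     (\<exists>r>1. trace_vanishes \<Omega> \<T> \<beta> r zp (Gamma_out \<Omega> \<T> \<beta>)) \<and>
     (\<exists>r>1. trace_vanishes \<Omega> \<T> \<beta> r zm (Gamma_in \<Omega> \<T> \<beta>)))"

section \<open>The variational formulation\<close>

definition DK :: "'n::finite field \<Rightarrow> 'n vsimplex \<Rightarrow> 'n scalar \<Rightarrow> 'n functional" where
  "DK \<beta> K w v = ip (cell K) (bgrad \<beta> (cell K) w) v + ip (cell K) w (bgrad \<beta> (cell K) v)"

definition Dh :: "'n::finite vsimplex set \<Rightarrow> 'n field \<Rightarrow> 'n scalar \<Rightarrow> 'n functional" where
  "Dh \<T> \<beta> z v = (\<Sum>K\<in>\<T>. DK \<beta> K z v)"

definition Ysp :: "'n::finite vsimplex set \<Rightarrow> 'n field \<Rightarrow> real \<Rightarrow> 'n scalar set" where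
  "Ysp \<T> \<beta> q = {v. \<forall>K\<in>\<T>. v \<in> Wsp q \<beta> (cell K)}"

definition Ynorm :: "'n::finite vsimplex set \<Rightarrow> 'n field \<Rightarrow> real \<Rightarrow> 'n scalar \<Rightarrow> real" where
  "Ynorm \<T> \<beta> q v =
     (\<Sum>K\<in>\<T>. elem_scale \<beta> K powr (- q) * Lnorm q (cell K) v powr q
            + Lnorm q (cell K) (bgrad \<beta> (cell K) v) powr q) powr (1 / q)"

definition nonzero :: "'n::finite vsimplex set \<Rightarrow> 'n scalar \<Rightarrow> bool" where
  "nonzero \<T> v \<longleftrightarrow> \<not> (\<forall>K\<in>\<T>. AE x in lebesgue_on (cell K). v x = 0)"

definition bform :: "'n::finite vsimplex set \<Rightarrow> 'n field \<Rightarrow> 'n scalar \<times> 'n functional \<Rightarrow> 'n functional" where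
  "bform \<T> \<beta> W v = snd W v - (\<Sum>K\<in>\<T>. ip (cell K) (fst W) (bgrad \<beta> (cell K) v))"

text \<open>Suprema are taken in the extended reals, so that they are meaningful without a boundedness proof.\<close>

definition dual_norm ::
  "'n::finite vsimplex set \<Rightarrow> 'n field \<Rightarrow> real \<Rightarrow> 'n scalar set \<Rightarrow> 'n functional \<Rightarrow> ereal" where
  "dual_norm \<T> \<beta> q S g = (SUP v\<in>{v \<in> S. nonzero \<T> v}. ereal (g v / Ynorm \<T> \<beta> q v))"

definition energy_norm ::
  "'n::finite vsimplex set \<Rightarrow> 'n field \<Rightarrow> real \<Rightarrow> 'n scalar \<times> 'n functional \<Rightarrow> ereal" where
  "energy_norm \<T> \<beta> q W = dual_norm \<T> \<beta> q (Ysp \<T> \<beta> q) (bform \<T> \<beta> W)"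

definition op_norm ::
  "'n::finite vsimplex set \<Rightarrow> 'n field \<Rightarrow> real \<Rightarrow> ('n scalar \<Rightarrow> 'n scalar) \<Rightarrow> ereal" where
  "op_norm \<T> \<beta> q A =
     (SUP v\<in>{v \<in> Ysp \<T> \<beta> q. nonzero \<T> v}. ereal (Ynorm \<T> \<beta> q (A v) / Ynorm \<T> \<beta> q v))"

definition finite_dim_subspace :: "'n::finite vsimplex set \<Rightarrow> 'n scalar set \<Rightarrow> 'n scalar set \<Rightarrow> bool" where
  "finite_dim_subspace \<T> Y Yh \<longleftrightarrow> (\<exists>B. finite B \<and> B \<subseteq> Y \<and>
     Yh = {v \<in> Y. \<exists>c. \<forall>K\<in>\<T>. AE x in lebesgue_on (cell K). v x = (\<Sum>e\<in>B. c e * e x)})"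

section \<open>Discrete spaces\<close>

definition polys :: "int \<Rightarrow> 'n::finite scalar set" where
  "polys j = range (\<lambda>(c :: ('n \<Rightarrow> nat) \<Rightarrow> real) x.
     \<Sum>\<alpha> | int (\<Sum>i\<in>UNIV. \<alpha> i) \<le> j. c \<alpha> * (\<Prod>i\<in>UNIV. (x $ i) ^ \<alpha> i))"

definition broken :: "'n::finite vsimplex set \<Rightarrow> ('n vsimplex \<Rightarrow> 'n scalar set) \<Rightarrow> 'n scalar set" where
  "broken \<T> S = {v. \<forall>K\<in>\<T>. \<exists>w\<in>S K. AE x in lebesgue_on (cell K). v x = w x}"

definition Sh0 ::
  "(real ^ 'n::finite) set \<Rightarrow> 'n vsimplex set \<Rightarrow> 'n field \<Rightarrow> nat \<Rightarrow> 'n scalar set" where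
  "Sh0 \<Omega> \<T> \<beta> k = {z. continuous_on (closure \<Omega>) z \<and>
     (\<forall>K\<in>\<T>. \<exists>w\<in>polys (int k). \<forall>x\<in>elem K. z x = w x) \<and> (\<forall>x\<in>Gamma_in \<Omega> \<T> \<beta>. z x = 0)}"

definition Xh ::
  "(real ^ 'n::finite) set \<Rightarrow> 'n vsimplex set \<Rightarrow> 'n field \<Rightarrow> nat \<Rightarrow> ('n scalar \<times> 'n functional) set" where
  "Xh \<Omega> \<T> \<beta> k = broken \<T> (\<lambda>_. polys (int k - 1)) \<times> Dh \<T> \<beta> ` Sh0 \<Omega> \<T> \<beta> k"

definition polys_ring :: "'n::finite vsimplex \<Rightarrow> int \<Rightarrow> 'n scalar set" where
  "polys_ring K j = {z \<in> polys j. \<forall>x\<in>frontier (elem K). z x = 0}"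

definition polys_perp :: "'n::finite vsimplex \<Rightarrow> int \<Rightarrow> 'n scalar set" where
  "polys_perp K j = {z \<in> polys j. \<forall>r\<in>polys_ring K j. ip (cell K) z r = 0}"

definition bubble :: "'n::finite vsimplex \<Rightarrow> 'n scalar" where
  "bubble K x = (\<Prod>j\<in>UNIV. bary K j x)"

definition facet_bubble :: "'n::finite vsimplex \<Rightarrow> 'n option \<Rightarrow> 'n scalar" where
  "facet_bubble K i x = (\<Prod>j\<in>UNIV - {i}. bary K j x)"

definition signed_bubble :: "'n::finite field \<Rightarrow> 'n vsimplex \<Rightarrow> 'n scalar" where
  "signed_bubble \<beta> K x = (\<Sum>i\<in>UNIV. sgn (beta_n \<beta> K i) * facet_bubble K i x)"

definition VK :: "'n::finite field \<Rightarrow> nat \<Rightarrow> 'n vsimplex \<Rightarrow> 'n scalar set" where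
  "VK \<beta> k K = {(\<lambda>x. signed_bubble \<beta> K x * r x + bubble K x * t x) | r t.
                 r \<in> polys_perp K (int k) \<and> t \<in> polys (int k - 2)}"

definition VKpp :: "'n::finite field \<Rightarrow> nat \<Rightarrow> 'n vsimplex \<Rightarrow> 'n scalar set" where
  "VKpp \<beta> k K = {(\<lambda>x. w x + c x + d * bubble K x) | w c d. w \<in> VK \<beta> k K \<and> c \<in> polys 0}"

section \<open>The projections and the oscillation\<close>

definition PiK :: "'n::finite field \<Rightarrow> nat \<Rightarrow> 'n vsimplex \<Rightarrow> 'n scalar \<Rightarrow> 'n scalar" where
  "PiK \<beta> k K v = (THE w. w \<in> VK \<beta> k K \<and>
     (\<forall>z\<in>polys_perp K (int k). DK \<beta> K z (\<lambda>x. w x - v x) = 0) \<and>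
     (\<forall>z\<in>polys (int k - 2). ip (cell K) z (\<lambda>x. w x - v x) = 0))"

definition mean :: "'n::finite vsimplex \<Rightarrow> 'n scalar \<Rightarrow> real" where
  "mean K v = (LINT x|lebesgue_on (cell K). v x) / measure lebesgue (cell K)"

definition PiKp :: "'n::finite field \<Rightarrow> nat \<Rightarrow> 'n vsimplex \<Rightarrow> 'n scalar \<Rightarrow> 'n scalar" where
  "PiKp \<beta> k K v = (\<lambda>x. mean K v + PiK \<beta> k K (\<lambda>y. v y - mean K v) x)"

definition PiKpp :: "'n::finite field \<Rightarrow> nat \<Rightarrow> 'n vsimplex \<Rightarrow> 'n scalar \<Rightarrow> 'n scalar" where
  "PiKpp \<beta> k K v = (\<lambda>x. PiKp \<beta> k K v x +
     ip (cell K) (\<lambda>y. v y - PiKp \<beta> k K v y) (\<lambda>_. 1) / ip (cell K) (bubble K) (\<lambda>_. 1) * bubble K x)"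

definition Pihpp :: "'n::finite vsimplex set \<Rightarrow> 'n field \<Rightarrow> nat \<Rightarrow> 'n scalar \<Rightarrow> 'n scalar" where
  "Pihpp \<T> \<beta> k v = (\<lambda>x. \<Sum>K\<in>\<T>. indicator (cell K) x * PiKpp \<beta> k K v x)"

definition QK :: "int \<Rightarrow> 'n::finite vsimplex \<Rightarrow> 'n scalar \<Rightarrow> 'n scalar" where
  "QK j K v = (THE w. w \<in> polys j \<and> (\<forall>r\<in>polys j. ip (cell K) w r = ip (cell K) v r))"

definition osc :: "'n::finite vsimplex set \<Rightarrow> 'n field \<Rightarrow> real \<Rightarrow> nat \<Rightarrow> 'n scalar \<Rightarrow> real" where
  "osc \<T> \<beta> p k f =
     (\<Sum>K\<in>\<T>. elem_scale \<beta> K powr p *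
        Lnorm p (cell K) (\<lambda>x. f x - QK (max (int k - 2) 0) K f x) powr p) powr (1 / p)"

definition residual ::
  "(real ^ 'n::finite) set \<Rightarrow> 'n vsimplex set \<Rightarrow> 'n field \<Rightarrow> 'n scalar \<Rightarrow> 'n scalar \<times> 'n functional \<Rightarrow> 'n functional" where
  "residual \<Omega> \<T> \<beta> f W v = ip \<Omega> f v - bform \<T> \<beta> W v"

definition is_minimizer ::
  "(real ^ 'n::finite) set \<Rightarrow> 'n vsimplex set \<Rightarrow> 'n field \<Rightarrow> real \<Rightarrow> nat \<Rightarrow> 'n scalar set \<Rightarrow> 'n scalar
   \<Rightarrow> 'n scalar \<times> 'n functional \<Rightarrow> bool" where
  "is_minimizer \<Omega> \<T> \<beta> q k Yh f U \<longleftrightarrow> U \<in> Xh \<Omega> \<T> \<beta> k \<and>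
     (\<forall>W\<in>Xh \<Omega> \<T> \<beta> k. dual_norm \<T> \<beta> q Yh (residual \<Omega> \<T> \<beta> f U) \<le> dual_norm \<T> \<beta> q Yh (residual \<Omega> \<T> \<beta> f W))"

end

theory Submission
  imports Defs
begin

text \<open>
  For a discrete pair \<open>(uh, D\<^sub>h z)\<close> the functional \<open>\<ell> - b((uh, D\<^sub>h z), \<cdot>)\<close> on the broken space \<open>Y\<close> coincides with
  the error functional \<open>b(u - uh, D\<^sub>h u - D\<^sub>h z)\<close>, because \<open>\<beta> \<bullet> \<nabla>u = f\<close> on every cell. Its discrete parts are
  annihilated by \<open>v - \<Pi>v\<close>, where \<open>\<Pi>\<close> is the projection onto \<open>V\<^sup>+\<^sup>+\<close>; what remains is \<open>(f - Qf, v - \<Pi>v)\<close>, which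
  Hoelder's inequality bounds by the oscillation.

  The projection exists because, with the signed bubble, \<open>\<langle>D\<^sub>K z, b\<^sub>s r\<rangle> = \<Sum>\<^sub>i |\<beta> \<bullet> n\<^sub>i| \<integral>\<^bsub>F\<^sub>i\<^esub> b\<^sub>i z r\<close> is a positive definite form on
  \<open>P\<^sub>k\<^sup>\<bottom>(K)\<close>: a polynomial with vanishing form vanishes on all facets. If \<open>k = 1\<close>, vanishing on two facets
  is enough for this, and some pair of facets always has \<open>|\<beta> \<bullet> n\<^sub>i|\<close> bounded from below, which is why
  \<open>\<theta>\<^sub>0\<close> does not enter. On \<open>P\<^sub>k\<^sup>\<bottom>(K)\<close> the forms \<open>\<integral>\<^bsub>F\<^sub>i\<^esub> b\<^sub>i z\<^sup>2\<close> are compared with the maximum norm on the reference simplex,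
  so that the bounds for \<open>\<Pi>\<close> depend on the shape regularity only.
\<close>

section \<open>Polynomials\<close>

text \<open>An element of the graph space has only a distributional derivative, tested with
  compactly supported functions, so neither a trace nor a Green formula on a simplex is at hand. A
  single integration by parts suffices: an integrable v against a polynomial that vanishes on the
  boundary of K. The polynomial is approximated by its products with cutoffs; its linear decay at
  the facets balances the steepening of the cutoffs. The boundary integrals that remain contain
  polynomials only and are encoded as volume integrals of derivatives.

  Since the interior bubble vanishes on the boundary, it does not contribute to \<open>DK\<close>
  against polynomials. The equations for the two parts \<open>r\<close> and \<open>t\<close> of the
  projection are therefore triangular: a Riesz problem for \<open>r\<close>, then one for
  \<open>t\<close>. Inserting \<open>r\<close> and \<open>t\<close> themselves as test functions
  gives the bounds.

  In the scaling the Jacobian appears only as a ratio of volumes. Shape regularity acts through the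
  inverse inequality alone, where the length of the pulled-back field has to be compared with that
  of the field itself.\<close>

inductive pol :: "nat \<Rightarrow> 'n::finite scalar \<Rightarrow> bool" where
  pol_const: "pol m (\<lambda>x. c)"
| pol_add: "pol m f \<Longrightarrow> pol m g \<Longrightarrow> pol m (\<lambda>x. f x + g x)"
| pol_coord: "pol m f \<Longrightarrow> pol (Suc m) (\<lambda>x. x $ i * f x)"

lemma pol_Suc: "pol m f \<Longrightarrow> pol (Suc m) f"
  by (induction rule: pol.induct) (auto intro: pol.intros)

lemma pol_mono: "m \<le> n \<Longrightarrow> pol m f \<Longrightarrow> pol n f"
  by (induction rule: dec_induct) (auto intro: pol_Suc)

lemma pol_cmult: "pol m f \<Longrightarrow> pol m (\<lambda>x. c * f x)"
proof (induction rule: pol.induct)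
  case (pol_const m d) show ?case by (rule pol.pol_const)
next
  case (pol_add m f g)
  then show ?case by (simp add: distrib_left pol.pol_add)
next
  case (pol_coord m f i)
  have "(\<lambda>x. c * (x $ i * f x)) = (\<lambda>x. x $ i * (c * f x))" by (simp add: ac_simps)
  then show ?case using pol.pol_coord[OF pol_coord.IH, of i] by simp
qed

lemma pol_mult:
  assumes "pol m f" and g: "pol n g"
  shows "pol (m + n) (\<lambda>x. f x * g x)"
  using assms(1)
proof (induction rule: pol.induct)
  case (pol_const m c)
  show ?case by (rule pol_mono[of n]) (simp_all add: g pol_cmult)
next
  case (pol_add m f g)
  then show ?case by (simp add: distrib_right pol.pol_add)
next
  case (pol_coord m f i)
  then show ?case using pol.pol_coord[OF pol_coord.IH, of i] by (simp add: mult.assoc)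
qed

lemma pol_diff: "pol m f \<Longrightarrow> pol m g \<Longrightarrow> pol m (\<lambda>x. f x - g x)"
  using pol_add[of m f "\<lambda>x. -1 * g x"] pol_cmult[of m g "-1"] by simp

lemma pol_sum: "(\<And>a. a \<in> A \<Longrightarrow> pol m (f a)) \<Longrightarrow> pol m (\<lambda>x. \<Sum>a\<in>A. f a x)"
  by (induction A rule: infinite_finite_induct) (auto intro: pol.intros)

lemma pol_prod:
  "(\<And>a. a \<in> A \<Longrightarrow> pol (d a) (f a)) \<Longrightarrow> pol (\<Sum>a\<in>A. d a) (\<lambda>x. \<Prod>a\<in>A. f a x)"
  by (induction A rule: infinite_finite_induct) (auto intro: pol_const pol_mult)

lemma pol_power: "pol m f \<Longrightarrow> pol (j * m) (\<lambda>x. f x ^ j)"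
  by (induction j) (auto intro: pol_const pol_mult)

lemma pol_monomial: "(\<Sum>i\<in>UNIV. \<alpha> i) = s \<Longrightarrow> pol s (\<lambda>x. \<Prod>i\<in>UNIV. (x $ i) ^ \<alpha> i)"
proof -
  assume s: "(\<Sum>i\<in>UNIV. \<alpha> i) = s"
  have "pol 1 (\<lambda>x::real^'a. x $ i)" for i
    using pol_coord[OF pol_const[of 0 1], of i] by simp
  then have "pol (\<alpha> i) (\<lambda>x. (x $ i) ^ \<alpha> i)" for i
    using pol_power[of 1 "\<lambda>x. x $ i" "\<alpha> i"] by simp
  then have "pol (\<Sum>i\<in>UNIV. \<alpha> i) (\<lambda>x. \<Prod>i\<in>UNIV. (x $ i) ^ \<alpha> i)" by (rule pol_prod)
  then show ?thesis by (simp add: s)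
qed

lemma finite_multi_indices: "finite {\<alpha>::'n::finite \<Rightarrow> nat. int (\<Sum>i\<in>UNIV. \<alpha> i) \<le> j}"
proof (rule finite_subset[OF _ finite_PiE[of UNIV "\<lambda>_. {..nat j}"]])
  show "{\<alpha>::'n \<Rightarrow> nat. int (\<Sum>i\<in>UNIV. \<alpha> i) \<le> j} \<subseteq> (\<Pi>\<^sub>E i\<in>UNIV. {..nat j})"
  proof
    fix \<alpha> :: "'n \<Rightarrow> nat" assume "\<alpha> \<in> {\<alpha>. int (\<Sum>i\<in>UNIV. \<alpha> i) \<le> j}"
    then have "(\<Sum>i\<in>UNIV. \<alpha> i) \<le> nat j" by (simp add: nat_le_iff flip: of_nat_sum)
    moreover have "\<alpha> i \<le> (\<Sum>i\<in>UNIV. \<alpha> i)" for i by (rule member_le_sum) auto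
    ultimately show "\<alpha> \<in> (\<Pi>\<^sub>E i\<in>UNIV. {..nat j})" by (auto intro: order_trans)
  qed
qed auto

lemma polys_neg: "j < 0 \<Longrightarrow> polys j = {\<lambda>x. 0}"
proof -
  assume j: "j < 0"
  have "\<not> int (\<Sum>i\<in>UNIV. \<alpha> i) \<le> j" for \<alpha> :: "'a \<Rightarrow> nat"
    using j of_nat_0_le_iff[of "\<Sum>i\<in>UNIV. \<alpha> i"] by linarith
  then show ?thesis unfolding polys_def by (simp del: of_nat_sum)
qed

text \<open>Rule induction on \<open>pol\<close> yields products, affine substitution and
  derivatives without exponent bookkeeping; this equality is the bridge to the sums of
  monomials.\<close>

lemma polys_eq_pol: "polys (int n) = (Collect (pol n) :: 'n::finite scalar set)"
proof (intro set_eqI iffI CollectI)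
  fix f :: "'n scalar" assume "f \<in> polys (int n)"
  then obtain c :: "('n \<Rightarrow> nat) \<Rightarrow> real" where
    f: "f = (\<lambda>x. \<Sum>\<alpha> | int (\<Sum>i\<in>UNIV. \<alpha> i) \<le> int n. c \<alpha> * (\<Prod>i\<in>UNIV. (x $ i) ^ \<alpha> i))"
    unfolding polys_def by (elim rangeE) (rule that)
  show "pol n f" unfolding f
  proof (rule pol_sum)
    fix \<alpha> :: "'n \<Rightarrow> nat" assume "\<alpha> \<in> {\<alpha>. int (\<Sum>i\<in>UNIV. \<alpha> i) \<le> int n}"
    then have le: "(\<Sum>i\<in>UNIV. \<alpha> i) \<le> n" by (simp flip: of_nat_sum)
    have "pol n (\<lambda>x. (\<Prod>i\<in>UNIV. (x $ i) ^ \<alpha> i))" by (rule pol_mono[OF le pol_monomial]) (rule refl)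
    then show "pol n (\<lambda>x. c \<alpha> * (\<Prod>i\<in>UNIV. (x $ i) ^ \<alpha> i))" by (rule pol_cmult)
  qed
next
  fix f :: "'n scalar" assume "f \<in> Collect (pol n)"
  then have "pol n f" by simp
  then show "f \<in> polys (int n)"
  proof (induction rule: pol.induct)
    case (pol_const m c)
    let ?c = "\<lambda>\<alpha>::'n \<Rightarrow> nat. if \<alpha> = (\<lambda>_. 0) then c else 0"
    have "c = (\<Sum>\<alpha> | int (\<Sum>i\<in>UNIV. \<alpha> i) \<le> int m. ?c \<alpha> * (\<Prod>i\<in>UNIV. (x $ i) ^ \<alpha> i))" for x :: "real^'n"
    proof -
      have "(\<Sum>\<alpha> | int (\<Sum>i\<in>UNIV. \<alpha> i) \<le> int m. ?c \<alpha> * (\<Prod>i\<in>UNIV. (x $ i) ^ \<alpha> i))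
        = (\<Sum>\<alpha> | int (\<Sum>i\<in>UNIV. \<alpha> i) \<le> int m. ?c \<alpha>)"
        by (rule sum.cong[OF refl]) simp
      then show ?thesis using finite_multi_indices[where 'n='n, of "int m"] by (simp add: sum.delta)
    qed
    then show ?case unfolding polys_def by (intro image_eqI[where x="?c"]) auto
  next
    case (pol_add m f g)
    obtain c d where "f = (\<lambda>x. \<Sum>\<alpha> | int (\<Sum>i\<in>UNIV. \<alpha> i) \<le> int m. c \<alpha> * (\<Prod>i\<in>UNIV. (x $ i) ^ \<alpha> i))"
      "g = (\<lambda>x. \<Sum>\<alpha> | int (\<Sum>i\<in>UNIV. \<alpha> i) \<le> int m. d \<alpha> * (\<Prod>i\<in>UNIV. (x $ i) ^ \<alpha> i))"
      using pol_add.IH unfolding polys_def by (elim rangeE) blast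
    then show ?case unfolding polys_def
      by (intro image_eqI[where x="\<lambda>\<alpha>. c \<alpha> + d \<alpha>"]) (auto simp: distrib_right sum.distrib)
  next
    case (pol_coord m f i)
    let ?A = "\<lambda>m. {\<alpha>::'n \<Rightarrow> nat. int (\<Sum>i\<in>UNIV. \<alpha> i) \<le> int m}"
    let ?M = "\<lambda>\<alpha> x. \<Prod>i\<in>UNIV. ((x::real^'n) $ i) ^ \<alpha> i"
    obtain c where f: "f = (\<lambda>x. \<Sum>\<alpha>\<in>?A m. c \<alpha> * ?M \<alpha> x)"
      using pol_coord.IH unfolding polys_def by (elim rangeE) (rule that)
    \<comment> \<open>Multiplication by the coordinate raises the i-th exponent by one, so
      coefficients move along this shift; monomials free of the coordinate receive 0.\<close>
    let ?c = "\<lambda>\<alpha>::'n \<Rightarrow> nat. if \<alpha> i > 0 then c (\<alpha>(i := \<alpha> i - 1)) else 0"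
    have su: "(\<Sum>j\<in>UNIV. (\<alpha>(i := Suc (\<alpha> i))) j) = Suc (\<Sum>j\<in>UNIV. \<alpha> j)" for \<alpha> :: "'n \<Rightarrow> nat"
      by (simp add: sum.remove[of UNIV i])
    have su': "\<alpha> i > 0 \<Longrightarrow> (\<Sum>j\<in>UNIV. \<alpha> j) = Suc (\<Sum>j\<in>UNIV. (\<alpha>(i := \<alpha> i - 1)) j)" for \<alpha> :: "'n \<Rightarrow> nat"
      using su[of "\<alpha>(i := \<alpha> i - 1)"] by simp
    have pr: "?M (\<alpha>(i := Suc (\<alpha> i))) x = x $ i * ?M \<alpha> x" for \<alpha> x
      by (simp add: prod.remove[of UNIV i] mult.assoc)
    have "x $ i * f x = (\<Sum>\<alpha>\<in>?A (Suc m). ?c \<alpha> * ?M \<alpha> x)" for x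
    proof -
      have "(\<Sum>\<alpha>\<in>?A (Suc m). ?c \<alpha> * ?M \<alpha> x) = (\<Sum>\<alpha>\<in>{\<alpha>\<in>?A (Suc m). \<alpha> i > 0}. ?c \<alpha> * ?M \<alpha> x)"
        by (rule sum.mono_neutral_right) (use finite_multi_indices[where 'n='n, of "int (Suc m)"] in auto)
      also have "\<dots> = (\<Sum>\<alpha>\<in>?A m. c \<alpha> * (x $ i * ?M \<alpha> x))"
      proof (rule sum.reindex_bij_witness[where i="\<lambda>\<alpha>. \<alpha>(i := Suc (\<alpha> i))" and j="\<lambda>\<alpha>. \<alpha>(i := \<alpha> i - 1)"])
        fix \<alpha> assume a: "\<alpha> \<in> {\<alpha>\<in>?A (Suc m). \<alpha> i > 0}"
        then show "\<alpha>(i := \<alpha> i - 1) \<in> ?A m" using su'[of \<alpha>] by (simp flip: of_nat_sum)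
        show "c (\<alpha>(i := \<alpha> i - 1)) * (x $ i * ?M (\<alpha>(i := \<alpha> i - 1)) x) = ?c \<alpha> * ?M \<alpha> x"
          using a pr[where x=x and \<alpha>="\<alpha>(i := \<alpha> i - 1)"] by simp
      next
        fix \<alpha> assume a: "\<alpha> \<in> ?A m"
        then show "\<alpha>(i := Suc (\<alpha> i)) \<in> {\<alpha>\<in>?A (Suc m). \<alpha> i > 0}"
          using su[of \<alpha>] by (simp flip: of_nat_sum)
      qed auto
      also have "\<dots> = x $ i * f x" unfolding f by (simp add: sum_distrib_left ac_simps)
      finally show ?thesis by simp
    qed
    then show ?case unfolding polys_def by (intro image_eqI[where x="?c"]) auto
  qed
qed

section \<open>Polynomials along lines and under affine substitution\<close>

lemma pol_line: "pol m f \<Longrightarrow> \<exists>p. \<forall>t. f (x + t *\<^sub>R v) = poly p t"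
proof (induction rule: pol.induct)
  case (pol_const m c)
  show ?case by (rule exI[of _ "[:c:]"]) simp
next
  case (pol_add m f g)
  then obtain p q where "\<forall>t. f (x + t *\<^sub>R v) = poly p t" "\<forall>t. g (x + t *\<^sub>R v) = poly q t" by auto
  then show ?case by (intro exI[of _ "p + q"]) simp
next
  case (pol_coord m f i)
  then obtain p where "\<forall>t. f (x + t *\<^sub>R v) = poly p t" by auto
  then show ?case by (intro exI[of _ "[:x $ i, v $ i:] * p"]) (simp add: algebra_simps)
qed

text \<open>On the line from a point of S to any y the function is a univariate polynomial with
  infinitely many zeros near the starting point, hence zero also at parameter 1.\<close>

lemma pol_zero_on_open:
  assumes f: "pol m f" and S: "open S" "S \<noteq> {}" and 0: "\<And>x. x \<in> S \<Longrightarrow> f x = 0"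
  shows "f = (\<lambda>x. 0)"
proof
  fix y
  obtain x where x: "x \<in> S" using S by auto
  obtain p where p: "\<And>t. f (x + t *\<^sub>R (y - x)) = poly p t" using pol_line[OF f] by blast
  have "open ((\<lambda>t. x + t *\<^sub>R (y - x)) -` S)"
    by (rule open_vimage[OF S(1)]) (intro continuous_intros)
  moreover have "0 \<in> (\<lambda>t. x + t *\<^sub>R (y - x)) -` S" using x by simp
  ultimately obtain e where e: "e > 0" "ball 0 e \<subseteq> (\<lambda>t. x + t *\<^sub>R (y - x)) -` S"
    unfolding open_contains_ball by blast
  have "{0<..<e} \<subseteq> {t. poly p t = 0}" using e(2) 0 by (auto simp: p[symmetric] subset_eq dist_norm)
  then have "infinite {t. poly p t = 0}" using infinite_Ioo[OF e(1)] finite_subset by blast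
  then have "p = 0" using poly_roots_finite by blast
  then show "f y = 0" using p[of 1] by simp
qed

lemma pol_comp:
  assumes "pol m f" and g: "\<And>i. pol 1 (\<lambda>x. g x $ i)"
  shows "pol m (\<lambda>x. f (g x))"
  using assms(1)
proof (induction rule: pol.induct)
  case (pol_coord m f i)
  then show ?case using pol_mult[OF g[of i] pol_coord.IH] by simp
qed (auto intro: pol.intros)

lemma pol_coord1: "pol 1 (\<lambda>x. x $ i)"
  using pol_coord[OF pol_const[of 0 1], of i] by simp

lemma pol_inner: "pol 1 (\<lambda>x. a \<bullet> x)"
  unfolding inner_vec_def inner_real_def by (intro pol_sum pol_cmult pol_coord1)

lemma pol_affine: "pol m f \<Longrightarrow> pol m (\<lambda>x. f (A *v x + a))"
  by (erule pol_comp)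
     (auto simp: matrix_vector_mult_def intro!: pol_add pol_const pol_sum pol_cmult pol_coord1[simplified])

lemma pol_continuous: "pol m f \<Longrightarrow> continuous_on S f"
  by (induction rule: pol.induct) (auto intro!: continuous_intros)

section \<open>Directional derivatives\<close>

definition dd :: "real ^ 'n \<Rightarrow> 'n::finite scalar \<Rightarrow> 'n scalar" where
  "dd v f x = frechet_derivative f (at x) v"

lemma dd_eqI: "(f has_derivative f') (at x) \<Longrightarrow> dd v f x = f' v"
  unfolding dd_def by (metis frechet_derivative_at)

lemma dd_has_derivative: "f differentiable (at x) \<Longrightarrow> (f has_derivative (\<lambda>v. dd v f x)) (at x)"
  unfolding dd_def by (simp add: frechet_derivative_works)

lemma dd_const [simp]: "dd v (\<lambda>x. c) x = 0"
  by (rule dd_eqI) (rule has_derivative_const)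

lemma dd_add:
  "f differentiable (at x) \<Longrightarrow> g differentiable (at x) \<Longrightarrow> dd v (\<lambda>x. f x + g x) x = dd v f x + dd v g x"
  by (rule dd_eqI[OF has_derivative_add[OF dd_has_derivative dd_has_derivative]])

lemma dd_mult:
  "f differentiable (at x) \<Longrightarrow> g differentiable (at x)
    \<Longrightarrow> dd v (\<lambda>x. f x * g x) x = f x * dd v g x + dd v f x * g x"
  by (rule dd_eqI[OF has_derivative_mult[OF dd_has_derivative dd_has_derivative]])

lemma dd_cmult: "f differentiable (at x) \<Longrightarrow> dd v (\<lambda>x. c * f x) x = c * dd v f x"
  using dd_mult[of "\<lambda>x. c" x f v] by simp

lemma dd_sum:
  "(\<And>a. a \<in> A \<Longrightarrow> f a differentiable (at x)) \<Longrightarrow> dd v (\<lambda>x. \<Sum>a\<in>A. f a x) x = (\<Sum>a\<in>A. dd v (f a) x)"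
proof (induction A rule: infinite_finite_induct)
  case (insert a A)
  then have "(\<lambda>x. \<Sum>a\<in>A. f a x) differentiable (at x)" by (intro differentiable_sum) auto
  then show ?case using insert by (simp add: dd_add)
qed auto

lemma dd_lin: "f differentiable (at x) \<Longrightarrow> dd (a *\<^sub>R v + b *\<^sub>R w) f x = a * dd v f x + b * dd w f x"
proof -
  assume "f differentiable (at x)"
  then have "linear (frechet_derivative f (at x))" by (rule linear_frechet_derivative)
  then show ?thesis unfolding dd_def by (simp add: linear_add linear_scale)
qed

lemma dd_coord: "dd v (\<lambda>x. x $ i) x = v $ i"
  by (rule dd_eqI) (auto intro!: derivative_eq_intros bounded_linear_imp_has_derivative bounded_linear_vec_nth)

lemma coord_differentiable: "(\<lambda>x::real^'n. x $ i) differentiable (at x)"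
  using bounded_linear_imp_differentiable[OF bounded_linear_vec_nth] by blast

lemma pol_differentiable: "pol m f \<Longrightarrow> f differentiable (at x)"
  by (induction rule: pol.induct) (auto intro!: derivative_intros coord_differentiable)

text \<open>With truncated subtraction the degree bound alone does not survive the coordinate rule
  at m = 0: the term \<open>x $ i * dd v f x\<close> would be counted with degree 1. Carrying along
  that the derivative is zero for m = 0 closes this gap.\<close>

lemma pol_dd_aux: "pol m f \<Longrightarrow> (m = 0 \<longrightarrow> dd v f = (\<lambda>x. 0)) \<and> pol (m - 1) (dd v f)"
proof (induction rule: pol.induct)
  case (pol_const m c)
  have "dd v (\<lambda>x. c) = (\<lambda>x. 0)" by auto
  then show ?case by (simp add: pol.pol_const)
next
  case (pol_add m f g)
  then have "dd v (\<lambda>x. f x + g x) = (\<lambda>x. dd v f x + dd v g x)"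
    by (auto simp: dd_add pol_differentiable)
  then show ?case using pol_add by (auto intro: pol.pol_add)
next
  case (pol_coord m f i)
  then have eq: "dd v (\<lambda>x. x $ i * f x) = (\<lambda>x. x $ i * dd v f x + v $ i * f x)"
    by (auto simp: dd_mult pol_differentiable coord_differentiable dd_coord)
  show ?case
  proof (cases m)
    case 0
    then show ?thesis using pol_coord by (simp add: eq pol_cmult)
  next
    case (Suc m')
    then have "pol (Suc m') (\<lambda>x. x $ i * dd v f x)" using pol_coord by (auto intro: pol.pol_coord)
    then show ?thesis using pol_coord Suc by (auto simp: eq intro: pol.pol_add pol_cmult)
  qed
qed

lemma pol_dd: "pol m f \<Longrightarrow> pol (m - 1) (dd v f)"
  using pol_dd_aux by blast

lemma pol_0_dd: "pol 0 f \<Longrightarrow> dd v f = (\<lambda>x. 0)"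
  using pol_dd_aux by blast

lemma pol_0_const: "pol 0 f \<Longrightarrow> \<exists>c. f = (\<lambda>x. c)"
proof -
  have "pol m f \<Longrightarrow> m = 0 \<Longrightarrow> \<exists>c. f = (\<lambda>x. c)" for m
    by (induction rule: pol.induct) auto
  then show "pol 0 f \<Longrightarrow> \<exists>c. f = (\<lambda>x. c)" by blast
qed

lemma pol_1_affine:
  assumes "pol 1 f"
  shows "\<exists>a c. f = (\<lambda>x. a \<bullet> x + c)"
proof -
  have "pol m f \<Longrightarrow> m = 1 \<Longrightarrow> \<exists>a c. f = (\<lambda>x. a \<bullet> x + c)" for m
  proof (induction rule: pol.induct)
    case (pol_const m c)
    show ?case by (rule exI[of _ 0]) auto
  next
    case (pol_add m f g)
    then obtain a b c d where "f = (\<lambda>x. a \<bullet> x + c)" "g = (\<lambda>x. b \<bullet> x + d)" by auto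
    then show ?case by (intro exI[of _ "a + b"] exI[of _ "c + d"]) (simp add: inner_add_left algebra_simps)
  next
    case (pol_coord m f i)
    then obtain c where "f = (\<lambda>x. c)" using pol_0_const by auto
    then show ?case
      by (intro exI[of _ "axis i c"] exI[of _ 0]) (auto simp: inner_axis' mult.commute)
  qed
  with assms show ?thesis by blast
qed

section \<open>Positive definite forms on finite-dimensional function spaces\<close>

definition fspan :: "('a \<Rightarrow> real) set \<Rightarrow> ('a \<Rightarrow> real) set" where
  "fspan B = range (\<lambda>c x. \<Sum>e\<in>B. c e * e x)"

definition fsub :: "('a \<Rightarrow> real) set \<Rightarrow> bool" where
  "fsub S \<longleftrightarrow> (\<lambda>x. 0) \<in> S \<and> (\<forall>f\<in>S. \<forall>g\<in>S. \<forall>c. (\<lambda>x. f x + c * g x) \<in> S)"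

text \<open>Linearity is asked in the first argument only and reaches the second through symmetry.
  Everything is restricted to S because the facet forms are definite on a proper subspace of the
  polynomials.\<close>

definition spd :: "('a \<Rightarrow> real) set \<Rightarrow> (('a \<Rightarrow> real) \<Rightarrow> ('a \<Rightarrow> real) \<Rightarrow> real) \<Rightarrow> bool" where
  "spd S G \<longleftrightarrow> (\<forall>f\<in>S. \<forall>g\<in>S. \<forall>h\<in>S. \<forall>c. G (\<lambda>x. f x + c * g x) h = G f h + c * G g h)
     \<and> (\<forall>f\<in>S. \<forall>g\<in>S. G f g = G g f) \<and> (\<forall>f\<in>S. 0 \<le> G f f \<and> (G f f = 0 \<longrightarrow> f = (\<lambda>x. 0)))"

lemma fsub_zero: "fsub S \<Longrightarrow> (\<lambda>x. 0) \<in> S"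
  by (simp add: fsub_def)

lemma fsub_comb: "fsub S \<Longrightarrow> f \<in> S \<Longrightarrow> g \<in> S \<Longrightarrow> (\<lambda>x. f x + c * g x) \<in> S"
  unfolding fsub_def by (elim conjE) (drule (1) bspec, drule (1) bspec, erule spec)

lemma spd_comb:
  "spd S G \<Longrightarrow> f \<in> S \<Longrightarrow> g \<in> S \<Longrightarrow> h \<in> S \<Longrightarrow> G (\<lambda>x. f x + c * g x) h = G f h + c * G g h"
  unfolding spd_def by (elim conjE) (drule (1) bspec, drule (1) bspec, drule (1) bspec, erule spec)

lemma spd_sym: "spd S G \<Longrightarrow> f \<in> S \<Longrightarrow> g \<in> S \<Longrightarrow> G f g = G g f"
  unfolding spd_def by (elim conjE) (drule (1) bspec, drule (1) bspec)

lemma spd_pos: "spd S G \<Longrightarrow> f \<in> S \<Longrightarrow> 0 \<le> G f f"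
  and spd_definite: "spd S G \<Longrightarrow> f \<in> S \<Longrightarrow> G f f = 0 \<Longrightarrow> f = (\<lambda>x. 0)"
  unfolding spd_def by blast+

lemma fsub_sum: "fsub S \<Longrightarrow> (\<And>e. e \<in> E \<Longrightarrow> g e \<in> S) \<Longrightarrow> (\<lambda>x. \<Sum>e\<in>E. c e * g e x) \<in> S"
proof (induction E rule: infinite_finite_induct)
  case (insert a E)
  then have "(\<lambda>x. (\<Sum>e\<in>E. c e * g e x) + c a * g a x) \<in> S" by (intro fsub_comb) auto
  then show ?case using insert by (simp add: add.commute)
qed (auto simp: fsub_def)

lemma spd_zero: "fsub S \<Longrightarrow> spd S G \<Longrightarrow> h \<in> S \<Longrightarrow> G (\<lambda>x. 0) h = 0"
  using spd_comb[of S G "\<lambda>x. 0" "\<lambda>x. 0" h 1] fsub_zero[of S] by simp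

lemma lin_sum:
  assumes S: "fsub S" and l: "\<And>f g c. f \<in> S \<Longrightarrow> g \<in> S \<Longrightarrow> l (\<lambda>x. f x + c * g x) = l f + c * (l g :: real)"
    and E: "\<And>e. e \<in> E \<Longrightarrow> g e \<in> S"
  shows "l (\<lambda>x. \<Sum>e\<in>E. c e * g e x) = (\<Sum>e\<in>E. c e * l (g e))"
proof -
  have 0: "(\<lambda>x. 0) \<in> S" using S by (simp add: fsub_def)
  have l0: "l (\<lambda>x. 0) = 0" using l[OF 0 0, of 1] by simp
  show ?thesis using E
  proof (induction E rule: infinite_finite_induct)
    case (insert a E)
    have "l (\<lambda>x. (\<Sum>e\<in>E. c e * g e x) + c a * g a x) = l (\<lambda>x. \<Sum>e\<in>E. c e * g e x) + c a * l (g a)"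
      using insert S by (intro l fsub_sum) auto
    then show ?case using insert by (simp add: add.commute)
  qed (simp_all add: l0)
qed

lemma spd_sum:
  assumes S: "fsub S" and G: "spd S G" and E: "\<And>e. e \<in> E \<Longrightarrow> g e \<in> S" and h: "h \<in> S"
  shows "G (\<lambda>x. \<Sum>e\<in>E. c e * g e x) h = (\<Sum>e\<in>E. c e * G (g e) h)"
  by (rule lin_sum[where l="\<lambda>f. G f h" and S=S]) (use S E spd_comb[OF G _ _ h] in simp_all)

text \<open>Gram-Schmidt by induction on the spanning set. S need not contain B, so the induction
  runs over all subspaces: the hypothesis is applied to the intersection of S with the smaller span,
  and one element y outside that span accounts for the rest of S.\<close>

lemma orthonormal_expansion:
  assumes "finite B"
  shows "\<And>S. S \<subseteq> fspan B \<Longrightarrow> fsub S \<Longrightarrow> spd S G \<Longrightarrow>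
    \<exists>E. finite E \<and> E \<subseteq> S \<and> (\<forall>d\<in>E. \<forall>e\<in>E. G d e = (if d = e then 1 else 0)) \<and>
        (\<forall>f\<in>S. f = (\<lambda>x. \<Sum>e\<in>E. G f e * e x))"
  using assms
proof (induction B)
  case empty
  then have "f = (\<lambda>x. 0)" if "f \<in> S" for f using that unfolding fspan_def by auto
  then show ?case by (intro exI[of _ "{}"]) auto
next
  case (insert b B)
  let ?T = "S \<inter> fspan B"
  have comb: "(\<lambda>x. f x + c * g x) \<in> fspan B" if fg: "f \<in> fspan B" "g \<in> fspan B" for f g c
  proof -
    obtain p q where "f = (\<lambda>x. \<Sum>e\<in>B. p e * e x)" "g = (\<lambda>x. \<Sum>e\<in>B. q e * e x)"
      using fg unfolding fspan_def by (elim rangeE) blast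
    then show ?thesis unfolding fspan_def
      by (intro image_eqI[where x="\<lambda>e. p e + c * q e"])
         (auto simp: sum.distrib sum_distrib_left distrib_right mult.assoc)
  qed
  have T: "fsub ?T" using fsub_comb[OF insert.prems(2)] fsub_zero[OF insert.prems(2)] comb
    unfolding fsub_def[of ?T] by (auto simp: fspan_def intro!: image_eqI[where x="\<lambda>_. 0"])
  have GT: "spd ?T G" using insert.prems(3) unfolding spd_def by simp
  obtain E where E: "finite E" "E \<subseteq> ?T" "\<And>d e. d \<in> E \<Longrightarrow> e \<in> E \<Longrightarrow> G d e = (if d = e then 1 else 0)"
    "\<And>f. f \<in> ?T \<Longrightarrow> f = (\<lambda>x. \<Sum>e\<in>E. G f e * e x)"
    using insert.IH[OF _ T GT] by (auto 0 3)
  note S = insert.prems(2) and G = insert.prems(3)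
  have Gadd: "G (\<lambda>x. f x + c * g x) h = G f h + c * G g h" if "f \<in> S" "g \<in> S" "h \<in> S" for f g h c
    using spd_comb[OF G that] .
  have Gsym: "G f g = G g f" if "f \<in> S" "g \<in> S" for f g using spd_sym[OF G that] .
  have ES: "\<And>e. e \<in> E \<Longrightarrow> e \<in> S" using E(2) by auto
  show ?case
  proof (cases "S \<subseteq> fspan B")
    case True
    then have "?T = S" by auto
    with E show ?thesis by (intro exI[of _ E]) auto
  next
    case False
    then obtain y where y: "y \<in> S" "y \<notin> fspan B" by auto
    \<comment> \<open>The component of y orthogonal to the family E obtained so far.\<close>
    define z where "z = (\<lambda>x. y x + (-1) * (\<Sum>e\<in>E. G y e * e x))"
    have pS: "(\<lambda>x. \<Sum>e\<in>E. G y e * e x) \<in> S" using fsub_sum[OF S, where E="E" and g="\<lambda>e. e"] ES by auto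
    have pT: "(\<lambda>x. \<Sum>e\<in>E. G y e * e x) \<in> fspan B" using fsub_sum[OF T, where E="E" and g="\<lambda>e. e"] E(2) by auto
    have zS: "z \<in> S" unfolding z_def by (rule fsub_comb[OF S y(1) pS])
    have zE: "G z e = 0" if e: "e \<in> E" for e
    proof -
      have "G (\<lambda>x. \<Sum>e\<in>E. G y e * e x) e = (\<Sum>d\<in>E. G y d * G d e)"
        using spd_sum[OF S G, where E=E and g="\<lambda>e. e" and h=e] ES e by auto
      also have "\<dots> = (\<Sum>d\<in>E. if d = e then G y e else 0)" by (rule sum.cong) (use e E(3) in auto)
      also have "\<dots> = G y e" using E(1) e by simp
      finally show ?thesis unfolding z_def using Gadd[OF y(1) pS ES[OF e], of "-1"] by simp
    qed
    have "z \<noteq> (\<lambda>x. 0)"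
    proof
      assume "z = (\<lambda>x. 0)"
      then have "z x = 0" for x by simp
      then have "y = (\<lambda>x. \<Sum>e\<in>E. G y e * e x)" unfolding z_def by (intro ext) simp
      with pT y(2) show False by simp
    qed
    then have zz: "G z z > 0" using spd_pos[OF G zS] spd_definite[OF G zS] by fastforce
    define s where "s = 1 / sqrt (G z z)"
    have s: "s > 0" "s * s * G z z = 1" unfolding s_def using zz by (simp_all add: field_simps)
    \<comment> \<open>The leading 0 brings the normalised vector into the form f + c g of the
      closure and linearity rules.\<close>
    define w where "w = (\<lambda>x. 0 + s * z x)"
    have 0: "(\<lambda>x. 0) \<in> S" using S by (simp add: fsub_def)
    have wS: "w \<in> S" unfolding w_def by (rule fsub_comb[OF S 0 zS])
    have Gw: "G w h = s * G z h" if "h \<in> S" for h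
      unfolding w_def using Gadd[OF 0 zS that, of s] spd_zero[OF S G that] by simp
    have ww: "G w w = 1"
    proof -
      have "G w w = s * G z w" by (rule Gw[OF wS])
      also have "G z w = G w z" by (rule Gsym[OF zS wS])
      also have "G w z = s * G z z" by (rule Gw[OF zS])
      finally show ?thesis using s by simp
    qed
    have wE: "G w e = 0" "G e w = 0" if "e \<in> E" for e
      using Gw[OF ES[OF that]] zE[OF that] Gsym[OF wS ES[OF that]] by auto
    have wnE: "w \<notin> E" using wE(1) ww by force
    show ?thesis
    proof (intro exI[of _ "insert w E"] conjI ballI)
      fix f assume f: "f \<in> S"
      obtain c where c: "f = (\<lambda>x. \<Sum>e\<in>insert b B. c e * e x)" using f insert.prems(1) unfolding fspan_def by auto
      obtain d where d: "y = (\<lambda>x. \<Sum>e\<in>insert b B. d e * e x)" using y insert.prems(1) unfolding fspan_def by auto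
      have db: "d b \<noteq> 0"
      proof
        assume "d b = 0"
        then have "y = (\<lambda>x. \<Sum>e\<in>B. d e * e x)" using d insert.hyps by simp
        with y(2) show False unfolding fspan_def by auto
      qed
      \<comment> \<open>The multiple of y that removes the coefficient of b from f, so that the
        difference g falls under the induction hypothesis.\<close>
      define r where "r = c b / d b"
      define g where "g = (\<lambda>x. f x + (- r) * y x)"
      have gS: "g \<in> S" unfolding g_def by (rule fsub_comb[OF S f y(1)])
      have rb: "c b = r * d b" unfolding r_def using db by simp
      have "g = (\<lambda>x. \<Sum>e\<in>B. (c e - r * d e) * e x)"
        unfolding g_def by (subst c, subst d)
          (use insert.hyps rb in \<open>simp add: algebra_simps sum_distrib_left sum_subtractf sum_negf\<close>)
      then have "g \<in> fspan B" unfolding fspan_def by (intro image_eqI[where x="\<lambda>e. c e - r * d e"]) auto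
      then have g: "g = (\<lambda>x. \<Sum>e\<in>E. G g e * e x)" using E(4) gS by auto
      \<comment> \<open>Coefficients of f = g + r y in the extended family, with y written as its
        projection onto E plus z = w / s.\<close>
      define q where "q = (\<lambda>e. if e = w then r / s else G g e + r * G y e)"
      have yz: "y x = (\<Sum>e\<in>E. G y e * e x) + z x" for x unfolding z_def by simp
      have zw: "z x = w x / s" for x unfolding w_def using s by simp
      have "f x = (\<Sum>e\<in>E. G g e * e x) + r * y x" for x
        using fun_cong[OF g, of x] unfolding g_def by simp
      then have f1: "f x = (\<Sum>e\<in>E. (G g e + r * G y e) * e x) + r / s * w x" for x
        by (simp add: yz zw distrib_right sum.distrib distrib_left sum_distrib_left mult.assoc)
      have f2: "(\<Sum>e\<in>E. (G g e + r * G y e) * e x) = (\<Sum>e\<in>E. q e * e x)" for x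
        by (rule sum.cong) (use wnE in \<open>auto simp: q_def\<close>)
      have qw: "q w = r / s" by (simp add: q_def)
      have fq: "f = (\<lambda>x. \<Sum>e\<in>insert w E. q e * e x)"
        by (intro ext) (simp only: f1 f2 qw sum.insert[OF E(1) wnE] add.commute)
      have "G f e = q e" if e: "e \<in> insert w E" for e
      proof -
        have eS: "e \<in> S" using e ES wS by auto
        have "G f e = (\<Sum>d\<in>insert w E. q d * G d e)"
          unfolding fq using spd_sum[OF S G, where E="insert w E" and g="\<lambda>e. e" and h=e] ES wS eS by auto
        also have "\<dots> = (\<Sum>d\<in>insert w E. if d = e then q e else 0)"
          by (rule sum.cong) (use e E(3) wE ww in auto)
        also have "\<dots> = q e" using E(1) e by auto
        finally show ?thesis .
      qed
      then have "(\<lambda>x. \<Sum>e\<in>insert w E. G f e * e x) = (\<lambda>x. \<Sum>e\<in>insert w E. q e * e x)"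
        by (intro ext sum.cong) auto
      then show "f = (\<lambda>x. \<Sum>e\<in>insert w E. G f e * e x)" using fq by simp
    qed (use E wE ww ES wS in auto)
  qed
qed

text \<open>The representer is the combination of an orthonormal family with coefficients
  \<open>l e\<close>.\<close>

lemma riesz_finite:
  assumes B: "finite B" "S \<subseteq> fspan B" and S: "fsub S" and G: "spd S G"
    and l: "\<And>f g c. f \<in> S \<Longrightarrow> g \<in> S \<Longrightarrow> l (\<lambda>x. f x + c * g x) = l f + c * l g"
  shows "\<exists>r\<in>S. \<forall>z\<in>S. G z r = l z"
proof -
  obtain E where E: "finite E" "E \<subseteq> S" "\<And>f. f \<in> S \<Longrightarrow> f = (\<lambda>x. \<Sum>e\<in>E. G f e * e x)"
    using orthonormal_expansion[OF B S G] by auto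
  let ?r = "\<lambda>x. \<Sum>e\<in>E. l e * e x"
  have r: "?r \<in> S" using fsub_sum[OF S, where E="E" and g="\<lambda>e. e"] E(2) by auto
  have "G z ?r = l z" if z: "z \<in> S" for z
  proof -
    have "G z ?r = G ?r z" using spd_sym[OF G z r] .
    also have "\<dots> = (\<Sum>e\<in>E. l e * G e z)" using spd_sum[OF S G, where E=E and g="\<lambda>e. e" and h=z] E(2) z by auto
    also have "\<dots> = (\<Sum>e\<in>E. G z e * l e)"
      by (rule sum.cong) (use spd_sym[OF G _ z] E(2) in \<open>auto simp: mult.commute\<close>)
    also have "\<dots> = l (\<lambda>x. \<Sum>e\<in>E. G z e * e x)" 
      by (rule lin_sum[where l=l and g="\<lambda>e. e" and S=S, OF S l, symmetric]) (use E(2) in blast)+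
    also have "\<dots> = l z" using E(3)[OF z] by simp
    finally show ?thesis .
  qed
  with r show ?thesis by blast
qed

text \<open>Parseval: \<open>G f f\<close> is the sum of the squared coefficients, so it dominates
  each of them.\<close>

lemma expansion_coeff_bound:
  assumes B: "finite B" "S \<subseteq> fspan B" and S: "fsub S" and G: "spd S G"
  shows "\<exists>E. finite E \<and> E \<subseteq> S \<and> (\<forall>f\<in>S. f = (\<lambda>x. \<Sum>e\<in>E. G f e * e x) \<and> (\<forall>e\<in>E. \<bar>G f e\<bar> \<le> sqrt (G f f)))"
proof -
  obtain E where E: "finite E" "E \<subseteq> S" "\<And>f. f \<in> S \<Longrightarrow> f = (\<lambda>x. \<Sum>e\<in>E. G f e * e x)"
    using orthonormal_expansion[OF B S G] by auto
  have "\<bar>G f e\<bar> \<le> sqrt (G f f)" if f: "f \<in> S" and e: "e \<in> E" for f e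
  proof -
    have "G f f = G (\<lambda>x. \<Sum>e\<in>E. G f e * e x) f" using E(3)[OF f] by simp
    also have "\<dots> = (\<Sum>e\<in>E. G f e * G e f)" using spd_sum[OF S G, where E=E and g="\<lambda>e. e" and h=f] E(2) f by auto
    also have "\<dots> = (\<Sum>e\<in>E. (G f e)^2)"
      by (rule sum.cong) (use spd_sym[OF G _ f] E(2) in \<open>auto simp: power2_eq_square\<close>)
    finally have "(G f e)^2 \<le> G f f" using member_le_sum[OF e, of "\<lambda>e. (G f e)^2"] E(1) by simp
    then have "sqrt ((G f e)^2) \<le> sqrt (G f f)" by (rule real_sqrt_le_mono)
    then show ?thesis by simp
  qed
  with E show ?thesis by blast
qed

lemma pol_fspan: "\<exists>B. finite B \<and> (Collect (pol m) :: 'n::finite scalar set) \<subseteq> fspan B"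
proof -
  let ?A = "{\<alpha>::'n \<Rightarrow> nat. int (\<Sum>i\<in>UNIV. \<alpha> i) \<le> int m}"
  let ?M = "\<lambda>(\<alpha>::'n \<Rightarrow> nat) x. \<Prod>i\<in>UNIV. ((x::real^'n) $ i) ^ \<alpha> i"
  have "f \<in> fspan (?M ` ?A)" if f: "(f :: 'n scalar) \<in> polys (int m)" for f
  proof -
    obtain c where c: "f = (\<lambda>x. \<Sum>\<alpha>\<in>?A. c \<alpha> * ?M \<alpha> x)" using f unfolding polys_def by (elim rangeE) blast
    \<comment> \<open>\<open>fspan\<close> is indexed by functions and not by multi-indices, so the
      coefficients of all indices with the same monomial function are added up.\<close>
    let ?d = "\<lambda>e. \<Sum>\<alpha>\<in>{\<alpha>\<in>?A. ?M \<alpha> = e}. c \<alpha>"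
    have "f x = (\<Sum>e\<in>?M ` ?A. ?d e * e x)" for x
    proof -
      have "f x = (\<Sum>e\<in>?M ` ?A. \<Sum>\<alpha>\<in>{\<alpha>\<in>?A. ?M \<alpha> = e}. c \<alpha> * ?M \<alpha> x)"
        unfolding c by (rule sum.image_gen[OF finite_multi_indices])
      also have "\<dots> = (\<Sum>e\<in>?M ` ?A. ?d e * e x)"
      proof (rule sum.cong[OF refl])
        fix e assume "e \<in> ?M ` ?A"
        have "c \<alpha> * ?M \<alpha> x = c \<alpha> * e x" if a: "\<alpha> \<in> {\<alpha>\<in>?A. ?M \<alpha> = e}" for \<alpha>
        proof -
          have "?M \<alpha> = e" using a by blast
          then show ?thesis using fun_cong[of "?M \<alpha>" e x] by simp
        qed
        then show "(\<Sum>\<alpha>\<in>{\<alpha>\<in>?A. ?M \<alpha> = e}. c \<alpha> * ?M \<alpha> x) = ?d e * e x"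
          unfolding sum_distrib_right by (rule sum.cong[OF refl])
      qed
      finally show ?thesis .
    qed
    then show ?thesis unfolding fspan_def by (intro image_eqI[where x="?d"]) auto
  qed
  moreover have "finite (?M ` ?A)" using finite_multi_indices[where 'n='n, of "int m"] by (rule finite_imageI)
  ultimately show ?thesis unfolding polys_eq_pol by blast
qed

section \<open>Smooth functions\<close>

lemma C_diff_Suc_dd:
  "C_diff (Suc m) \<phi> \<longleftrightarrow> (\<forall>x. \<phi> differentiable at x) \<and> (\<forall>i. C_diff m (dd (axis i 1) \<phi>))"
  unfolding dd_def[abs_def] by simp

declare C_diff.simps(2) [simp del]

lemma C_diff_lower: "C_diff (Suc m) \<phi> \<Longrightarrow> C_diff m \<phi>"
proof (induction m arbitrary: \<phi>)
  case 0
  then show ?case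
    by (auto simp: C_diff_Suc_dd continuous_on_eq_continuous_at intro: differentiable_imp_continuous_within)
next
  case (Suc m)
  then show ?case using C_diff_Suc_dd[of "Suc m" \<phi>] C_diff_Suc_dd[of m \<phi>] by blast
qed

lemma C_diff_const: "C_diff m (\<lambda>x. c)"
proof (induction m arbitrary: c)
  case (Suc m)
  have "dd v (\<lambda>x. c) = (\<lambda>x. 0)" for v :: "real^'a" by auto
  with Suc show ?case by (simp add: C_diff_Suc_dd)
qed simp

lemma C_diff_add: "C_diff m f \<Longrightarrow> C_diff m g \<Longrightarrow> C_diff m (\<lambda>x. f x + g x)"
proof (induction m arbitrary: f g)
  case 0
  then show ?case by (simp add: continuous_on_add)
next
  case (Suc m)
  have "dd v (\<lambda>x. f x + g x) = (\<lambda>x. dd v f x + dd v g x)" for v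
    using Suc.prems by (auto simp: C_diff_Suc_dd dd_add)
  with Suc show ?case by (simp add: C_diff_Suc_dd)
qed

lemma C_diff_mult: "C_diff m f \<Longrightarrow> C_diff m g \<Longrightarrow> C_diff m (\<lambda>x. f x * g x)"
proof (induction m arbitrary: f g)
  case 0
  then show ?case by (simp add: continuous_on_mult)
next
  case (Suc m)
  have eq: "dd v (\<lambda>x. f x * g x) = (\<lambda>x. f x * dd v g x + dd v f x * g x)" for v
    using Suc.prems by (auto simp: C_diff_Suc_dd dd_mult)
  have "C_diff m f" "C_diff m g" using Suc.prems by (auto intro: C_diff_lower)
  then have "C_diff m (dd (axis i 1) (\<lambda>x. f x * g x))" for i
    unfolding eq using Suc.prems by (intro C_diff_add Suc.IH) (auto simp: C_diff_Suc_dd)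
  then show ?case using Suc.prems by (auto simp: C_diff_Suc_dd)
qed

lemma C_diff_prod:
  "(\<And>i. i \<in> I \<Longrightarrow> C_diff m (f i)) \<Longrightarrow> C_diff m (\<lambda>x. \<Prod>i\<in>I. f i x)"
  by (induction I rule: infinite_finite_induct) (auto intro: C_diff_const C_diff_mult)

lemma pol_C_diff: "pol n f \<Longrightarrow> C_diff m f"
proof (induction m arbitrary: f n)
  case 0
  then show ?case by (auto intro: pol_continuous)
next
  case (Suc m)
  then show ?case by (auto simp: C_diff_Suc_dd intro: pol_differentiable pol_dd)
qed

lemma has_derivative_comp_affine:
  fixes a :: "real^'n::finite"
  assumes "\<And>t. (s has_real_derivative s' t) (at t)"
  shows "((\<lambda>x. s (a \<bullet> x + c)) has_derivative (\<lambda>v. (a \<bullet> v) * s' (a \<bullet> x + c))) (at x)"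
proof -
  have "((\<lambda>x. a \<bullet> x + c) has_derivative (\<lambda>v. a \<bullet> v)) (at x)"
    by (auto intro!: derivative_eq_intros)
  from DERIV_compose_FDERIV[OF assms this] show ?thesis .
qed

text \<open>The hypothesis supplies the whole chain of derivatives, so the induction on m can move
  from \<open>s j\<close> to \<open>s (Suc j)\<close>; the inner derivative is a constant.\<close>

lemma C_diff_comp_affine:
  fixes a :: "real^'n::finite"
  assumes s: "\<And>j t. (s j has_real_derivative s (Suc j) t) (at t)"
  shows "C_diff m (\<lambda>x. s j (a \<bullet> x + c))"
proof (induction m arbitrary: j)
  case 0
  have "continuous_on UNIV (s j)"
    using s[of j] by (auto simp: continuous_on_eq_continuous_at intro: DERIV_isCont)
  then show ?case by (auto intro!: continuous_on_compose2[of UNIV "s j"] continuous_intros)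
next
  case (Suc m)
  note d = has_derivative_comp_affine[of "s j" "s (Suc j)", OF s]
  have "dd v (\<lambda>x. s j (a \<bullet> x + c)) = (\<lambda>x. (a \<bullet> v) * s (Suc j) (a \<bullet> x + c))" for v
    by (intro ext dd_eqI d)
  moreover have "(\<lambda>x. s j (a \<bullet> x + c)) differentiable (at x)" for x
    using d[of a c x] unfolding differentiable_def by blast
  ultimately show ?case
    using Suc by (auto simp: C_diff_Suc_dd intro!: C_diff_mult C_diff_const)
qed

text \<open>\<open>flat 0 t = exp (- 1 / t)\<close> for \<open>t > 0\<close>, extended by zero, and \<open>flat j\<close> is its \<open>j\<close>-th derivative.\<close>

primrec flat_poly :: "nat \<Rightarrow> real poly" where
  "flat_poly 0 = 1"
| "flat_poly (Suc j) = [:0, 0, 1:] * (flat_poly j - pderiv (flat_poly j))"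

definition flat :: "nat \<Rightarrow> real \<Rightarrow> real" where
  "flat j t = (if t > 0 then poly (flat_poly j) (1 / t) * exp (- (1 / t)) else 0)"

lemma poly_times_exp_neg: "((\<lambda>y. poly p y * exp (- y)) \<longlongrightarrow> (0::real)) at_top"
proof -
  have "((\<lambda>y::real. coeff p i * y ^ i * exp (- y)) \<longlongrightarrow> 0) at_top" for i
    using tendsto_mult_right_zero[OF tendsto_power_div_exp_0[of i], of "coeff p i"]
    by (simp add: exp_minus divide_inverse mult.assoc)
  then have "((\<lambda>y. \<Sum>i\<le>degree p. coeff p i * y ^ i * exp (- y)) \<longlongrightarrow> 0) at_top"
    by (intro tendsto_null_sum)
  then show ?thesis by (simp add: poly_altdef sum_distrib_right)
qed

text \<open>With y = 1 / t the derivative in t is - y^2 times the derivative in y; applied to P(y)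
  exp(-y) this gives the recursion y^2 (P - P') of \<open>flat_poly\<close>. At 0 the right
  difference quotient is y P(y) exp(-y), which tends to 0 as y grows.\<close>

lemma flat_has_derivative: "(flat j has_real_derivative flat (Suc j) t) (at t)"
proof -
  consider "t > 0" | "t < 0" | "t = 0" by linarith
  then show ?thesis
  proof cases
    case 1
    let ?f = "\<lambda>t. poly (flat_poly j) (1 / t) * exp (- (1 / t))"
    have "(?f has_real_derivative flat (Suc j) t) (at t)"
      using 1 by (auto intro!: derivative_eq_intros poly_DERIV[THEN DERIV_chain2]
          simp: flat_def field_simps power2_eq_square)
    then show ?thesis
      by (rule has_field_derivative_transform_within_open[where S="{0<..}"]) (use 1 in \<open>auto simp: flat_def\<close>)
  next
    case 2
    have "((\<lambda>t. 0) has_real_derivative flat (Suc j) t) (at t)" using 2 by (simp add: flat_def)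
    then show ?thesis
      by (rule has_field_derivative_transform_within_open[where S="{..<0}"]) (use 2 in \<open>auto simp: flat_def\<close>)
  next
    case 3
    have "((\<lambda>h. flat j h / h) \<longlongrightarrow> 0) (at_left 0)"
      by (rule tendsto_eventually) (auto simp: eventually_at_left_field flat_def intro!: exI[of _ "-1"])
    moreover have "((\<lambda>h. flat j h / h) \<longlongrightarrow> 0) (at_right 0)"
    proof -
      have "((\<lambda>h. poly (pCons 0 (flat_poly j)) (inverse h) * exp (- (inverse h))) \<longlongrightarrow> 0) (at_right (0::real))"
        by (rule filterlim_compose[OF poly_times_exp_neg filterlim_inverse_at_top_right])
      then show ?thesis
        by (rule Lim_transform_eventually)
          (auto simp: eventually_at_right_field flat_def divide_inverse intro!: exI[of _ 1])
    qed
    ultimately have "((\<lambda>h. flat j h / h) \<longlongrightarrow> 0) (at 0)" by (rule filterlim_split_at)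
    then show ?thesis using 3 by (simp add: has_field_derivative_iff flat_def)
  qed
qed

lemma flat_0_bounds: "0 \<le> flat 0 t" "flat 0 t \<le> 1"
  by (auto simp: flat_def)

lemma flat_nonpos: "t \<le> 0 \<Longrightarrow> flat j t = 0"
  by (simp add: flat_def)

lemma flat_0_limit: "(flat 0 \<longlongrightarrow> 1) at_top"
proof -
  have "((\<lambda>t::real. exp (- inverse t)) \<longlongrightarrow> exp (- 0)) at_top"
    by (intro tendsto_intros tendsto_inverse_0_at_top filterlim_ident)
  then have "((\<lambda>t::real. exp (- inverse t)) \<longlongrightarrow> 1) at_top" by simp
  then show ?thesis
    by (rule Lim_transform_eventually)
      (auto simp: flat_def eventually_at_top_dense divide_inverse intro!: exI[of _ 0])
qed

lemma flat_1: "flat (Suc 0) t = (if t > 0 then (1 / t)^2 * exp (- (1 / t)) else 0)"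
  by (simp add: flat_def power2_eq_square)

text \<open>In a cutoff with argument t = s l - 1 the factor t + 1 is s l, so this controls l times
  the derivative of the cutoff uniformly in s. With y = 1 / t the product is (y + y^2) exp(-y), and
  exp y exceeds its quadratic Taylor polynomial.\<close>

lemma flat_1_bound: "\<bar>(t + 1) * flat (Suc 0) t\<bar> \<le> 3"
proof (cases "t > 0")
  case True
  define y where "y = 1 / t"
  have y: "y > 0" "t = 1 / y" using True by (auto simp: y_def)
  have e: "1 + y + y^2 / 2 \<le> exp y" using exp_lower_Taylor_quadratic[of y] y by simp
  have eq: "(t + 1) * flat (Suc 0) t = (y + y^2) * exp (- y)"
  proof -
    have "flat (Suc 0) t = y^2 * exp (- y)" using True by (simp add: flat_1 y_def)
    moreover have "(t + 1) * y^2 = y + y^2"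
      unfolding y(2) using y(1) by (simp add: field_simps power2_eq_square)
    ultimately show ?thesis by (simp add: mult.assoc[symmetric])
  qed
  have "y + y^2 \<le> 3 * exp y" using e y zero_le_power2[of y] by linarith
  then have "(y + y^2) * exp (- y) \<le> 3" by (simp add: exp_minus field_simps)
  moreover have "0 \<le> (y + y^2) * exp (- y)" using y by simp
  ultimately show ?thesis using eq by linarith
qed (simp add: flat_1)

lemma flat_1_limit: "((\<lambda>t. (t + 1) * flat (Suc 0) t) \<longlongrightarrow> 0) at_top"
proof -
  have "((\<lambda>t::real. (inverse t + inverse t ^ 2) * exp (- inverse t)) \<longlongrightarrow> (0 + 0 ^ 2) * exp (- 0)) at_top"
    by (intro tendsto_intros tendsto_inverse_0_at_top filterlim_ident)
  then have "((\<lambda>t::real. (inverse t + inverse t ^ 2) * exp (- inverse t)) \<longlongrightarrow> 0) at_top" by simp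
  then show ?thesis
    by (rule Lim_transform_eventually)
      (auto simp: flat_1 eventually_at_top_dense field_simps power2_eq_square intro!: exI[of _ 0])
qed

section \<open>Test functions\<close>

lemma test_functions_mono: "A \<subseteq> B \<Longrightarrow> test_functions A \<subseteq> test_functions B"
  unfolding test_functions_def by auto

lemma test_C_diff: "\<phi> \<in> test_functions D \<Longrightarrow> C_diff m \<phi>"
  unfolding test_functions_def by auto

lemma test_differentiable: "\<phi> \<in> test_functions D \<Longrightarrow> \<phi> differentiable (at x)"
  using test_C_diff[of \<phi> D "Suc 0"] by (auto simp: C_diff_Suc_dd)

lemma C_diff_dd_continuous:
  assumes "C_diff (Suc 0) \<phi>" shows "continuous_on UNIV (dd v \<phi>)"
proof -
  have d: "\<phi> differentiable (at x)" and c: "continuous_on UNIV (dd (axis i 1) \<phi>)" for x i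
    using assms by (auto simp: C_diff_Suc_dd)
  have "dd v \<phi> x = (\<Sum>i\<in>UNIV. v $ i * dd (axis i 1) \<phi> x)" for x
  proof -
    have l: "linear (\<lambda>v. dd v \<phi> x)" using linear_frechet_derivative[OF d[of x]] by (simp add: dd_def)
    have "dd v \<phi> x = dd (\<Sum>i\<in>UNIV. v $ i *\<^sub>R axis i 1) \<phi> x"
      using basis_expansion[of v] by (simp add: scalar_mult_eq_scaleR)
    also have "\<dots> = (\<Sum>i\<in>UNIV. v $ i * dd (axis i 1) \<phi> x)"
      by (simp add: linear_sum[OF l] linear_scale[OF l])
    finally show ?thesis .
  qed
  then have "dd v \<phi> = (\<lambda>x. \<Sum>i\<in>UNIV. v $ i * dd (axis i 1) \<phi> x)" by auto
  then show ?thesis using c by (auto intro!: continuous_intros)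
qed

lemma dd_outside_support:
  assumes "x \<notin> closure {x. \<phi> x \<noteq> 0}" shows "dd v \<phi> x = 0"
proof -
  have "((\<lambda>x. 0) has_derivative (\<lambda>v. 0)) (at x)" by simp
  then have "(\<phi> has_derivative (\<lambda>v. 0)) (at x)"
    by (rule has_derivative_transform_within_open[where s="- closure {x. \<phi> x \<noteq> 0}"])
       (use assms closure_subset[of "{x. \<phi> x \<noteq> 0}"] in auto)
  then show ?thesis by (rule dd_eqI)
qed

lemma test_zero_outside:
  assumes "\<phi> \<in> test_functions D" "x \<notin> D" shows "\<phi> x = 0" "dd v \<phi> x = 0"
proof -
  have c: "closure {x. \<phi> x \<noteq> 0} \<subseteq> D" using assms(1) by (simp add: test_functions_def)
  then show "\<phi> x = 0" using assms(2) closure_subset[of "{x. \<phi> x \<noteq> 0}"] by auto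
  show "dd v \<phi> x = 0" by (rule dd_outside_support) (use c assms(2) in auto)
qed

text \<open>The support lies in \<open>{x. \<forall>i\<in>I. s * l i x \<ge> 1}\<close>, and for \<open>s \<rightarrow> \<infinity>\<close> the factors tend to \<open>1\<close> where \<open>l i\<close> is positive.\<close>

definition cutoff :: "'i set \<Rightarrow> ('i \<Rightarrow> 'n::finite scalar) \<Rightarrow> real \<Rightarrow> 'n scalar" where
  "cutoff I l s x = (\<Prod>i\<in>I. flat 0 (s * l i x - 1))"

lemma cutoff_test_function:
  assumes I: "finite I" and l: "\<And>i x. i \<in> I \<Longrightarrow> l i x = a i \<bullet> x + c i"
    and b: "bounded {x. \<forall>i\<in>I. l i x > 0}" and s: "s > 0" and z: "\<And>m. C_diff m z"
  shows "(\<lambda>x. z x * cutoff I l s x) \<in> test_functions {x. \<forall>i\<in>I. l i x > 0}"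
proof -
  let ?\<phi> = "\<lambda>x. z x * cutoff I l s x"
  have "C_diff m (\<lambda>x. flat 0 (s * l i x - 1))" if "i \<in> I" for m i
  proof -
    have "C_diff m (\<lambda>x. flat 0 ((s *\<^sub>R a i) \<bullet> x + (s * c i - 1)))"
      by (rule C_diff_comp_affine[where s=flat, OF flat_has_derivative])
    then show ?thesis by (simp add: l[OF that] algebra_simps)
  qed
  then have smooth: "C_diff m ?\<phi>" for m
    unfolding cutoff_def by (intro C_diff_mult z C_diff_prod)
  let ?C = "{x. \<forall>i\<in>I. l i x \<ge> 1 / s}"
  have eq: "?C = (\<Inter>i\<in>I. {x. 1 / s \<le> a i \<bullet> x + c i})" using l by auto
  have clo: "closed ?C" unfolding eq by (intro closed_INT ballI closed_Collect_le continuous_intros)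
  have sub: "?C \<subseteq> {x. \<forall>i\<in>I. l i x > 0}" using s by (auto intro: less_le_trans[of 0 "1 / s"])
  have "{x. ?\<phi> x \<noteq> 0} \<subseteq> ?C"
  proof clarify
    fix x i assume x: "z x * cutoff I l s x \<noteq> 0" and i: "i \<in> I"
    then have "flat 0 (s * l i x - 1) \<noteq> 0" using I by (auto simp: cutoff_def)
    then have "s * l i x > 1" using flat_nonpos[of "s * l i x - 1" 0] by linarith
    then show "1 / s \<le> l i x" using s by (simp add: field_simps)
  qed
  then have "closure {x. ?\<phi> x \<noteq> 0} \<subseteq> ?C" using clo by (simp add: closure_minimal)
  moreover have "bounded ?C" by (rule bounded_subset[OF b sub])
  ultimately have "compact (closure {x. ?\<phi> x \<noteq> 0})" "closure {x. ?\<phi> x \<noteq> 0} \<subseteq> {x. \<forall>i\<in>I. l i x > 0}"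
    using sub bounded_subset[of ?C] by (auto simp: compact_eq_bounded_closed)
  then show ?thesis unfolding test_functions_def using smooth by simp
qed

lemma cutoff_bounds: "0 \<le> cutoff I l s x" "cutoff I l s x \<le> 1"
  unfolding cutoff_def by (auto intro!: prod_nonneg prod_le_1 simp: flat_0_bounds)

lemma cutoff_zero:
  assumes "finite I" "i \<in> I" "l i x \<le> 0" "s \<ge> 0" shows "cutoff I l s x = 0"
proof -
  have "s * l i x \<le> 0" using assms by (simp add: mult_nonneg_nonpos)
  then have "flat 0 (s * l i x - 1) = 0" by (intro flat_nonpos) simp
  with assms show ?thesis unfolding cutoff_def by auto
qed

lemma scale_at_top: "(t::real) > 0 \<Longrightarrow> filterlim (\<lambda>n. real (Suc n) * t - 1) at_top sequentially"
proof -
  assume t: "t > 0"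
  have "filterlim (\<lambda>n. real (Suc n) * t) at_top sequentially"
    by (rule filterlim_at_top_mult_tendsto_pos[OF tendsto_const t])
       (rule filterlim_compose[OF filterlim_real_sequentially filterlim_Suc])
  then show ?thesis using filterlim_tendsto_add_at_top[OF tendsto_const[of "-1"], of "\<lambda>n. real (Suc n) * t"]
    by simp
qed

lemma cutoff_limit:
  assumes "\<And>i. i \<in> I \<Longrightarrow> l i x > 0"
  shows "(\<lambda>n. cutoff I l (real (Suc n)) x) \<longlonglongrightarrow> 1"
proof -
  have "(\<lambda>n. flat 0 (real (Suc n) * l i x - 1)) \<longlonglongrightarrow> 1" if "i \<in> I" for i
    by (rule filterlim_compose[OF flat_0_limit scale_at_top[OF assms[OF that]]])
  then have "(\<lambda>n. cutoff I l (real (Suc n)) x) \<longlonglongrightarrow> (\<Prod>i\<in>I. 1)"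
    unfolding cutoff_def by (intro tendsto_prod)
  then show ?thesis by simp
qed

lemma line_has_derivative:
  assumes "\<phi> differentiable (at (x + t *\<^sub>R v))"
  shows "((\<lambda>t. \<phi> (x + t *\<^sub>R v)) has_real_derivative dd v \<phi> (x + t *\<^sub>R v)) (at t)"
proof -
  have 1: "((\<lambda>t. x + t *\<^sub>R v) has_derivative (\<lambda>h. h *\<^sub>R v)) (at t)"
    by (auto intro!: derivative_eq_intros)
  have l: "linear (\<lambda>v. dd v \<phi> (x + t *\<^sub>R v'))" if "\<phi> differentiable (at (x + t *\<^sub>R v'))" for v'
    using linear_frechet_derivative[OF that] by (simp add: dd_def)
  have "((\<lambda>t. \<phi> (x + t *\<^sub>R v)) has_derivative (\<lambda>h. dd (h *\<^sub>R v) \<phi> (x + t *\<^sub>R v))) (at t)"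
    by (rule has_derivative_compose[OF 1 dd_has_derivative[OF assms]])
  then have "((\<lambda>t. \<phi> (x + t *\<^sub>R v)) has_derivative (\<lambda>h. h * dd v \<phi> (x + t *\<^sub>R v))) (at t)"
    using linear_scale[OF l[OF assms]] by simp
  moreover have "(\<lambda>h. h * dd v \<phi> (x + t *\<^sub>R v)) = (*) (dd v \<phi> (x + t *\<^sub>R v))"
    by (auto simp: mult.commute)
  ultimately show ?thesis by (simp add: has_field_derivative_def)
qed

lemma limit_of_zeros:
  assumes "X \<longlonglongrightarrow> L" "\<And>n. X n = (0::real)" shows "L = 0"
proof -
  have "X = (\<lambda>n. 0)" using assms(2) by auto
  then show ?thesis using assms(1) by (simp add: LIMSEQ_const_iff)
qed

text \<open>Translation invariance of the Lebesgue measure, differentiated.\<close>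

lemma integral_dd_compact_support:
  fixes \<phi> :: "'n::finite scalar"
  assumes d: "\<And>x. \<phi> differentiable (at x)" and c: "continuous_on UNIV (dd v \<phi>)"
    and supp: "\<And>x. norm x \<ge> R \<Longrightarrow> \<phi> x = 0"
  shows "(LINT x|lebesgue. dd v \<phi> x) = 0"
proof -
  define f where "f = (\<lambda>n x. real (Suc n) * (\<phi> (x + inverse (real (Suc n)) *\<^sub>R v) - \<phi> x))"
  have cphi: "continuous_on UNIV \<phi>"
    using d by (auto simp: continuous_on_eq_continuous_at intro: differentiable_imp_continuous_within)
  have [measurable]: "\<phi> \<in> borel_measurable borel" "dd v \<phi> \<in> borel_measurable borel"
    using cphi c by (auto intro: borel_measurable_continuous_onI)
  have int: "integrable lborel \<phi>"
  proof -
    have "integrable lborel (\<lambda>x. indicator (cball 0 R) x *\<^sub>R \<phi> x)"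
      using borel_integrable_compact[of "cball 0 R" \<phi>] continuous_on_subset[OF cphi] by (auto simp: set_integrable_def)
    moreover have "(\<lambda>x. indicator (cball 0 R) x *\<^sub>R \<phi> x) = \<phi>"
      by (rule ext) (use supp in \<open>auto simp: indicator_def\<close>)
    ultimately show ?thesis by simp
  qed
  have trans: "integrable lborel (\<lambda>x. \<phi> (x + w))" "(LINT x|lborel. \<phi> (x + w)) = (LINT x|lborel. \<phi> x)" for w
  proof -
    have "integrable (distr lborel borel ((+) w)) \<phi>" using int by (simp add: lborel_distr_plus)
    then show "integrable lborel (\<lambda>x. \<phi> (x + w))" by (subst (asm) integrable_distr_eq) (auto simp: add.commute)
    have "(LINT x|distr lborel borel ((+) w). \<phi> x) = (LINT x|lborel. \<phi> (w + x))"
      by (rule integral_distr) auto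
    then show "(LINT x|lborel. \<phi> (x + w)) = (LINT x|lborel. \<phi> x)" by (simp add: lborel_distr_plus add.commute)
  qed
  have f0: "(LINT x|lborel. f n x) = 0" for n
    unfolding f_def using trans int by simp
  \<comment> \<open>A difference quotient can be nonzero only for |x| at most R + |v|; the
    intermediate points of the mean value theorem then lie within R + 2 |v|.\<close>
  let ?K = "cball (0::real^'n) (R + 2 * norm v)"
  have "compact (dd v \<phi> ` ?K)" by (rule compact_continuous_image[OF continuous_on_subset[OF c]]) auto
  then obtain B where B: "\<And>x. x \<in> ?K \<Longrightarrow> \<bar>dd v \<phi> x\<bar> \<le> B"
    using compact_imp_bounded bounded_iff by (metis imageI real_norm_def)
  have fB: "\<bar>f n x\<bar> \<le> B * indicator (cball 0 (R + norm v)) x" for n x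
  proof -
    let ?s = "inverse (real (Suc n))"
    have s: "0 < ?s" "?s \<le> 1" by (auto simp: field_simps)
    have nsv: "norm (t *\<^sub>R v) \<le> norm v" if "0 \<le> t" "t \<le> ?s" for t
      using that s mult_right_mono[of t 1 "norm v"] by simp
    show ?thesis
    proof (cases "x \<in> cball 0 (R + norm v)")
      case True
      obtain t where t: "0 < t" "t < ?s" "\<phi> (x + ?s *\<^sub>R v) - \<phi> (x + 0 *\<^sub>R v) = (?s - 0) * dd v \<phi> (x + t *\<^sub>R v)"
        using MVT2[OF s(1), of "\<lambda>t. \<phi> (x + t *\<^sub>R v)" "\<lambda>t. dd v \<phi> (x + t *\<^sub>R v)"] line_has_derivative[OF d] by blast
      have eq: "f n x = dd v \<phi> (x + t *\<^sub>R v)"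
        using t(3) unfolding f_def by (simp del: of_nat_Suc add: field_simps)
      have "norm (x + t *\<^sub>R v) \<le> norm x + norm (t *\<^sub>R v)" by (rule norm_triangle_ineq)
      then have "x + t *\<^sub>R v \<in> ?K" using True nsv[of t] t by simp
      then show ?thesis using eq B True by simp
    next
      case False
      have "norm x \<le> norm (x + ?s *\<^sub>R v) + norm (?s *\<^sub>R v)"
        using norm_triangle_ineq4[of "x + ?s *\<^sub>R v" "?s *\<^sub>R v"] by simp
      then have "norm (x + ?s *\<^sub>R v) \<ge> R" using False nsv[of ?s] s by simp
      moreover have "norm x \<ge> R"
      proof -
        have "norm x > R + norm v" using False by simp
        then show ?thesis using norm_ge_zero[of v] by linarith
      qed
      ultimately show ?thesis using False supp by (simp add: f_def)
    qed
  qed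
  have lim: "(\<lambda>n. f n x) \<longlonglongrightarrow> dd v \<phi> x" for x
  proof -
    have "((\<lambda>t. \<phi> (x + t *\<^sub>R v)) has_real_derivative dd v \<phi> x) (at 0)"
      using line_has_derivative[of \<phi> x 0 v] d by simp
    then have "((\<lambda>t. (\<phi> (x + t *\<^sub>R v) - \<phi> x) / t) \<longlongrightarrow> dd v \<phi> x) (at 0)"
      by (simp add: has_field_derivative_iff)
    moreover have "filterlim (\<lambda>n. inverse (real (Suc n))) (at 0) sequentially"
      by (auto simp: filterlim_at simp del: of_nat_Suc intro: LIMSEQ_inverse_real_of_nat)
    ultimately have "(\<lambda>n. (\<phi> (x + inverse (real (Suc n)) *\<^sub>R v) - \<phi> x) / inverse (real (Suc n))) \<longlonglongrightarrow> dd v \<phi> x"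
      by (rule filterlim_compose)
    then show ?thesis by (simp add: f_def divide_inverse mult.commute)
  qed
  have "(\<lambda>n. LINT x|lborel. f n x) \<longlonglongrightarrow> (LINT x|lborel. dd v \<phi> x)"
  proof (rule integral_dominated_convergence)
    show "integrable lborel (\<lambda>x. B * indicator (cball 0 (R + norm v)) x :: real)"
      by (intro integrable_mult_right integrable_real_indicator) (use emeasure_bounded_finite[OF bounded_cball, of 0 "R + norm v"] in auto)
    show "AE x in lborel. (\<lambda>n. f n x) \<longlonglongrightarrow> dd v \<phi> x" using lim by simp
    show "AE x in lborel. norm (f n x) \<le> B * indicator (cball 0 (R + norm v)) x" for n using fB by simp
  qed (auto simp: f_def)
  then have "(LINT x|lborel. dd v \<phi> x) = 0" by (rule limit_of_zeros) (rule f0)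
  then show ?thesis by (simp add: integral_completion)
qed

section \<open>Functions that integrate to zero against boxes or test functions\<close>

text \<open>Dynkin's argument: boxes are stable under intersection and generate the Borel sets.
  Complements require the total integral to vanish, which follows by exhausting the space with
  growing cubes.\<close>

lemma AE_zero_if_integral_boxes_zero:
  fixes h :: "'n::finite scalar"
  assumes h: "integrable lborel h" and 0: "\<And>a b. (LINT x|lborel. indicator (box a b) x * h x) = 0"
  shows "AE x in lborel. h x = 0"
proof -
  let ?G = "range (\<lambda>(a::real^'n, b). box a b)"
  have [measurable]: "h \<in> borel_measurable borel" using borel_measurable_integrable[OF h] by simp
  have int: "integrable lborel (\<lambda>x. indicator A x * h x)" if "A \<in> sets borel" for A
    using integrable_mult_indicator[OF _ h, of A] that by simp
  have 1: "box 0 (\<Sum>i\<in>Basis. 1 *\<^sub>R i) \<in> ?G" by auto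
  have "(LINT x|lborel. indicator A x * h x) = 0" if A: "A \<in> sets borel" for A
  proof -
    have sb: "sets (borel :: (real^'n) measure) = sigma_sets UNIV ?G"
      by (subst borel_eq_box) (simp add: image_def)
    have "Int_stable ?G"
      by (auto simp: Int_stable_def box_Int_box)
    moreover have "?G \<subseteq> Pow UNIV" by auto
    moreover have "A \<in> sigma_sets UNIV ?G" using A sb by simp
    ultimately show ?thesis
    proof (induction rule: sigma_sets_induct_disjoint)
      case (basic A)
      then show ?case using 0 by auto
    next
      case empty
      show ?case by simp
    next
      case (compl A)
      then have A: "A \<in> sets borel" using sb by simp
      have tot: "(LINT x|lborel. h x) = 0"
      proof -
        define w where "w = (\<lambda>n x. indicator (box (- (\<Sum>i\<in>Basis. real n *\<^sub>R i)) (\<Sum>i\<in>Basis. real n *\<^sub>R i)) x * h x)"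
        have "(\<lambda>n. LINT x|lborel. w n x) \<longlonglongrightarrow> (LINT x|lborel. h x)"
        proof (rule integral_dominated_convergence)
          show "integrable lborel (\<lambda>x. \<bar>h x\<bar>)" using h by simp
          show "AE x in lborel. (\<lambda>n. w n x) \<longlonglongrightarrow> h x"
          proof (intro AE_I2 tendsto_eventually)
            fix x :: "real^'n"
            obtain N :: nat where N: "real N > norm x" using reals_Archimedean2 by blast
            have "x \<in> box (- (\<Sum>i\<in>Basis. real n *\<^sub>R i)) (\<Sum>i\<in>Basis. real n *\<^sub>R i)" if "n \<ge> N" for n
            proof -
              have "\<bar>x \<bullet> i\<bar> < real n" if "i \<in> Basis" for i
                using Basis_le_norm[OF that, of x] N \<open>n \<ge> N\<close> by simp
              then show ?thesis by (auto simp: mem_box inner_minus_left abs_less_iff minus_less_iff)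
            qed
            then show "\<forall>\<^sub>F n in sequentially. w n x = h x"
              by (auto simp: w_def eventually_sequentially intro!: exI[of _ N])
          qed
          show "AE x in lborel. norm (w n x) \<le> \<bar>h x\<bar>" for n by (auto simp: w_def indicator_def)
        qed (auto simp: w_def)
        moreover have "(LINT x|lborel. w n x) = 0" for n unfolding w_def by (rule 0)
        ultimately show ?thesis by (rule limit_of_zeros)
      qed
      have "(\<lambda>x. indicator (UNIV - A) x * h x) = (\<lambda>x. h x - indicator A x * h x)"
        by (auto simp: indicator_def)
      then show ?case using compl(2) tot h int[OF A] by simp
    next
      case (union A)
      have A: "\<And>i. A i \<in> sets borel" using union(2) sb by auto
      define w where "w = (\<lambda>n x. \<Sum>i<n. indicator (A i) x * h x)"
      have wi: "w n x = indicator (\<Union>i<n. A i) x * h x" for n x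
      proof -
        have "indicator (\<Union>i<n. A i) x = (\<Sum>i<n. indicator (A i) x :: real)"
          by (rule indicator_UN_disjoint) (use union(1) in \<open>auto simp: disjoint_family_on_def\<close>)
        then show ?thesis by (simp add: w_def sum_distrib_right)
      qed
      have "(\<lambda>n. LINT x|lborel. w n x) \<longlonglongrightarrow> (LINT x|lborel. indicator (\<Union>i. A i) x * h x)"
      proof (rule integral_dominated_convergence)
        show "integrable lborel (\<lambda>x. \<bar>h x\<bar>)" using h by simp
        show "AE x in lborel. (\<lambda>n. w n x) \<longlonglongrightarrow> indicator (\<Union>i. A i) x * h x"
          unfolding wi by (intro AE_I2 tendsto_mult tendsto_const LIMSEQ_indicator_UN)
        show "AE x in lborel. norm (w n x) \<le> \<bar>h x\<bar>" for n by (auto simp: wi indicator_def)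
      qed (use A in \<open>auto simp: w_def\<close>)
      moreover have "(LINT x|lborel. w n x) = 0" for n
        unfolding w_def using int A union(3) by (subst Bochner_Integration.integral_sum) auto
      ultimately show ?case by (rule limit_of_zeros)
    qed
  qed
  then show ?thesis
    by (intro sigma_finite_measure.density_zero[OF sigma_finite_lborel h]) (simp add: set_lebesgue_integral_def)
qed

lemma LINT_lebesgue_on: "D \<in> sets lebesgue \<Longrightarrow> (LINT x|lebesgue_on D. f x) = (LINT x|lebesgue. indicator D x * (f x :: real))"
  by (subst integral_restrict_space) auto

lemma integrable_lebesgue_on:
  "D \<in> sets lebesgue \<Longrightarrow> integrable (lebesgue_on D) f \<longleftrightarrow> integrable lebesgue (\<lambda>x. indicator D x * (f x :: real))"
  by (subst integrable_restrict_space) auto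

text \<open>The fundamental lemma of the calculus of variations: cutoffs of a box inside D converge
  boundedly to its indicator, so the integrals of g over all such boxes vanish.\<close>

lemma AE_zero_if_test_zero:
  fixes g :: "'n::finite scalar"
  assumes D: "open D" and g: "integrable (lebesgue_on D) g"
    and 0: "\<And>\<phi>. \<phi> \<in> test_functions D \<Longrightarrow> ip D g \<phi> = 0"
  shows "AE x in lebesgue_on D. g x = 0"
proof -
  have Dl [measurable]: "D \<in> sets lebesgue" using D by simp
  define g0 where "g0 = (\<lambda>x. indicator D x * g x)"
  have g0: "integrable lebesgue g0" using g by (simp add: g0_def integrable_lebesgue_on)
  have box0: "(LINT x|lebesgue. indicator (box a b) x * g0 x) = 0" if ab: "box a b \<subseteq> D" for a b
  proof -
    \<comment> \<open>A box is the intersection of two half-spaces per coordinate; the Boolean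
      selects the lower or the upper side.\<close>
    define l :: "'n \<times> bool \<Rightarrow> 'n scalar" where "l = (\<lambda>(i, s) x. if s then x $ i - a $ i else b $ i - x $ i)"
    define A :: "'n \<times> bool \<Rightarrow> real^'n" where "A = (\<lambda>(i, s). if s then axis i 1 else - axis i 1)"
    define c :: "'n \<times> bool \<Rightarrow> real" where "c = (\<lambda>(i, s). if s then - a $ i else b $ i)"
    have l: "l j x = A j \<bullet> x + c j" for j x
      by (cases j) (auto simp: l_def A_def c_def inner_axis')
    have boxl: "(\<forall>j. l j x > 0) \<longleftrightarrow> x \<in> box a b" for x
      by (simp only: split_paired_All all_bool_eq l_def mem_box_cart all_conj_distrib prod.case) simp
    then have set: "{x. \<forall>j\<in>UNIV. l j x > 0} = box a b" by simp
    have phi: "(\<lambda>x. 1 * cutoff UNIV l (real (Suc n)) x) \<in> test_functions D" for n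
      using cutoff_test_function[of UNIV l A c "real (Suc n)" "\<lambda>_. 1"] l ab test_functions_mono[OF ab]
      unfolding set by (auto simp: C_diff_const)
    have "(\<lambda>n. LINT x|lebesgue. g0 x * cutoff UNIV l (real (Suc n)) x) \<longlonglongrightarrow> (LINT x|lebesgue. indicator (box a b) x * g0 x)"
    proof (rule integral_dominated_convergence)
      show "integrable lebesgue (\<lambda>x. \<bar>g0 x\<bar>)" using g0 by simp
      show "AE x in lebesgue. (\<lambda>n. g0 x * cutoff UNIV l (real (Suc n)) x) \<longlonglongrightarrow> indicator (box a b) x * g0 x"
      proof (intro AE_I2)
        fix x
        show "(\<lambda>n. g0 x * cutoff UNIV l (real (Suc n)) x) \<longlonglongrightarrow> indicator (box a b) x * g0 x"
        proof (cases "x \<in> box a b")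
          case True
          then have "\<And>j. l j x > 0" using boxl[of x] by blast
          then have "(\<lambda>n. g0 x * cutoff UNIV l (real (Suc n)) x) \<longlonglongrightarrow> g0 x * 1"
            by (intro tendsto_mult tendsto_const cutoff_limit)
          with True show ?thesis by simp
        next
          case False
          then obtain j where "l j x \<le> 0" using boxl[of x] not_less by blast
          then have "cutoff UNIV l (real (Suc n)) x = 0" for n by (intro cutoff_zero) auto
          with False show ?thesis by simp
        qed
      qed
      show "AE x in lebesgue. norm (g0 x * cutoff UNIV l (real (Suc n)) x) \<le> \<bar>g0 x\<bar>" for n
        by (rule AE_I2) (simp add: abs_mult cutoff_bounds mult_left_le)
      show "(\<lambda>x. g0 x * cutoff UNIV l (real (Suc n)) x) \<in> borel_measurable lebesgue" for n
      proof -
        have "continuous_on UNIV (cutoff UNIV l (real (Suc n)))" using test_C_diff[OF phi, of 0 n] by simp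
        then have "cutoff UNIV l (real (Suc n)) \<in> borel_measurable lebesgue"
          by (intro measurable_completion) (auto intro: borel_measurable_continuous_onI)
        then show ?thesis using g0 by measurable
      qed
    qed (use borel_measurable_integrable[OF g0] in \<open>auto intro!: borel_measurable_times borel_measurable_indicator\<close>)
    moreover have "(LINT x|lebesgue. g0 x * cutoff UNIV l (real (Suc n)) x) = 0" for n
      using 0[OF phi[of n]] by (simp add: ip_def LINT_lebesgue_on g0_def mult.assoc)
    ultimately show ?thesis by (rule limit_of_zeros)
  qed
  \<comment> \<open>The statement on boxes concerns \<open>lborel\<close>, so the Lebesgue
    measurable function is replaced by a Borel representative.\<close>
  obtain g' where g'm [measurable]: "g' \<in> borel_measurable lborel" and g': "AE x in lborel. g0 x = g' x"
    using completion_ex_borel_measurable_real[OF borel_measurable_integrable[OF g0]] by blast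
  have [measurable]: "g' \<in> borel_measurable lebesgue" "g0 \<in> borel_measurable lebesgue"
    using measurable_completion[OF g'm] borel_measurable_integrable[OF g0] by auto
  have g'': "AE x in lebesgue. g0 x = g' x" using g' by (rule AE_completion)
  have g'i: "integrable lborel g'"
  proof -
    have "integrable lebesgue g'" using g0 by (rule Bochner_Integration.integrable_cong_AE_imp) (use g'' in \<open>auto simp: eq_commute\<close>)
    then show ?thesis by (simp add: integrable_completion)
  qed
  have boxAE: "AE x in lebesgue. x \<in> box p r \<longrightarrow> g x = 0" if pr: "box p r \<subseteq> D" for p r
  proof -
    have "AE x in lborel. indicator (box p r) x * g' x = 0"
    proof (rule AE_zero_if_integral_boxes_zero)
      show "integrable lborel (\<lambda>x. indicator (box p r) x * g' x)"
        using integrable_mult_indicator[OF _ g'i, of "box p r"] by simp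
      fix a b :: "real^'n"
      obtain a' b' where ab': "box a b \<inter> box p r = box a' b'" using box_Int_box[of a b p r] by blast
      have "(LINT x|lborel. indicator (box a b) x * (indicator (box p r) x * g' x))
         = (LINT x|lebesgue. indicator (box a b) x * (indicator (box p r) x * g' x))"
        by (subst integral_completion) auto
      also have "\<dots> = (LINT x|lebesgue. indicator (box a' b') x * g0 x)"
        by (rule integral_cong_AE) (use g'' g0 in \<open>auto simp: ab'[symmetric] indicator_inter_arith intro!: borel_measurable_times borel_measurable_indicator\<close>)
      also have "\<dots> = 0" using ab' pr by (intro box0) auto
      finally show "(LINT x|lborel. indicator (box a b) x * (indicator (box p r) x * g' x)) = 0" .
    qed
    then have "AE x in lebesgue. indicator (box p r) x * g' x = 0" by (rule AE_completion)
    with g'' show ?thesis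
    proof eventually_elim
      case (elim x)
      then show ?case using pr by (auto simp: g0_def indicator_def split: if_splits)
    qed
  qed
  \<comment> \<open>Countability of the cover by boxes keeps the union of the exceptional sets
    null.\<close>
  obtain \<D> where \<D>: "countable \<D>" "\<D> \<subseteq> Pow D" "\<And>X. X \<in> \<D> \<Longrightarrow> \<exists>a b. X = box a b" "\<Union>\<D> = D"
    by (rule open_countable_Union_open_box[OF D], rule that)
  have "AE x in lebesgue. \<forall>X\<in>\<D>. x \<in> X \<longrightarrow> g x = 0"
    unfolding AE_ball_countable[OF \<D>(1)]
  proof
    fix X assume X: "X \<in> \<D>"
    then obtain a b where "X = box a b" using \<D>(3) by blast
    then show "AE x in lebesgue. x \<in> X \<longrightarrow> g x = 0" using boxAE[of a b] \<D>(2) X by auto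
  qed
  then have "AE x in lebesgue. x \<in> D \<longrightarrow> g x = 0" by eventually_elim (use \<D>(4) in auto)
  then show ?thesis by (subst AE_restrict_space_iff) (auto simp: D)
qed

section \<open>Geometry of simplices\<close>

lemma sum_option: "(\<Sum>i\<in>(UNIV :: 'n::finite option set). f i) = f None + (\<Sum>j\<in>UNIV. f (Some j))"
  by (simp add: UNIV_option_conv sum.reindex)

lemma ex_other_index: "\<exists>j. j \<noteq> (i :: 'n option)"
  by (cases i) auto

lemma ref_matrix_column:
  assumes "is_ref_map K M g"
  shows "g = K None" "M = (\<chi> i j. (K (Some j) - K None) $ i)"
proof -
  show g: "g = K None" using assms unfolding is_ref_map_def ref_simplex_def by (auto dest: spec[of _ None])
  have "M *v axis j 1 + g = K (Some j)" for j
    using assms unfolding is_ref_map_def ref_simplex_def by (auto dest: spec[of _ "Some j"])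
  then have "column j M = K (Some j) - K None" for j
    using g by (simp add: matrix_vector_mult_basis eq_diff_eq)
  then show "M = (\<chi> i j. (K (Some j) - K None) $ i)"
    by (auto simp: vec_eq_iff column_def)
qed

lemma is_ref_map_ref_matrix: "is_ref_map K (ref_matrix K) (K None)"
proof -
  let ?M = "\<chi> i j. (K (Some j) - K None) $ i"
  have M: "is_ref_map K ?M (K None)"
    unfolding is_ref_map_def
  proof
    fix i
    have "column j ?M = K (Some j) - K None" for j by (simp add: column_def vec_eq_iff)
    then show "?M *v ref_simplex i + K None = K i"
      by (cases i) (simp_all add: ref_simplex_def matrix_vector_mult_basis)
  qed
  have "ref_matrix K = ?M" unfolding ref_matrix_def
    by (rule the_equality) (use M ref_matrix_column in blast)+
  with M show ?thesis by simp
qed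

lemma ref_matrix_mult: "ref_matrix K *v x = (\<Sum>j\<in>UNIV. x $ j *\<^sub>R (K (Some j) - K None))"
proof -
  have "ref_matrix K = (\<chi> i j. (K (Some j) - K None) $ i)"
    using ref_matrix_column[OF is_ref_map_ref_matrix[of K]] by blast
  then show ?thesis by (simp add: matrix_vector_mult_def vec_eq_iff sum_component mult.commute)
qed

lemma nondegenerate_coeffs_zero:
  fixes K :: "'n::finite vsimplex"
  assumes nd: "nondegenerate K" and s: "(\<Sum>i\<in>UNIV. l i) = 0" and z: "(\<Sum>i\<in>UNIV. l i *\<^sub>R K i) = 0"
  shows "l i = 0"
proof (rule ccontr)
  assume n: "l i \<noteq> 0"
  have inj: "inj K" and ai: "\<not> affine_dependent (range K)" using nd by (auto simp: nondegenerate_def)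
  let ?U = "\<lambda>p. l (inv K p)"
  have "sum ?U (range K) = 0" using s inj by (simp add: sum.reindex)
  moreover have "(\<Sum>p\<in>range K. ?U p *\<^sub>R p) = 0" using z inj by (simp add: sum.reindex)
  moreover have "\<exists>p\<in>range K. ?U p \<noteq> 0" using n inj by auto
  ultimately have "affine_dependent (range K)"
    by (subst affine_dependent_explicit_finite) (auto intro: exI[of _ ?U])
  with ai show False by simp
qed

lemma nondegenerate_ref_simplex: "nondegenerate (ref_simplex :: 'n::finite vsimplex)"
  unfolding nondegenerate_def
proof
  have ne: "axis j (1::real) \<noteq> (0 :: real^'n)" for j by (simp add: axis_eq_0_iff)
  show inj: "inj (ref_simplex :: 'n vsimplex)"
    by (rule injI) (auto simp: ref_simplex_def axis_eq_axis ne ne[symmetric] split: option.splits)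
  show "\<not> affine_dependent (range (ref_simplex :: 'n vsimplex))"
  proof
    assume "affine_dependent (range (ref_simplex :: 'n vsimplex))"
    then obtain U where U: "sum U (range ref_simplex) = 0" "\<exists>v\<in>range (ref_simplex :: 'n vsimplex). U v \<noteq> 0"
      "(\<Sum>v\<in>range (ref_simplex :: 'n vsimplex). U v *\<^sub>R v) = 0"
      by (subst (asm) affine_dependent_explicit_finite) auto
    have 1: "U (ref_simplex None) + (\<Sum>j\<in>UNIV. U (ref_simplex (Some j))) = 0"
      using U(1) inj by (simp add: sum.reindex sum_option)
    have "(\<Sum>j\<in>UNIV. U (axis j 1) *\<^sub>R axis j (1::real)) = (0::real^'n)"
    proof -
      have "(\<Sum>i\<in>UNIV. U (ref_simplex i) *\<^sub>R (ref_simplex i :: real^'n)) = 0"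
        using U(3) inj by (simp add: sum.reindex)
      then show ?thesis by (simp add: sum_option ref_simplex_def)
    qed
    then have "(\<Sum>j\<in>UNIV. U (axis j 1) *\<^sub>R axis j (1::real)) $ i = (0::real^'n) $ i" for i by simp
    then have 2: "U (axis i 1) = 0" for i
      by (simp add: sum_component axis_def if_distrib[of "\<lambda>t. _ * t"] sum.delta' cong: if_cong)
    then have "U (ref_simplex (Some j)) = 0" for j by (simp add: ref_simplex_def)
    with 1 have "U (ref_simplex i) = 0" for i :: "'n option" by (cases i) auto
    with U(2) show False by auto
  qed
qed

text \<open>The gradient of the \<open>i\<close>-th barycentric coordinate.\<close>

definition grd :: "'n::finite vsimplex \<Rightarrow> 'n option \<Rightarrow> real ^ 'n" where
  "grd K i = adjoint (\<lambda>x. bary K i x - bary K i 0) 1"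

section \<open>Barycentric coordinates, gradients and normals\<close>

context
  fixes K :: "'n::finite vsimplex"
  assumes nd: "nondegenerate K"
begin

lemma ref_matrix_inj: "ref_matrix K *v x = 0 \<Longrightarrow> x = 0"
proof -
  assume 0: "ref_matrix K *v x = 0"
  \<comment> \<open>The coefficient of vertex \<open>None\<close> balances the others, which turns a
    kernel vector into an affine relation between the vertices.\<close>
  define l where "l = (\<lambda>i. case i of None \<Rightarrow> - (\<Sum>j\<in>UNIV. x $ j) | Some j \<Rightarrow> x $ j)"
  have "(\<Sum>i\<in>UNIV. l i) = 0" by (simp add: sum_option l_def)
  moreover have "(\<Sum>i\<in>UNIV. l i *\<^sub>R K i) = 0"
    using 0 by (simp add: sum_option l_def ref_matrix_mult scaleR_diff_right sum_subtractf scaleR_sum_left)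
  ultimately have "l (Some j) = 0" for j by (rule nondegenerate_coeffs_zero[OF nd])
  then show "x = 0" by (simp add: l_def vec_eq_iff)
qed

lemma ref_matrix_invertible: "invertible (ref_matrix K)"
proof -
  have "inj ((*v) (ref_matrix K))"
    using ref_matrix_inj by (auto simp: inj_def) (metis eq_iff_diff_eq_0 matrix_vector_mult_diff_distrib)
  then show ?thesis by (simp add: invertible_left_inverse matrix_left_invertible_injective)
qed

lemma ref_matrix_inv:
  "ref_matrix K *v (matrix_inv (ref_matrix K) *v y) = y"
  "matrix_inv (ref_matrix K) *v (ref_matrix K *v y) = y"
proof -
  have "ref_matrix K ** matrix_inv (ref_matrix K) = mat 1 \<and> matrix_inv (ref_matrix K) ** ref_matrix K = mat 1"
    using ref_matrix_invertible unfolding invertible_def matrix_inv_def by (rule someI_ex)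
  then show "ref_matrix K *v (matrix_inv (ref_matrix K) *v y) = y"
    "matrix_inv (ref_matrix K) *v (ref_matrix K *v y) = y"
    by (simp_all add: matrix_vector_mul_assoc)
qed

lemma bary_exists: "\<exists>l. (\<Sum>j\<in>UNIV. l j) = 1 \<and> (\<Sum>j\<in>UNIV. l j *\<^sub>R K j) = x"
proof -
  define y where "y = matrix_inv (ref_matrix K) *v (x - K None)"
  define l where "l = (\<lambda>i. case i of None \<Rightarrow> 1 - (\<Sum>j\<in>UNIV. y $ j) | Some j \<Rightarrow> y $ j)"
  have "(\<Sum>j\<in>UNIV. y $ j *\<^sub>R (K (Some j) - K None)) = x - K None"
    using ref_matrix_inv(1)[of "x - K None"] by (simp add: y_def[symmetric] ref_matrix_mult)
  then have "(\<Sum>j\<in>UNIV. l j *\<^sub>R K j) = x"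
    by (simp add: sum_option l_def scaleR_diff_right sum_subtractf scaleR_sum_left algebra_simps)
  moreover have "(\<Sum>j\<in>UNIV. l j) = 1" by (simp add: sum_option l_def)
  ultimately show ?thesis by blast
qed

lemma bary_unique_aux:
  assumes "(\<Sum>j\<in>UNIV. l j) = 1" "(\<Sum>j\<in>UNIV. l j *\<^sub>R K j) = x" "(\<Sum>j\<in>UNIV. m j) = 1" "(\<Sum>j\<in>UNIV. m j *\<^sub>R K j) = x"
  shows "l = m"
proof
  fix i
  have "l i - m i = 0"
    by (rule nondegenerate_coeffs_zero[OF nd]) (use assms in \<open>simp_all add: sum_subtractf scaleR_diff_left\<close>)
  then show "l i = m i" by simp
qed

lemma bary_unique:
  assumes "(\<Sum>j\<in>UNIV. l j) = 1" "(\<Sum>j\<in>UNIV. l j *\<^sub>R K j) = x"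
  shows "bary K i x = l i"
proof -
  have "(THE l. (\<Sum>j\<in>UNIV. l j) = 1 \<and> (\<Sum>j\<in>UNIV. l j *\<^sub>R K j) = x) = l"
    by (rule the_equality) (use assms bary_unique_aux in blast)+
  then show ?thesis by (simp add: bary_def)
qed

lemma bary_sum: "(\<Sum>j\<in>UNIV. bary K j x) = 1"
  and bary_expand: "(\<Sum>j\<in>UNIV. bary K j x *\<^sub>R K j) = x"
proof -
  obtain l where l: "(\<Sum>j\<in>UNIV. l j) = 1" "(\<Sum>j\<in>UNIV. l j *\<^sub>R K j) = x" using bary_exists by blast
  then show "(\<Sum>j\<in>UNIV. bary K j x) = 1" "(\<Sum>j\<in>UNIV. bary K j x *\<^sub>R K j) = x"
    by (simp_all add: bary_unique[OF l])
qed

lemma bary_vertex: "bary K i (K j) = (if i = j then 1 else 0)"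
  by (rule bary_unique) (auto simp: if_distrib[of "\<lambda>t. t *\<^sub>R _"] cong: if_cong)

lemma bary_combination: "a + b + c = 1 \<Longrightarrow>
  bary K i (a *\<^sub>R x + b *\<^sub>R y + c *\<^sub>R z) = a * bary K i x + b * bary K i y + c * bary K i z"
  by (rule bary_unique)
     (simp_all add: sum.distrib sum_distrib_left[symmetric] bary_sum scaleR_add_left
       scaleR_scaleR[symmetric] scaleR_sum_right[symmetric] bary_expand del: scaleR_scaleR)

lemma bary_affine: "bary K i x = grd K i \<bullet> x + bary K i 0"
proof -
  let ?f = "\<lambda>x. bary K i x - bary K i 0"
  have "linear ?f"
  proof
    fix x y
    show "?f (x + y) = ?f x + ?f y" using bary_combination[of 1 1 "-1" i x y 0] by simp
  next
    fix r x
    show "?f (r *\<^sub>R x) = r *\<^sub>R ?f x"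
      using bary_combination[of r "1 - r" 0 i x 0 0] by (simp add: algebra_simps)
  qed
  from adjoint_works[OF this, of x 1] show ?thesis by (simp add: grd_def inner_commute)
qed

lemma bary_add: "bary K i (x + v) = bary K i x + grd K i \<bullet> v"
  using bary_affine[of i "x + v"] bary_affine[of i x] by (simp add: inner_add_right)

lemma bary_pol: "pol 1 (bary K i)"
proof -
  have "bary K i = (\<lambda>x. grd K i \<bullet> x + bary K i 0)" by (intro ext bary_affine)
  moreover have "pol 1 (\<lambda>x. grd K i \<bullet> x + bary K i 0)" by (rule pol_add[OF pol_inner pol_const])
  ultimately show ?thesis by simp
qed

lemma grd_sum: "(\<Sum>i\<in>UNIV. grd K i \<bullet> v) = 0"
  using bary_sum[of "0 + v"] bary_sum[of 0] unfolding bary_add by (simp add: sum.distrib)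

lemma grd_expand: "(\<Sum>i\<in>UNIV. (grd K i \<bullet> v) *\<^sub>R K i) = v"
  using bary_expand[of "0 + v"] bary_expand[of 0] unfolding bary_add by (simp add: sum.distrib scaleR_add_left)

lemma dd_bary: "dd v (bary K i) x = grd K i \<bullet> v"
proof -
  have "bary K i = (\<lambda>x. grd K i \<bullet> x + bary K i 0)" by (intro ext bary_affine)
  then have "dd v (bary K i) x = dd v (\<lambda>x. grd K i \<bullet> x + bary K i 0) x" by (rule arg_cong)
  also have "\<dots> = grd K i \<bullet> v"
    by (rule dd_eqI) (auto intro!: derivative_eq_intros)
  finally show ?thesis .
qed

lemma grd_vertex_diff: "grd K i \<bullet> (K j - K m) = (if i = j then 1 else 0) - (if i = m then 1 else 0)"
  using bary_add[of i "K m" "K j - K m"] by (simp add: bary_vertex)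

lemma grd_nonzero: "grd K i \<noteq> 0"
proof -
  obtain j where "j \<noteq> i" using ex_other_index by blast
  then show ?thesis using grd_vertex_diff[of i i j] by auto
qed

text \<open>J = UNIV gives the element and J = UNIV - {i} a facet, while the common vertices of two
  elements give their intersection. All later geometry is thereby reduced to inequalities for
  barycentric coordinates.\<close>

lemma convex_hull_vertices:
  "convex hull (K ` J) = {x. (\<forall>i. 0 \<le> bary K i x) \<and> (\<forall>i. i \<notin> J \<longrightarrow> bary K i x = 0)}"
proof (intro set_eqI iffI)
  have inj: "inj K" using nd by (simp add: nondegenerate_def)
  fix y
  { assume "y \<in> convex hull (K ` J)"
    then obtain u where u: "\<forall>p\<in>K ` J. 0 \<le> u p" "sum u (K ` J) = 1" "(\<Sum>p\<in>K ` J. u p *\<^sub>R p) = y"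
      by (subst (asm) convex_hull_finite) auto
    define l where "l = (\<lambda>i. if i \<in> J then u (K i) else 0)"
    have "(\<Sum>i\<in>UNIV. l i) = (\<Sum>i\<in>J. u (K i))"
      unfolding l_def by (simp add: sum.If_cases)
    also have "\<dots> = 1" using u(2) by (simp add: sum.reindex inj_on_subset[OF inj])
    finally have 1: "(\<Sum>i\<in>UNIV. l i) = 1" .
    have "(\<Sum>i\<in>UNIV. l i *\<^sub>R K i) = (\<Sum>i\<in>J. u (K i) *\<^sub>R K i)"
      unfolding l_def by (simp add: if_distrib[of "\<lambda>t. t *\<^sub>R _"] sum.If_cases cong: if_cong)
    also have "\<dots> = y" using u(3) by (simp add: sum.reindex inj_on_subset[OF inj])
    finally have "bary K i y = l i" for i by (rule bary_unique[OF 1])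
    then show "y \<in> {x. (\<forall>i. 0 \<le> bary K i x) \<and> (\<forall>i. i \<notin> J \<longrightarrow> bary K i x = 0)}"
      using u(1) by (auto simp: l_def) }
  { assume y: "y \<in> {x. (\<forall>i. 0 \<le> bary K i x) \<and> (\<forall>i. i \<notin> J \<longrightarrow> bary K i x = 0)}"
    let ?u = "\<lambda>p. bary K (inv K p) y"
    have "sum ?u (K ` J) = (\<Sum>i\<in>J. bary K i y)"
      using inj by (simp add: sum.reindex inj_on_subset[OF inj])
    also have "\<dots> = (\<Sum>i\<in>UNIV. bary K i y)"
      by (rule sum.mono_neutral_left) (use y in auto)
    finally have 1: "sum ?u (K ` J) = 1" by (simp add: bary_sum)
    have "(\<Sum>p\<in>K ` J. ?u p *\<^sub>R p) = (\<Sum>i\<in>J. bary K i y *\<^sub>R K i)"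
      using inj by (simp add: sum.reindex inj_on_subset[OF inj])
    also have "\<dots> = (\<Sum>i\<in>UNIV. bary K i y *\<^sub>R K i)"
      by (rule sum.mono_neutral_left) (use y in auto)
    finally have "(\<Sum>p\<in>K ` J. ?u p *\<^sub>R p) = y" by (simp add: bary_expand)
    with 1 show "y \<in> convex hull (K ` J)" using y
      by (subst convex_hull_finite) (auto intro!: exI[of _ ?u]) }
qed

lemma elem_bary: "elem K = {x. \<forall>i. 0 \<le> bary K i x}"
  using convex_hull_vertices[of UNIV] by (simp add: elem_def)

lemma facet_bary: "facet K i = {x. (\<forall>j. 0 \<le> bary K j x) \<and> bary K i x = 0}"
  using convex_hull_vertices[of "UNIV - {i}"] by (auto simp: facet_def)

lemma bary_continuous: "continuous_on S (bary K i)"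
  by (rule pol_continuous[OF bary_pol])

lemma cell_bary: "cell K = {x. \<forall>i. 0 < bary K i x}"
proof
  have "open {x. \<forall>i. 0 < bary K i x}"
  proof -
    have "{x. \<forall>i. 0 < bary K i x} = (\<Inter>i\<in>UNIV. {x. 0 < bary K i x})" by auto
    moreover have "open {x. 0 < bary K i x}" for i
      by (rule open_Collect_less) (auto intro: bary_continuous continuous_intros)
    ultimately show ?thesis by (metis (no_types, lifting) open_INT finite_code)
  qed
  then show "{x. \<forall>i. 0 < bary K i x} \<subseteq> cell K"
    by (rule interior_maximal[rotated]) (auto simp: elem_bary less_imp_le)
  show "cell K \<subseteq> {x. \<forall>i. 0 < bary K i x}"
  proof clarify
    fix x and i :: "'n option" assume x: "x \<in> cell K"
    obtain j where j: "j \<noteq> i" using ex_other_index by blast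
    \<comment> \<open>In this direction the i-th coordinate falls with slope -1, so a ball around x
      inside the element leaves room only if the coordinate is positive at x.\<close>
    define v where "v = K j - K i"
    have gv: "grd K i \<bullet> v = -1" using j by (simp add: v_def grd_vertex_diff)
    have v0: "v \<noteq> 0" using gv by auto
    obtain e where e: "e > 0" "ball x e \<subseteq> elem K" using x by (auto simp: mem_interior)
    define t where "t = e / (2 * norm v)"
    have t: "t > 0" using e v0 by (simp add: t_def)
    have "x + t *\<^sub>R v \<in> ball x e" using e v0 by (simp add: t_def dist_norm)
    then have "0 \<le> bary K i (x + t *\<^sub>R v)" using e(2) by (auto simp: elem_bary)
    then show "0 < bary K i x" using t by (simp add: bary_add gv)
  qed
qed

lemma elem_compact: "compact (elem K)"
  by (simp add: elem_def compact_convex_hull finite_imp_compact)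

lemma frontier_bary: "frontier (elem K) = {x. (\<forall>i. 0 \<le> bary K i x) \<and> (\<exists>i. bary K i x = 0)}"
proof -
  have "frontier (elem K) = elem K - cell K"
    by (simp add: frontier_def closure_closed elem_compact compact_imp_closed)
  then show ?thesis unfolding cell_bary unfolding elem_bary
    by (simp only: set_diff_eq mem_Collect_eq) (metis less_le order.refl)
qed

lemma cell_nonempty: "cell K \<noteq> {}"
proof -
  let ?c = "1 / real (CARD('n option))"
  have "bary K i (\<Sum>j\<in>UNIV. ?c *\<^sub>R K j) = ?c" for i
    by (rule bary_unique) auto
  then have "(\<Sum>j\<in>UNIV. ?c *\<^sub>R K j) \<in> cell K" unfolding cell_bary by auto
  then show ?thesis by blast
qed

lemma cell_bounded: "bounded (cell K)"
  using elem_compact compact_imp_bounded bounded_subset interior_subset by blast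

lemma facet_vertex: "j \<noteq> i \<Longrightarrow> K j \<in> facet K i"
  by (auto simp: facet_bary bary_vertex)

text \<open>For uniqueness, any v is expanded in the vertices with weights
  \<open>grd K l \<bullet> v\<close> of sum zero. A candidate n takes the same value at all vertices
  of the facet, so only the i-th weight survives and n is a negative multiple of the gradient; the
  unit length fixes the multiple.\<close>

lemma normal_grd: "normal K i = - (grd K i /\<^sub>R norm (grd K i))"
  unfolding normal_def
proof (rule the_equality)
  let ?g = "grd K i"
  have g: "norm ?g > 0" using grd_nonzero by simp
  have bi: "?g \<bullet> (x - y) = bary K i x - bary K i y" for x y
    using bary_affine[of i x] bary_affine[of i y] by (simp add: inner_diff_right)
  show "norm (- (?g /\<^sub>R norm ?g)) = 1 \<and> (\<forall>x\<in>facet K i. \<forall>y\<in>facet K i. (- (?g /\<^sub>R norm ?g)) \<bullet> (x - y) = 0)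
     \<and> (\<forall>x\<in>facet K i. (- (?g /\<^sub>R norm ?g)) \<bullet> (K i - x) < 0)"
    using g grd_nonzero by (auto simp: inner_minus_left bi facet_bary bary_vertex)
  fix n assume n: "norm n = 1 \<and> (\<forall>x\<in>facet K i. \<forall>y\<in>facet K i. n \<bullet> (x - y) = 0)
     \<and> (\<forall>x\<in>facet K i. n \<bullet> (K i - x) < 0)"
  obtain m where m: "m \<noteq> i" using ex_other_index by blast
  define c where "c = - (n \<bullet> (K i - K m))"
  have c: "c > 0" using n facet_vertex[OF m] by (auto simp: c_def)
  have nl: "n \<bullet> (K l - K m) = (if l = i then - c else 0)" for l
    using n facet_vertex[OF m] facet_vertex[of l i] by (auto simp: c_def)
  have "n \<bullet> v = (- c *\<^sub>R ?g) \<bullet> v" for v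
  proof -
    have "n \<bullet> v = n \<bullet> (\<Sum>l\<in>UNIV. (grd K l \<bullet> v) *\<^sub>R K l)" by (simp only: grd_expand)
    also have "\<dots> = (\<Sum>l\<in>UNIV. (grd K l \<bullet> v) * (n \<bullet> K l))" by (simp add: inner_sum_right)
    also have "\<dots> = (\<Sum>l\<in>UNIV. (grd K l \<bullet> v) * (n \<bullet> (K l - K m))) + (\<Sum>l\<in>UNIV. (grd K l \<bullet> v)) * (n \<bullet> K m)"
      by (simp add: sum_distrib_right inner_diff_right right_diff_distrib sum_subtractf)
    also have "\<dots> = (grd K i \<bullet> v) * - c"
      unfolding nl grd_sum by (simp add: if_distrib[of "\<lambda>t. _ * t"] cong: if_cong)
    finally show ?thesis by simp
  qed
  then have ng: "n = - c *\<^sub>R ?g" using vector_eq_rdot[of n "- c *\<^sub>R ?g"] by blast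
  then have "c * norm ?g = 1" using n c by simp
  then have "c = inverse (norm ?g)" using g by (simp add: field_simps)
  then show "n = - (?g /\<^sub>R norm ?g)" using ng by simp
qed

lemma inner_normal: "v \<bullet> normal K i = - (grd K i \<bullet> v) / norm (grd K i)"
  by (simp add: normal_grd inner_commute divide_inverse)

lemma sgn_inner_normal: "sgn (v \<bullet> normal K i) = - sgn (grd K i \<bullet> v)"
  using grd_nonzero[of i] by (simp add: inner_normal sgn_divide sgn_minus)

lemma edge_le_diameter: "norm (K i - K j) \<le> diameter (elem K)"
proof -
  have "K i \<in> elem K" for i by (simp add: elem_def hull_inc)
  then show ?thesis using diameter_bounded_bound[of "elem K" "K i" "K j"] elem_compact compact_imp_bounded
    by (auto simp: dist_norm)
qed

lemma diameter_elem_pos: "diameter (elem K) > 0"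
proof -
  obtain j where j: "j \<noteq> (None :: 'n option)" using ex_other_index by blast
  have "inj K" using nd by (simp add: nondegenerate_def)
  then have "K j \<noteq> K None" using j by (auto dest: injD)
  then have "0 < norm (K j - K None)" by simp
  then show ?thesis using edge_le_diameter[of j None] by linarith
qed

text \<open>An edge ending at vertex i has slope 1 for the i-th coordinate and is no longer than the
  diameter. This converts a bound on the angle between field and normal into one on the field
  component along the unnormalised gradient.\<close>

lemma norm_grd_lower: "1 \<le> norm (grd K i) * diameter (elem K)"
proof -
  obtain j where "j \<noteq> i" using ex_other_index by blast
  then have "1 = grd K i \<bullet> (K i - K j)" by (simp add: grd_vertex_diff)
  also have "\<dots> \<le> norm (grd K i) * norm (K i - K j)" by (rule norm_cauchy_schwarz)
  also have "\<dots> \<le> norm (grd K i) * diameter (elem K)" by (intro mult_left_mono edge_le_diameter) auto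
  finally show ?thesis .
qed

text \<open>As the weights \<open>grd K i \<bullet> v\<close> add up to zero, v is a combination of
  edge vectors from vertex \<open>None\<close>. For the advection field this bounds the sum of its
  components along the gradients from below, whatever its direction.\<close>

lemma norm_le_grd_sum: "norm v \<le> diameter (elem K) * (\<Sum>i\<in>UNIV. \<bar>grd K i \<bullet> v\<bar>)"
proof -
  have "v = (\<Sum>i\<in>UNIV. (grd K i \<bullet> v) *\<^sub>R K i) - (\<Sum>i\<in>UNIV. grd K i \<bullet> v) *\<^sub>R K None"
    by (simp add: grd_expand grd_sum)
  also have "\<dots> = (\<Sum>i\<in>UNIV. (grd K i \<bullet> v) *\<^sub>R (K i - K None))"
    by (simp add: scaleR_diff_right sum_subtractf scaleR_sum_left)
  finally have "norm v = norm (\<Sum>i\<in>UNIV. (grd K i \<bullet> v) *\<^sub>R (K i - K None))" by simp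
  also have "\<dots> \<le> (\<Sum>i\<in>UNIV. \<bar>grd K i \<bullet> v\<bar> * diameter (elem K))"
    by (rule order_trans[OF norm_sum sum_mono]) (auto intro!: mult_left_mono edge_le_diameter)
  finally show ?thesis by (simp add: sum_distrib_left mult.commute)
qed

end

section \<open>The affine map from the reference simplex\<close>

definition Phi :: "'n::finite vsimplex \<Rightarrow> 'n field" where "Phi K x = ref_matrix K *v x + K None"

lemma Phi_vertex: "Phi K (ref_simplex i) = K i"
  using is_ref_map_ref_matrix[of K] by (simp add: is_ref_map_def Phi_def)

lemma Phi_surj: "nondegenerate K \<Longrightarrow> Phi K (matrix_inv (ref_matrix K) *v (y - K None)) = y"
  by (simp add: Phi_def ref_matrix_inv)

lemma Phi_add: "Phi K (x + v) = Phi K x + ref_matrix K *v v"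
  by (simp add: Phi_def matrix_vector_right_distrib)

lemma bary_Phi:
  fixes K :: "'n::finite vsimplex"
  assumes nd: "nondegenerate K"
  shows "bary K i (Phi K x) = bary ref_simplex i x"
proof (rule bary_unique[OF nd])
  note nr = nondegenerate_ref_simplex[where 'n='n]
  show 1: "(\<Sum>j\<in>UNIV. bary ref_simplex j x) = 1" by (rule bary_sum[OF nr])
  have K: "K j = ref_matrix K *v ref_simplex j + K None" for j
    using Phi_vertex[of K j] by (simp add: Phi_def)
  have "(\<Sum>j\<in>UNIV. bary ref_simplex j x *\<^sub>R K j)
      = (\<Sum>j\<in>UNIV. ref_matrix K *v (bary ref_simplex j x *\<^sub>R ref_simplex j) + bary ref_simplex j x *\<^sub>R K None)"
  proof (rule sum.cong[OF refl])
    fix j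
    show "bary ref_simplex j x *\<^sub>R K j
      = ref_matrix K *v (bary ref_simplex j x *\<^sub>R ref_simplex j) + bary ref_simplex j x *\<^sub>R K None"
      unfolding matrix_vector_mult_scaleR scaleR_add_right[symmetric] by (rule arg_cong[OF K])
  qed
  also have "\<dots> = ref_matrix K *v (\<Sum>j\<in>UNIV. bary ref_simplex j x *\<^sub>R ref_simplex j) + K None"
    by (simp add: sum.distrib scaleR_sum_left[symmetric] 1
        linear_sum[OF matrix_vector_mul_linear, symmetric])
  also have "\<dots> = Phi K x" by (simp add: bary_expand[OF nr] Phi_def)
  finally show "(\<Sum>j\<in>UNIV. bary ref_simplex j x *\<^sub>R K j) = Phi K x" .
qed

lemma Phi_mem:
  fixes K :: "'n::finite vsimplex"
  assumes nd: "nondegenerate K"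
  shows "Phi K x \<in> elem K \<longleftrightarrow> x \<in> elem ref_simplex" "Phi K x \<in> cell K \<longleftrightarrow> x \<in> cell ref_simplex"
    "Phi K x \<in> facet K i \<longleftrightarrow> x \<in> facet ref_simplex i"
    "Phi K x \<in> frontier (elem K) \<longleftrightarrow> x \<in> frontier (elem ref_simplex)"
proof -
  note nr = nondegenerate_ref_simplex[where 'n='n]
  show "Phi K x \<in> cell K \<longleftrightarrow> x \<in> cell ref_simplex"
    unfolding cell_bary[OF nd] cell_bary[OF nr] by (simp add: bary_Phi[OF nd])
  show "Phi K x \<in> elem K \<longleftrightarrow> x \<in> elem ref_simplex"
    unfolding elem_bary[OF nd] elem_bary[OF nr] by (simp add: bary_Phi[OF nd])
  show "Phi K x \<in> facet K i \<longleftrightarrow> x \<in> facet ref_simplex i"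
    unfolding facet_bary[OF nd] facet_bary[OF nr] by (simp add: bary_Phi[OF nd])
  show "Phi K x \<in> frontier (elem K) \<longleftrightarrow> x \<in> frontier (elem ref_simplex)"
    unfolding frontier_bary[OF nd] frontier_bary[OF nr] by (simp add: bary_Phi[OF nd])
qed

lemma pol_Phi: "pol m f \<Longrightarrow> pol m (\<lambda>x. f (Phi K x))"
  unfolding Phi_def by (rule pol_affine)

lemma pol_Phi_inverse: "pol m f \<Longrightarrow> pol m (\<lambda>x. f (matrix_inv (ref_matrix K) *v (x - K None)))"
  using pol_affine[of m f "matrix_inv (ref_matrix K)" "- (matrix_inv (ref_matrix K) *v K None)"]
  by (simp add: matrix_vector_mult_diff_distrib)

lemma dd_Phi:
  assumes "\<And>x. f differentiable (at x)"
  shows "dd v (\<lambda>x. f (Phi K x)) x = dd (ref_matrix K *v v) f (Phi K x)"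
proof (rule dd_eqI)
  have "(Phi K has_derivative (\<lambda>v. ref_matrix K *v v)) (at x)"
    unfolding Phi_def by (auto intro!: derivative_eq_intros bounded_linear_imp_has_derivative matrix_vector_mul_bounded_linear)
  then show "((\<lambda>x. f (Phi K x)) has_derivative (\<lambda>v. dd (ref_matrix K *v v) f (Phi K x))) (at x)"
    by (rule has_derivative_compose) (rule dd_has_derivative[OF assms])
qed

text \<open>Multiplied by the norm of the inverse matrix, this bounds h_K |M^(-1) c| / |c| by the
  shape constant times the reference diameter. It is what makes the inverse inequality uniform over
  the mesh.\<close>

lemma diameter_le_mat_norm:
  fixes K :: "'n::finite vsimplex"
  assumes nd: "nondegenerate K"
  shows "diameter (elem K) \<le> mat_norm (ref_matrix K) * diameter (elem (ref_simplex :: 'n vsimplex))"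
proof (rule diameter_le)
  have bl: "bounded_linear ((*v) (ref_matrix K))" by (rule matrix_vector_mul_bounded_linear)
  note nr = nondegenerate_ref_simplex[where 'n='n]
  show "elem K \<noteq> {} \<or> 0 \<le> mat_norm (ref_matrix K) * diameter (elem (ref_simplex :: 'n vsimplex))"
    using cell_nonempty[OF nd] interior_subset by auto
  fix x y assume xy: "x \<in> elem K" "y \<in> elem K"
  define a b where "a = matrix_inv (ref_matrix K) *v (x - K None)" and "b = matrix_inv (ref_matrix K) *v (y - K None)"
  have ab: "Phi K a = x" "Phi K b = y" by (simp_all add: a_def b_def Phi_surj[OF nd])
  have "a \<in> elem ref_simplex" "b \<in> elem ref_simplex"
    using xy ab Phi_mem(1)[OF nd] by metis+
  then have d: "norm (a - b) \<le> diameter (elem (ref_simplex :: 'n vsimplex))"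
    using diameter_bounded_bound[of "elem (ref_simplex :: 'n vsimplex)" a b] elem_compact[OF nr] compact_imp_bounded
    by (auto simp: dist_norm)
  have "x - y = ref_matrix K *v (a - b)"
    unfolding ab[symmetric] by (simp add: Phi_def matrix_vector_mult_diff_distrib)
  then have "norm (x - y) \<le> mat_norm (ref_matrix K) * norm (a - b)"
    using onorm[OF bl, of "a - b"] by (simp add: mat_norm_def)
  also have "\<dots> \<le> mat_norm (ref_matrix K) * diameter (elem (ref_simplex :: 'n vsimplex))"
    using d by (intro mult_left_mono) (auto simp: mat_norm_def onorm_pos_le[OF bl])
  finally show "norm (x - y) \<le> mat_norm (ref_matrix K) * diameter (elem (ref_simplex :: 'n vsimplex))" .
qed

section \<open>The Lebesgue measure under an affine bijection\<close>

text \<open>Uniqueness of translation invariant measures, by the classical Fubini argument.\<close>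

lemma translation_invariant_proportional:
  fixes \<nu> :: "'a::euclidean_space measure"
  assumes sets [measurable_cong]: "sets \<nu> = sets borel"
    and bdd: "\<And>A. bounded A \<Longrightarrow> A \<in> sets borel \<Longrightarrow> emeasure \<nu> A < \<infinity>"
    and inv: "\<And>w f. f \<in> borel_measurable borel \<Longrightarrow> (\<integral>\<^sup>+x. f (x + w) \<partial>\<nu>) = (\<integral>\<^sup>+x. f x \<partial>\<nu>)"
    and A [measurable]: "A \<in> sets borel"
  shows "emeasure \<nu> A * emeasure lborel (cball (0::'a) 1) = emeasure \<nu> (cball 0 1) * emeasure lborel A"
proof -
  have sp: "space \<nu> = UNIV" using sets_eq_imp_space_eq[OF sets] by simp
  interpret \<nu>: sigma_finite_measure \<nu>
  proof
    show "\<exists>B. countable B \<and> B \<subseteq> sets \<nu> \<and> \<Union> B = space \<nu> \<and> (\<forall>a\<in>B. emeasure \<nu> a \<noteq> \<infinity>)"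
    proof (intro exI conjI ballI)
      show "countable (range (\<lambda>n. ball (0::'a) (real n)))" by simp
      show "range (\<lambda>n. ball (0::'a) (real n)) \<subseteq> sets \<nu>" by (auto simp: sets)
      show "\<Union> (range (\<lambda>n. ball (0::'a) (real n))) = space \<nu>"
        unfolding sp by (auto simp: reals_Archimedean2)
      fix B assume "B \<in> range (\<lambda>n. ball (0::'a) (real n))"
      then show "emeasure \<nu> B \<noteq> \<infinity>" using bdd[of B] by auto
    qed
  qed
  interpret P: pair_sigma_finite lborel \<nu> ..
  have linv: "(\<integral>\<^sup>+x. f (x + w) \<partial>lborel) = (\<integral>\<^sup>+x. f x \<partial>lborel)" if [measurable]: "f \<in> borel_measurable borel"
    for w :: 'a and f
  proof -
    have "(\<integral>\<^sup>+x. f x \<partial>distr lborel borel ((+) w)) = (\<integral>\<^sup>+x. f (w + x) \<partial>lborel)"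
      by (rule nn_integral_distr) auto
    then show ?thesis by (simp add: lborel_distr_plus add.commute)
  qed
  define B where "B = cball (0::'a) 1"
  have Bm [measurable]: "B \<in> sets borel" by (simp add: B_def)
  let ?i = "\<lambda>S x. indicator S x :: ennreal"
  have "emeasure \<nu> A * emeasure lborel B = (\<integral>\<^sup>+y. ?i A y * (\<integral>\<^sup>+x. ?i B x \<partial>lborel) \<partial>\<nu>)"
    using A by (simp add: nn_integral_multc sets)
  also have "\<dots> = (\<integral>\<^sup>+y. (\<integral>\<^sup>+x. ?i A y * ?i B (x + (- y)) \<partial>lborel) \<partial>\<nu>)"
  proof (rule nn_integral_cong)
    fix y
    have m: "(\<lambda>x. ?i B (x + - y)) \<in> borel_measurable lborel" by measurable
    have iB: "?i B \<in> borel_measurable borel" by measurable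
    show "?i A y * (\<integral>\<^sup>+x. ?i B x \<partial>lborel) = (\<integral>\<^sup>+x. ?i A y * ?i B (x + - y) \<partial>lborel)"
      by (simp only: nn_integral_cmult[OF m] linv[OF iB])
  qed
  also have "\<dots> = (\<integral>\<^sup>+x. (\<integral>\<^sup>+y. ?i A y * ?i B (x + (- y)) \<partial>\<nu>) \<partial>lborel)"
    by (rule P.Fubini') measurable
  also have "\<dots> = (\<integral>\<^sup>+x. (\<integral>\<^sup>+y. ?i A (y + x) * ?i B (x + (- (y + x))) \<partial>\<nu>) \<partial>lborel)"
  proof (rule nn_integral_cong)
    fix x
    have m: "(\<lambda>y. ?i A y * ?i B (x + - y)) \<in> borel_measurable borel" by measurable
    show "(\<integral>\<^sup>+y. ?i A y * ?i B (x + - y) \<partial>\<nu>) = (\<integral>\<^sup>+y. ?i A (y + x) * ?i B (x + - (y + x)) \<partial>\<nu>)"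
      by (rule inv[OF m, symmetric])
  qed
  \<comment> \<open>The argument x - (y + x) is -y, and the ball is symmetric under
    reflection.\<close>
  also have "\<dots> = (\<integral>\<^sup>+x. (\<integral>\<^sup>+y. ?i A (y + x) * ?i B y \<partial>\<nu>) \<partial>lborel)"
    by (intro nn_integral_cong) (simp add: B_def indicator_def)
  also have "\<dots> = (\<integral>\<^sup>+y. (\<integral>\<^sup>+x. ?i A (y + x) * ?i B y \<partial>lborel) \<partial>\<nu>)"
    by (rule P.Fubini'[symmetric]) measurable
  also have "\<dots> = (\<integral>\<^sup>+y. ?i B y * (\<integral>\<^sup>+x. ?i A x \<partial>lborel) \<partial>\<nu>)"
  proof (rule nn_integral_cong)
    fix y
    have m: "(\<lambda>x. ?i A (x + y)) \<in> borel_measurable lborel" by measurable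
    have iA: "?i A \<in> borel_measurable borel" by measurable
    show "(\<integral>\<^sup>+x. ?i A (y + x) * ?i B y \<partial>lborel) = ?i B y * (\<integral>\<^sup>+x. ?i A x \<partial>lborel)"
      unfolding add.commute[of y] nn_integral_multc[OF m] linv[OF iA] by (rule mult.commute)
  qed
  also have "\<dots> = emeasure \<nu> B * emeasure lborel A"
    using A by (simp add: nn_integral_multc sets)
  finally show ?thesis by (simp add: B_def)
qed

text \<open>The image of Lebesgue measure under \<open>Phi K\<close> is again translation invariant
  and finite on bounded sets, hence a multiple of Lebesgue measure. The factor stays anonymous;
  constant integrands later identify it as a ratio of volumes.\<close>

lemma integral_affine_image:
  fixes K :: "'n::finite vsimplex"
  assumes nd: "nondegenerate K"
  shows "\<exists>J>0. \<forall>f. f \<in> borel_measurable borel \<longrightarrow>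
    (integrable lborel (\<lambda>x. f (Phi K x)) \<longleftrightarrow> integrable lborel f) \<and>
    (LINT x|lborel. f x) = J * (LINT x|lborel. f (Phi K x) :: real)"
proof -
  let ?N = "matrix_inv (ref_matrix K)"
  have [measurable]: "Phi K \<in> borel_measurable borel"
    unfolding Phi_def by (intro borel_measurable_continuous_onI continuous_intros matrix_vector_mult_linear_continuous_on)
  define \<nu> where "\<nu> = distr lborel borel (Phi K)"
  have s [measurable_cong]: "sets \<nu> = sets borel" by (simp add: \<nu>_def)
  have em: "emeasure \<nu> A = emeasure lborel (Phi K -` A)" if "A \<in> sets borel" for A
    unfolding \<nu>_def using that by (subst emeasure_distr) auto
  have vim: "Phi K -` A = (\<lambda>y. ?N *v (y - K None)) ` A" for A
    by (auto simp: Phi_surj[OF nd] Phi_def ref_matrix_inv[OF nd] intro!: image_eqI)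
  have bl: "bounded_linear ((*v) ?N)" by (rule matrix_vector_mul_bounded_linear)
  have fin: "emeasure \<nu> A < \<infinity>" if "bounded A" "A \<in> sets borel" for A
  proof -
    have "bounded ((\<lambda>y. - K None + y) ` A)" by (rule bounded_translation[OF that(1)])
    then have "bounded ((*v) ?N ` ((\<lambda>y. - K None + y) ` A))" by (rule bounded_linear_image[OF _ bl])
    then have "bounded (Phi K -` A)" unfolding vim by (simp add: image_image)
    then show ?thesis using em[OF that(2)] emeasure_bounded_finite by simp
  qed
  have linv: "(\<integral>\<^sup>+x. f (x + w) \<partial>lborel) = (\<integral>\<^sup>+x. f x \<partial>lborel)" if [measurable]: "f \<in> borel_measurable borel"
    for w :: "real^'n" and f
  proof -
    have "(\<integral>\<^sup>+x. f x \<partial>distr lborel borel ((+) w)) = (\<integral>\<^sup>+x. f (w + x) \<partial>lborel)"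
      by (rule nn_integral_distr) auto
    then show ?thesis by (simp add: lborel_distr_plus add.commute)
  qed
  have inv: "(\<integral>\<^sup>+x. f (x + w) \<partial>\<nu>) = (\<integral>\<^sup>+x. f x \<partial>\<nu>)" if [measurable]: "f \<in> borel_measurable borel" for w f
  proof -
    have "(\<integral>\<^sup>+x. f (x + w) \<partial>\<nu>) = (\<integral>\<^sup>+x. f (Phi K x + w) \<partial>lborel)"
      unfolding \<nu>_def by (rule nn_integral_distr) auto
    also have "\<dots> = (\<integral>\<^sup>+x. f (Phi K (x + ?N *v w)) \<partial>lborel)"
      by (simp add: Phi_add ref_matrix_inv[OF nd])
    also have "\<dots> = (\<integral>\<^sup>+x. f (Phi K x) \<partial>lborel)" by (rule linv) measurable
    also have "\<dots> = (\<integral>\<^sup>+x. f x \<partial>\<nu>)" unfolding \<nu>_def by (rule nn_integral_distr[symmetric]) auto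
    finally show ?thesis .
  qed
  let ?B = "cball (0::real^'n) 1"
  have B: "emeasure lborel ?B < \<infinity>" "emeasure \<nu> ?B < \<infinity>" using fin emeasure_bounded_finite by auto
  have pos: "emeasure lborel S > 0" if "open S" "S \<noteq> {}" for S :: "(real^'n) set"
    using that open_not_negligible[OF that] by (simp add: negligible_iff_emeasure0 zero_less_iff_neq_zero)
  have B0: "emeasure lborel ?B > 0"
    using pos[of "ball 0 1"] emeasure_mono[of "ball 0 1" ?B lborel] by (auto intro: less_le_trans)
  have \<nu>B0: "emeasure \<nu> ?B > 0"
  proof -
    have "open (Phi K -` ball 0 1)" unfolding Phi_def
      by (intro open_vimage continuous_intros matrix_vector_mult_linear_continuous_on) auto
    moreover have "Phi K -` ball 0 1 \<noteq> {}" unfolding vim by auto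
    ultimately have "0 < emeasure lborel (Phi K -` ball 0 1)" by (rule pos)
    also have "\<dots> = emeasure \<nu> (ball 0 1)" by (rule em[symmetric]) auto
    also have "\<dots> \<le> emeasure \<nu> ?B" by (rule emeasure_mono) (auto simp: s)
    finally show ?thesis .
  qed
  \<comment> \<open>Both measures are compared on the unit ball, where they are positive and finite;
    J is the reciprocal of this ratio.\<close>
  define c where "c = enn2real (emeasure \<nu> ?B) / enn2real (emeasure lborel ?B)"
  have c: "c > 0" using B B0 \<nu>B0 by (auto simp: c_def enn2real_positive_iff)
  have em2: "emeasure \<nu> A = ennreal c * emeasure lborel A" if "A \<in> sets borel" for A
  proof -
    obtain a b where ab: "emeasure \<nu> ?B = ennreal a" "emeasure lborel ?B = ennreal b" "a > 0" "b > 0"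
      using B B0 \<nu>B0 by (cases "emeasure \<nu> ?B"; cases "emeasure lborel ?B") auto
    have "emeasure \<nu> A * emeasure lborel ?B = emeasure \<nu> ?B * emeasure lborel A"
      by (rule translation_invariant_proportional[OF s fin inv that])
    then have e1: "emeasure \<nu> A * ennreal b = ennreal a * emeasure lborel A"
      by (simp only: ab)
    have b1: "ennreal b * ennreal (1 / b) = 1" using ab by (simp flip: ennreal_mult)
    have c1: "ennreal a * ennreal (1 / b) = ennreal c" using ab by (simp add: c_def flip: ennreal_mult)
    have "emeasure \<nu> A = (emeasure \<nu> A * ennreal b) * ennreal (1 / b)"
      by (simp only: mult.assoc b1 mult_1_right)
    also have "\<dots> = (ennreal a * ennreal (1 / b)) * emeasure lborel A" unfolding e1 by (simp only: ac_simps)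
    finally show ?thesis by (simp only: c1)
  qed
  have eq: "\<nu> = density lborel (\<lambda>_. ennreal c)"
    by (rule measure_eqI) (auto simp: s em2 emeasure_density nn_integral_cmult)
  have "(integrable lborel (\<lambda>x. f (Phi K x)) \<longleftrightarrow> integrable lborel f) \<and>
    (LINT x|lborel. f x) = (1 / c) * (LINT x|lborel. f (Phi K x) :: real)" if [measurable]: "f \<in> borel_measurable borel" for f
  proof
    have "integrable lborel (\<lambda>x. f (Phi K x)) \<longleftrightarrow> integrable \<nu> f"
      unfolding \<nu>_def by (subst integrable_distr_eq) auto
    also have "\<dots> \<longleftrightarrow> integrable lborel f"
      unfolding eq using c by (subst integrable_density) auto
    finally show "integrable lborel (\<lambda>x. f (Phi K x)) \<longleftrightarrow> integrable lborel f" .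
    have "(LINT x|lborel. f (Phi K x)) = (LINT x|\<nu>. f x)"
      unfolding \<nu>_def by (subst integral_distr) auto
    also have "\<dots> = c * (LINT x|lborel. f x)"
      unfolding eq using c by (subst integral_density) auto
    finally show "(LINT x|lborel. f x) = (1 / c) * (LINT x|lborel. f (Phi K x))" using c by simp
  qed
  note main = this
  show ?thesis
  proof (rule exI[of _ "1 / c"], rule conjI)
    show "0 < 1 / c" using c by simp
  qed (intro allI impI main)
qed

section \<open>Weak derivatives in a constant direction\<close>

lemma continuous_imp_measurable_lebesgue_on:
  fixes f :: "'n::finite scalar"
  assumes "continuous_on UNIV f"
  shows "f \<in> borel_measurable (lebesgue_on D)"
proof -
  have "f \<in> borel_measurable lborel" using assms by (simp add: borel_measurable_continuous_onI)
  then have "f \<in> borel_measurable lebesgue" by (rule measurable_completion)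
  then show ?thesis by (rule measurable_restrict_space1)
qed

lemma integrable_mult_bounded:
  fixes f g :: "'n::finite scalar"
  assumes g: "integrable (lebesgue_on D) g" and f: "continuous_on UNIV f"
    and B: "\<And>x. x \<in> D \<Longrightarrow> \<bar>f x\<bar> \<le> B"
  shows "integrable (lebesgue_on D) (\<lambda>x. g x * f x)"
proof (rule Bochner_Integration.integrable_bound)
  show "integrable (lebesgue_on D) (\<lambda>x. B * \<bar>g x\<bar>)" using g by simp
  show "(\<lambda>x. g x * f x) \<in> borel_measurable (lebesgue_on D)"
    using borel_measurable_integrable[OF g] continuous_imp_measurable_lebesgue_on[OF f]
    by (rule borel_measurable_times)
  show "AE x in lebesgue_on D. norm (g x * f x) \<le> norm (B * \<bar>g x\<bar>)"
  proof (rule AE_I2)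
    fix x assume "x \<in> space (lebesgue_on D)"
    then have b: "\<bar>f x\<bar> \<le> B" by (simp add: B)
    then have "0 \<le> B" by linarith
    have "\<bar>g x\<bar> * \<bar>f x\<bar> \<le> \<bar>g x\<bar> * B" using b by (intro mult_left_mono) auto
    then show "norm (g x * f x) \<le> norm (B * \<bar>g x\<bar>)" using \<open>0 \<le> B\<close> by (simp add: abs_mult mult.commute)
  qed
qed

lemma test_bounded:
  assumes "\<phi> \<in> test_functions D"
  shows "continuous_on UNIV \<phi>" "continuous_on UNIV (dd v \<phi>)" "\<exists>B. \<forall>x. \<bar>\<phi> x\<bar> \<le> B \<and> \<bar>dd v \<phi> x\<bar> \<le> B"
proof -
  show c1: "continuous_on UNIV \<phi>" using test_C_diff[OF assms, of 0] by simp
  show c2: "continuous_on UNIV (dd v \<phi>)" by (rule C_diff_dd_continuous[OF test_C_diff[OF assms]])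
  let ?C = "closure {x. \<phi> x \<noteq> 0}"
  have comp: "compact ?C" using assms by (simp add: test_functions_def)
  have "bounded (\<phi> ` ?C)" "bounded (dd v \<phi> ` ?C)"
    by (intro compact_imp_bounded compact_continuous_image comp continuous_on_subset[OF c1] continuous_on_subset[OF c2] subset_UNIV)+
  then obtain B1 B2 where B: "\<And>x. x \<in> ?C \<Longrightarrow> \<bar>\<phi> x\<bar> \<le> B1" "\<And>x. x \<in> ?C \<Longrightarrow> \<bar>dd v \<phi> x\<bar> \<le> B2"
    unfolding bounded_iff by auto
  have "\<bar>\<phi> x\<bar> \<le> max 0 (max B1 B2) \<and> \<bar>dd v \<phi> x\<bar> \<le> max 0 (max B1 B2)" for x
  proof (cases "x \<in> ?C")
    case True
    then show ?thesis using B by fastforce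
  next
    case False
    then have "\<phi> x = 0" using closure_subset[of "{x. \<phi> x \<noteq> 0}"] by auto
    then show ?thesis using dd_outside_support[OF False] by simp
  qed
  then show "\<exists>B. \<forall>x. \<bar>\<phi> x\<bar> \<le> B \<and> \<bar>dd v \<phi> x\<bar> \<le> B" by blast
qed

lemma integrable_mult_test:
  assumes "integrable (lebesgue_on D) g" "\<phi> \<in> test_functions E"
  shows "integrable (lebesgue_on D) (\<lambda>x. g x * \<phi> x)" "integrable (lebesgue_on D) (\<lambda>x. g x * dd v \<phi> x)"
proof -
  obtain B where B: "\<And>x. \<bar>\<phi> x\<bar> \<le> B \<and> \<bar>dd v \<phi> x\<bar> \<le> B" using test_bounded(3)[OF assms(2)] by blast
  show "integrable (lebesgue_on D) (\<lambda>x. g x * \<phi> x)" "integrable (lebesgue_on D) (\<lambda>x. g x * dd v \<phi> x)"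
    by (rule integrable_mult_bounded[OF assms(1) test_bounded(1)[OF assms(2)]], use B in blast)
       (rule integrable_mult_bounded[OF assms(1) test_bounded(2)[OF assms(2)]], use B in blast)
qed

lemma ip_cong: "(\<And>x. x \<in> D \<Longrightarrow> f x * g x = f' x * g' x) \<Longrightarrow> ip D f g = ip D f' g'"
  unfolding ip_def by (rule Bochner_Integration.integral_cong) auto

lemma ip_cong_AE:
  assumes "integrable (lebesgue_on D) (\<lambda>x. f x * g x)" "integrable (lebesgue_on D) (\<lambda>x. f' x * g' x)"
    "AE x in lebesgue_on D. f x * g x = f' x * g' x"
  shows "ip D f g = ip D f' g'"
  unfolding ip_def by (rule integral_cong_AE) (use assms in auto)

lemma weak_deriv_iff:
  assumes "\<And>x. x \<in> D \<Longrightarrow> \<beta> x = c"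
  shows "weak_deriv \<beta> D v g \<longleftrightarrow> (\<forall>\<phi>\<in>test_functions D. ip D v (dd c \<phi>) = - ip D g \<phi>)"
proof -
  have "ip D v (\<lambda>x. frechet_derivative \<phi> (at x) (\<beta> x)) = ip D v (dd c \<phi>)" for \<phi>
    by (rule ip_cong) (simp add: assms dd_def)
  then show ?thesis by (simp add: weak_deriv_def)
qed

lemma weak_derivI:
  "(\<And>x. x \<in> D \<Longrightarrow> \<beta> x = c) \<Longrightarrow> (\<And>\<phi>. \<phi> \<in> test_functions D \<Longrightarrow> ip D v (dd c \<phi>) = - ip D g \<phi>)
    \<Longrightarrow> weak_deriv \<beta> D v g"
  by (subst weak_deriv_iff) auto

lemma weak_derivD:
  "weak_deriv \<beta> D v g \<Longrightarrow> (\<And>x. x \<in> D \<Longrightarrow> \<beta> x = c) \<Longrightarrow> \<phi> \<in> test_functions D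
    \<Longrightarrow> ip D v (dd c \<phi>) = - ip D g \<phi>"
  by (subst (asm) weak_deriv_iff) auto

text \<open>This makes \<open>bgrad\<close>, a choice by \<open>SOME\<close>, well defined up to
  null sets.\<close>

lemma weak_deriv_unique:
  fixes D :: "(real^'n::finite) set"
  assumes D: "open D" and i: "integrable (lebesgue_on D) g" "integrable (lebesgue_on D) h"
    and w: "weak_deriv \<beta> D v g" "weak_deriv \<beta> D v h"
  shows "AE x in lebesgue_on D. g x = h x"
proof -
  have "AE x in lebesgue_on D. g x - h x = 0"
  proof (rule AE_zero_if_test_zero[OF D])
    show "integrable (lebesgue_on D) (\<lambda>x. g x - h x)" using i by simp
    fix \<phi> :: "'n scalar" assume p: "\<phi> \<in> test_functions D"
    then have "ip D g \<phi> = ip D h \<phi>" using w unfolding weak_deriv_def by (metis neg_equal_iff_equal)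
    then show "ip D (\<lambda>x. g x - h x) \<phi> = 0"
      using integrable_mult_test(1)[OF i(1) p] integrable_mult_test(1)[OF i(2) p]
      by (simp add: ip_def left_diff_distrib)
  qed
  then show ?thesis by eventually_elim simp
qed

lemma weak_deriv_comb:
  assumes b: "\<And>x. x \<in> D \<Longrightarrow> \<beta> x = c"
    and i: "integrable (lebesgue_on D) v" "integrable (lebesgue_on D) w"
    "integrable (lebesgue_on D) g" "integrable (lebesgue_on D) h"
    and w: "weak_deriv \<beta> D v g" "weak_deriv \<beta> D w h"
  shows "weak_deriv \<beta> D (\<lambda>x. v x + a * w x) (\<lambda>x. g x + a * h x)"
proof (rule weak_derivI[OF b], assumption)
  fix \<phi> assume p: "\<phi> \<in> test_functions D"
  note im = integrable_mult_test[OF i(1) p] integrable_mult_test[OF i(2) p]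
    integrable_mult_test[OF i(3) p] integrable_mult_test[OF i(4) p]
  have "ip D (\<lambda>x. v x + a * w x) (dd c \<phi>) = ip D v (dd c \<phi>) + a * ip D w (dd c \<phi>)"
    using im by (simp add: ip_def distrib_right mult.assoc)
  also have "\<dots> = - (ip D g \<phi> + a * ip D h \<phi>)"
    using weak_derivD[OF w(1) b p] weak_derivD[OF w(2) b p] by simp
  also have "ip D g \<phi> + a * ip D h \<phi> = ip D (\<lambda>x. g x + a * h x) \<phi>"
    using im by (simp add: ip_def distrib_right mult.assoc)
  finally show "ip D (\<lambda>x. v x + a * w x) (dd c \<phi>) = - ip D (\<lambda>x. g x + a * h x) \<phi>" .
qed

lemma weak_deriv_cong:
  assumes "\<And>x. x \<in> D \<Longrightarrow> v x = v' x" "\<And>x. x \<in> D \<Longrightarrow> g x = g' x"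
  shows "weak_deriv \<beta> D v g \<longleftrightarrow> weak_deriv \<beta> D v' g'"
proof -
  have "ip D v f = ip D v' f" "ip D g f = ip D g' f" for f
    by (auto intro!: ip_cong simp: assms)
  then show ?thesis by (simp add: weak_deriv_def)
qed

lemma ip_open_zero_outside:
  fixes D :: "(real^'n::finite) set"
  assumes D: "open D" and f: "\<And>x. x \<notin> D \<Longrightarrow> f x = (0::real)"
  shows "(LINT x|lebesgue_on D. f x) = (LINT x|lebesgue. f x)"
proof -
  have "(LINT x|lebesgue_on D. f x) = (LINT x|lebesgue. indicator D x * f x)"
    using D by (simp add: LINT_lebesgue_on)
  also have "(\<lambda>x. indicator D x * f x) = f" by (rule ext) (use f in \<open>auto simp: indicator_def\<close>)
  finally show ?thesis .
qed

text \<open>For a test function \<phi> the product of z and \<phi> has compact support, so the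
  integral of its derivative over the whole space vanishes; since \<phi> is supported in D, that
  integral is the one over D.\<close>

lemma weak_deriv_smooth:
  fixes D :: "(real^'n::finite) set"
  assumes D: "open D" and b: "\<And>x. x \<in> D \<Longrightarrow> \<beta> x = c" and z: "\<And>m. C_diff m z"
    and iz: "integrable (lebesgue_on D) z" "integrable (lebesgue_on D) (dd c z)"
  shows "weak_deriv \<beta> D z (dd c z)"
proof (rule weak_derivI[OF b], assumption)
  fix \<phi> assume p: "\<phi> \<in> test_functions D"
  have zd: "z differentiable (at x)" for x using z[of 1] by (simp add: C_diff_Suc_dd)
  have eq: "dd c (\<lambda>x. z x * \<phi> x) = (\<lambda>x. z x * dd c \<phi> x + dd c z x * \<phi> x)"
    by (intro ext dd_mult zd test_differentiable[OF p])
  have "bounded (closure {x. \<phi> x \<noteq> 0})" using p by (simp add: test_functions_def compact_imp_bounded)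
  then obtain R where R: "\<And>x. x \<in> closure {x. \<phi> x \<noteq> 0} \<Longrightarrow> norm x \<le> R" unfolding bounded_iff by blast
  have "(LINT x|lebesgue. dd c (\<lambda>x. z x * \<phi> x) x) = 0"
  proof (rule integral_dd_compact_support[where R="R + 1"])
    show "(\<lambda>x. z x * \<phi> x) differentiable (at x)" for x
      by (intro derivative_intros zd test_differentiable[OF p])
    have "C_diff (Suc 0) (\<lambda>x. z x * \<phi> x)" by (intro C_diff_mult z test_C_diff[OF p])
    then show "continuous_on UNIV (dd c (\<lambda>x. z x * \<phi> x))" by (rule C_diff_dd_continuous)
    fix x :: "real^'n" assume "R + 1 \<le> norm x"
    then have "x \<notin> closure {x. \<phi> x \<noteq> 0}" using R[of x] by auto
    then show "z x * \<phi> x = 0" using closure_subset[of "{x. \<phi> x \<noteq> 0}"] by auto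
  qed
  then have "(LINT x|lebesgue_on D. z x * dd c \<phi> x + dd c z x * \<phi> x) = 0"
    using test_zero_outside[OF p] by (subst ip_open_zero_outside[OF D]) (auto simp: eq)
  then show "ip D z (dd c \<phi>) = - ip D (dd c z) \<phi>"
    using integrable_mult_test(2)[OF iz(1) p] integrable_mult_test(1)[OF iz(2) p]
    by (simp add: ip_def)
qed

section \<open>Integration by parts on a simplex\<close>

context
  fixes K :: "'n::finite vsimplex"
  assumes nd: "nondegenerate K"
begin

lemma cell_measurable [measurable]: "cell K \<in> sets lebesgue"
  by simp

lemma elem_bounded_continuous:
  assumes "continuous_on UNIV (f :: 'n scalar)" shows "\<exists>B\<ge>0. \<forall>x\<in>elem K. \<bar>f x\<bar> \<le> B"
proof -
  have "bounded (f ` elem K)"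
    by (intro compact_imp_bounded compact_continuous_image elem_compact[OF nd] continuous_on_subset[OF assms] subset_UNIV)
  then obtain B where "\<forall>x\<in>elem K. \<bar>f x\<bar> \<le> B" unfolding bounded_iff by auto
  then show ?thesis by (intro exI[of _ "max 0 B"]) auto
qed

lemma cell_integrable_const: "integrable (lebesgue_on (cell K)) (\<lambda>x. c :: real)"
proof -
  have "cell K \<in> lmeasurable" using cell_bounded[OF nd] by (simp add: lmeasurable_open)
  then interpret finite_measure "lebesgue_on (cell K)" by (rule finite_measure_lebesgue_on)
  show ?thesis by simp
qed

lemma cell_integrable:
  assumes "continuous_on UNIV (f :: 'n scalar)" shows "integrable (lebesgue_on (cell K)) f"
proof -
  obtain B where B: "\<And>x. x \<in> elem K \<Longrightarrow> \<bar>f x\<bar> \<le> B" using elem_bounded_continuous[OF assms] by blast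
  have "integrable (lebesgue_on (cell K)) (\<lambda>x. 1 * f x)"
    by (rule integrable_mult_bounded[OF cell_integrable_const assms, of B]) (use B interior_subset in blast)
  then show ?thesis by simp
qed

lemma cell_integrable_mult:
  assumes "continuous_on UNIV (f :: 'n scalar)" "integrable (lebesgue_on (cell K)) g"
  shows "integrable (lebesgue_on (cell K)) (\<lambda>x. g x * f x)"
proof -
  obtain B where B: "\<And>x. x \<in> elem K \<Longrightarrow> \<bar>f x\<bar> \<le> B" using elem_bounded_continuous[OF assms(1)] by blast
  show ?thesis
    by (rule integrable_mult_bounded[OF assms(2,1), of B]) (use B interior_subset in blast)
qed

lemma weak_deriv_pol:
  assumes b: "\<And>x. x \<in> cell K \<Longrightarrow> \<beta> x = c" and z: "pol m z"
  shows "weak_deriv \<beta> (cell K) z (dd c z)"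
  by (rule weak_deriv_smooth[OF open_interior b pol_C_diff[OF z]])
     (auto intro!: cell_integrable pol_continuous[OF z] pol_continuous[OF pol_dd[OF z]])

text \<open>Moving towards the facet \<open>F\<^sub>j\<close> along the edge from \<open>a\<^sub>j\<close> to another vertex stays in \<open>K\<close>.\<close>

lemma boundary_zero_bound:
  assumes z: "pol m z" and 0: "\<And>x. x \<in> frontier (elem K) \<Longrightarrow> z x = 0"
  shows "\<exists>C\<ge>0. \<forall>x\<in>elem K. \<forall>j. \<bar>z x\<bar> \<le> C * bary K j x"
proof -
  have "\<exists>C\<ge>0. \<forall>x\<in>elem K. \<bar>z x\<bar> \<le> C * bary K j x" for j
  proof -
    obtain l where l: "l \<noteq> j" using ex_other_index by blast
    let ?w = "K j - K l"
    obtain C where C: "C \<ge> 0" "\<And>x. x \<in> elem K \<Longrightarrow> \<bar>dd ?w z x\<bar> \<le> C"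
      using elem_bounded_continuous[OF pol_continuous[OF pol_dd[OF z]]] by blast
    have "\<bar>z x\<bar> \<le> C * bary K j x" if x: "x \<in> elem K" for x
    proof -
      define s where "s = bary K j x"
      \<comment> \<open>The point of the facet opposite vertex j that is reached from x along the
        edge direction; the parameter s is the distance to the facet measured by the j-th
        coordinate.\<close>
      define y where "y = x + (- s) *\<^sub>R ?w"
      have bx: "\<And>i. 0 \<le> bary K i x" using x by (simp add: elem_bary[OF nd])
      have bry: "bary K i (y + t *\<^sub>R ?w) = bary K i x + (t - s) * ((if i = j then 1 else 0) - (if i = l then 1 else 0))" for i t
      proof -
        have "y + t *\<^sub>R ?w = x + (t - s) *\<^sub>R ?w" by (simp add: y_def algebra_simps)
        then show ?thesis by (simp only: bary_add[OF nd] inner_scaleR_right grd_vertex_diff[OF nd])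
      qed
      have s0: "s \<ge> 0" using bx by (simp add: s_def)
      have mem: "y + t *\<^sub>R ?w \<in> elem K" if "0 \<le> t" "t \<le> s" for t
        using that bx l by (auto simp: elem_bary[OF nd] bry s_def)
      have "bary K j y = 0" using bry[of j 0] l by (simp add: s_def)
      moreover have "\<forall>i. 0 \<le> bary K i y" using mem[of 0] s0 by (simp add: elem_bary[OF nd])
      ultimately have "y \<in> frontier (elem K)" unfolding frontier_bary[OF nd] by auto
      then have zy: "z y = 0" by (rule 0)
      have yx: "y + s *\<^sub>R ?w = x" by (simp add: y_def)
      show ?thesis
      proof (cases "s = 0")
        case True
        then show ?thesis using zy yx by (simp add: s_def[symmetric])
      next
        case False
        then have sp: "0 < s" using s0 by simp
        obtain t where t: "0 < t" "t < s" "z (y + s *\<^sub>R ?w) - z (y + 0 *\<^sub>R ?w) = (s - 0) * dd ?w z (y + t *\<^sub>R ?w)"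
          using MVT2[OF sp, of "\<lambda>t. z (y + t *\<^sub>R ?w)" "\<lambda>t. dd ?w z (y + t *\<^sub>R ?w)"]
            line_has_derivative[OF pol_differentiable[OF z]] by blast
        then have "\<bar>z x\<bar> = s * \<bar>dd ?w z (y + t *\<^sub>R ?w)\<bar>" using zy yx sp by (simp add: abs_mult)
        also have "\<dots> \<le> s * C" using C(2)[OF mem[of t]] t sp by (intro mult_left_mono) auto
        finally show ?thesis by (simp add: s_def mult.commute)
      qed
    qed
    with C show ?thesis by blast
  qed
  then obtain C where C: "\<And>j. C j \<ge> 0" "\<And>j x. x \<in> elem K \<Longrightarrow> \<bar>z x\<bar> \<le> C j * bary K j x" by metis
  have "\<bar>z x\<bar> \<le> (\<Sum>j\<in>UNIV. C j) * bary K j x" if x: "x \<in> elem K" for x j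
  proof -
    have "C j \<le> (\<Sum>j\<in>UNIV. C j)" by (rule member_le_sum) (use C in auto)
    then have "C j * bary K j x \<le> (\<Sum>j\<in>UNIV. C j) * bary K j x"
      using x by (intro mult_right_mono) (auto simp: elem_bary[OF nd])
    with C(2)[OF x, of j] show ?thesis by linarith
  qed
  then show ?thesis using C(1) by (intro exI[of _ "\<Sum>j\<in>UNIV. C j"]) (auto intro: sum_nonneg)
qed

lemma dd_cutoff_bary:
  "(cutoff UNIV (bary K) s) differentiable (at x)"
  "dd c (cutoff UNIV (bary K) s) x
    = (\<Sum>j\<in>UNIV. s * (grd K j \<bullet> c) * flat (Suc 0) (s * bary K j x - 1) * (\<Prod>i\<in>UNIV - {j}. flat 0 (s * bary K i x - 1)))"
proof -
  have "((\<lambda>x. flat 0 (s * bary K j x - 1)) has_derivative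
      (\<lambda>v. s * (grd K j \<bullet> v) * flat (Suc 0) (s * bary K j x - 1))) (at x)" for j x
  proof -
    have eq: "(s *\<^sub>R grd K j) \<bullet> x + (s * bary K j 0 - 1) = s * bary K j x - 1" for x
      by (subst (2) bary_affine[OF nd]) (simp add: algebra_simps)
    show ?thesis
      using has_derivative_comp_affine[of "flat 0" "flat (Suc 0)" "s *\<^sub>R grd K j" "s * bary K j 0 - 1" x, OF flat_has_derivative]
      unfolding eq by simp
  qed
  then have d: "(cutoff UNIV (bary K) s has_derivative (\<lambda>v. \<Sum>j\<in>UNIV. s * (grd K j \<bullet> v) * flat (Suc 0) (s * bary K j x - 1) *
      (\<Prod>i\<in>UNIV - {j}. flat 0 (s * bary K i x - 1)))) (at x)"
    unfolding cutoff_def[abs_def] by (intro has_derivative_prod)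
  then show "(cutoff UNIV (bary K) s) differentiable (at x)" unfolding differentiable_def by blast
  from dd_eqI[OF d] show "dd c (cutoff UNIV (bary K) s) x
    = (\<Sum>j\<in>UNIV. s * (grd K j \<bullet> c) * flat (Suc 0) (s * bary K j x - 1) * (\<Prod>i\<in>UNIV - {j}. flat 0 (s * bary K i x - 1)))" .
qed

text \<open>The test functions are z times cutoffs of the cell. The derivative of a cutoff grows
  like its scale s, but z is bounded by C times every barycentric coordinate, so the error term is
  controlled by s times the coordinate times \<open>flat (Suc 0)\<close>, which is bounded and tends
  to zero at each interior point. Dominated convergence removes the cutoff.\<close>

lemma integration_by_parts_zero:
  assumes b: "\<And>x. x \<in> cell K \<Longrightarrow> \<beta> x = c" and z: "pol m z"
    and 0: "\<And>x. x \<in> frontier (elem K) \<Longrightarrow> z x = 0"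
    and v: "integrable (lebesgue_on (cell K)) v" "integrable (lebesgue_on (cell K)) g"
    and w: "weak_deriv \<beta> (cell K) v g"
  shows "ip (cell K) v (dd c z) + ip (cell K) g z = 0"
proof -
  define \<psi> where "\<psi> = (\<lambda>n. cutoff UNIV (bary K) (real (Suc n)))"
  define \<phi> where "\<phi> = (\<lambda>n x. z x * \<psi> n x)"
  have setc: "{x. \<forall>i\<in>UNIV. bary K i x > 0} = cell K" by (simp add: cell_bary[OF nd])
  have test: "\<phi> n \<in> test_functions (cell K)" for n
  proof -
    have "(\<lambda>x. z x * cutoff UNIV (bary K) (real (Suc n)) x) \<in> test_functions {x. \<forall>i\<in>UNIV. bary K i x > 0}"
    proof (rule cutoff_test_function)
      show "bary K i x = grd K i \<bullet> x + bary K i 0" for i x by (rule bary_affine[OF nd])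
      show "bounded {x. \<forall>i\<in>UNIV. bary K i x > 0}" unfolding setc by (rule cell_bounded[OF nd])
      show "C_diff m z" for m by (rule pol_C_diff[OF z])
    qed auto
    then show ?thesis unfolding setc \<phi>_def \<psi>_def .
  qed
  have cl: "x \<in> cell K \<Longrightarrow> x \<in> elem K" for x using interior_subset by blast
  obtain B where B: "B \<ge> 0" "\<And>x. x \<in> elem K \<Longrightarrow> \<bar>z x\<bar> \<le> B" using elem_bounded_continuous[OF pol_continuous[OF z]] by blast
  obtain B' where B': "B' \<ge> 0" "\<And>x. x \<in> elem K \<Longrightarrow> \<bar>dd c z x\<bar> \<le> B'"
    using elem_bounded_continuous[OF pol_continuous[OF pol_dd[OF z]]] by blast
  obtain C where C: "C \<ge> 0" "\<And>x j. x \<in> elem K \<Longrightarrow> \<bar>z x\<bar> \<le> C * bary K j x"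
    using boundary_zero_bound[OF z 0] by blast
  define E where "E = (\<lambda>n x. z x * dd c (\<psi> n) x)"
  have ddphi: "dd c (\<phi> n) x = E n x + dd c z x * \<psi> n x" for n x
    unfolding \<phi>_def E_def \<psi>_def by (rule dd_mult[OF pol_differentiable[OF z] dd_cutoff_bary(1)])
  \<comment> \<open>In the j-th summand the decay of z is used towards the j-th facet; the scale and
    the coordinate then combine to the argument of \<open>flat\<close> plus 1.\<close>
  have Eterm: "\<bar>E n x\<bar> \<le> (\<Sum>j\<in>UNIV. C * \<bar>grd K j \<bullet> c\<bar> * \<bar>real (Suc n) * bary K j x * flat (Suc 0) (real (Suc n) * bary K j x - 1)\<bar>)"
    if x: "x \<in> cell K" for n x
  proof -
    let ?s = "real (Suc n)"
    have "\<bar>E n x\<bar> \<le> (\<Sum>j\<in>UNIV. \<bar>z x * (?s * (grd K j \<bullet> c) * flat (Suc 0) (?s * bary K j x - 1) *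
        (\<Prod>i\<in>UNIV - {j}. flat 0 (?s * bary K i x - 1)))\<bar>)"
      unfolding E_def \<psi>_def dd_cutoff_bary(2) sum_distrib_left by (rule sum_abs)
    also have "\<dots> \<le> (\<Sum>j\<in>UNIV. C * \<bar>grd K j \<bullet> c\<bar> * \<bar>?s * bary K j x * flat (Suc 0) (?s * bary K j x - 1)\<bar>)"
    proof (rule sum_mono)
      fix j
      let ?P = "\<Prod>i\<in>UNIV - {j}. flat 0 (?s * bary K i x - 1)"
      have P: "0 \<le> ?P" "?P \<le> 1" by (auto intro!: prod_nonneg prod_le_1 simp: flat_0_bounds)
      have bp: "bary K j x > 0" using x by (simp add: cell_bary[OF nd])
      have "\<bar>z x * (?s * (grd K j \<bullet> c) * flat (Suc 0) (?s * bary K j x - 1) * ?P)\<bar>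
          = \<bar>z x\<bar> * (?s * \<bar>grd K j \<bullet> c\<bar> * \<bar>flat (Suc 0) (?s * bary K j x - 1)\<bar>) * ?P"
        using P by (simp add: abs_mult del: of_nat_Suc)
      also have "\<dots> \<le> (C * bary K j x) * (?s * \<bar>grd K j \<bullet> c\<bar> * \<bar>flat (Suc 0) (?s * bary K j x - 1)\<bar>) * 1"
        using C(2)[OF cl[OF x], of j] P C(1) bp by (intro mult_mono mult_nonneg_nonneg) auto
      also have "\<dots> = C * \<bar>grd K j \<bullet> c\<bar> * \<bar>?s * bary K j x * flat (Suc 0) (?s * bary K j x - 1)\<bar>"
        using bp by (simp add: abs_mult del: of_nat_Suc)
      finally show "\<bar>z x * (?s * (grd K j \<bullet> c) * flat (Suc 0) (?s * bary K j x - 1) * ?P)\<bar>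
        \<le> C * \<bar>grd K j \<bullet> c\<bar> * \<bar>?s * bary K j x * flat (Suc 0) (?s * bary K j x - 1)\<bar>" .
    qed
    finally show ?thesis .
  qed
  define A where "A = (\<Sum>j\<in>(UNIV::'n option set). C * \<bar>grd K j \<bullet> c\<bar> * 3)"
  have Ebound: "\<bar>E n x\<bar> \<le> A" if x: "x \<in> cell K" for n x
    unfolding A_def
  proof (rule order_trans[OF Eterm[OF x] sum_mono])
    fix j
    show "C * \<bar>grd K j \<bullet> c\<bar> * \<bar>real (Suc n) * bary K j x * flat (Suc 0) (real (Suc n) * bary K j x - 1)\<bar> \<le> C * \<bar>grd K j \<bullet> c\<bar> * 3"
      using flat_1_bound[of "real (Suc n) * bary K j x - 1"] C(1) by (intro mult_left_mono) auto
  qed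
  have Elim: "(\<lambda>n. E n x) \<longlonglongrightarrow> 0" if x: "x \<in> cell K" for x
  proof (rule tendsto_0_le[of _ _ _ 1])
    have "(\<lambda>n. real (Suc n) * bary K j x * flat (Suc 0) (real (Suc n) * bary K j x - 1)) \<longlonglongrightarrow> 0" for j
      using filterlim_compose[OF flat_1_limit scale_at_top[of "bary K j x"]] x by (simp add: cell_bary[OF nd])
    then have "(\<lambda>n. \<Sum>j\<in>(UNIV::'n option set). C * \<bar>grd K j \<bullet> c\<bar> * \<bar>real (Suc n) * bary K j x * flat (Suc 0) (real (Suc n) * bary K j x - 1)\<bar>)
      \<longlonglongrightarrow> (\<Sum>j\<in>(UNIV::'n option set). C * \<bar>grd K j \<bullet> c\<bar> * \<bar>0\<bar>)"
      by (intro tendsto_sum tendsto_mult tendsto_const tendsto_rabs)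
    then show "(\<lambda>n. \<Sum>j\<in>(UNIV::'n option set). C * \<bar>grd K j \<bullet> c\<bar> * \<bar>real (Suc n) * bary K j x * flat (Suc 0) (real (Suc n) * bary K j x - 1)\<bar>)
      \<longlonglongrightarrow> 0" by simp
    show "\<forall>\<^sub>F n in sequentially. norm (E n x) \<le> norm (\<Sum>j\<in>(UNIV::'n option set). C * \<bar>grd K j \<bullet> c\<bar> * \<bar>real (Suc n) * bary K j x * flat (Suc 0) (real (Suc n) * bary K j x - 1)\<bar>) * 1"
      using Eterm[OF x] by (intro always_eventually allI) (auto intro: order_trans[OF _ abs_ge_self])
  qed
  have \<psi>lim: "(\<lambda>n. \<psi> n x) \<longlonglongrightarrow> 1" if x: "x \<in> cell K" for x
    unfolding \<psi>_def by (rule cutoff_limit) (use x in \<open>simp add: cell_bary[OF nd]\<close>)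
  have \<psi>b: "0 \<le> \<psi> n x" "\<psi> n x \<le> 1" for n x unfolding \<psi>_def by (rule cutoff_bounds)+
  have vm: "v \<in> borel_measurable (lebesgue_on (cell K))" "g \<in> borel_measurable (lebesgue_on (cell K))"
    using v by auto
  note tm = continuous_imp_measurable_lebesgue_on[OF test_bounded(1)[OF test]]
    continuous_imp_measurable_lebesgue_on[OF test_bounded(2)[OF test]]
  have zm: "z \<in> borel_measurable (lebesgue_on (cell K))" "dd c z \<in> borel_measurable (lebesgue_on (cell K))"
    by (intro continuous_imp_measurable_lebesgue_on pol_continuous[OF z] pol_continuous[OF pol_dd[OF z]])+
  have lim1: "(\<lambda>n. ip (cell K) v (dd c (\<phi> n))) \<longlonglongrightarrow> ip (cell K) v (dd c z)"
    unfolding ip_def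
  proof (rule integral_dominated_convergence)
    show "integrable (lebesgue_on (cell K)) (\<lambda>x. \<bar>v x\<bar> * (A + B'))" using v by simp
    show "AE x in lebesgue_on (cell K). (\<lambda>n. v x * dd c (\<phi> n) x) \<longlonglongrightarrow> v x * dd c z x"
    proof (rule AE_I2)
      fix x assume "x \<in> space (lebesgue_on (cell K))"
      then have x: "x \<in> cell K" by simp
      have "(\<lambda>n. v x * dd c (\<phi> n) x) \<longlonglongrightarrow> v x * (0 + dd c z x * 1)"
        unfolding ddphi by (intro tendsto_mult tendsto_add tendsto_const Elim[OF x] \<psi>lim[OF x])
      then show "(\<lambda>n. v x * dd c (\<phi> n) x) \<longlonglongrightarrow> v x * dd c z x" by simp
    qed
    show "AE x in lebesgue_on (cell K). norm (v x * dd c (\<phi> n) x) \<le> \<bar>v x\<bar> * (A + B')" for n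
    proof (rule AE_I2)
      fix x assume "x \<in> space (lebesgue_on (cell K))"
      then have x: "x \<in> cell K" by simp
      have "\<bar>dd c z x * \<psi> n x\<bar> \<le> B' * 1"
        unfolding abs_mult using B'(2)[OF cl[OF x]] \<psi>b[of n x] by (intro mult_mono) auto
      then have "\<bar>dd c (\<phi> n) x\<bar> \<le> A + B'" unfolding ddphi using Ebound[OF x, of n] by linarith
      then show "norm (v x * dd c (\<phi> n) x) \<le> \<bar>v x\<bar> * (A + B')"
        by (simp add: abs_mult mult_left_mono)
    qed
  qed (use vm tm zm in auto)
  have lim2: "(\<lambda>n. ip (cell K) g (\<phi> n)) \<longlonglongrightarrow> ip (cell K) g z"
    unfolding ip_def
  proof (rule integral_dominated_convergence)
    show "integrable (lebesgue_on (cell K)) (\<lambda>x. \<bar>g x\<bar> * B)" using v by simp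
    show "AE x in lebesgue_on (cell K). (\<lambda>n. g x * \<phi> n x) \<longlonglongrightarrow> g x * z x"
    proof (rule AE_I2)
      fix x assume "x \<in> space (lebesgue_on (cell K))"
      then have x: "x \<in> cell K" by simp
      have "(\<lambda>n. g x * \<phi> n x) \<longlonglongrightarrow> g x * (z x * 1)"
        unfolding \<phi>_def by (intro tendsto_mult tendsto_const \<psi>lim[OF x])
      then show "(\<lambda>n. g x * \<phi> n x) \<longlonglongrightarrow> g x * z x" by simp
    qed
    show "AE x in lebesgue_on (cell K). norm (g x * \<phi> n x) \<le> \<bar>g x\<bar> * B" for n
    proof (rule AE_I2)
      fix x assume "x \<in> space (lebesgue_on (cell K))"
      then have x: "x \<in> cell K" by simp
      have "\<bar>z x * \<psi> n x\<bar> \<le> B * 1"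
        unfolding abs_mult using B(2)[OF cl[OF x]] \<psi>b[of n x] by (intro mult_mono) auto
      then show "norm (g x * \<phi> n x) \<le> \<bar>g x\<bar> * B" by (simp add: \<phi>_def abs_mult mult_left_mono)
    qed
  qed (use vm tm zm in auto)
  have "ip (cell K) v (dd c (\<phi> n)) + ip (cell K) g (\<phi> n) = 0" for n
    using weak_derivD[OF w b test[of n]] by simp
  with tendsto_add[OF lim1 lim2] show ?thesis by (rule limit_of_zeros)
qed

text \<open>The divergence theorem without boundary term: integration by parts against the constant
  1, whose weak derivative is 0.\<close>

lemma integral_dd_boundary_zero:
  assumes z: "pol m z" and 0: "\<And>x. x \<in> frontier (elem K) \<Longrightarrow> z x = 0"
  shows "(LINT x|lebesgue_on (cell K). dd c z x) = 0"
proof -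
  have "pol 0 (\<lambda>x::real^'n. 1)" by (rule pol_const)
  from weak_deriv_pol[of "\<lambda>_. c" c, OF refl this]
  have "weak_deriv (\<lambda>_. c) (cell K) (\<lambda>x. 1) (\<lambda>x. 0)" by (simp add: pol_0_dd[OF \<open>pol 0 (\<lambda>x. 1)\<close>])
  from integration_by_parts_zero[OF refl z 0 cell_integrable_const cell_integrable_const this]
  show ?thesis by (simp add: ip_def)
qed

lemma continuous_nonneg_integral_zero:
  assumes f: "continuous_on UNIV (f :: 'n scalar)" and nn: "\<And>x. x \<in> cell K \<Longrightarrow> 0 \<le> f x"
    and 0: "(LINT x|lebesgue_on (cell K). f x) = 0" and x: "x \<in> cell K"
  shows "f x = 0"
proof (rule ccontr)
  assume n: "f x \<noteq> 0"
  have "AE x in lebesgue_on (cell K). 0 \<le> f x" by (rule AE_I2) (use nn in simp)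
  then have "AE x in lebesgue_on (cell K). f x = 0"
    using integral_nonneg_eq_0_iff_AE[OF cell_integrable[OF f]] 0 by blast
  then have ae: "AE x in lebesgue. x \<in> cell K \<longrightarrow> f x = 0"
    by (subst (asm) AE_restrict_space_iff) auto
  let ?U = "cell K \<inter> {x. f x \<noteq> 0}"
  have "open {x. f x \<noteq> 0}" by (rule open_Collect_neq) (use f in \<open>auto intro: continuous_intros\<close>)
  then have "open ?U" by auto
  moreover have "?U \<noteq> {}" using x n by auto
  moreover have "negligible ?U"
  proof -
    from ae obtain N where N: "N \<in> null_sets lebesgue" "{x. \<not> (x \<in> cell K \<longrightarrow> f x = 0)} \<subseteq> N"
      by (auto simp: eventually_ae_filter)
    have "negligible N" using N(1) by (simp add: negligible_iff_null_sets)
    then show ?thesis by (rule negligible_subset) (use N(2) in auto)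
  qed
  ultimately show False using open_not_negligible by blast
qed

end

section \<open>Bubbles and facet functionals\<close>

lemma card_other_indices: "card (UNIV - {i :: 'n::finite option}) = CARD('n)"
  by (simp add: card_Diff_singleton)

text \<open>
  The functional \<open>g \<mapsto> \<integral>\<^bsub>F\<^sub>i\<^esub> b\<^sub>i g\<close> up to the factor \<open>|\<nabla>\<lambda>\<^sub>i|\<close>, written as a volume integral through the
  divergence theorem: \<open>b\<^sub>i\<close> vanishes on all facets but \<open>F\<^sub>i\<close>.
\<close>

definition flux :: "'n::finite vsimplex \<Rightarrow> 'n option \<Rightarrow> 'n scalar \<Rightarrow> real" where
  "flux K i g = - (LINT x|lebesgue_on (cell K). dd (K i - K (SOME j. j \<noteq> i)) (\<lambda>x. facet_bubble K i x * g x) x)"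

lemma some_other: "(SOME j. j \<noteq> i) \<noteq> (i :: 'n option)"
  by (rule someI_ex[OF ex_other_index])

context
  fixes K :: "'n::finite vsimplex"
  assumes nd: "nondegenerate K"
begin

lemma facet_bubble_pol: "pol (CARD('n)) (facet_bubble K i)"
proof -
  have "pol (\<Sum>j\<in>UNIV - {i}. 1) (\<lambda>x. \<Prod>j\<in>UNIV - {i}. bary K j x)"
    by (rule pol_prod) (rule bary_pol[OF nd])
  then show ?thesis by (simp add: facet_bubble_def[abs_def] card_other_indices)
qed

lemma bubble_pol: "pol (CARD('n) + 1) (bubble K)"
proof -
  have "pol (\<Sum>j\<in>(UNIV::'n option set). 1) (\<lambda>x. \<Prod>j\<in>UNIV. bary K j x)"
    by (rule pol_prod) (rule bary_pol[OF nd])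
  then show ?thesis by (simp add: bubble_def[abs_def])
qed

lemma bubble_zero: "x \<in> frontier (elem K) \<Longrightarrow> bubble K x = 0"
  by (auto simp: frontier_bary[OF nd] bubble_def intro: prod_zero)

lemma bubble_pos: "x \<in> cell K \<Longrightarrow> bubble K x > 0"
  by (auto simp: cell_bary[OF nd] bubble_def intro: prod_pos)

lemma bary_le_1: "x \<in> elem K \<Longrightarrow> bary K i x \<le> 1"
  using member_le_sum[of i UNIV "\<lambda>i. bary K i x"] by (simp add: elem_bary[OF nd] bary_sum[OF nd])

lemma bubble_bounds: "x \<in> elem K \<Longrightarrow> 0 \<le> bubble K x \<and> bubble K x \<le> 1"
  using bary_le_1 by (auto simp: elem_bary[OF nd] bubble_def intro!: prod_nonneg prod_le_1)

lemma facet_bubble_bounds: "x \<in> elem K \<Longrightarrow> 0 \<le> facet_bubble K i x \<and> facet_bubble K i x \<le> 1"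
  using bary_le_1 by (auto simp: elem_bary[OF nd] facet_bubble_def intro!: prod_nonneg prod_le_1)

lemma facet_bubble_pos: "x \<in> cell K \<Longrightarrow> facet_bubble K i x > 0"
  by (auto simp: cell_bary[OF nd] facet_bubble_def intro: prod_pos)

lemma facet_bubble_mult_zero:
  assumes "\<And>x. x \<in> facet K i \<Longrightarrow> g x = 0" "x \<in> frontier (elem K)"
  shows "facet_bubble K i x * g x = 0"
proof -
  obtain j where j: "bary K j x = 0" and nn: "\<And>l. 0 \<le> bary K l x"
    using assms(2) by (auto simp: frontier_bary[OF nd])
  show ?thesis
  proof (cases "j = i")
    case True
    then have "x \<in> facet K i" using j nn by (simp add: facet_bary[OF nd])
    then show ?thesis using assms(1) by simp
  next
    case False
    then have "facet_bubble K i x = 0" unfolding facet_bubble_def using j by (intro prod_zero) auto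
    then show ?thesis by simp
  qed
qed

lemma pol_integrable: "pol m f \<Longrightarrow> integrable (lebesgue_on (cell K)) f"
  by (rule cell_integrable[OF nd pol_continuous])

text \<open>The factor \<open>h M\<close> vanishes on the i-th facet, so together with the facet
  bubble the product vanishes on the whole boundary. It is constant in directions tangential to that
  facet, hence passes through the derivative, and it tends to 1 inside the cell.\<close>

lemma integral_dd_tangential:
  assumes g: "pol m g" and v: "grd K i \<bullet> v = 0"
  shows "(LINT x|lebesgue_on (cell K). dd v (\<lambda>x. facet_bubble K i x * g x) x) = 0"
proof -
  define G where "G = (\<lambda>x. facet_bubble K i x * g x)"
  have G: "pol (CARD('n) + m) G" unfolding G_def by (rule pol_mult[OF facet_bubble_pol g])
  note dG = pol_dd[OF G, of v]
  define h where "h = (\<lambda>M x. 1 - (1 - bary K i x) ^ M)"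
  have h: "pol (M * 1) (h M)" for M
    unfolding h_def by (intro pol_diff pol_const pol_power bary_pol[OF nd])
  have dh: "dd v (h M) x = 0" for M x
  proof -
    have b: "(bary K i has_derivative (\<lambda>w. grd K i \<bullet> w)) (at x)"
      using dd_has_derivative[OF pol_differentiable[OF bary_pol[OF nd, of i]], of x] by (simp add: dd_bary[OF nd])
    have "(h M has_derivative (\<lambda>w. 0 - of_nat M * (0 - grd K i \<bullet> w) * (1 - bary K i x) ^ (M - 1))) (at x)"
      unfolding h_def
      by (rule has_derivative_diff[OF has_derivative_const has_derivative_power[OF has_derivative_diff[OF has_derivative_const b]]])
    from dd_eqI[OF this, of v] show ?thesis by (simp add: v)
  qed
  have int0: "(LINT x|lebesgue_on (cell K). h M x * dd v G x) = 0" for M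
  proof -
    have "(LINT x|lebesgue_on (cell K). dd v (\<lambda>x. h M x * G x) x) = 0"
    proof (rule integral_dd_boundary_zero[OF nd pol_mult[OF h G]])
      fix x assume x: "x \<in> frontier (elem K)"
      have "facet_bubble K i x * (h M x * g x) = 0"
        by (rule facet_bubble_mult_zero[OF _ x]) (simp add: facet_bary[OF nd] h_def)
      then show "h M x * G x = 0" by (simp add: G_def mult_ac)
    qed
    moreover have "dd v (\<lambda>x. h M x * G x) = (\<lambda>x. h M x * dd v G x)"
      by (intro ext) (simp add: dd_mult[OF pol_differentiable[OF h] pol_differentiable[OF G]] dh)
    ultimately show ?thesis by simp
  qed
  have "(\<lambda>M. LINT x|lebesgue_on (cell K). h M x * dd v G x) \<longlonglongrightarrow> (LINT x|lebesgue_on (cell K). dd v G x)"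
  proof (rule integral_dominated_convergence)
    show "integrable (lebesgue_on (cell K)) (\<lambda>x. \<bar>dd v G x\<bar>)" using pol_integrable[OF dG] by simp
    have b01: "0 < bary K i x \<and> bary K i x \<le> 1" if "x \<in> cell K" for x
      using that bary_le_1[of x i] interior_subset[of "elem K"] by (auto simp: cell_bary[OF nd])
    show "AE x in lebesgue_on (cell K). (\<lambda>M. h M x * dd v G x) \<longlonglongrightarrow> dd v G x"
    proof (rule AE_I2)
      fix x assume "x \<in> space (lebesgue_on (cell K))"
      then have "0 < bary K i x \<and> bary K i x \<le> 1" by (intro b01) simp
      then have "(\<lambda>M. (1 - bary K i x) ^ M) \<longlonglongrightarrow> 0" by (intro LIMSEQ_power_zero) auto
      then have "(\<lambda>M. h M x * dd v G x) \<longlonglongrightarrow> (1 - 0) * dd v G x"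
        unfolding h_def by (intro tendsto_mult tendsto_diff tendsto_const)
      then show "(\<lambda>M. h M x * dd v G x) \<longlonglongrightarrow> dd v G x" by simp
    qed
    show "AE x in lebesgue_on (cell K). norm (h M x * dd v G x) \<le> \<bar>dd v G x\<bar>" for M
    proof (rule AE_I2)
      fix x assume "x \<in> space (lebesgue_on (cell K))"
      then have b: "0 < bary K i x \<and> bary K i x \<le> 1" by (intro b01) simp
      then have "0 \<le> (1 - bary K i x) ^ M" "(1 - bary K i x) ^ M \<le> 1"
        by (auto intro: power_le_one)
      then have "\<bar>h M x\<bar> \<le> 1" by (simp add: h_def)
      then show "norm (h M x * dd v G x) \<le> \<bar>dd v G x\<bar>"
        by (simp add: abs_mult mult_left_le_one_le)
    qed
    show "(\<lambda>x. dd v G x) \<in> borel_measurable (lebesgue_on (cell K))"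
      by (rule continuous_imp_measurable_lebesgue_on[OF pol_continuous[OF dG]])
    show "(\<lambda>x. h M x * dd v G x) \<in> borel_measurable (lebesgue_on (cell K))" for M
      by (rule continuous_imp_measurable_lebesgue_on[OF pol_continuous[OF pol_mult[OF h dG]]])
  qed
  then show ?thesis unfolding G_def[symmetric] by (rule limit_of_zeros) (rule int0)
qed

text \<open>Only the component of v across the i-th facet counts: subtracting a multiple of the edge
  direction used in \<open>flux\<close>, which has slope 1 for the i-th coordinate, leaves a
  tangential direction.\<close>

lemma integral_dd_flux:
  assumes g: "pol m g"
  shows "(LINT x|lebesgue_on (cell K). dd v (\<lambda>x. facet_bubble K i x * g x) x) = - (grd K i \<bullet> v) * flux K i g"
proof -
  define G where "G = (\<lambda>x. facet_bubble K i x * g x)"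
  have G: "pol (CARD('n) + m) G" unfolding G_def by (rule pol_mult[OF facet_bubble_pol g])
  define d where "d = K i - K (SOME j. j \<noteq> i)"
  have gd: "grd K i \<bullet> d = 1" unfolding d_def using some_other[of i] by (auto simp: grd_vertex_diff[OF nd])
  let ?a = "grd K i \<bullet> v"
  define w where "w = 1 *\<^sub>R v + (- ?a) *\<^sub>R d"
  have "grd K i \<bullet> w = 0" by (simp add: w_def inner_diff_right gd)
  then have "(LINT x|lebesgue_on (cell K). dd w G x) = 0" unfolding G_def by (rule integral_dd_tangential[OF g])
  moreover have "dd w G = (\<lambda>x. dd v G x - ?a * dd d G x)"
    unfolding w_def by (intro ext) (subst dd_lin[OF pol_differentiable[OF G]], simp)
  ultimately have "(LINT x|lebesgue_on (cell K). dd v G x - ?a * dd d G x) = 0" by simp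
  then show ?thesis
    using pol_integrable[OF pol_dd[OF G]] by (simp add: flux_def G_def[symmetric] d_def[symmetric])
qed

lemma flux_comb:
  assumes g: "pol m g" and h: "pol n h"
  shows "flux K i (\<lambda>x. g x + c * h x) = flux K i g + c * flux K i h"
proof -
  define G where "G = (\<lambda>x. facet_bubble K i x * g x)"
  define H where "H = (\<lambda>x. facet_bubble K i x * h x)"
  have G: "pol (CARD('n) + m) G" and H: "pol (CARD('n) + n) H"
    unfolding G_def H_def by (rule pol_mult[OF facet_bubble_pol g] pol_mult[OF facet_bubble_pol h])+
  have eq: "(\<lambda>x. facet_bubble K i x * (g x + c * h x)) = (\<lambda>x. G x + c * H x)"
    by (auto simp: G_def H_def algebra_simps)
  have "dd v (\<lambda>x. G x + c * H x) = (\<lambda>x. dd v G x + c * dd v H x)" for v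
    using pol_differentiable[OF G] pol_differentiable[OF H]
    by (intro ext, subst dd_add) (auto simp: dd_cmult intro: derivative_intros)
  then show ?thesis
    unfolding flux_def eq G_def[symmetric] H_def[symmetric]
    using pol_integrable[OF pol_dd[OF G]] pol_integrable[OF pol_dd[OF H]] by simp
qed

lemma flux_zero:
  assumes g: "pol m g" and 0: "\<And>x. x \<in> facet K i \<Longrightarrow> g x = 0"
  shows "flux K i g = 0"
proof -
  have "(LINT x|lebesgue_on (cell K). dd v (\<lambda>x. facet_bubble K i x * g x) x) = 0" for v
    by (rule integral_dd_boundary_zero[OF nd pol_mult[OF facet_bubble_pol g]]) (rule facet_bubble_mult_zero[OF 0])
  then show ?thesis by (simp add: flux_def)
qed

text \<open>The volume integral depends on boundary values only. This permits the exchange of g for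
  another extension of its values on the facet.\<close>

lemma flux_cong:
  assumes g: "pol m g" and h: "pol n h" and eq: "\<And>x. x \<in> facet K i \<Longrightarrow> g x = h x"
  shows "flux K i g = flux K i h"
proof -
  have "flux K i (\<lambda>x. g x + (- 1) * h x) = 0"
    by (rule flux_zero[of "max m n"])
       (use eq pol_mono[OF _ g, of "max m n"] pol_mono[OF _ h, of "max m n"] in \<open>auto intro!: pol_diff\<close>)
  then show ?thesis using flux_comb[OF g h, of i "-1"] by simp
qed

lemma bary_ray: "bary K j (K i + s *\<^sub>R (x - K i)) = bary K j (K i) + s * (bary K j x - bary K j (K i))"
  using bary_add[OF nd, of j "K i" "s *\<^sub>R (x - K i)"] bary_add[OF nd, of j "K i" "x - K i"] by simp

text \<open>
  For a homogeneous \<open>G\<close> about \<open>a\<^sub>i\<close>, integrate the divergence of \<open>G(x) (x - a\<^sub>i)\<close>; this field is tangent to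
  every facet but \<open>F\<^sub>i\<close>.
\<close>

lemma flux_homogeneous:
  assumes g: "pol m g" and hom: "\<And>s x. g (K i + s *\<^sub>R (x - K i)) = s ^ k * g x"
  shows "flux K i g = real (2 * CARD('n) + k) * (LINT x|lebesgue_on (cell K). facet_bubble K i x * g x)"
proof -
  let ?N = "CARD('n)"
  define G where "G = (\<lambda>x. facet_bubble K i x * g x)"
  have G: "pol (?N + m) G" unfolding G_def by (rule pol_mult[OF facet_bubble_pol g])
  have dG: "G differentiable (at x)" for x by (rule pol_differentiable[OF G])
  have fb: "facet_bubble K i (K i + s *\<^sub>R (x - K i)) = s ^ ?N * facet_bubble K i x" for s x
  proof -
    have "facet_bubble K i (K i + s *\<^sub>R (x - K i)) = (\<Prod>j\<in>UNIV - {i}. s * bary K j x)"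
      unfolding facet_bubble_def by (rule prod.cong) (auto simp: bary_ray bary_vertex[OF nd])
    then show ?thesis by (simp add: prod.distrib facet_bubble_def card_other_indices)
  qed
  have homG: "G (K i + s *\<^sub>R (x - K i)) = s ^ (?N + k) * G x" for s x
    by (simp add: G_def fb hom power_add)
  \<comment> \<open>Euler's identity, by differentiating the homogeneity relation along the ray at
    parameter 1; the facet bubble contributes N to the degree.\<close>
  have euler: "dd (x - K i) G x = real (?N + k) * G x" for x
  proof -
    have "((\<lambda>t. G (K i + t *\<^sub>R (x - K i))) has_real_derivative dd (x - K i) G (K i + 1 *\<^sub>R (x - K i))) (at 1)"
      by (rule line_has_derivative[OF dG])
    moreover have "((\<lambda>t. t ^ (?N + k) * G x) has_real_derivative real (?N + k) * G x) (at 1)"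
      by (auto intro!: derivative_eq_intros)
    ultimately show ?thesis unfolding homG using DERIV_unique by fastforce
  qed
  have lin: "linear (\<lambda>v. dd v G x)" for x
    using linear_frechet_derivative[OF dG[of x]] by (simp add: dd_def)
  have bG: "pol (1 + (?N + m)) (\<lambda>x. bary K l x * G x)" for l by (rule pol_mult[OF bary_pol[OF nd] G])
  have bg: "pol (1 + m) (\<lambda>x. bary K l x * g x)" for l by (rule pol_mult[OF bary_pol[OF nd] g])
  \<comment> \<open>The left side is the divergence of G(x) (x - a_i). The derivatives of the N
    coordinates give N, and Euler's identity gives N + k.\<close>
  have pt: "(\<Sum>l\<in>UNIV - {i}. dd (K l - K i) (\<lambda>x. bary K l x * G x) x) = real (2 * ?N + k) * G x" for x
  proof -
    have "dd (K l - K i) (\<lambda>x. bary K l x * G x) x = dd (bary K l x *\<^sub>R (K l - K i)) G x + G x" if "l \<in> UNIV - {i}" for l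
    proof -
      have "dd (K l - K i) (\<lambda>x. bary K l x * G x) x = bary K l x * dd (K l - K i) G x + (grd K l \<bullet> (K l - K i)) * G x"
        using dd_mult[OF pol_differentiable[OF bary_pol[OF nd, of l]] dG, of "K l - K i" x] by (simp add: dd_bary[OF nd])
      then show ?thesis using that linear_scale[OF lin] by (auto simp: grd_vertex_diff[OF nd])
    qed
    then have "(\<Sum>l\<in>UNIV - {i}. dd (K l - K i) (\<lambda>x. bary K l x * G x) x)
        = (\<Sum>l\<in>UNIV - {i}. dd (bary K l x *\<^sub>R (K l - K i)) G x) + real ?N * G x"
      by (simp add: sum.distrib card_other_indices)
    also have "(\<Sum>l\<in>UNIV - {i}. dd (bary K l x *\<^sub>R (K l - K i)) G x) = dd (\<Sum>l\<in>UNIV - {i}. bary K l x *\<^sub>R (K l - K i)) G x"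
      by (simp add: linear_sum[OF lin])
    also have "(\<Sum>l\<in>UNIV - {i}. bary K l x *\<^sub>R (K l - K i)) = (\<Sum>l\<in>UNIV. bary K l x *\<^sub>R (K l - K i))"
      by (rule sum.mono_neutral_left) auto
    also have "\<dots> = x - K i"
      by (simp add: scaleR_diff_right sum_subtractf bary_expand[OF nd] scaleR_sum_left[symmetric] bary_sum[OF nd])
    finally show ?thesis by (simp add: euler algebra_simps)
  qed
  \<comment> \<open>Each direction a_l - a_i has slope -1 for the i-th coordinate, so the integral
    equals the flux with the right sign.\<close>
  have fl: "(LINT x|lebesgue_on (cell K). dd (K l - K i) (\<lambda>x. bary K l x * G x) x) = flux K i (\<lambda>x. bary K l x * g x)"
    if "l \<in> UNIV - {i}" for l
  proof -
    have "(\<lambda>x. bary K l x * G x) = (\<lambda>x. facet_bubble K i x * (bary K l x * g x))" by (auto simp: G_def)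
    then show ?thesis using integral_dd_flux[OF bg, of "K l - K i" i l] that by (auto simp: grd_vertex_diff[OF nd])
  qed
  have fsum: "finite A \<Longrightarrow> flux K i (\<lambda>x. (\<Sum>l\<in>A. bary K l x) * g x) = (\<Sum>l\<in>A. flux K i (\<lambda>x. bary K l x * g x))" for A
  proof (induction A rule: finite_induct)
    case empty
    show ?case using flux_zero[OF pol_const[of 0 0]] by simp
  next
    case (insert a A)
    have "pol (1 + m) (\<lambda>x. (\<Sum>l\<in>A. bary K l x) * g x)" by (intro pol_mult pol_sum bary_pol[OF nd] g)
    from flux_comb[OF bg[of a] this, of i 1] insert show ?case by (simp add: distrib_right)
  qed
  \<comment> \<open>On the i-th facet the remaining coordinates add up to 1, so their sum may be
    inserted as a factor.\<close>
  have "flux K i g = flux K i (\<lambda>x. (\<Sum>l\<in>UNIV - {i}. bary K l x) * g x)"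
  proof (rule flux_cong[OF g])
    show "pol (1 + m) (\<lambda>x. (\<Sum>l\<in>UNIV - {i}. bary K l x) * g x)" by (intro pol_mult pol_sum bary_pol[OF nd] g)
    fix x assume "x \<in> facet K i"
    then have "(\<Sum>l\<in>UNIV - {i}. bary K l x) = 1"
      using bary_sum[OF nd, of x] by (simp add: sum.remove[of UNIV i] facet_bary[OF nd])
    then show "g x = (\<Sum>l\<in>UNIV - {i}. bary K l x) * g x" by simp
  qed
  also have "\<dots> = (\<Sum>l\<in>UNIV - {i}. LINT x|lebesgue_on (cell K). dd (K l - K i) (\<lambda>x. bary K l x * G x) x)"
    using fl by (simp add: fsum)
  also have "\<dots> = (LINT x|lebesgue_on (cell K). (\<Sum>l\<in>UNIV - {i}. dd (K l - K i) (\<lambda>x. bary K l x * G x) x))"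
    by (rule Bochner_Integration.integral_sum[symmetric]) (rule pol_integrable[OF pol_dd[OF bG]])
  also have "\<dots> = real (2 * ?N + k) * (LINT x|lebesgue_on (cell K). G x)" by (simp add: pt)
  finally show ?thesis by (simp add: G_def)
qed

text \<open>Along rays from a_i both 1 - \<lambda>_i and x_j - (a_i)_j \<lambda>_i scale linearly,
  and on the facet they equal 1 and x_j. Replacing constants by powers of the former and coordinates
  by the latter makes a polynomial homogeneous without changing it on the facet.\<close>

lemma homogeneous_extension:
  assumes "pol m r"
  shows "\<exists>h. pol m h \<and> (\<forall>x. bary K i x = 0 \<longrightarrow> h x = r x) \<and> (\<forall>s x. h (K i + s *\<^sub>R (x - K i)) = s ^ m * h x)"
  using assms
proof (induction rule: pol.induct)
  case (pol_const m c)
  have "pol (m * 1) (\<lambda>x. (1 - bary K i x) ^ m)" by (intro pol_power pol_diff pol.pol_const bary_pol[OF nd])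
  then have "pol m (\<lambda>x. c * (1 - bary K i x) ^ m)" by (simp add: pol_cmult)
  moreover have "c * (1 - bary K i (K i + s *\<^sub>R (x - K i))) ^ m = s ^ m * (c * (1 - bary K i x) ^ m)" for s x
  proof -
    have "1 - bary K i (K i + s *\<^sub>R (x - K i)) = s * (1 - bary K i x)"
      unfolding bary_ray bary_vertex[OF nd] by (simp add: algebra_simps)
    then show ?thesis by (simp add: power_mult_distrib)
  qed
  ultimately show ?case by (intro exI[of _ "\<lambda>x. c * (1 - bary K i x) ^ m"]) auto
next
  case (pol_add m f g)
  then obtain f' g' where "pol m f'" "\<forall>x. bary K i x = 0 \<longrightarrow> f' x = f x" "\<forall>s x. f' (K i + s *\<^sub>R (x - K i)) = s ^ m * f' x"
    "pol m g'" "\<forall>x. bary K i x = 0 \<longrightarrow> g' x = g x" "\<forall>s x. g' (K i + s *\<^sub>R (x - K i)) = s ^ m * g' x" by blast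
  then show ?case by (intro exI[of _ "\<lambda>x. f' x + g' x"]) (auto simp: distrib_left intro: pol.pol_add)
next
  case (pol_coord m f j)
  then obtain f' where f': "pol m f'" "\<forall>x. bary K i x = 0 \<longrightarrow> f' x = f x" "\<forall>s x. f' (K i + s *\<^sub>R (x - K i)) = s ^ m * f' x"
    by blast
  define y where "y = (\<lambda>x. x $ j - K i $ j * bary K i x)"
  have "pol 1 y" unfolding y_def by (intro pol_diff pol_coord1 pol_cmult bary_pol[OF nd])
  then have "pol (Suc m) (\<lambda>x. y x * f' x)" using pol_mult[OF _ f'(1), of 1 y] by simp
  moreover have "y (K i + s *\<^sub>R (x - K i)) = s * y x" for s x
    unfolding y_def bary_ray bary_vertex[OF nd] by (simp add: algebra_simps)
  ultimately show ?case using f' by (intro exI[of _ "\<lambda>x. y x * f' x"]) (auto simp: y_def)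
qed

text \<open>The sign is not visible in the definition of \<open>flux\<close>. For the homogeneous
  extension h of r it becomes a positive multiple of the integral of b_i h^2 over the cell; if that
  vanishes then so does h, and r agrees with h on the facet.\<close>

lemma flux_square:
  assumes r: "pol m r"
  shows "0 \<le> flux K i (\<lambda>x. r x * r x)"
    and "flux K i (\<lambda>x. r x * r x) = 0 \<Longrightarrow> x \<in> facet K i \<Longrightarrow> r x = 0"
proof -
  obtain h where h: "pol m h" "\<And>x. bary K i x = 0 \<Longrightarrow> h x = r x" "\<And>s x. h (K i + s *\<^sub>R (x - K i)) = s ^ m * h x"
    using homogeneous_extension[OF r, of i] by blast
  have h2: "pol (m + m) (\<lambda>x. h x * h x)" by (rule pol_mult[OF h(1) h(1)])
  have "flux K i (\<lambda>x. r x * r x) = flux K i (\<lambda>x. h x * h x)"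
    by (rule flux_cong[OF pol_mult[OF r r] h2]) (auto simp: facet_bary[OF nd] h(2))
  also have "\<dots> = real (2 * CARD('n) + (m + m)) * (LINT x|lebesgue_on (cell K). facet_bubble K i x * (h x * h x))"
    by (rule flux_homogeneous[OF h2]) (simp add: h(3) power_add)
  finally have eq: "flux K i (\<lambda>x. r x * r x) = real (2 * CARD('n) + (m + m)) * (LINT x|lebesgue_on (cell K). facet_bubble K i x * (h x * h x))" .
  have nn: "0 \<le> facet_bubble K i x * (h x * h x)" if "x \<in> cell K" for x
    using facet_bubble_pos[OF that, of i] by simp
  have "0 \<le> (LINT x|lebesgue_on (cell K). facet_bubble K i x * (h x * h x))"
    by (rule Bochner_Integration.integral_nonneg) (use nn in simp)
  then show "0 \<le> flux K i (\<lambda>x. r x * r x)" unfolding eq by (rule mult_nonneg_nonneg[rotated]) simp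
  assume fl: "flux K i (\<lambda>x. r x * r x) = 0" and x: "x \<in> facet K i"
  have "2 * CARD('n) + (m + m) \<noteq> 0" using zero_less_card_finite[where 'a='n] by linarith
  then have "real (2 * CARD('n) + (m + m)) \<noteq> 0" by (simp only: of_nat_eq_0_iff) simp
  then have 0: "(LINT x|lebesgue_on (cell K). facet_bubble K i x * (h x * h x)) = 0"
    using trans[OF eq[symmetric] fl] unfolding mult_eq_0_iff by blast
  have "h y = 0" if y: "y \<in> cell K" for y
  proof -
    have "facet_bubble K i y * (h y * h y) = 0"
      by (rule continuous_nonneg_integral_zero[OF nd _ nn 0 y])
         (auto intro: pol_continuous[OF pol_mult[OF facet_bubble_pol h2]])
    then show ?thesis using facet_bubble_pos[OF y, of i] by simp
  qed
  then have "h = (\<lambda>x. 0)" by (rule pol_zero_on_open[OF h(1) open_interior cell_nonempty[OF nd]])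
  then show "r x = 0" using h(2)[of x] x by (simp add: facet_bary[OF nd])
qed

text \<open>The i-th facet term carries the factor \<open>- (grd K i \<bullet> c)\<close>, and the
  sign in the bubble, that of c against the outer normal, is minus the sign of
  \<open>grd K i \<bullet> c\<close>. The product is an absolute value; this is the purpose of the
  signs.\<close>

lemma integral_dd_signed_bubble:
  assumes g: "pol m g" and c: "beta_on \<beta> K = c"
  shows "(LINT x|lebesgue_on (cell K). dd c (\<lambda>x. signed_bubble \<beta> K x * g x) x) = (\<Sum>i\<in>UNIV. \<bar>grd K i \<bullet> c\<bar> * flux K i g)"
proof -
  define G where "G = (\<lambda>i x. facet_bubble K i x * g x)"
  have G: "pol (CARD('n) + m) (G i)" for i unfolding G_def by (rule pol_mult[OF facet_bubble_pol g])
  define s where "s = (\<lambda>i. - sgn (grd K i \<bullet> c))"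
  have eq: "(\<lambda>x. signed_bubble \<beta> K x * g x) = (\<lambda>x. \<Sum>i\<in>UNIV. s i * G i x)"
    by (auto simp: s_def signed_bubble_def G_def c sgn_inner_normal[OF nd] sum_distrib_right mult.assoc)
  have "dd c (\<lambda>x. \<Sum>i\<in>UNIV. s i * G i x) = (\<lambda>x. \<Sum>i\<in>UNIV. s i * dd c (G i) x)"
    using pol_differentiable[OF G] by (intro ext, subst dd_sum) (auto simp: dd_cmult intro: derivative_intros)
  then have "(LINT x|lebesgue_on (cell K). dd c (\<lambda>x. signed_bubble \<beta> K x * g x) x)
      = (\<Sum>i\<in>UNIV. s i * (LINT x|lebesgue_on (cell K). dd c (G i) x))"
    unfolding eq using pol_integrable[OF pol_dd[OF G]] by simp
  also have "\<dots> = (\<Sum>i\<in>UNIV. \<bar>grd K i \<bullet> c\<bar> * flux K i g)"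
    unfolding G_def integral_dd_flux[OF g] by (rule sum.cong[OF refl]) (simp add: s_def abs_sgn)
  finally show ?thesis .
qed

section \<open>Definite forms on polynomial spaces\<close>

lemma fsub_pol: "fsub (Collect (pol m :: 'n scalar \<Rightarrow> bool))"
  unfolding fsub_def by (auto intro: pol_const pol_add pol_cmult)

lemma spd_weighted:
  assumes w: "pol l w" and pos: "\<And>x. x \<in> cell K \<Longrightarrow> w x > 0"
  shows "spd (Collect (pol m)) (\<lambda>z y. LINT x|lebesgue_on (cell K). w x * (z x * y x))"
  unfolding spd_def
proof (intro conjI ballI allI)
  note i = pol_integrable[OF pol_mult[OF w pol_mult]]
  fix f g h :: "'n scalar" and c :: real
  assume f: "f \<in> Collect (pol m)" and g: "g \<in> Collect (pol m)"
  show "(LINT x|lebesgue_on (cell K). w x * (f x * g x)) = (LINT x|lebesgue_on (cell K). w x * (g x * f x))"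
    by (simp add: mult.commute[of "f _"])
  assume h: "h \<in> Collect (pol m)"
  have "(\<lambda>x. w x * ((f x + c * g x) * h x)) = (\<lambda>x. w x * (f x * h x) + c * (w x * (g x * h x)))"
    by (auto simp: algebra_simps)
  then show "(LINT x|lebesgue_on (cell K). w x * ((f x + c * g x) * h x))
    = (LINT x|lebesgue_on (cell K). w x * (f x * h x)) + c * (LINT x|lebesgue_on (cell K). w x * (g x * h x))"
    using i f g h by simp
next
  fix f :: "'n scalar" assume f: "f \<in> Collect (pol m)"
  have nn: "0 \<le> w x * (f x * f x)" if "x \<in> cell K" for x using pos[OF that] by simp
  show "0 \<le> (LINT x|lebesgue_on (cell K). w x * (f x * f x))"
    by (rule Bochner_Integration.integral_nonneg) (use nn in simp)
  show "(LINT x|lebesgue_on (cell K). w x * (f x * f x)) = 0 \<longrightarrow> f = (\<lambda>x. 0)"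
  proof
    assume 0: "(LINT x|lebesgue_on (cell K). w x * (f x * f x)) = 0"
    have "f x = 0" if x: "x \<in> cell K" for x
    proof -
      have "w x * (f x * f x) = 0"
        by (rule continuous_nonneg_integral_zero[OF nd _ nn 0 x])
           (use f in \<open>auto intro: pol_continuous[OF pol_mult[OF w pol_mult]]\<close>)
      then show ?thesis using pos[OF x] by simp
    qed
    then show "f = (\<lambda>x. 0)" using f pol_zero_on_open[of m f "cell K"] cell_nonempty[OF nd] by auto
  qed
qed

lemma spd_L2: "spd (Collect (pol m)) (ip (cell K))"
proof -
  have "spd (Collect (pol m)) (\<lambda>z y. LINT x|lebesgue_on (cell K). 1 * (z x * y x))"
    by (rule spd_weighted[of 0]) (auto intro: pol_const)
  then show ?thesis by (simp add: ip_def[abs_def])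
qed

lemma spd_flux:
  assumes S: "S \<subseteq> Collect (pol m)" and w: "\<And>i. w i \<ge> 0"
    and det: "\<And>z. z \<in> S \<Longrightarrow> (\<And>i x. w i > 0 \<Longrightarrow> x \<in> facet K i \<Longrightarrow> z x = 0) \<Longrightarrow> z = (\<lambda>x. 0)"
  shows "spd S (\<lambda>z y. \<Sum>i\<in>UNIV. w i * flux K i (\<lambda>x. z x * y x))"
  unfolding spd_def
proof (intro conjI ballI allI)
  fix f g h :: "'n scalar" and c :: real
  assume f: "f \<in> S" and g: "g \<in> S"
  show "(\<Sum>i\<in>UNIV. w i * flux K i (\<lambda>x. f x * g x)) = (\<Sum>i\<in>UNIV. w i * flux K i (\<lambda>x. g x * f x))"
    by (simp add: mult.commute[of "f _"])
  assume h: "h \<in> S"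
  have p: "pol (m + m) (\<lambda>x. f x * h x)" "pol (m + m) (\<lambda>x. g x * h x)"
    using f g h S by (auto intro!: pol_mult)
  have "flux K i (\<lambda>x. (f x + c * g x) * h x) = flux K i (\<lambda>x. f x * h x) + c * flux K i (\<lambda>x. g x * h x)" for i
    using flux_comb[OF p, of i c] by (simp add: distrib_right mult.assoc)
  then show "(\<Sum>i\<in>UNIV. w i * flux K i (\<lambda>x. (f x + c * g x) * h x))
    = (\<Sum>i\<in>UNIV. w i * flux K i (\<lambda>x. f x * h x)) + c * (\<Sum>i\<in>UNIV. w i * flux K i (\<lambda>x. g x * h x))"
    by (simp add: distrib_left sum.distrib sum_distrib_left mult.left_commute)
next
  fix f assume f: "f \<in> S"
  then have p: "pol m f" using S by auto
  note sq = flux_square[OF p]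
  show "0 \<le> (\<Sum>i\<in>UNIV. w i * flux K i (\<lambda>x. f x * f x))" by (intro sum_nonneg mult_nonneg_nonneg w sq(1))
  show "(\<Sum>i\<in>UNIV. w i * flux K i (\<lambda>x. f x * f x)) = 0 \<longrightarrow> f = (\<lambda>x. 0)"
  proof
    assume "(\<Sum>i\<in>UNIV. w i * flux K i (\<lambda>x. f x * f x)) = 0"
    then have "w i * flux K i (\<lambda>x. f x * f x) = 0" for i
      by (subst (asm) sum_nonneg_eq_0_iff) (auto intro: mult_nonneg_nonneg w sq(1))
    then have "w i > 0 \<Longrightarrow> flux K i (\<lambda>x. f x * f x) = 0" for i by (metis less_irrefl mult_eq_0_iff)
    then show "f = (\<lambda>x. 0)" using sq(2) by (intro det[OF f]) blast
  qed
qed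

lemma polys_perp_pol: "polys_perp K (int k) \<subseteq> Collect (pol k)"
  by (auto simp: polys_perp_def polys_eq_pol)

lemma fsub_polys_perp: "fsub (polys_perp K (int k))"
  unfolding fsub_def
proof (intro conjI ballI allI)
  show "(\<lambda>x. 0) \<in> polys_perp K (int k)"
    by (auto simp: polys_perp_def polys_eq_pol ip_def intro: pol_const)
  fix f g :: "'n scalar" and c :: real
  assume f: "f \<in> polys_perp K (int k)" and g: "g \<in> polys_perp K (int k)"
  have "ip (cell K) (\<lambda>x. f x + c * g x) r = 0" if r: "r \<in> polys_ring K (int k)" for r
  proof -
    have "f \<in> Collect (pol k)" "g \<in> Collect (pol k)" "r \<in> Collect (pol k)"
      using f g r by (auto simp: polys_perp_def polys_ring_def polys_eq_pol)
    from spd_comb[OF spd_L2 this, of c] show ?thesis using f g r by (simp add: polys_perp_def)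
  qed
  moreover have "pol k (\<lambda>x. f x + c * g x)"
    using f g by (auto simp: polys_perp_def polys_eq_pol intro: pol_add pol_cmult)
  ultimately show "(\<lambda>x. f x + c * g x) \<in> polys_perp K (int k)"
    by (simp add: polys_perp_def polys_eq_pol)
qed

text \<open>If z vanishes on all facets it belongs to the polynomials to which it is orthogonal, so
  its norm is zero. For k = 1 two distinct facets already contain every vertex, and an affine
  function is determined by its values there.\<close>

lemma polys_perp_determined:
  assumes z: "z \<in> polys_perp K (int k)"
    and J: "J = UNIV \<or> k = 1 \<and> (\<exists>i\<in>J. \<exists>j\<in>J. i \<noteq> j)"
    and 0: "\<And>i x. i \<in> J \<Longrightarrow> x \<in> facet K i \<Longrightarrow> z x = 0"
  shows "z = (\<lambda>x. 0)"
  using J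
proof
  assume "J = UNIV"
  then have "z x = 0" if "x \<in> frontier (elem K)" for x
    using that 0 by (auto simp: frontier_bary[OF nd] facet_bary[OF nd])
  then have "z \<in> polys_ring K (int k)" using z by (simp add: polys_ring_def polys_perp_def)
  then have "ip (cell K) z z = 0" using z by (simp add: polys_perp_def)
  then show ?thesis using spd_definite[OF spd_L2] z polys_perp_pol by blast
next
  assume "k = 1 \<and> (\<exists>i\<in>J. \<exists>j\<in>J. i \<noteq> j)"
  then obtain i j where ij: "k = 1" "i \<in> J" "j \<in> J" "i \<noteq> j" by blast
  have "pol 1 z" using z polys_perp_pol[of k] ij by auto
  then obtain a c where zac: "z = (\<lambda>x. a \<bullet> x + c)" using pol_1_affine by blast
  have zv: "z (K l) = 0" for l
    using 0[OF ij(2) facet_vertex[OF nd, of l i]] 0[OF ij(3) facet_vertex[OF nd, of l j]] ij(4) by (cases "l = i") auto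
  have "z x = 0" for x
  proof -
    have "z x = (\<Sum>l\<in>UNIV. bary K l x * z (K l))"
    proof -
      have "a \<bullet> x = (\<Sum>l\<in>UNIV. bary K l x * (a \<bullet> K l))"
        by (subst (1) bary_expand[OF nd, of x, symmetric]) (simp add: inner_sum_right)
      then show ?thesis using bary_sum[OF nd, of x]
        by (simp add: zac distrib_left sum.distrib sum_distrib_right[symmetric])
    qed
    then show ?thesis by (simp add: zv)
  qed
  then show ?thesis by auto
qed

text \<open>Equivalence of norms in finite dimension: the coefficients in an orthonormal family are
  at most the square root of \<open>G z z\<close>, and the family is bounded on the compact
  element.\<close>

lemma pointwise_bound:
  assumes S: "S \<subseteq> Collect (pol m)" "fsub S" and G: "spd S G"
  shows "\<exists>c>0. \<forall>z\<in>S. \<forall>x\<in>elem K. c * (z x)\<^sup>2 \<le> G z z"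
proof -
  obtain B :: "'n scalar set" where B: "finite B" "Collect (pol m) \<subseteq> fspan B" using pol_fspan by blast
  obtain E where E: "finite E" "E \<subseteq> S" "\<And>f. f \<in> S \<Longrightarrow> f = (\<lambda>x. \<Sum>e\<in>E. G f e * e x)"
    "\<And>f e. f \<in> S \<Longrightarrow> e \<in> E \<Longrightarrow> \<bar>G f e\<bar> \<le> sqrt (G f f)"
    using expansion_coeff_bound[OF B(1) order_trans[OF S(1) B(2)] S(2) G] by blast
  have "\<exists>b\<ge>0. \<forall>x\<in>elem K. \<bar>e x\<bar> \<le> b" if "e \<in> E" for e
    by (rule elem_bounded_continuous[OF nd pol_continuous[of m]]) (use that E(2) S(1) in auto)
  then obtain b where b: "\<And>e. e \<in> E \<Longrightarrow> b e \<ge> 0" "\<And>e x. e \<in> E \<Longrightarrow> x \<in> elem K \<Longrightarrow> \<bar>e x\<bar> \<le> b e" by metis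
  define C where "C = (\<Sum>e\<in>E. b e)"
  have C: "C \<ge> 0" unfolding C_def by (intro sum_nonneg b(1))
  \<comment> \<open>The summand 1 keeps the quotient meaningful when C = 0.\<close>
  have "1 / (C^2 + 1) * (z x)\<^sup>2 \<le> G z z" if z: "z \<in> S" and x: "x \<in> elem K" for z x
  proof -
    have p: "0 \<le> G z z" by (rule spd_pos[OF G z])
    have "\<bar>z x\<bar> = \<bar>\<Sum>e\<in>E. G z e * e x\<bar>" using fun_cong[OF E(3)[OF z], of x] by simp
    also have "\<dots> \<le> (\<Sum>e\<in>E. \<bar>G z e\<bar> * \<bar>e x\<bar>)" by (rule order_trans[OF sum_abs]) (simp add: abs_mult)
    also have "\<dots> \<le> (\<Sum>e\<in>E. sqrt (G z z) * b e)" by (intro sum_mono mult_mono E(4)[OF z] b(2) x) (auto simp: p)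
    also have "\<dots> = sqrt (G z z) * C" by (simp add: C_def sum_distrib_left)
    finally have "\<bar>z x\<bar>^2 \<le> (sqrt (G z z) * C)^2" by (intro power_mono) auto
    then have "(z x)^2 \<le> G z z * C^2" using p by (simp add: power_mult_distrib)
    also have "\<dots> \<le> G z z * (C^2 + 1)" using p by (intro mult_left_mono) auto
    finally show ?thesis by (simp add: field_simps add_pos_nonneg)
  qed
  then show ?thesis by (intro exI[of _ "1 / (C^2 + 1)"]) (auto simp: add_nonneg_pos)
qed

lemma dd_bounded:
  assumes e: "pol m e"
  shows "\<exists>C\<ge>0. \<forall>x\<in>elem K. \<forall>v. \<bar>dd v e x\<bar> \<le> C * norm v"
proof -
  have "\<exists>b\<ge>0. \<forall>x\<in>elem K. \<bar>dd (axis i 1) e x\<bar> \<le> b" for i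
    by (rule elem_bounded_continuous[OF nd pol_continuous[OF pol_dd[OF e]]])
  then obtain b where b: "\<And>i. b i \<ge> 0" "\<And>i x. x \<in> elem K \<Longrightarrow> \<bar>dd (axis i 1) e x\<bar> \<le> b i" by metis
  have "\<bar>dd v e x\<bar> \<le> (\<Sum>i\<in>UNIV. b i) * norm v" if x: "x \<in> elem K" for x v
  proof -
    have l: "linear (\<lambda>v. dd v e x)"
      using linear_frechet_derivative[OF pol_differentiable[OF e, of x]] by (simp add: dd_def)
    have "dd v e x = dd (\<Sum>i\<in>UNIV. v $ i *\<^sub>R axis i 1) e x"
      using basis_expansion[of v] by (simp add: scalar_mult_eq_scaleR)
    also have "\<dots> = (\<Sum>i\<in>UNIV. v $ i * dd (axis i 1) e x)"
      by (simp add: linear_sum[OF l] linear_scale[OF l])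
    finally have "\<bar>dd v e x\<bar> \<le> (\<Sum>i\<in>UNIV. \<bar>v $ i\<bar> * \<bar>dd (axis i 1) e x\<bar>)"
      using sum_abs[of "\<lambda>i. v $ i * dd (axis i 1) e x" UNIV] by (simp add: abs_mult)
    also have "\<dots> \<le> (\<Sum>i\<in>UNIV. norm v * b i)"
      by (intro sum_mono mult_mono b(2) x component_le_norm_cart) auto
    finally show ?thesis by (simp add: sum_distrib_left mult.commute)
  qed
  then show ?thesis using b(1) by (intro exI[of _ "\<Sum>i\<in>UNIV. b i"]) (auto intro: sum_nonneg)
qed

text \<open>Differentiation of an L2-orthonormal expansion: each coefficient is at most M times the
  root of the volume. The constant depends on K, so uniformity comes from using it on the reference
  simplex.\<close>

lemma inverse_inequality:
  "\<exists>C\<ge>0. \<forall>z. pol m z \<longrightarrow> (\<forall>M\<ge>0. (\<forall>x\<in>elem K. \<bar>z x\<bar> \<le> M) \<longrightarrow> (\<forall>x\<in>elem K. \<forall>v. \<bar>dd v z x\<bar> \<le> C * M * norm v))"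
proof -
  let ?S = "Collect (pol m) :: 'n scalar set"
  let ?G = "ip (cell K)"
  obtain B :: "'n scalar set" where B: "finite B" "?S \<subseteq> fspan B" using pol_fspan by blast
  obtain E where E: "finite E" "E \<subseteq> ?S" "\<And>f. f \<in> ?S \<Longrightarrow> f = (\<lambda>x. \<Sum>e\<in>E. ?G f e * e x)"
    "\<And>f e. f \<in> ?S \<Longrightarrow> e \<in> E \<Longrightarrow> \<bar>?G f e\<bar> \<le> sqrt (?G f f)"
    using expansion_coeff_bound[OF B fsub_pol spd_L2] by blast
  have "\<exists>b\<ge>0. \<forall>x\<in>elem K. \<forall>v. \<bar>dd v e x\<bar> \<le> b * norm v" if "e \<in> E" for e
    by (rule dd_bounded) (use that E(2) in auto)
  then obtain b where b: "\<And>e. e \<in> E \<Longrightarrow> b e \<ge> 0" "\<And>e x v. e \<in> E \<Longrightarrow> x \<in> elem K \<Longrightarrow> \<bar>dd v e x\<bar> \<le> b e * norm v" by metis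
  define V where "V = (LINT x|lebesgue_on (cell K). 1 :: real)"
  have "\<bar>dd v z x\<bar> \<le> (sqrt V * (\<Sum>e\<in>E. b e)) * M * norm v"
    if z: "pol m z" and M: "M \<ge> 0" "\<forall>x\<in>elem K. \<bar>z x\<bar> \<le> M" and x: "x \<in> elem K" for z M x v
  proof -
    have zS: "z \<in> ?S" using z by simp
    have "?G z z \<le> (LINT x|lebesgue_on (cell K). M^2 * 1)" unfolding ip_def
    proof (rule integral_mono)
      show "integrable (lebesgue_on (cell K)) (\<lambda>x. z x * z x)" by (rule pol_integrable[OF pol_mult[OF z z]])
      show "integrable (lebesgue_on (cell K)) (\<lambda>x. M^2 * 1)" by (rule cell_integrable_const[OF nd])
      fix x assume "x \<in> space (lebesgue_on (cell K))"
      then have "\<bar>z x\<bar> \<le> M" using M interior_subset by auto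
      then have "\<bar>z x\<bar> * \<bar>z x\<bar> \<le> M * M" by (intro mult_mono) auto
      then show "z x * z x \<le> M^2 * 1" by (simp add: power2_eq_square)
    qed
    also have "\<dots> = M^2 * V" unfolding V_def by (rule integral_mult_right_zero)
    finally have "sqrt (?G z z) \<le> sqrt (M^2 * V)" by (rule real_sqrt_le_mono)
    then have sG: "sqrt (?G z z) \<le> sqrt V * M" using M(1) by (simp add: real_sqrt_mult mult.commute)
    have eb: "\<bar>dd v e x\<bar> \<le> b e * norm v" if "e \<in> E" for e by (rule b(2)[OF that x])
    have ed: "e differentiable (at x)" if "e \<in> E" for e using that E(2) pol_differentiable by blast
    have "dd v z x = dd v (\<lambda>x. \<Sum>e\<in>E. ?G z e * e x) x" using E(3)[OF zS] by simp
    also have "\<dots> = (\<Sum>e\<in>E. dd v (\<lambda>x. ?G z e * e x) x)"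
      by (rule dd_sum) (intro derivative_intros ed)
    also have "\<dots> = (\<Sum>e\<in>E. ?G z e * dd v e x)" by (rule sum.cong[OF refl]) (rule dd_cmult[OF ed])
    finally have "\<bar>dd v z x\<bar> \<le> (\<Sum>e\<in>E. \<bar>?G z e\<bar> * \<bar>dd v e x\<bar>)"
      using sum_abs[of "\<lambda>e. ?G z e * dd v e x" E] by (simp add: abs_mult)
    also have "\<dots> \<le> (\<Sum>e\<in>E. (sqrt V * M) * (b e * norm v))"
      by (intro sum_mono mult_mono eb order_trans[OF E(4)[OF zS] sG]) (use order_trans[OF real_sqrt_ge_zero[OF spd_pos[OF spd_L2 zS]] sG] in auto)
    also have "\<dots> = (sqrt V * (\<Sum>e\<in>E. b e)) * M * norm v"
      by (simp add: sum_distrib_left sum_distrib_right mult_ac)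
    finally show ?thesis .
  qed
  moreover have "0 \<le> sqrt V * (\<Sum>e\<in>E. b e)"
    by (intro mult_nonneg_nonneg sum_nonneg b(1)) (auto simp: V_def intro!: Bochner_Integration.integral_nonneg)
  ultimately show ?thesis by blast
qed

end

section \<open>Lebesgue and graph spaces on a simplex\<close>

text \<open>The sum is at most twice the larger term. This crude substitute for Minkowski's
  inequality costs a factor that enters the stability constants only.\<close>

lemma powr_add_le:
  fixes a b r :: real
  assumes "r > 0" shows "\<bar>a + b\<bar> powr r \<le> 2 powr r * (\<bar>a\<bar> powr r + \<bar>b\<bar> powr r)"
proof -
  have "\<bar>a + b\<bar> \<le> 2 * max \<bar>a\<bar> \<bar>b\<bar>" by linarith
  then have "\<bar>a + b\<bar> powr r \<le> (2 * max \<bar>a\<bar> \<bar>b\<bar>) powr r" using assms by (intro powr_mono2) auto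
  also have "\<dots> = 2 powr r * max \<bar>a\<bar> \<bar>b\<bar> powr r" by (intro powr_mult)
  also have "\<dots> \<le> 2 powr r * (\<bar>a\<bar> powr r + \<bar>b\<bar> powr r)" by (intro mult_left_mono) (auto simp: max_def)
  finally show ?thesis .
qed

lemma abs_le_one_plus_powr: "1 \<le> r \<Longrightarrow> \<bar>a\<bar> \<le> 1 + \<bar>a :: real\<bar> powr r"
proof (cases "\<bar>a\<bar> \<le> 1")
  case True
  then show ?thesis using powr_ge_zero[of "\<bar>a\<bar>" r] by linarith
next
  case False
  assume "1 \<le> r"
  then have "\<bar>a\<bar> powr 1 \<le> \<bar>a\<bar> powr r" using False by (intro powr_mono) auto
  then show ?thesis using False by simp
qed

lemma Lsp_comb:
  assumes r: "r > 0" and v: "v \<in> Lsp r D" and w: "w \<in> Lsp r D"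
  shows "(\<lambda>x. v x + c * w x) \<in> Lsp r D"
proof -
  have [measurable]: "v \<in> borel_measurable (lebesgue_on D)" "w \<in> borel_measurable (lebesgue_on D)"
    using v w by (auto simp: Lsp_def)
  have "integrable (lebesgue_on D) (\<lambda>x. \<bar>v x + c * w x\<bar> powr r)"
  proof (rule Bochner_Integration.integrable_bound)
    show "integrable (lebesgue_on D) (\<lambda>x. 2 powr r * (\<bar>v x\<bar> powr r + \<bar>c\<bar> powr r * \<bar>w x\<bar> powr r))"
      using v w by (auto simp: Lsp_def)
    show "AE x in lebesgue_on D. norm (\<bar>v x + c * w x\<bar> powr r) \<le> norm (2 powr r * (\<bar>v x\<bar> powr r + \<bar>c\<bar> powr r * \<bar>w x\<bar> powr r))"
    proof (rule AE_I2)
      fix x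
      show "norm (\<bar>v x + c * w x\<bar> powr r) \<le> norm (2 powr r * (\<bar>v x\<bar> powr r + \<bar>c\<bar> powr r * \<bar>w x\<bar> powr r))"
        using powr_add_le[OF r, of "v x" "c * w x"] by (simp add: abs_mult powr_mult)
    qed
  qed measurable
  then show ?thesis by (simp add: Lsp_def)
qed

lemma Lsp_cong_AE:
  assumes v: "v \<in> Lsp r D" and w: "w \<in> borel_measurable (lebesgue_on D)"
    and ae: "AE x in lebesgue_on D. w x = v x"
  shows "w \<in> Lsp r D"
proof -
  have [measurable]: "v \<in> borel_measurable (lebesgue_on D)" using v by (simp add: Lsp_def)
  note [measurable] = w
  have "integrable (lebesgue_on D) (\<lambda>x. \<bar>w x\<bar> powr r)"
    by (rule Bochner_Integration.integrable_cong_AE_imp[of _ "\<lambda>x. \<bar>v x\<bar> powr r"])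
       (use v ae in \<open>auto simp: Lsp_def elim: eventually_mono\<close>)
  then show ?thesis using w by (simp add: Lsp_def)
qed

lemma Lsp_subset:
  assumes v: "v \<in> Lsp r D" and D: "D \<in> sets lebesgue" "E \<in> sets lebesgue" "E \<subseteq> D"
  shows "v \<in> Lsp r E"
proof -
  have m: "v \<in> borel_measurable (lebesgue_on E)"
  proof -
    have "v \<in> borel_measurable (lebesgue_on D)" using v by (simp add: Lsp_def)
    then show ?thesis by (rule measurable_restrict_mono[OF _ D(3)])
  qed
  have "integrable lebesgue (\<lambda>x. indicator D x * \<bar>v x\<bar> powr r)"
    using v D by (simp add: Lsp_def integrable_lebesgue_on)
  from integrable_mult_indicator[OF D(2) this]
  have "integrable lebesgue (\<lambda>x. indicator E x * (indicator D x * \<bar>v x\<bar> powr r))" by simp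
  moreover have "(\<lambda>x. indicator E x * (indicator D x * \<bar>v x\<bar> powr r)) = (\<lambda>x. indicator E x * \<bar>v x\<bar> powr r)"
    by (rule ext) (use D(3) in \<open>auto simp: indicator_def\<close>)
  ultimately show ?thesis using m D by (simp add: Lsp_def integrable_lebesgue_on)
qed

lemma Lsp_1: "v \<in> Lsp 1 D \<longleftrightarrow> integrable (lebesgue_on D) v"
proof
  assume "v \<in> Lsp 1 D"
  then have "v \<in> borel_measurable (lebesgue_on D)" "integrable (lebesgue_on D) (\<lambda>x. \<bar>v x\<bar>)"
    by (auto simp: Lsp_def)
  then show "integrable (lebesgue_on D) v" by (subst (asm) integrable_abs_iff) auto
next
  assume i: "integrable (lebesgue_on D) v"
  then show "v \<in> Lsp 1 D" using borel_measurable_integrable[OF i] by (simp add: Lsp_def)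
qed

section \<open>The graph space without exponent\<close>

text \<open>On a bounded cell this contains the graph spaces for all exponents at least 1.
  Polynomials are bounded there, so pairing with them takes integrability only, and the projection
  can be constructed independently of q.\<close>

definition W1 :: "'n::finite field \<Rightarrow> 'n vsimplex \<Rightarrow> 'n scalar set" where
  "W1 \<beta> K = {v. integrable (lebesgue_on (cell K)) v \<and>
     (\<exists>g. integrable (lebesgue_on (cell K)) g \<and> weak_deriv \<beta> (cell K) v g)}"

lemma W1_bgrad:
  assumes "v \<in> W1 \<beta> K"
  shows "integrable (lebesgue_on (cell K)) v" "integrable (lebesgue_on (cell K)) (bgrad \<beta> (cell K) v)"
    "weak_deriv \<beta> (cell K) v (bgrad \<beta> (cell K) v)"
proof -
  show "integrable (lebesgue_on (cell K)) v" using assms by (simp add: W1_def)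
  have "\<exists>g. g \<in> Lsp 1 (cell K) \<and> weak_deriv \<beta> (cell K) v g" using assms by (auto simp: W1_def Lsp_1)
  from someI_ex[OF this]
  show "integrable (lebesgue_on (cell K)) (bgrad \<beta> (cell K) v)" "weak_deriv \<beta> (cell K) v (bgrad \<beta> (cell K) v)"
    by (simp_all add: bgrad_def Lsp_1)
qed

lemma W1_I:
  assumes "integrable (lebesgue_on (cell K)) v" "integrable (lebesgue_on (cell K)) g" "weak_deriv \<beta> (cell K) v g"
  shows "v \<in> W1 \<beta> K" "AE x in lebesgue_on (cell K). bgrad \<beta> (cell K) v x = g x"
proof -
  show v: "v \<in> W1 \<beta> K" using assms by (auto simp: W1_def)
  show "AE x in lebesgue_on (cell K). bgrad \<beta> (cell K) v x = g x"
    by (rule weak_deriv_unique[OF open_interior W1_bgrad(2)[OF v] assms(2) W1_bgrad(3)[OF v] assms(3)])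
qed

locale simplex_field =
  fixes K :: "'n::finite vsimplex" and \<beta> :: "'n field" and c :: "real^'n"
  assumes nd: "nondegenerate K" and beta: "\<And>x. x \<in> cell K \<Longrightarrow> \<beta> x = c"
begin

abbreviation "\<mu> \<equiv> lebesgue_on (cell K)"
abbreviation "vol \<equiv> measure lebesgue (cell K)"
abbreviation "bg \<equiv> bgrad \<beta> (cell K)"

lemma beta_on_eq: "beta_on \<beta> K = c"
proof -
  obtain x where "x \<in> cell K" using cell_nonempty[OF nd] by blast
  then show ?thesis unfolding beta_on_def by (intro the_equality) (auto simp: beta)
qed

lemma cell_lmeasurable: "cell K \<in> lmeasurable"
  using cell_bounded[OF nd] by (simp add: lmeasurable_open)

lemma integral_const_cell: "(LINT x|\<mu>. a) = a * vol"
proof -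
  have "(LINT x|\<mu>. a) = (LINT x|lebesgue. indicator (cell K) x * a)" by (rule LINT_lebesgue_on) simp
  then show ?thesis using cell_lmeasurable by (simp add: fmeasurable_def mult.commute)
qed

lemma vol_pos: "vol > 0"
proof -
  have "\<not> negligible (cell K)" using open_not_negligible[OF open_interior cell_nonempty[OF nd]] .
  then have "vol \<noteq> 0" using cell_lmeasurable negligible_iff_measure0 by blast
  then show ?thesis using measure_nonneg[of lebesgue "cell K"] by linarith
qed

lemma Lsp_integrable:
  assumes "1 \<le> r" "v \<in> Lsp r (cell K)" shows "integrable \<mu> v"
proof (rule Bochner_Integration.integrable_bound)
  show "integrable \<mu> (\<lambda>x. 1 + \<bar>v x\<bar> powr r)"
    using assms by (auto simp: Lsp_def intro: cell_integrable_const[OF nd])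
  show "v \<in> borel_measurable \<mu>" using assms by (simp add: Lsp_def)
  show "AE x in \<mu>. norm (v x) \<le> norm (1 + \<bar>v x\<bar> powr r)"
  proof (rule AE_I2)
    fix x show "norm (v x) \<le> norm (1 + \<bar>v x\<bar> powr r)"
      using abs_le_one_plus_powr[OF assms(1), of "v x"] by simp
  qed
qed

lemma pol_Lsp:
  assumes "r > 0" "pol m z" shows "z \<in> Lsp r (cell K)"
proof -
  have c: "continuous_on UNIV z" by (rule pol_continuous[OF assms(2)])
  have "continuous_on UNIV (\<lambda>x. \<bar>z x\<bar> powr r)" using assms(1) c by (intro continuous_on_powr') (auto intro!: continuous_intros)
  then show ?thesis
    using continuous_imp_measurable_lebesgue_on[OF c] cell_integrable[OF nd] by (simp add: Lsp_def)
qed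

lemma Wsp_bgrad:
  assumes r: "1 \<le> r" and v: "v \<in> Wsp r \<beta> (cell K)"
  shows "v \<in> W1 \<beta> K" "v \<in> Lsp r (cell K)" "bg v \<in> Lsp r (cell K)"
proof -
  obtain g where g: "g \<in> Lsp r (cell K)" "weak_deriv \<beta> (cell K) v g" using v by (auto simp: Wsp_def)
  show vL: "v \<in> Lsp r (cell K)" using v by (simp add: Wsp_def)
  note W = W1_I[OF Lsp_integrable[OF r vL] Lsp_integrable[OF r g(1)] g(2)]
  show "v \<in> W1 \<beta> K" by (rule W(1))
  show "bg v \<in> Lsp r (cell K)"
    by (rule Lsp_cong_AE[OF g(1) _ W(2)]) (use W1_bgrad(2)[OF W(1)] in auto)
qed

lemma Wsp_I:
  assumes "1 \<le> r" "v \<in> Lsp r (cell K)" "g \<in> Lsp r (cell K)" "weak_deriv \<beta> (cell K) v g"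
  shows "v \<in> Wsp r \<beta> (cell K)"
  using assms by (auto simp: Wsp_def)

lemma bgrad_pol:
  assumes z: "pol m z"
  shows "z \<in> W1 \<beta> K" "AE x in \<mu>. bg z x = dd c z x"
proof -
  note i = cell_integrable[OF nd pol_continuous[OF z]] cell_integrable[OF nd pol_continuous[OF pol_dd[OF z]]]
  show "z \<in> W1 \<beta> K" "AE x in \<mu>. bg z x = dd c z x"
    using W1_I[OF i weak_deriv_pol[OF nd beta z]] by auto
qed

lemma pol_Wsp: "1 \<le> r \<Longrightarrow> pol m z \<Longrightarrow> z \<in> Wsp r \<beta> (cell K)"
  by (rule Wsp_I[OF _ _ _ weak_deriv_pol[OF nd beta]]) (auto intro!: pol_Lsp pol_dd)

lemma bgrad_comb:
  assumes v: "v \<in> W1 \<beta> K" and w: "w \<in> W1 \<beta> K"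
  shows "(\<lambda>x. v x + a * w x) \<in> W1 \<beta> K"
    "AE x in \<mu>. bg (\<lambda>x. v x + a * w x) x = bg v x + a * bg w x"
proof -
  note V = W1_bgrad[OF v] and W = W1_bgrad[OF w]
  have i: "integrable \<mu> (\<lambda>x. v x + a * w x)" "integrable \<mu> (\<lambda>x. bg v x + a * bg w x)"
    using V W by auto
  note I = W1_I[OF i weak_deriv_comb[OF beta V(1) W(1) V(2) W(2) V(3) W(3)]]
  show "(\<lambda>x. v x + a * w x) \<in> W1 \<beta> K"
    "AE x in \<mu>. bg (\<lambda>x. v x + a * w x) x = bg v x + a * bg w x" using I by auto
qed

lemma Wsp_comb:
  assumes r: "1 \<le> r" and v: "v \<in> Wsp r \<beta> (cell K)" and w: "w \<in> Wsp r \<beta> (cell K)"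
  shows "(\<lambda>x. v x + a * w x) \<in> Wsp r \<beta> (cell K)"
proof -
  note V = Wsp_bgrad[OF r v] and W = Wsp_bgrad[OF r w]
  have r0: "r > 0" using r by simp
  show ?thesis
    by (rule Wsp_I[OF r Lsp_comb[OF r0 V(2) W(2)] Lsp_comb[OF r0 V(3) W(3)]
        weak_deriv_comb[OF beta W1_bgrad(1)[OF V(1)] W1_bgrad(1)[OF W(1)] W1_bgrad(2)[OF V(1)] W1_bgrad(2)[OF W(1)]
          W1_bgrad(3)[OF V(1)] W1_bgrad(3)[OF W(1)]]])
qed

lemma W1_cong:
  assumes "\<And>x. x \<in> cell K \<Longrightarrow> v x = w x"
  shows "weak_deriv \<beta> (cell K) v g \<longleftrightarrow> weak_deriv \<beta> (cell K) w g" "bg v = bg w"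
proof -
  have *: "weak_deriv \<beta> (cell K) v g \<longleftrightarrow> weak_deriv \<beta> (cell K) w g" for g
    by (rule weak_deriv_cong) (auto simp: assms)
  then show "weak_deriv \<beta> (cell K) v g \<longleftrightarrow> weak_deriv \<beta> (cell K) w g" .
  show "bg v = bg w" unfolding bgrad_def by (simp add: *)
qed

lemma ip_mult_integrable:
  assumes "pol m z" "integrable \<mu> v" shows "integrable \<mu> (\<lambda>x. z x * v x)" "integrable \<mu> (\<lambda>x. v x * z x)"
  using cell_integrable_mult[OF nd pol_continuous[OF assms(1)] assms(2)] by (simp_all add: mult.commute)

text \<open>For a polynomial \<open>bgrad\<close> is a chosen representative that equals the
  classical derivative only almost everywhere; inside the integral it may be replaced.\<close>

lemma DK_pol_W1:
  assumes z: "pol m z" and v: "v \<in> W1 \<beta> K"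
  shows "DK \<beta> K z v = ip (cell K) (dd c z) v + ip (cell K) z (bg v)"
proof -
  note V = W1_bgrad[OF v] and Z = bgrad_pol[OF z]
  have i: "integrable \<mu> (\<lambda>x. dd c z x * v x)" by (rule ip_mult_integrable[OF pol_dd[OF z] V(1)])
  have ae: "AE x in \<mu>. bg z x * v x = dd c z x * v x" using Z(2) by eventually_elim simp
  have "integrable \<mu> (\<lambda>x. bg z x * v x)"
  proof (rule Bochner_Integration.integrable_cong_AE_imp[OF i])
    show "(\<lambda>x. bg z x * v x) \<in> borel_measurable \<mu>"
      using W1_bgrad(2)[OF Z(1)] V(1) by (intro borel_measurable_times) auto
    show "AE x in \<mu>. dd c z x * v x = bg z x * v x" using ae by eventually_elim auto
  qed
  from ip_cong_AE[OF this i ae] show ?thesis by (simp add: DK_def)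
qed

lemma ip_bgrad_comb:
  assumes z: "pol m z" and v: "v \<in> W1 \<beta> K" and w: "w \<in> W1 \<beta> K"
  shows "ip (cell K) z (bg (\<lambda>x. v x + a * w x)) = ip (cell K) z (bg v) + a * ip (cell K) z (bg w)"
proof -
  note V = W1_bgrad[OF v] and W = W1_bgrad[OF w] and C = bgrad_comb[OF v w, of a]
  note i = ip_mult_integrable(1)[OF z V(2)] ip_mult_integrable(1)[OF z W(2)]
  have i': "integrable \<mu> (\<lambda>x. z x * (bg v x + a * bg w x))"
    using i by (simp add: distrib_left mult.left_commute)
  have "ip (cell K) z (bg (\<lambda>x. v x + a * w x)) = ip (cell K) z (\<lambda>x. bg v x + a * bg w x)"
  proof (rule ip_cong_AE[OF ip_mult_integrable(1)[OF z W1_bgrad(2)[OF C(1)]] i'])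
    show "AE x in \<mu>. z x * bg (\<lambda>x. v x + a * w x) x = z x * (bg v x + a * bg w x)"
      using C(2) by eventually_elim simp
  qed
  then show ?thesis using i by (simp add: ip_def distrib_left mult.left_commute)
qed

lemma ip_comb_right:
  assumes z: "pol m z" and v: "integrable \<mu> v" and w: "integrable \<mu> w"
  shows "ip (cell K) z (\<lambda>x. v x + a * w x) = ip (cell K) z v + a * ip (cell K) z w"
  using ip_mult_integrable(1)[OF z v] ip_mult_integrable(1)[OF z w]
  by (simp add: ip_def distrib_left mult.left_commute)

lemma ip_comb_left:
  assumes z: "pol m z" and y: "pol m y" and v: "integrable \<mu> v"
  shows "ip (cell K) (\<lambda>x. z x + a * y x) v = ip (cell K) z v + a * ip (cell K) y v"
  using ip_mult_integrable(1)[OF z v] ip_mult_integrable(1)[OF y v]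
  by (simp add: ip_def distrib_right mult.assoc)

lemma DK_comb_right:
  assumes z: "pol m z" and v: "v \<in> W1 \<beta> K" and w: "w \<in> W1 \<beta> K"
  shows "DK \<beta> K z (\<lambda>x. v x + a * w x) = DK \<beta> K z v + a * DK \<beta> K z w"
  unfolding DK_pol_W1[OF z v] DK_pol_W1[OF z w] DK_pol_W1[OF z bgrad_comb(1)[OF v w]] ip_bgrad_comb[OF z v w]
    ip_comb_right[OF pol_dd[OF z] W1_bgrad(1)[OF v] W1_bgrad(1)[OF w]]
  by (simp add: algebra_simps)

lemma DK_diff_right:
  assumes z: "pol m z" and v: "v \<in> W1 \<beta> K" and w: "w \<in> W1 \<beta> K"
  shows "DK \<beta> K z (\<lambda>x. v x - w x) = DK \<beta> K z v - DK \<beta> K z w"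
  using DK_comb_right[OF z v w, of "-1"] by simp

lemma dd_comb:
  assumes z: "pol m z" and y: "pol n y" shows "dd v (\<lambda>x. z x + a * y x) = (\<lambda>x. dd v z x + a * dd v y x)"
  using pol_differentiable[OF z] pol_differentiable[OF y]
  by (intro ext, subst dd_add) (auto simp: dd_cmult intro: derivative_intros)

lemma DK_comb_left:
  assumes z: "pol m z" and y: "pol m y" and v: "v \<in> W1 \<beta> K"
  shows "DK \<beta> K (\<lambda>x. z x + a * y x) v = DK \<beta> K z v + a * DK \<beta> K y v"
  unfolding DK_pol_W1[OF z v] DK_pol_W1[OF y v] DK_pol_W1[OF pol_add[OF z pol_cmult[OF y]] v] dd_comb[OF z y]
    ip_comb_left[OF z y W1_bgrad(2)[OF v]] ip_comb_left[OF pol_dd[OF z] pol_dd[OF y] W1_bgrad(1)[OF v]]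
  by (simp add: algebra_simps)

lemma DK_pol_pol:
  assumes z: "pol m z" and y: "pol n y"
  shows "DK \<beta> K z y = (LINT x|\<mu>. dd c (\<lambda>x. z x * y x) x)"
proof -
  note Y = bgrad_pol[OF y]
  have i: "integrable \<mu> (\<lambda>x. z x * dd c y x)" "integrable \<mu> (\<lambda>x. dd c z x * y x)"
    by (rule pol_integrable[OF nd pol_mult[OF z pol_dd[OF y]]] pol_integrable[OF nd pol_mult[OF pol_dd[OF z] y]])+
  have "ip (cell K) z (bg y) = ip (cell K) z (dd c y)"
    by (rule ip_cong_AE[OF ip_mult_integrable(1)[OF z W1_bgrad(2)[OF Y(1)]] i(1)])
       (use Y(2) in \<open>eventually_elim, simp\<close>)
  moreover have "dd c (\<lambda>x. z x * y x) = (\<lambda>x. z x * dd c y x + dd c z x * y x)"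
    by (intro ext dd_mult pol_differentiable[OF z] pol_differentiable[OF y])
  ultimately show ?thesis using i by (simp add: DK_pol_W1[OF z Y(1)] ip_def)
qed

lemma DK_boundary_zero:
  assumes z: "pol m z" and 0: "\<And>x. x \<in> frontier (elem K) \<Longrightarrow> z x = 0" and v: "v \<in> W1 \<beta> K"
  shows "DK \<beta> K z v = 0"
  using integration_by_parts_zero[OF nd beta z 0 W1_bgrad[OF v]]
  by (simp add: DK_pol_W1[OF z v] ip_def mult.commute)

lemma DK_boundary_zero_right:
  assumes z: "pol m z" and y: "pol n y" and 0: "\<And>x. x \<in> frontier (elem K) \<Longrightarrow> y x = 0"
  shows "DK \<beta> K z y = 0"
  unfolding DK_pol_pol[OF z y] by (rule integral_dd_boundary_zero[OF nd pol_mult[OF z y]]) (simp add: 0)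

lemma ip_abs_bound:
  assumes z: "pol m z" and v: "integrable \<mu> v" and A: "\<And>x. x \<in> elem K \<Longrightarrow> \<bar>z x\<bar> \<le> A"
  shows "\<bar>ip (cell K) z v\<bar> \<le> A * (LINT x|\<mu>. \<bar>v x\<bar>)"
proof -
  have "\<bar>ip (cell K) z v\<bar> \<le> (LINT x|\<mu>. \<bar>z x * v x\<bar>)" unfolding ip_def by (rule integral_abs_bound)
  also have "\<dots> \<le> (LINT x|\<mu>. A * \<bar>v x\<bar>)"
  proof (rule integral_mono)
    show "integrable \<mu> (\<lambda>x. \<bar>z x * v x\<bar>)" using ip_mult_integrable(1)[OF z v] by simp
    show "integrable \<mu> (\<lambda>x. A * \<bar>v x\<bar>)" using v by simp
    fix x assume "x \<in> space \<mu>"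
    then have "\<bar>z x\<bar> \<le> A" using A interior_subset by auto
    then show "\<bar>z x * v x\<bar> \<le> A * \<bar>v x\<bar>" by (simp add: abs_mult mult_right_mono)
  qed
  finally show ?thesis by simp
qed

lemma DK_bound:
  assumes z: "pol m z" and v: "v \<in> W1 \<beta> K"
    and A: "\<And>x. x \<in> elem K \<Longrightarrow> \<bar>z x\<bar> \<le> A" "\<And>x. x \<in> elem K \<Longrightarrow> \<bar>dd c z x\<bar> \<le> B"
  shows "\<bar>DK \<beta> K z v\<bar> \<le> B * (LINT x|\<mu>. \<bar>v x\<bar>) + A * (LINT x|\<mu>. \<bar>bg v x\<bar>)"
  unfolding DK_pol_W1[OF z v]
  using ip_abs_bound[OF pol_dd[OF z] W1_bgrad(1)[OF v] A(2)] ip_abs_bound[OF z W1_bgrad(2)[OF v] A(1)] by linarith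

lemma signed_bubble_pol: "pol (CARD('n)) (signed_bubble \<beta> K)"
  unfolding signed_bubble_def[abs_def] by (intro pol_sum pol_cmult facet_bubble_pol[OF nd])

lemma signed_bubble_bound:
  assumes x: "x \<in> elem K" shows "\<bar>signed_bubble \<beta> K x\<bar> \<le> real (CARD('n) + 1)"
proof -
  have "\<bar>signed_bubble \<beta> K x\<bar> \<le> (\<Sum>i\<in>UNIV. \<bar>sgn (beta_n \<beta> K i) * facet_bubble K i x\<bar>)"
    unfolding signed_bubble_def by (rule sum_abs)
  also have "\<dots> \<le> (\<Sum>i\<in>(UNIV::'n option set). 1)"
    by (rule sum_mono) (use facet_bubble_bounds[OF nd x] in \<open>auto simp: abs_mult abs_sgn_eq\<close>)
  finally show ?thesis by simp
qed

text \<open>The degree k - 2 is negative for k = 1; the space is then {0}, and the truncated degree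
  0 still bounds it.\<close>

lemma polys_nat: "polys j \<subseteq> (Collect (pol (nat j)) :: 'n scalar set)" "fsub (polys j :: 'n scalar set)"
proof -
  have "polys j \<subseteq> (Collect (pol (nat j)) :: 'n scalar set) \<and> fsub (polys j :: 'n scalar set)"
  proof (cases "j < 0")
    case True
    then show ?thesis by (auto simp: polys_neg fsub_def intro: pol_const)
  next
    case False
    then have "polys j = (Collect (pol (nat j)) :: 'n scalar set)" using polys_eq_pol[of "nat j"] by simp
    then show ?thesis using fsub_pol[OF nd, of "nat j"] by simp
  qed
  then show "polys j \<subseteq> (Collect (pol (nat j)) :: 'n scalar set)" "fsub (polys j :: 'n scalar set)" by auto
qed

lemma spd_subset: "spd S G \<Longrightarrow> T \<subseteq> S \<Longrightarrow> spd T G"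
  unfolding spd_def by (meson subset_iff)

lemma pol_riesz:
  assumes S: "S \<subseteq> Collect (pol m :: 'n scalar \<Rightarrow> bool)" "fsub S" "spd S G"
    and l: "\<And>f g c. f \<in> S \<Longrightarrow> g \<in> S \<Longrightarrow> l (\<lambda>x. f x + c * g x) = l f + c * l g"
  shows "\<exists>r\<in>S. \<forall>z\<in>S. G z r = l z"
proof -
  obtain B :: "'n scalar set" where "finite B" "Collect (pol m) \<subseteq> fspan B" using pol_fspan by blast
  with S(1) show ?thesis by (intro riesz_finite[OF _ _ S(2,3) l]) auto
qed

lemma bubble_form:
  "spd (Collect (pol m)) (\<lambda>z y. LINT x|\<mu>. bubble K x * (z x * y x))"
  by (rule spd_weighted[OF nd bubble_pol[OF nd] bubble_pos[OF nd]])

end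

section \<open>Existence and orthogonality of the projection\<close>

lemma (in simplex_field) flux_form:
  assumes z: "pol m z" and y: "pol n y"
  shows "(LINT x|\<mu>. dd c (\<lambda>x. z x * (signed_bubble \<beta> K x * y x)) x) = (\<Sum>i\<in>UNIV. \<bar>grd K i \<bullet> c\<bar> * flux K i (\<lambda>x. z x * y x))"
  using integral_dd_signed_bubble[OF nd pol_mult[OF z y] beta_on_eq] by (simp add: mult.left_commute)

text \<open>J collects facets crossed by the flow. It is large enough for functions in
  \<open>polys_perp\<close> to be determined by their values there: all facets or, for k = 1, at
  least two.\<close>

locale stable_simplex = simplex_field K \<beta> c for K :: "'n::finite vsimplex" and \<beta> c +
  fixes k :: nat and J :: "'n option set"
  assumes k: "k \<ge> 1" and J: "J = UNIV \<or> k = 1 \<and> (\<exists>i\<in>J. \<exists>j\<in>J. i \<noteq> j)"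
    and cJ: "\<And>i. i \<in> J \<Longrightarrow> grd K i \<bullet> c \<noteq> 0"
begin

abbreviation "perp \<equiv> polys_perp K (int k)"
abbreviation "low \<equiv> polys (int k - 2) :: 'n scalar set"

definition form :: "'n scalar \<Rightarrow> 'n scalar \<Rightarrow> real" where
  "form z y = (\<Sum>i\<in>UNIV. \<bar>grd K i \<bullet> c\<bar> * flux K i (\<lambda>x. z x * y x))"

lemma low_pol: "low \<subseteq> Collect (pol (k - 1))" "fsub low"
proof -
  have "low \<subseteq> Collect (pol (nat (int k - 2)))" by (rule polys_nat(1))
  moreover have "nat (int k - 2) \<le> k - 1" by simp
  ultimately show "low \<subseteq> Collect (pol (k - 1))" using pol_mono by blast
qed (rule polys_nat(2))

lemma form_spd: "spd perp form"
proof -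
  have "spd perp (\<lambda>z y. \<Sum>i\<in>UNIV. \<bar>grd K i \<bullet> c\<bar> * flux K i (\<lambda>x. z x * y x))"
  proof (rule spd_flux[OF nd polys_perp_pol[OF nd]])
    fix z assume z: "z \<in> perp" and 0: "\<And>i x. 0 < \<bar>grd K i \<bullet> c\<bar> \<Longrightarrow> x \<in> facet K i \<Longrightarrow> z x = 0"
    show "z = (\<lambda>x. 0)" by (rule polys_perp_determined[OF nd z J]) (use 0 cJ in auto)
  qed auto
  then show ?thesis by (simp add: form_def[abs_def])
qed

text \<open>The interior bubble vanishes on the boundary, so \<open>DK\<close> against a polynomial
  sees \<open>r\<close> only. This decouples the first set of equations from
  \<open>t\<close>.\<close>

lemma DK_form:
  assumes z: "pol m z" and r: "pol n r" and t: "pol l t"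
  shows "DK \<beta> K z (\<lambda>x. signed_bubble \<beta> K x * r x + bubble K x * t x) = form z r"
proof -
  have sr: "pol (CARD('n) + n) (\<lambda>x. signed_bubble \<beta> K x * r x)" by (rule pol_mult[OF signed_bubble_pol r])
  have bt: "pol (CARD('n) + 1 + l) (\<lambda>x. bubble K x * t x)" by (rule pol_mult[OF bubble_pol[OF nd] t])
  have "DK \<beta> K z (\<lambda>x. signed_bubble \<beta> K x * r x + 1 * (bubble K x * t x))
      = DK \<beta> K z (\<lambda>x. signed_bubble \<beta> K x * r x) + 1 * DK \<beta> K z (\<lambda>x. bubble K x * t x)"
    by (rule DK_comb_right[OF z bgrad_pol(1)[OF sr] bgrad_pol(1)[OF bt]])
  moreover have "DK \<beta> K z (\<lambda>x. bubble K x * t x) = 0"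
    by (rule DK_boundary_zero_right[OF z bt]) (simp add: bubble_zero[OF nd])
  moreover have "DK \<beta> K z (\<lambda>x. signed_bubble \<beta> K x * r x) = form z r"
    unfolding DK_pol_pol[OF z sr] form_def by (rule flux_form[OF z r])
  ultimately show ?thesis by simp
qed

lemma VK_pol: "w \<in> VK \<beta> k K \<Longrightarrow> pol (CARD('n) + 1 + k) w"
proof -
  assume "w \<in> VK \<beta> k K"
  then obtain r t where w: "w = (\<lambda>x. signed_bubble \<beta> K x * r x + bubble K x * t x)" "r \<in> perp" "t \<in> low"
    by (auto simp: VK_def)
  have "pol (CARD('n) + k) (\<lambda>x. signed_bubble \<beta> K x * r x)"
    using w(2) polys_perp_pol[OF nd] by (intro pol_mult signed_bubble_pol) auto
  moreover have "pol (CARD('n) + 1 + (k - 1)) (\<lambda>x. bubble K x * t x)"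
    using w(3) low_pol(1) by (intro pol_mult bubble_pol[OF nd]) auto
  ultimately show ?thesis unfolding w(1)
    by (intro pol_add) (auto elim!: pol_mono[rotated])
qed

text \<open>The defining conditions of the projection, in the unknowns r and t. The system is
  triangular: r comes from a Riesz problem for \<open>form\<close>, and with r known t comes from
  one for the L2 product weighted with the bubble.\<close>

definition solves :: "'n scalar \<Rightarrow> 'n scalar \<Rightarrow> 'n scalar \<Rightarrow> bool" where
  "solves v r t \<longleftrightarrow> r \<in> perp \<and> t \<in> low \<and> (\<forall>z\<in>perp. form z r = DK \<beta> K z v) \<and>
     (\<forall>y\<in>low. (LINT x|\<mu>. bubble K x * (y x * t x)) = ip (cell K) y v - ip (cell K) y (\<lambda>x. signed_bubble \<beta> K x * r x))"

lemma solves_exists: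
  assumes v: "v \<in> W1 \<beta> K" shows "\<exists>r t. solves v r t"
proof -
  have pp: "z \<in> perp \<Longrightarrow> pol k z" for z using polys_perp_pol[OF nd] by auto
  have lp: "z \<in> low \<Longrightarrow> pol (k - 1) z" for z using low_pol(1) by auto
  have "\<exists>r\<in>perp. \<forall>z\<in>perp. form z r = DK \<beta> K z v"
    by (rule pol_riesz[OF polys_perp_pol[OF nd] fsub_polys_perp[OF nd] form_spd])
       (intro DK_comb_left[where m=k, OF _ _ v] pp)
  then obtain r where r: "r \<in> perp" "\<And>z. z \<in> perp \<Longrightarrow> form z r = DK \<beta> K z v" by blast
  let ?l = "\<lambda>y. ip (cell K) y v - ip (cell K) y (\<lambda>x. signed_bubble \<beta> K x * r x)"
  have si: "integrable \<mu> (\<lambda>x. signed_bubble \<beta> K x * r x)"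
    by (rule pol_integrable[OF nd pol_mult[OF signed_bubble_pol pp[OF r(1)]]])
  have "\<exists>t\<in>low. \<forall>y\<in>low. (LINT x|\<mu>. bubble K x * (y x * t x)) = ?l y"
  proof (rule pol_riesz[OF low_pol spd_subset[OF bubble_form low_pol(1)]])
    fix f g a assume f: "f \<in> low" and g: "g \<in> low"
    show "?l (\<lambda>x. f x + a * g x) = ?l f + a * ?l g"
      unfolding ip_comb_left[OF lp[OF f] lp[OF g] W1_bgrad(1)[OF v]] ip_comb_left[OF lp[OF f] lp[OF g] si]
      by (simp add: algebra_simps)
  qed
  with r show ?thesis unfolding solves_def by blast
qed

definition conds :: "'n scalar \<Rightarrow> 'n scalar \<Rightarrow> bool" where
  "conds v w \<longleftrightarrow> w \<in> VK \<beta> k K \<and> (\<forall>z\<in>perp. DK \<beta> K z (\<lambda>x. w x - v x) = 0) \<and>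
     (\<forall>z\<in>low. ip (cell K) z (\<lambda>x. w x - v x) = 0)"

text \<open>Conditions on the difference w - v become equations with v on the right-hand side.
  Existence and uniqueness of the object described by \<open>THE\<close> in \<open>PiK\<close> are
  thereby questions about (r, t).\<close>

lemma conds_iff_solves:
  assumes v: "v \<in> W1 \<beta> K"
  shows "conds v w \<longleftrightarrow> (\<exists>r t. solves v r t \<and> w = (\<lambda>x. signed_bubble \<beta> K x * r x + bubble K x * t x))"
proof -
  have pp: "z \<in> perp \<Longrightarrow> pol k z" for z using polys_perp_pol[OF nd] by auto
  have lp: "z \<in> low \<Longrightarrow> pol (k - 1) z" for z using low_pol(1) by auto
  have eq: "conds v (\<lambda>x. signed_bubble \<beta> K x * r x + bubble K x * t x) \<longleftrightarrow> solves v r t" if r: "r \<in> perp" and t: "t \<in> low" for r t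
  proof -
    let ?w = "\<lambda>x. signed_bubble \<beta> K x * r x + bubble K x * t x"
    have wV: "?w \<in> VK \<beta> k K" using r t by (auto simp: VK_def)
    have wp: "pol (CARD('n) + 1 + k) ?w" by (rule VK_pol[OF wV])
    have 1: "DK \<beta> K z (\<lambda>x. ?w x - v x) = form z r - DK \<beta> K z v" if "z \<in> perp" for z
      using DK_diff_right[OF pp[OF that] bgrad_pol(1)[OF wp] v] DK_form[OF pp[OF that] pp[OF r] lp[OF t]] by simp
    have 2: "ip (cell K) z (\<lambda>x. ?w x - v x) = (LINT x|\<mu>. bubble K x * (z x * t x))
        + ip (cell K) z (\<lambda>x. signed_bubble \<beta> K x * r x) - ip (cell K) z v" if z: "z \<in> low" for z
    proof -
      have i1: "integrable \<mu> (\<lambda>x. signed_bubble \<beta> K x * r x)"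
        by (rule pol_integrable[OF nd pol_mult[OF signed_bubble_pol pp[OF r]]])
      have i2: "integrable \<mu> (\<lambda>x. bubble K x * t x)"
        by (rule pol_integrable[OF nd pol_mult[OF bubble_pol[OF nd] lp[OF t]]])
      have "ip (cell K) z ?w = ip (cell K) z (\<lambda>x. signed_bubble \<beta> K x * r x) + 1 * ip (cell K) z (\<lambda>x. bubble K x * t x)"
        using ip_comb_right[OF lp[OF z] i1 i2, of 1] by simp
      moreover have "ip (cell K) z (\<lambda>x. ?w x + (-1) * v x) = ip (cell K) z ?w + (-1) * ip (cell K) z v"
        by (rule ip_comb_right[OF lp[OF z] pol_integrable[OF nd wp] W1_bgrad(1)[OF v]])
      moreover have "ip (cell K) z (\<lambda>x. bubble K x * t x) = (LINT x|\<mu>. bubble K x * (z x * t x))"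
        unfolding ip_def by (simp add: mult.left_commute)
      ultimately show ?thesis by simp
    qed
    have "(\<forall>z\<in>perp. DK \<beta> K z (\<lambda>x. ?w x - v x) = 0) \<longleftrightarrow> (\<forall>z\<in>perp. form z r = DK \<beta> K z v)"
      by (rule ball_cong[OF refl]) (simp add: 1)
    moreover have "(\<forall>z\<in>low. ip (cell K) z (\<lambda>x. ?w x - v x) = 0) \<longleftrightarrow> (\<forall>y\<in>low. (LINT x|\<mu>. bubble K x * (y x * t x))
        = ip (cell K) y v - ip (cell K) y (\<lambda>x. signed_bubble \<beta> K x * r x))"
    proof (rule ball_cong[OF refl])
      fix y assume "y \<in> low"
      from 2[OF this] show "(ip (cell K) y (\<lambda>x. ?w x - v x) = 0) \<longleftrightarrow> ((LINT x|\<mu>. bubble K x * (y x * t x))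
        = ip (cell K) y v - ip (cell K) y (\<lambda>x. signed_bubble \<beta> K x * r x))" by linarith
    qed
    ultimately show ?thesis unfolding conds_def solves_def using wV r t by blast
  qed
  show ?thesis
  proof
    assume c: "conds v w"
    then obtain r t where rt: "w = (\<lambda>x. signed_bubble \<beta> K x * r x + bubble K x * t x)" "r \<in> perp" "t \<in> low"
      by (auto simp: conds_def VK_def)
    with c eq[OF rt(2,3)] show "\<exists>r t. solves v r t \<and> w = (\<lambda>x. signed_bubble \<beta> K x * r x + bubble K x * t x)" by blast
  next
    assume "\<exists>r t. solves v r t \<and> w = (\<lambda>x. signed_bubble \<beta> K x * r x + bubble K x * t x)"
    then obtain r t where rt: "solves v r t" "w = (\<lambda>x. signed_bubble \<beta> K x * r x + bubble K x * t x)" by blast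
    then have "r \<in> perp" "t \<in> low" by (auto simp: solves_def)
    from eq[OF this] rt show "conds v w" by simp
  qed
qed

lemma solves_unique:
  assumes 1: "solves v r t" and 2: "solves v r' t'" shows "r = r'" "t = t'"
proof -
  have S: "r \<in> perp" "r' \<in> perp" "t \<in> low" "t' \<in> low" using 1 2 by (auto simp: solves_def)
  let ?d = "\<lambda>x. r x + (-1) * r' x"
  have d: "?d \<in> perp" by (rule fsub_comb[OF fsub_polys_perp[OF nd] S(1,2)])
  have "form ?d ?d = form r ?d + (-1) * form r' ?d" by (rule spd_comb[OF form_spd S(1,2) d])
  also have "\<dots> = form ?d r + (-1) * form ?d r'"
    using spd_sym[OF form_spd S(1) d] spd_sym[OF form_spd S(2) d] by simp
  also have "\<dots> = 0" using 1 2 d by (simp add: solves_def)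
  finally have "?d = (\<lambda>x. 0)" by (rule spd_definite[OF form_spd d])
  then show rr: "r = r'" by (auto simp: fun_eq_iff)
  let ?G = "\<lambda>z y. LINT x|\<mu>. bubble K x * (z x * y x)"
  note G = spd_subset[OF bubble_form low_pol(1)]
  let ?e = "\<lambda>x. t x + (-1) * t' x"
  have e: "?e \<in> low" by (rule fsub_comb[OF low_pol(2) S(3,4)])
  have "?G ?e ?e = ?G t ?e + (-1) * ?G t' ?e" by (rule spd_comb[OF G S(3,4) e])
  also have "\<dots> = ?G ?e t + (-1) * ?G ?e t'"
    using spd_sym[OF G S(3) e] spd_sym[OF G S(4) e] by simp
  also have "\<dots> = 0"
  proof -
    have A: "?G y t = ip (cell K) y v - ip (cell K) y (\<lambda>x. signed_bubble \<beta> K x * r x)" if "y \<in> low" for y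
      using 1 that unfolding solves_def by blast
    have B: "?G y t' = ip (cell K) y v - ip (cell K) y (\<lambda>x. signed_bubble \<beta> K x * r' x)" if "y \<in> low" for y
      using 2 that unfolding solves_def by blast
    show ?thesis unfolding A[OF e] B[OF e] rr by simp
  qed
  finally have "?e = (\<lambda>x. 0)" by (rule spd_definite[OF G e])
  then show "t = t'" by (auto simp: fun_eq_iff)
qed

lemma PiK_solves:
  assumes v: "v \<in> W1 \<beta> K"
  shows "\<exists>r t. solves v r t \<and> PiK \<beta> k K v = (\<lambda>x. signed_bubble \<beta> K x * r x + bubble K x * t x)"
    and "conds v (PiK \<beta> k K v)"
proof -
  obtain r t where rt: "solves v r t" using solves_exists[OF v] by blast
  let ?w = "\<lambda>x. signed_bubble \<beta> K x * r x + bubble K x * t x"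
  have "PiK \<beta> k K v = (THE w. conds v w)" by (simp add: PiK_def conds_def)
  also have "\<dots> = ?w"
  proof (rule the_equality)
    show "conds v ?w" using conds_iff_solves[OF v] rt by blast
    fix w assume "conds v w"
    then obtain r' t' where "solves v r' t'" "w = (\<lambda>x. signed_bubble \<beta> K x * r' x + bubble K x * t' x)"
      using conds_iff_solves[OF v] by blast
    with solves_unique[OF rt] show "w = ?w" by simp
  qed
  finally have eq: "PiK \<beta> k K v = ?w" .
  with rt show "\<exists>r t. solves v r t \<and> PiK \<beta> k K v = (\<lambda>x. signed_bubble \<beta> K x * r x + bubble K x * t x)" by blast
  show "conds v (PiK \<beta> k K v)" unfolding eq using conds_iff_solves[OF v] rt by blast
qed

text \<open>r is the L2 projection of z onto the polynomials vanishing on the boundary. The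
  splitting extends orthogonality from \<open>perp\<close> to all polynomials of degree k.\<close>

lemma perp_decomposition:
  assumes z: "pol k z"
  shows "\<exists>y\<in>perp. \<exists>r. pol k r \<and> (\<forall>x\<in>frontier (elem K). r x = 0) \<and> z = (\<lambda>x. y x + r x)"
proof -
  let ?R = "polys_ring K (int k)"
  have R: "?R \<subseteq> Collect (pol k)" by (auto simp: polys_ring_def polys_eq_pol)
  have fR: "fsub ?R" by (auto simp: fsub_def polys_ring_def polys_eq_pol intro: pol_const pol_add pol_cmult)
  have rp: "r \<in> ?R \<Longrightarrow> pol k r" for r using R by auto
  have "\<exists>r\<in>?R. \<forall>y\<in>?R. ip (cell K) y r = ip (cell K) y z"
    by (rule pol_riesz[OF R fR spd_subset[OF spd_L2[OF nd] R]]) (intro ip_comb_left[where m=k] rp pol_integrable[OF nd z])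
  then obtain r where r: "r \<in> ?R" "\<And>y. y \<in> ?R \<Longrightarrow> ip (cell K) y r = ip (cell K) y z" by blast
  have "ip (cell K) (\<lambda>x. z x + (-1) * r x) y = 0" if y: "y \<in> ?R" for y
  proof -
    have "ip (cell K) (\<lambda>x. z x + (-1) * r x) y = ip (cell K) z y + (-1) * ip (cell K) r y"
      by (rule ip_comb_left[OF z rp[OF r(1)] pol_integrable[OF nd rp[OF y]]])
    then show ?thesis using r(2)[OF y] by (simp add: ip_def mult.commute)
  qed
  moreover have "pol k (\<lambda>x. z x + (-1) * r x)" using z rp[OF r(1)] by (intro pol_add pol_cmult)
  ultimately have "(\<lambda>x. z x + (-1) * r x) \<in> perp" by (simp add: polys_perp_def polys_eq_pol)
  then show ?thesis using r(1) rp[OF r(1)]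
    by (intro bexI[of _ "\<lambda>x. z x + (-1) * r x"] exI[of _ r]) (auto simp: polys_ring_def)
qed

lemma bubble_integral_pos: "ip (cell K) (bubble K) (\<lambda>_. 1) > 0"
proof -
  have p: "pol 0 (\<lambda>_::real^'n. 1)" by (rule pol_const)
  have "(LINT x|\<mu>. bubble K x * (1 * 1)) \<noteq> 0"
  proof
    assume "(LINT x|\<mu>. bubble K x * (1 * 1)) = 0"
    then have "(\<lambda>_::real^'n. 1::real) = (\<lambda>x. 0)" using spd_definite[OF bubble_form[of 0], of "\<lambda>_. 1"] p by simp
    then show False by (simp add: fun_eq_iff)
  qed
  moreover have "0 \<le> (LINT x|\<mu>. bubble K x * (1 * 1))" using spd_pos[OF bubble_form[of 0], of "\<lambda>_. 1"] p by simp
  ultimately show ?thesis by (simp add: ip_def)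
qed

lemma shift_W1:
  assumes v: "v \<in> W1 \<beta> K"
  shows "(\<lambda>x. v x - a) \<in> W1 \<beta> K" "AE x in \<mu>. bg (\<lambda>x. v x - a) x = bg v x"
proof -
  have "pol 0 (\<lambda>x::real^'n. 1)" by (rule pol_const)
  note P = bgrad_pol[OF this]
  note C = bgrad_comb[OF v P(1), of "- a"]
  show "(\<lambda>x. v x - a) \<in> W1 \<beta> K" using C(1) by simp
  show "AE x in \<mu>. bg (\<lambda>x. v x - a) x = bg v x" using C(2) P(2) by eventually_elim simp
qed

definition corr :: "'n scalar \<Rightarrow> real" where
  "corr v = ip (cell K) (\<lambda>y. v y - PiKp \<beta> k K v y) (\<lambda>_. 1) / ip (cell K) (bubble K) (\<lambda>_. 1)"

lemma PiKpp_eq: "PiKpp \<beta> k K v = (\<lambda>x. mean K v + PiK \<beta> k K (\<lambda>y. v y - mean K v) x + corr v * bubble K x)"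
  by (simp add: PiKpp_def corr_def PiKp_def)

lemma PiKpp_pol:
  assumes v: "v \<in> W1 \<beta> K"
  shows "pol (CARD('n) + 1 + k) (PiKpp \<beta> k K v)" "pol (CARD('n) + 1 + k) (PiKp \<beta> k K v)"
proof -
  have "pol (CARD('n) + 1 + k) (PiK \<beta> k K (\<lambda>y. v y - mean K v))"
    using PiK_solves(2)[OF shift_W1(1)[OF v]] VK_pol by (simp add: conds_def)
  moreover have "pol (CARD('n) + 1 + k) (bubble K)" by (rule pol_mono[OF _ bubble_pol[OF nd]]) simp
  ultimately show "pol (CARD('n) + 1 + k) (PiKpp \<beta> k K v)" "pol (CARD('n) + 1 + k) (PiKp \<beta> k K v)"
    unfolding PiKpp_eq PiKp_def by (auto intro!: pol_add pol_const pol_cmult)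
qed

lemma PiKpp_VKpp:
  assumes v: "v \<in> W1 \<beta> K" shows "PiKpp \<beta> k K v \<in> VKpp \<beta> k K"
proof -
  have "PiK \<beta> k K (\<lambda>y. v y - mean K v) \<in> VK \<beta> k K"
    using PiK_solves(2)[OF shift_W1(1)[OF v]] by (simp add: conds_def)
  moreover have "(\<lambda>_::real^'n. mean K v) \<in> polys 0"
    using polys_eq_pol[of 0, where 'n='n] by (simp add: pol_const)
  moreover have "PiKpp \<beta> k K v = (\<lambda>x. PiK \<beta> k K (\<lambda>y. v y - mean K v) x + mean K v + corr v * bubble K x)"
    by (auto simp: PiKpp_eq)
  ultimately show ?thesis unfolding VKpp_def mem_Collect_eq
    by (intro exI[of _ "PiK \<beta> k K (\<lambda>y. v y - mean K v)"] exI[of _ "\<lambda>_. mean K v"] exI[of _ "corr v"] conjI)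
qed

lemma PiKp_orthogonal:
  assumes v: "v \<in> W1 \<beta> K" and z: "z \<in> low"
  shows "ip (cell K) z (\<lambda>x. PiKp \<beta> k K v x - v x) = 0"
proof -
  have "(\<lambda>x. PiKp \<beta> k K v x - v x) = (\<lambda>x. PiK \<beta> k K (\<lambda>y. v y - mean K v) x - (v x - mean K v))"
    by (auto simp: PiKp_def)
  then show ?thesis using PiK_solves(2)[OF shift_W1(1)[OF v]] z by (simp add: conds_def)
qed

text \<open>For k \<ge> 2 the constants are among the moments already preserved, so the bubble
  correction is zero. For k = 1 there are no such moments, and the correction is chosen to restore
  the mean value.\<close>

lemma PiKpp_orthogonal:
  assumes v: "v \<in> W1 \<beta> K" and z: "z \<in> polys (max (int k - 2) 0)"
  shows "ip (cell K) z (\<lambda>x. PiKpp \<beta> k K v x - v x) = 0"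
proof -
  let ?P = "PiKp \<beta> k K v"
  have PP: "PiKpp \<beta> k K v = (\<lambda>x. ?P x + corr v * bubble K x)" by (simp add: PiKpp_def corr_def)
  have vi: "integrable \<mu> v" by (rule W1_bgrad(1)[OF v])
  have Pi: "integrable \<mu> ?P" by (rule pol_integrable[OF nd PiKpp_pol(2)[OF v]])
  have bi: "integrable \<mu> (bubble K)" by (rule pol_integrable[OF nd bubble_pol[OF nd]])
  show ?thesis
  proof (cases "k \<ge> 2")
    case True
    then have m: "max (int k - 2) 0 = int k - 2" by simp
    have "pol 0 (\<lambda>_::real^'n. 1)" by (rule pol_const)
    then have 1: "(\<lambda>_. 1) \<in> low" using True polys_eq_pol[of "k - 2", where 'n='n] pol_mono[of 0 "k - 2"] by (simp add: of_nat_diff)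
    from PiKp_orthogonal[OF v this] have "(LINT x|\<mu>. ?P x - v x) = 0" by (simp add: ip_def)
    then have "(LINT x|\<mu>. v x - ?P x) = 0" using vi Pi by simp
    then have "corr v = 0" by (simp add: corr_def ip_def)
    then show ?thesis using PiKp_orthogonal[OF v] z m by (simp add: PP)
  next
    case False
    then have "z \<in> polys 0" using z k by simp
    then have "pol 0 z" using polys_eq_pol[of 0, where 'n='n] by simp
    then obtain a where a: "z = (\<lambda>_. a)" using pol_0_const by blast
    have "(LINT x|\<mu>. PiKpp \<beta> k K v x - v x) = (LINT x|\<mu>. corr v * bubble K x - (v x - ?P x))"
      by (simp add: PP algebra_simps)
    also have "\<dots> = corr v * (LINT x|\<mu>. bubble K x) - (LINT x|\<mu>. v x - ?P x)"
      using vi Pi bi by simp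
    also have "\<dots> = 0" using bubble_integral_pos by (simp add: corr_def ip_def)
    finally show ?thesis by (simp add: a ip_def)
  qed
qed

text \<open>Subtracting the mean from v and adding it back leaves the difference to v unchanged, and
  the correction by a bubble is invisible to \<open>DK\<close>. The part of z that vanishes on the
  boundary contributes nothing by integration by parts; the part in \<open>perp\<close> is covered
  by the definition of the projection.\<close>

lemma PiKpp_DK:
  assumes v: "v \<in> W1 \<beta> K" and z: "pol k z"
  shows "DK \<beta> K z (\<lambda>x. PiKpp \<beta> k K v x - v x) = 0"
proof -
  obtain y r where yr: "y \<in> perp" "pol k r" "\<And>x. x \<in> frontier (elem K) \<Longrightarrow> r x = 0" "z = (\<lambda>x. y x + r x)"
    using perp_decomposition[OF z] by blast
  have yp: "pol k y" using yr(1) polys_perp_pol[OF nd] by auto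
  let ?w = "PiK \<beta> k K (\<lambda>y. v y - mean K v)"
  let ?e = "\<lambda>x. ?w x - (v x - mean K v)"
  have wp: "pol (CARD('n) + 1 + k) ?w"
    using PiK_solves(2)[OF shift_W1(1)[OF v]] VK_pol by (simp add: conds_def)
  have eW: "?e \<in> W1 \<beta> K"
  proof -
    have "(\<lambda>x. ?w x + (-1) * (v x - mean K v)) \<in> W1 \<beta> K"
      by (rule bgrad_comb(1)[OF bgrad_pol(1)[OF wp] shift_W1(1)[OF v]])
    moreover have "(\<lambda>x. ?w x + (-1) * (v x - mean K v)) = ?e" by auto
    ultimately show ?thesis by (simp only:)
  qed
  have bW: "bubble K \<in> W1 \<beta> K" by (rule bgrad_pol(1)[OF bubble_pol[OF nd]])
  have eq: "(\<lambda>x. PiKpp \<beta> k K v x - v x) = (\<lambda>x. ?e x + corr v * bubble K x)"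
    by (auto simp: PiKpp_eq)
  have dW: "(\<lambda>x. ?e x + corr v * bubble K x) \<in> W1 \<beta> K" by (rule bgrad_comb(1)[OF eW bW])
  have "DK \<beta> K y ?e = 0" using PiK_solves(2)[OF shift_W1(1)[OF v]] yr(1) by (simp add: conds_def)
  moreover have "DK \<beta> K y (bubble K) = 0"
    by (rule DK_boundary_zero_right[OF yp bubble_pol[OF nd] bubble_zero[OF nd]])
  ultimately have "DK \<beta> K y (\<lambda>x. ?e x + corr v * bubble K x) = 0" by (simp add: DK_comb_right[OF yp eW bW])
  moreover have "DK \<beta> K r (\<lambda>x. ?e x + corr v * bubble K x) = 0" by (rule DK_boundary_zero[OF yr(2,3) dW])
  moreover have "DK \<beta> K (\<lambda>x. y x + 1 * r x) (\<lambda>x. ?e x + corr v * bubble K x)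
     = DK \<beta> K y (\<lambda>x. ?e x + corr v * bubble K x) + 1 * DK \<beta> K r (\<lambda>x. ?e x + corr v * bubble K x)"
    by (rule DK_comb_left[OF yp yr(2) dW])
  ultimately show ?thesis unfolding eq yr(4) by simp
qed

lemma PiKpp_diff_W1:
  assumes v: "v \<in> W1 \<beta> K" shows "(\<lambda>x. PiKpp \<beta> k K v x - v x) \<in> W1 \<beta> K"
  using bgrad_comb(1)[OF bgrad_pol(1)[OF PiKpp_pol(1)[OF v]] v, of "-1"] by simp

text \<open>The pairing of w with the derivative is \<open>DK\<close> minus the pairing of the
  derivative of w with the function itself. That derivative has degree at most k - 2, or is constant
  for k = 1, and such moments are preserved.\<close>

lemma PiKpp_gradient_orthogonal:
  assumes v: "v \<in> W1 \<beta> K" and w: "pol (k - 1) w"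
  shows "ip (cell K) w (bg (\<lambda>x. PiKpp \<beta> k K v x - v x)) = 0"
proof -
  have wk: "pol k w" by (rule pol_mono[OF _ w]) simp
  have "pol (nat (max (int k - 2) 0)) (dd c w)"
    by (rule pol_mono[OF _ pol_dd[OF w]]) simp
  then have "dd c w \<in> polys (max (int k - 2) 0)" using polys_eq_pol[of "nat (max (int k - 2) 0)", where 'n='n] by simp
  from PiKpp_orthogonal[OF v this] PiKpp_DK[OF v wk] DK_pol_W1[OF wk PiKpp_diff_W1[OF v]]
  show ?thesis by simp
qed

end

section \<open>Uniform bounds by scaling to the reference simplex\<close>

abbreviation ref_vol :: "'n::finite itself \<Rightarrow> real" where
  "ref_vol _ \<equiv> measure lebesgue (cell (ref_simplex :: 'n vsimplex))"

lemma simplex_fieldI: "nondegenerate K \<Longrightarrow> simplex_field K (\<lambda>_. c) c"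
  by unfold_locales auto

context
  fixes K :: "'n::finite vsimplex"
  assumes nd: "nondegenerate K"
begin

text \<open>The integrand 1 on the cell identifies the Jacobian as a ratio of volumes. Multiplied
  out with both volumes, the identity no longer mentions it.\<close>

lemma pullback_integral:
  assumes f: "continuous_on UNIV f"
  shows "(LINT x|lebesgue_on (cell K). f x) * ref_vol TYPE('n)
    = measure lebesgue (cell K) * (LINT x|lebesgue_on (cell ref_simplex). f (Phi K x) :: real)"
proof -
  note nr = nondegenerate_ref_simplex[where 'n='n]
  obtain J where J: "J > 0" "\<And>f. f \<in> borel_measurable borel \<Longrightarrow> (LINT x|lborel. f x) = J * (LINT x|lborel. f (Phi K x) :: real)"
    using integral_affine_image[OF nd] by blast
  have cont: "continuous_on UNIV (Phi K)"
    unfolding Phi_def by (intro continuous_intros matrix_vector_mult_linear_continuous_on)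
  have *: "(LINT x|lebesgue_on (cell K). f x) = J * (LINT x|lebesgue_on (cell ref_simplex). f (Phi K x))"
    if f: "continuous_on UNIV f" for f :: "'n scalar"
  proof -
    have [measurable]: "f \<in> borel_measurable borel" using f by (rule borel_measurable_continuous_onI)
    have c: "continuous_on UNIV (\<lambda>x. f (Phi K x))"
      using continuous_on_compose2[OF f cont] by simp
    have [measurable]: "(\<lambda>x. f (Phi K x)) \<in> borel_measurable borel" using c by (rule borel_measurable_continuous_onI)
    have [measurable]: "cell K \<in> sets borel" "cell (ref_simplex :: 'n vsimplex) \<in> sets borel" by auto
    have "(LINT x|lebesgue_on (cell K). f x) = (LINT x|lborel. indicator (cell K) x * f x)"
      by (subst LINT_lebesgue_on) (auto simp: integral_completion)
    also have "\<dots> = J * (LINT x|lborel. indicator (cell K) (Phi K x) * f (Phi K x))" by (rule J(2)) measurable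
    also have "(\<lambda>x. indicator (cell K) (Phi K x) * f (Phi K x)) = (\<lambda>x. indicator (cell ref_simplex) x * f (Phi K x))"
      using Phi_mem(2)[OF nd] by (auto simp: indicator_def)
    also have "(LINT x|lborel. indicator (cell ref_simplex) x * f (Phi K x)) = (LINT x|lebesgue_on (cell ref_simplex). f (Phi K x))"
      by (subst LINT_lebesgue_on) (auto simp: integral_completion)
    finally show ?thesis .
  qed
  have "measure lebesgue (cell K) = J * ref_vol TYPE('n)"
    using *[of "\<lambda>_. 1"] simplex_field.integral_const_cell[OF simplex_fieldI[OF nd], of 1]
      simplex_field.integral_const_cell[OF simplex_fieldI[OF nr], of 1] by simp
  then show ?thesis using *[OF f] by simp
qed

lemma facet_bubble_Phi: "facet_bubble K i (Phi K x) = facet_bubble ref_simplex i x"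
  and bubble_Phi: "bubble K (Phi K x) = bubble ref_simplex x"
  by (simp_all add: facet_bubble_def bubble_def bary_Phi[OF nd])

text \<open>Composition with \<open>Phi K\<close> multiplies L2 products by a constant and matches
  the polynomials vanishing on the two boundaries, so orthogonality is preserved.\<close>

lemma perp_Phi:
  assumes z: "z \<in> polys_perp K (int k)" shows "(\<lambda>x. z (Phi K x)) \<in> polys_perp ref_simplex (int k)"
proof -
  have zp: "pol k z" using z polys_perp_pol[OF nd] by auto
  have "ip (cell ref_simplex) (\<lambda>x. z (Phi K x)) r = 0" if r: "r \<in> polys_ring ref_simplex (int k)" for r
  proof -
    define s where "s = (\<lambda>x. r (matrix_inv (ref_matrix K) *v (x - K None)))"
    have rp: "pol k r" using r by (simp add: polys_ring_def polys_eq_pol)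
    have sp: "pol k s" unfolding s_def by (rule pol_Phi_inverse[OF rp])
    have sPhi: "s (Phi K x) = r x" for x by (simp add: s_def Phi_def ref_matrix_inv[OF nd])
    have "s x = 0" if "x \<in> frontier (elem K)" for x
    proof -
      let ?y = "matrix_inv (ref_matrix K) *v (x - K None)"
      have "?y \<in> frontier (elem ref_simplex)" using that Phi_mem(4)[OF nd, of ?y] Phi_surj[OF nd, of x] by simp
      then show ?thesis using r by (simp add: s_def polys_ring_def)
    qed
    then have "s \<in> polys_ring K (int k)" using sp by (simp add: polys_ring_def polys_eq_pol)
    then have "ip (cell K) z s = 0" using z by (simp add: polys_perp_def)
    moreover have "measure lebesgue (cell K) > 0"
      by (rule simplex_field.vol_pos[OF simplex_fieldI[OF nd]])
    ultimately show ?thesis using pullback_integral[OF pol_continuous[OF pol_mult[OF zp sp]]]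
      by (simp add: ip_def sPhi)
  qed
  then show ?thesis using pol_Phi[OF zp, of K] by (simp add: polys_perp_def polys_eq_pol)
qed

text \<open>The auxiliary index in \<open>flux\<close> depends on i alone, so the matrix maps the
  edge direction used on the reference simplex to the one used on K.\<close>

lemma flux_Phi:
  assumes g: "pol m g"
  shows "flux K i g * ref_vol TYPE('n) = measure lebesgue (cell K) * flux ref_simplex i (\<lambda>x. g (Phi K x))"
proof -
  define j where "j = (SOME j. j \<noteq> i)"
  define G where "G = (\<lambda>x. facet_bubble K i x * g x)"
  have G: "pol (CARD('n) + m) G" unfolding G_def by (rule pol_mult[OF facet_bubble_pol[OF nd] g])
  have M: "ref_matrix K *v (ref_simplex i - ref_simplex j) = K i - K j"
  proof -
    have "ref_matrix K *v ref_simplex i = K i - K None" for i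
      using Phi_vertex[of K i] by (simp add: Phi_def eq_diff_eq)
    then show ?thesis by (simp add: matrix_vector_mult_diff_distrib)
  qed
  have eq: "dd (ref_simplex i - ref_simplex j) (\<lambda>x. facet_bubble ref_simplex i x * g (Phi K x)) = (\<lambda>x. dd (K i - K j) G (Phi K x))"
  proof
    fix x
    have "dd (ref_simplex i - ref_simplex j) (\<lambda>x. G (Phi K x)) x = dd (K i - K j) G (Phi K x)"
      using dd_Phi[OF pol_differentiable[OF G], of "ref_simplex i - ref_simplex j" K x] M by simp
    then show "dd (ref_simplex i - ref_simplex j) (\<lambda>x. facet_bubble ref_simplex i x * g (Phi K x)) x = dd (K i - K j) G (Phi K x)"
      by (simp add: G_def facet_bubble_Phi)
  qed
  have "flux K i g * ref_vol TYPE('n) = - ((LINT x|lebesgue_on (cell K). dd (K i - K j) G x) * ref_vol TYPE('n))"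
    by (simp add: flux_def j_def G_def)
  also have "\<dots> = - (measure lebesgue (cell K) * (LINT x|lebesgue_on (cell ref_simplex). dd (K i - K j) G (Phi K x)))"
    by (simp only: pullback_integral[OF pol_continuous[OF pol_dd[OF G]]])
  also have "\<dots> = measure lebesgue (cell K) * flux ref_simplex i (\<lambda>x. g (Phi K x))"
    by (simp add: flux_def j_def[symmetric] eq)
  finally show ?thesis .
qed

end

section \<open>Lower bounds for the forms on the reference simplex\<close>

text \<open>The set J varies with the element and the field, so the constant must not depend on it;
  there are finitely many sets of facets, and the smallest of their constants serves all.\<close>

lemma ref_flux_bound:
  assumes k: "k \<ge> 1"
  shows "\<exists>c>0. \<forall>J. (J = UNIV \<or> k = 1 \<and> (\<exists>i\<in>J. \<exists>j\<in>J. i \<noteq> j)) \<longrightarrow>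
    (\<forall>z\<in>polys_perp (ref_simplex :: 'n::finite vsimplex) (int k). \<forall>x\<in>elem ref_simplex.
      c * (z x)\<^sup>2 \<le> (\<Sum>i\<in>J. flux ref_simplex i (\<lambda>x. z x * z x)))"
proof -
  let ?R = "ref_simplex :: 'n vsimplex"
  note nr = nondegenerate_ref_simplex[where 'n='n]
  have "\<exists>c>0. (J = UNIV \<or> k = 1 \<and> (\<exists>i\<in>J. \<exists>j\<in>J. i \<noteq> j)) \<longrightarrow>
    (\<forall>z\<in>polys_perp ?R (int k). \<forall>x\<in>elem ?R. c * (z x)\<^sup>2 \<le> (\<Sum>i\<in>J. flux ?R i (\<lambda>x. z x * z x)))" for J
  proof (cases "J = UNIV \<or> k = 1 \<and> (\<exists>i\<in>J. \<exists>j\<in>J. i \<noteq> j)")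
    case True
    let ?w = "\<lambda>i. if i \<in> J then 1 else (0::real)"
    have "spd (polys_perp ?R (int k)) (\<lambda>z y. \<Sum>i\<in>UNIV. ?w i * flux ?R i (\<lambda>x. z x * y x))"
    proof (rule spd_flux[OF nr polys_perp_pol[OF nr]])
      fix z assume z: "z \<in> polys_perp ?R (int k)"
        and 0: "\<And>i x. 0 < (if i \<in> J then 1 else (0::real)) \<Longrightarrow> x \<in> facet ?R i \<Longrightarrow> z x = 0"
      show "z = (\<lambda>x. 0)" by (rule polys_perp_determined[OF nr z True]) (use 0 in auto)
    qed auto
    from pointwise_bound[OF nr polys_perp_pol[OF nr] fsub_polys_perp[OF nr] this]
    have "\<exists>c>0. \<forall>z\<in>polys_perp ?R (int k). \<forall>x\<in>elem ?R. c * (z x)\<^sup>2 \<le> (\<Sum>i\<in>UNIV. ?w i * flux ?R i (\<lambda>x. z x * z x))" .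
    moreover have "(\<Sum>i\<in>UNIV. ?w i * flux ?R i g) = (\<Sum>i\<in>J. flux ?R i g)" for g
      by (simp add: if_distrib[of "\<lambda>t. t * _"] sum.If_cases cong: if_cong)
    ultimately have "\<exists>c>0. \<forall>z\<in>polys_perp ?R (int k). \<forall>x\<in>elem ?R. c * (z x)\<^sup>2 \<le> (\<Sum>i\<in>J. flux ?R i (\<lambda>x. z x * z x))"
      by (simp only:)
    then show ?thesis by - (erule exE, rule exI, erule conjE, rule conjI, assumption, rule impI, assumption)
  qed (auto intro: exI[of _ 1])
  then have "\<forall>J. \<exists>c. c > 0 \<and> ((J = UNIV \<or> k = 1 \<and> (\<exists>i\<in>J. \<exists>j\<in>J. i \<noteq> j)) \<longrightarrow>
    (\<forall>z\<in>polys_perp ?R (int k). \<forall>x\<in>elem ?R. c * (z x)\<^sup>2 \<le> (\<Sum>i\<in>J. flux ?R i (\<lambda>x. z x * z x))))" by (rule allI)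
  from choice[OF this] obtain c where c: "\<forall>J. c J > 0 \<and> ((J = UNIV \<or> k = 1 \<and> (\<exists>i\<in>J. \<exists>j\<in>J. i \<noteq> j)) \<longrightarrow>
    (\<forall>z\<in>polys_perp ?R (int k). \<forall>x\<in>elem ?R. c J * (z x)\<^sup>2 \<le> (\<Sum>i\<in>J. flux ?R i (\<lambda>x. z x * z x))))" ..
  let ?c = "Min (range c)"
  have "?c > 0" using c by (subst Min_gr_iff) auto
  moreover have "?c * (z x)\<^sup>2 \<le> (\<Sum>i\<in>J. flux ?R i (\<lambda>x. z x * z x))"
    if h: "J = UNIV \<or> k = 1 \<and> (\<exists>i\<in>J. \<exists>j\<in>J. i \<noteq> j)" "z \<in> polys_perp ?R (int k)" "x \<in> elem ?R" for J z x
  proof -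
    have "?c \<le> c J" by (rule Min_le) auto
    then have "?c * (z x)\<^sup>2 \<le> c J * (z x)\<^sup>2" by (rule mult_right_mono) simp
    also have "\<dots> \<le> (\<Sum>i\<in>J. flux ?R i (\<lambda>x. z x * z x))"
      by (rule c[THEN spec, THEN conjunct2, THEN mp, OF h(1), THEN bspec, OF h(2), THEN bspec, OF h(3)])
    finally show ?thesis .
  qed
  ultimately show ?thesis by (intro exI[of _ ?c] conjI allI impI ballI)
qed

lemma ref_bubble_bound:
  "\<exists>c>0. \<forall>t. pol m t \<longrightarrow> (\<forall>x\<in>elem (ref_simplex :: 'n::finite vsimplex).
      c * (t x)\<^sup>2 \<le> (LINT x|lebesgue_on (cell ref_simplex). bubble ref_simplex x * (t x * t x)))"
proof -
  note nr = nondegenerate_ref_simplex[where 'n='n]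
  have "spd (Collect (pol m)) (\<lambda>z y. LINT x|lebesgue_on (cell (ref_simplex :: 'n vsimplex)). bubble ref_simplex x * (z x * y x))"
    by (rule spd_weighted[OF nr bubble_pol[OF nr] bubble_pos[OF nr]])
  from pointwise_bound[OF nr order_refl fsub_pol[OF nr] this] show ?thesis by auto
qed

lemma sup_attained:
  assumes "nondegenerate K" "pol m z"
  shows "\<exists>x0\<in>elem K. \<forall>x\<in>elem K. \<bar>z x\<bar> \<le> \<bar>z x0\<bar>"
proof -
  have "elem K \<noteq> {}" using cell_nonempty[OF assms(1)] interior_subset by blast
  then show ?thesis
    by (intro continuous_attains_sup elem_compact[OF assms(1)] continuous_on_rabs pol_continuous[OF assms(2)])
qed

section \<open>Explicit constants on a single element\<close>

text \<open>Maximum norm bounds for r, t, the basic projection and the corrected one, in units of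
  \<open>size1 v / vol\<close>. Here rv is the reference volume, l the constant of the inverse
  inequality, \<theta> the flow threshold, c0 and cb the lower constants of the facet and bubble
  forms, and n bounds the signed bubble.\<close>

definition "bound1 rv l \<theta> c0 = rv * (l + 1) / (\<theta> * c0 :: real)"
definition "bound2 n rv l \<theta> c0 cb = rv * (1 + n * bound1 rv l \<theta> c0) / (cb :: real)"
definition "bound3 n rv l \<theta> c0 cb = n * bound1 rv l \<theta> c0 + bound2 n rv l \<theta> c0 cb"
definition "bound4 n rv l \<theta> c0 cb = 1 + 2 * bound3 n rv l \<theta> c0 cb + (2 + 2 * bound3 n rv l \<theta> c0 cb) * rv / cb"

lemma bound_nonneg:
  assumes "n \<ge> 0" "rv > 0" "c0 > 0" "cb > 0" "l \<ge> 0" "\<theta> > 0"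
  shows "bound1 rv l \<theta> c0 \<ge> 0" "bound2 n rv l \<theta> c0 cb \<ge> 0" "bound3 n rv l \<theta> c0 cb \<ge> 0"
    "bound4 n rv l \<theta> c0 cb \<ge> 0"
proof -
  show a1: "bound1 rv l \<theta> c0 \<ge> 0" unfolding bound1_def using assms by simp
  show a2: "bound2 n rv l \<theta> c0 cb \<ge> 0" unfolding bound2_def using assms a1 by simp
  show a3: "bound3 n rv l \<theta> c0 cb \<ge> 0" unfolding bound3_def using assms a1 a2 by simp
  show "bound4 n rv l \<theta> c0 cb \<ge> 0" unfolding bound4_def using assms a3 by simp
qed

lemma quadratic_le: "c * M\<^sup>2 \<le> M * B \<Longrightarrow> c > 0 \<Longrightarrow> M \<ge> 0 \<Longrightarrow> B \<ge> 0 \<Longrightarrow> M \<le> B / (c::real)"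
  by (cases "M = 0") (simp_all add: power2_eq_square field_simps)

context stable_simplex
begin

definition "hb = diameter (elem K) / norm c"
text \<open>The L1 analogue of the local norm of Y, multiplied by the element scale.\<close>

abbreviation "size1 v \<equiv> (LINT x|\<mu>. \<bar>v x\<bar>) + hb * (LINT x|\<mu>. \<bar>bg v x\<bar>)"

lemma c_nonzero: "c \<noteq> 0"
proof -
  have "J \<noteq> {}" using J by auto
  then show ?thesis using cJ by auto
qed

lemma hb_pos: "hb > 0"
  using diameter_elem_pos[OF nd] c_nonzero by (simp add: hb_def)

lemma size1_nonneg: "size1 v \<ge> 0"
  using hb_pos by (intro add_nonneg_nonneg mult_nonneg_nonneg Bochner_Integration.integral_nonneg) auto

text \<open>The assumptions \<open>flow\<close>, \<open>bub\<close> and \<open>inv\<close> are the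
  reference inequalities transported to K: an integral over K times the reference volume is the
  pulled-back integral times the volume of K, which accounts for the positions of \<open>vol\<close>
  and \<open>rv\<close>.\<close>

context
  fixes c0 cb l \<theta> rv :: real
  assumes rv: "rv > 0" and c0: "c0 > 0" and cb: "cb > 0" and l: "l \<ge> 0" and \<theta>: "\<theta> > 0"
    and \<theta>J: "\<And>i. i \<in> J \<Longrightarrow> \<theta> \<le> hb * \<bar>grd K i \<bullet> c\<bar>"
    and flow: "\<And>z x. z \<in> perp \<Longrightarrow> x \<in> elem K \<Longrightarrow> c0 * (z x)\<^sup>2 * vol \<le> rv * (\<Sum>i\<in>J. flux K i (\<lambda>x. z x * z x))"
    and bub: "\<And>t x. pol k t \<Longrightarrow> x \<in> elem K \<Longrightarrow> cb * (t x)\<^sup>2 * vol \<le> rv * (LINT x|\<mu>. bubble K x * (t x * t x))"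
    and inv: "\<And>z M x. pol (CARD('n) + 1 + k) z \<Longrightarrow> M \<ge> 0 \<Longrightarrow> (\<And>x. x \<in> elem K \<Longrightarrow> \<bar>z x\<bar> \<le> M) \<Longrightarrow> x \<in> elem K
      \<Longrightarrow> hb * \<bar>dd c z x\<bar> \<le> l * M"
begin

lemma A_nonneg: "(bound1 rv l \<theta> c0) \<ge> 0" "(bound2 (real (CARD('n) + 1)) rv l \<theta> c0 cb) \<ge> 0" "(bound3 (real (CARD('n) + 1)) rv l \<theta> c0 cb) \<ge> 0" "(bound4 (real (CARD('n) + 1)) rv l \<theta> c0 cb) \<ge> 0"
  by (rule bound_nonneg[where n="real (CARD('n) + 1)", OF of_nat_0_le_iff rv c0 cb l \<theta>])+

text \<open>The equation for r is tested with r itself. If M is its maximum, the form bounds M^2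
  from above while the right-hand side is linear in M by the inverse inequality; dividing by M gives
  the bound. The same argument for t uses the bubble form and the bound for r.\<close>

lemma solves_bound:
  assumes v: "v \<in> W1 \<beta> K" and s: "solves v r t" and x: "x \<in> elem K"
  shows "\<bar>r x\<bar> \<le> (bound1 rv l \<theta> c0) * (size1 v / vol)" "\<bar>t x\<bar> \<le> (bound2 (real (CARD('n) + 1)) rv l \<theta> c0 cb) * (size1 v / vol)"
proof -
  let ?X = "size1 v / vol"
  let ?N1 = "LINT x|\<mu>. \<bar>v x\<bar>" and ?N2 = "LINT x|\<mu>. \<bar>bg v x\<bar>"
  have N: "?N1 \<ge> 0" "?N2 \<ge> 0" by (auto intro: Bochner_Integration.integral_nonneg)
  have X: "?X \<ge> 0" using size1_nonneg vol_pos by simp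
  have rp: "r \<in> perp" and tp: "t \<in> low" using s by (auto simp: solves_def)
  have r: "pol k r" using rp polys_perp_pol[OF nd] by auto
  have t: "pol k t" using tp low_pol(1) pol_mono[of "k - 1" k t] by auto
  have r': "pol (CARD('n) + 1 + k) r" by (rule pol_mono[OF _ r]) simp
  obtain x0 where x0: "x0 \<in> elem K" "\<And>x. x \<in> elem K \<Longrightarrow> \<bar>r x\<bar> \<le> \<bar>r x0\<bar>" using sup_attained[OF nd r] by blast
  define M where "M = \<bar>r x0\<bar>"
  have M: "M \<ge> 0" by (simp add: M_def)
  have ddr: "\<bar>dd c r x\<bar> \<le> l * M / hb" if "x \<in> elem K" for x
    using inv[OF r' M _ that] x0(2) hb_pos by (simp add: M_def field_simps)
  have "\<bar>DK \<beta> K r v\<bar> \<le> (l * M / hb) * ?N1 + M * ?N2"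
    by (rule DK_bound[OF r v _ ddr]) (use x0(2) in \<open>simp add: M_def\<close>)
  then have "hb * \<bar>DK \<beta> K r v\<bar> \<le> hb * ((l * M / hb) * ?N1 + M * ?N2)"
    using hb_pos by (intro mult_left_mono) auto
  also have "\<dots> = M * (l * ?N1 + hb * ?N2)" using hb_pos by (simp add: field_simps)
  also have "\<dots> \<le> M * ((l + 1) * size1 v)"
  proof (rule mult_left_mono[OF _ M])
    have "0 \<le> l * (hb * ?N2)" using l N hb_pos by (intro mult_nonneg_nonneg) auto
    then show "l * ?N1 + hb * ?N2 \<le> (l + 1) * size1 v" using N by (simp add: algebra_simps)
  qed
  finally have D: "hb * \<bar>DK \<beta> K r v\<bar> \<le> M * ((l + 1) * size1 v)" .
  have fl: "0 \<le> flux K i (\<lambda>x. r x * r x)" for i by (rule flux_square(1)[OF nd r])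
  \<comment> \<open>On J the weights are at least \<theta>; the other facets may be added because
    their flux of a square is nonnegative.\<close>
  have "\<theta> * (\<Sum>i\<in>J. flux K i (\<lambda>x. r x * r x)) \<le> (\<Sum>i\<in>J. (hb * \<bar>grd K i \<bullet> c\<bar>) * flux K i (\<lambda>x. r x * r x))"
    unfolding sum_distrib_left by (intro sum_mono mult_right_mono \<theta>J fl)
  also have "\<dots> \<le> (\<Sum>i\<in>UNIV. (hb * \<bar>grd K i \<bullet> c\<bar>) * flux K i (\<lambda>x. r x * r x))"
    using hb_pos by (intro sum_mono2 mult_nonneg_nonneg fl) auto
  also have "\<dots> = hb * form r r" unfolding form_def sum_distrib_left by (simp add: mult.assoc)
  also have "form r r = DK \<beta> K r v" using s rp by (simp add: solves_def)
  finally have "\<theta> * (\<Sum>i\<in>J. flux K i (\<lambda>x. r x * r x)) \<le> hb * \<bar>DK \<beta> K r v\<bar>"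
    using hb_pos by (smt (verit) mult_left_mono)
  with D have F: "\<theta> * (\<Sum>i\<in>J. flux K i (\<lambda>x. r x * r x)) \<le> M * ((l + 1) * size1 v)" by linarith
  have "\<theta> * (c0 * M\<^sup>2 * vol) \<le> \<theta> * (rv * (\<Sum>i\<in>J. flux K i (\<lambda>x. r x * r x)))"
    using flow[OF rp x0(1)] \<theta> by (intro mult_left_mono) (auto simp: M_def)
  also have "\<dots> \<le> rv * (M * ((l + 1) * size1 v))" using mult_left_mono[OF F, of rv] rv by (simp add: mult.left_commute)
  finally have "(\<theta> * c0 * vol) * M\<^sup>2 \<le> M * (rv * ((l + 1) * size1 v))" by (simp add: mult_ac)
  then have "M \<le> (rv * ((l + 1) * size1 v)) / (\<theta> * c0 * vol)"
    by (rule quadratic_le) (use \<theta> c0 vol_pos M rv l size1_nonneg in auto)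
  also have "\<dots> = (bound1 rv l \<theta> c0) * ?X" by (simp add: bound1_def)
  finally have M1: "M \<le> (bound1 rv l \<theta> c0) * ?X" .
  then show "\<bar>r x\<bar> \<le> (bound1 rv l \<theta> c0) * ?X" using x0(2)[OF x] by (simp add: M_def)
  obtain y0 where y0: "y0 \<in> elem K" "\<And>x. x \<in> elem K \<Longrightarrow> \<bar>t x\<bar> \<le> \<bar>t y0\<bar>" using sup_attained[OF nd t] by blast
  define T where "T = \<bar>t y0\<bar>"
  have T: "T \<ge> 0" by (simp add: T_def)
  have Tb: "\<bar>t x\<bar> \<le> T" if "x \<in> elem K" for x using y0(2)[OF that] by (simp add: T_def)
  have sr: "pol (CARD('n) + k) (\<lambda>x. signed_bubble \<beta> K x * r x)" by (rule pol_mult[OF signed_bubble_pol r])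
  have i1: "\<bar>ip (cell K) t v\<bar> \<le> T * ?N1" by (rule ip_abs_bound[OF t W1_bgrad(1)[OF v] Tb])
  have "\<bar>ip (cell K) t (\<lambda>x. signed_bubble \<beta> K x * r x)\<bar> \<le> T * (LINT x|\<mu>. \<bar>signed_bubble \<beta> K x * r x\<bar>)"
    by (rule ip_abs_bound[OF t pol_integrable[OF nd sr] Tb])
  also have "\<dots> \<le> T * (LINT x|\<mu>. real (CARD('n) + 1) * ((bound1 rv l \<theta> c0) * ?X))"
  proof (intro mult_left_mono[OF _ T] integral_mono)
    show "integrable \<mu> (\<lambda>x. \<bar>signed_bubble \<beta> K x * r x\<bar>)" using pol_integrable[OF nd sr] by simp
    show "integrable \<mu> (\<lambda>x. real (CARD('n) + 1) * ((bound1 rv l \<theta> c0) * ?X))" by (rule cell_integrable_const[OF nd])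
    fix x assume "x \<in> space \<mu>"
    then have x: "x \<in> elem K" using interior_subset by auto
    have "\<bar>r x\<bar> \<le> (bound1 rv l \<theta> c0) * ?X" using x0(2)[OF x] M1 by (simp add: M_def)
    then show "\<bar>signed_bubble \<beta> K x * r x\<bar> \<le> real (CARD('n) + 1) * ((bound1 rv l \<theta> c0) * ?X)"
      unfolding abs_mult by (intro mult_mono signed_bubble_bound x) auto
  qed
  also have "(LINT x|\<mu>. real (CARD('n) + 1) * ((bound1 rv l \<theta> c0) * ?X)) = real (CARD('n) + 1) * (bound1 rv l \<theta> c0) * size1 v"
    unfolding integral_const_cell using vol_pos by simp
  finally have i2: "\<bar>ip (cell K) t (\<lambda>x. signed_bubble \<beta> K x * r x)\<bar> \<le> T * (real (CARD('n) + 1) * (bound1 rv l \<theta> c0) * size1 v)" .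
  have N1s: "?N1 \<le> size1 v" using N hb_pos by simp
  have "(LINT x|\<mu>. bubble K x * (t x * t x)) = ip (cell K) t v - ip (cell K) t (\<lambda>x. signed_bubble \<beta> K x * r x)"
    using s tp unfolding solves_def by blast
  also have "\<dots> \<le> T * ?N1 + T * (real (CARD('n) + 1) * (bound1 rv l \<theta> c0) * size1 v)" using i1 i2 by linarith
  also have "\<dots> \<le> T * size1 v + T * (real (CARD('n) + 1) * (bound1 rv l \<theta> c0) * size1 v)"
    using mult_left_mono[OF N1s T] by linarith
  also have "\<dots> = T * ((1 + real (CARD('n) + 1) * (bound1 rv l \<theta> c0)) * size1 v)" by (simp add: algebra_simps)
  finally have B: "(LINT x|\<mu>. bubble K x * (t x * t x)) \<le> T * ((1 + real (CARD('n) + 1) * (bound1 rv l \<theta> c0)) * size1 v)" .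
  have "cb * T\<^sup>2 * vol \<le> rv * (LINT x|\<mu>. bubble K x * (t x * t x))"
    using bub[OF t y0(1)] by (simp add: T_def)
  also have "\<dots> \<le> rv * (T * ((1 + real (CARD('n) + 1) * (bound1 rv l \<theta> c0)) * size1 v))"
    by (rule mult_left_mono[OF B]) (use rv in simp)
  finally have "(cb * vol) * T\<^sup>2 \<le> T * (rv * ((1 + real (CARD('n) + 1) * (bound1 rv l \<theta> c0)) * size1 v))" by (simp add: mult_ac)
  then have "T \<le> (rv * ((1 + real (CARD('n) + 1) * (bound1 rv l \<theta> c0)) * size1 v)) / (cb * vol)"
    by (rule quadratic_le) (use cb vol_pos T rv A_nonneg size1_nonneg in auto)
  also have "\<dots> = (bound2 (real (CARD('n) + 1)) rv l \<theta> c0 cb) * ?X" by (simp add: bound2_def)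
  finally show "\<bar>t x\<bar> \<le> (bound2 (real (CARD('n) + 1)) rv l \<theta> c0 cb) * ?X" using Tb[OF x] by linarith
qed

lemma PiK_bound:
  assumes v: "v \<in> W1 \<beta> K" and x: "x \<in> elem K"
  shows "\<bar>PiK \<beta> k K v x\<bar> \<le> (bound3 (real (CARD('n) + 1)) rv l \<theta> c0 cb) * (size1 v / vol)"
proof -
  obtain r t where rt: "solves v r t" "PiK \<beta> k K v = (\<lambda>x. signed_bubble \<beta> K x * r x + bubble K x * t x)"
    using PiK_solves(1)[OF v] by blast
  note B = solves_bound[OF v rt(1) x]
  have "\<bar>signed_bubble \<beta> K x * r x\<bar> \<le> real (CARD('n) + 1) * ((bound1 rv l \<theta> c0) * (size1 v / vol))"
    unfolding abs_mult by (intro mult_mono signed_bubble_bound x B) auto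
  moreover have "\<bar>bubble K x * t x\<bar> \<le> 1 * ((bound2 (real (CARD('n) + 1)) rv l \<theta> c0 cb) * (size1 v / vol))"
    unfolding abs_mult using bubble_bounds[OF nd x] by (intro mult_mono B) auto
  ultimately have "\<bar>signed_bubble \<beta> K x * r x + bubble K x * t x\<bar>
    \<le> real (CARD('n) + 1) * (bound1 rv l \<theta> c0 * (size1 v / vol)) + 1 * (bound2 (real (CARD('n) + 1)) rv l \<theta> c0 cb * (size1 v / vol))"
    by linarith
  also have "\<dots> = bound3 (real (CARD('n) + 1)) rv l \<theta> c0 cb * (size1 v / vol)"
    unfolding bound3_def by (simp only: distrib_right mult.assoc mult_1_left)
  finally show ?thesis unfolding rt(2) .
qed

text \<open>Subtracting the mean at most doubles \<open>size1\<close>, because |mean| times the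
  volume is at most the integral of |v|. The bubble correction is a quotient whose denominator is
  bounded below. The derivative is then estimated by the inverse inequality applied to the projected
  polynomial.\<close>

lemma PiKpp_bound:
  assumes v: "v \<in> W1 \<beta> K" and x: "x \<in> elem K"
  shows "\<bar>PiKpp \<beta> k K v x\<bar> \<le> (bound4 (real (CARD('n) + 1)) rv l \<theta> c0 cb) * (size1 v / vol)" "hb * \<bar>dd c (PiKpp \<beta> k K v) x\<bar> \<le> l * ((bound4 (real (CARD('n) + 1)) rv l \<theta> c0 cb) * (size1 v / vol))"
proof -
  define X where "X = size1 v / vol"
  let ?N1 = "LINT x|\<mu>. \<bar>v x\<bar>" and ?N2 = "LINT x|\<mu>. \<bar>bg v x\<bar>"
  have N: "?N1 \<ge> 0" "?N2 \<ge> 0" by (auto intro: Bochner_Integration.integral_nonneg)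
  have X: "X \<ge> 0" using size1_nonneg vol_pos by (simp add: X_def)
  have N1s: "?N1 \<le> size1 v" using N hb_pos by simp
  have Xv: "size1 v = X * vol" using vol_pos by (simp add: X_def)
  have vi: "integrable \<mu> v" by (rule W1_bgrad(1)[OF v])
  let ?m = "mean K v"
  let ?w = "\<lambda>x. v x - ?m"
  have "\<bar>?m\<bar> \<le> ?N1 / vol"
    unfolding mean_def abs_divide using vol_pos integral_abs_bound[of \<mu> v] by (simp add: divide_right_mono)
  also have "\<dots> \<le> X" using N1s vol_pos by (simp add: X_def divide_right_mono)
  finally have m: "\<bar>?m\<bar> \<le> X" .
  have mv: "\<bar>?m\<bar> * vol \<le> ?N1"
    using \<open>\<bar>?m\<bar> \<le> ?N1 / vol\<close> vol_pos by (simp add: field_simps)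
  have wW: "?w \<in> W1 \<beta> K" by (rule shift_W1(1)[OF v])
  have "(LINT x|\<mu>. \<bar>?w x\<bar>) \<le> (LINT x|\<mu>. \<bar>v x\<bar> + \<bar>?m\<bar>)"
    using vi W1_bgrad(1)[OF wW] by (intro integral_mono) (auto intro: cell_integrable_const[OF nd])
  also have "\<dots> = ?N1 + \<bar>?m\<bar> * vol"
    by (subst Bochner_Integration.integral_add) ((rule integrable_abs[OF vi] cell_integrable_const[OF nd])+, simp only: integral_const_cell)
  finally have w1: "(LINT x|\<mu>. \<bar>?w x\<bar>) \<le> 2 * ?N1" using mv by linarith
  have w2: "(LINT x|\<mu>. \<bar>bg ?w x\<bar>) = ?N2"
    by (rule integral_cong_AE) (use W1_bgrad(2)[OF v] W1_bgrad(2)[OF wW] shift_W1(2)[OF v, of ?m] in \<open>auto elim: eventually_mono\<close>)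
  have "size1 ?w \<le> 2 * size1 v" unfolding w2 using w1 N hb_pos
    by (smt (verit) mult_nonneg_nonneg)
  then have "size1 ?w / vol \<le> 2 * size1 v / vol" by (rule divide_right_mono) (use vol_pos in simp)
  then have sw: "size1 ?w / vol \<le> 2 * X" by (simp only: X_def times_divide_eq_right)
  have P1: "\<bar>PiKp \<beta> k K v x\<bar> \<le> (1 + 2 * (bound3 (real (CARD('n) + 1)) rv l \<theta> c0 cb)) * X" if x: "x \<in> elem K" for x
  proof -
    have "\<bar>PiK \<beta> k K ?w x\<bar> \<le> (bound3 (real (CARD('n) + 1)) rv l \<theta> c0 cb) * (2 * X)"
      using PiK_bound[OF wW x] mult_left_mono[OF sw A_nonneg(3)] by linarith
    then show ?thesis unfolding PiKp_def using m by (simp add: algebra_simps)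
  qed
  have Pi: "integrable \<mu> (PiKp \<beta> k K v)" by (rule pol_integrable[OF nd PiKpp_pol(2)[OF v]])
  have "\<bar>LINT x|\<mu>. v x - PiKp \<beta> k K v x\<bar> \<le> (LINT x|\<mu>. \<bar>v x\<bar> + (1 + 2 * (bound3 (real (CARD('n) + 1)) rv l \<theta> c0 cb)) * X)"
  proof (rule order_trans[OF integral_abs_bound integral_mono])
    show "integrable \<mu> (\<lambda>x. \<bar>v x - PiKp \<beta> k K v x\<bar>)" using vi Pi by simp
    show "integrable \<mu> (\<lambda>x. \<bar>v x\<bar> + (1 + 2 * (bound3 (real (CARD('n) + 1)) rv l \<theta> c0 cb)) * X)" using vi cell_integrable_const[OF nd] by simp
    fix x assume "x \<in> space \<mu>"
    then have "x \<in> elem K" using interior_subset by auto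
    from P1[OF this] show "\<bar>v x - PiKp \<beta> k K v x\<bar> \<le> \<bar>v x\<bar> + (1 + 2 * (bound3 (real (CARD('n) + 1)) rv l \<theta> c0 cb)) * X" by linarith
  qed
  also have "\<dots> = ?N1 + (1 + 2 * (bound3 (real (CARD('n) + 1)) rv l \<theta> c0 cb)) * X * vol"
    by (subst Bochner_Integration.integral_add) ((rule integrable_abs[OF vi] cell_integrable_const[OF nd])+, simp only: integral_const_cell)
  also have "\<dots> \<le> (2 + 2 * (bound3 (real (CARD('n) + 1)) rv l \<theta> c0 cb)) * X * vol" using N1s Xv by (simp add: algebra_simps)
  finally have num: "\<bar>LINT x|\<mu>. v x - PiKp \<beta> k K v x\<bar> \<le> (2 + 2 * (bound3 (real (CARD('n) + 1)) rv l \<theta> c0 cb)) * X * vol" .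
  \<comment> \<open>The bubble inequality for the constant 1 bounds the integral of the bubble from
    below.\<close>
  have "pol k (\<lambda>_::real^'n. 1)" by (rule pol_const)
  from bub[OF this x] have den: "cb * vol \<le> rv * (LINT x|\<mu>. bubble K x)" by simp
  have bp: "(LINT x|\<mu>. bubble K x) > 0" using bubble_integral_pos by (simp add: ip_def)
  have "\<bar>corr v\<bar> = \<bar>LINT x|\<mu>. v x - PiKp \<beta> k K v x\<bar> / (LINT x|\<mu>. bubble K x)"
    using bp by (simp add: corr_def ip_def)
  also have "\<dots> \<le> ((2 + 2 * (bound3 (real (CARD('n) + 1)) rv l \<theta> c0 cb)) * X * vol) / (cb * vol / rv)"
    using num den bp rv cb vol_pos A_nonneg(3) X by (intro frac_le) (auto simp: field_simps)
  also have "\<dots> = (2 + 2 * (bound3 (real (CARD('n) + 1)) rv l \<theta> c0 cb)) * rv / cb * X" using vol_pos by simp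
  finally have cr: "\<bar>corr v\<bar> \<le> (2 + 2 * (bound3 (real (CARD('n) + 1)) rv l \<theta> c0 cb)) * rv / cb * X" .
  have main: "\<bar>PiKpp \<beta> k K v x\<bar> \<le> (bound4 (real (CARD('n) + 1)) rv l \<theta> c0 cb) * X" if x: "x \<in> elem K" for x
  proof -
    have "\<bar>corr v * bubble K x\<bar> \<le> ((2 + 2 * (bound3 (real (CARD('n) + 1)) rv l \<theta> c0 cb)) * rv / cb * X) * 1"
      unfolding abs_mult using bubble_bounds[OF nd x] order_trans[OF abs_ge_zero cr] by (intro mult_mono cr) auto
    moreover have "PiKpp \<beta> k K v x = PiKp \<beta> k K v x + corr v * bubble K x" by (simp add: PiKpp_def corr_def)
    moreover have "(bound4 (real (CARD('n) + 1)) rv l \<theta> c0 cb) * X = (1 + 2 * (bound3 (real (CARD('n) + 1)) rv l \<theta> c0 cb)) * X + (2 + 2 * (bound3 (real (CARD('n) + 1)) rv l \<theta> c0 cb)) * rv / cb * X" by (simp add: bound4_def distrib_right)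
    ultimately show ?thesis using P1[OF x] by linarith
  qed
  show "\<bar>PiKpp \<beta> k K v x\<bar> \<le> (bound4 (real (CARD('n) + 1)) rv l \<theta> c0 cb) * (size1 v / vol)" using main[OF x] by (simp only: X_def)
  show "hb * \<bar>dd c (PiKpp \<beta> k K v) x\<bar> \<le> l * ((bound4 (real (CARD('n) + 1)) rv l \<theta> c0 cb) * (size1 v / vol))"
    unfolding X_def[symmetric] by (rule inv[OF PiKpp_pol(1)[OF v] _ main x]) (use A_nonneg(4) X in auto)
qed

end

end

text \<open>The constant is fixed before element, field, index set and function. All ingredients are
  taken on the reference simplex, and \<kappa> enters through the length of the pulled-back field in
  the inverse inequality.\<close>

lemma PiKpp_uniform_bound:
  assumes k: "k \<ge> 1" and \<theta>: "\<theta> > 0" and \<kappa>: "\<kappa> \<ge> 0"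
  shows "\<exists>C\<ge>0. \<forall>(K :: 'n::finite vsimplex) \<beta> c J v x. stable_simplex K \<beta> c k J \<longrightarrow>
    (\<forall>i\<in>J. \<theta> \<le> diameter (elem K) / norm c * \<bar>grd K i \<bullet> c\<bar>) \<longrightarrow>
    mat_norm (ref_matrix K) * mat_norm (matrix_inv (ref_matrix K)) \<le> \<kappa> \<longrightarrow> v \<in> W1 \<beta> K \<longrightarrow> x \<in> elem K \<longrightarrow>
    \<bar>PiKpp \<beta> k K v x\<bar> \<le> C * (((LINT x|lebesgue_on (cell K). \<bar>v x\<bar>)
        + diameter (elem K) / norm c * (LINT x|lebesgue_on (cell K). \<bar>bgrad \<beta> (cell K) v x\<bar>)) / measure lebesgue (cell K)) \<and>
    diameter (elem K) / norm c * \<bar>dd c (PiKpp \<beta> k K v) x\<bar> \<le> C * (((LINT x|lebesgue_on (cell K). \<bar>v x\<bar>)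
        + diameter (elem K) / norm c * (LINT x|lebesgue_on (cell K). \<bar>bgrad \<beta> (cell K) v x\<bar>)) / measure lebesgue (cell K))"
proof -
  let ?R = "ref_simplex :: 'n vsimplex"
  note nr = nondegenerate_ref_simplex[where 'n='n]
  define rv where "rv = ref_vol TYPE('n)"
  have rv: "rv > 0" unfolding rv_def by (rule simplex_field.vol_pos[OF simplex_fieldI[OF nr]])
  define dR where "dR = diameter (elem ?R)"
  have dR: "dR > 0" unfolding dR_def by (rule diameter_elem_pos[OF nr])
  obtain c0 where c0: "c0 > 0" "\<forall>J. (J = UNIV \<or> k = 1 \<and> (\<exists>i\<in>J. \<exists>j\<in>J. i \<noteq> j)) \<longrightarrow>
    (\<forall>z\<in>polys_perp ?R (int k). \<forall>x\<in>elem ?R. c0 * (z x)\<^sup>2 \<le> (\<Sum>i\<in>J. flux ?R i (\<lambda>x. z x * z x)))"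
    using ref_flux_bound[OF k, where 'n='n] by - (erule exE, erule conjE, rule that; assumption)
  obtain cb where cb: "cb > 0" "\<forall>t. pol k t \<longrightarrow> (\<forall>x\<in>elem ?R.
      cb * (t x)\<^sup>2 \<le> (LINT x|lebesgue_on (cell ?R). bubble ?R x * (t x * t x)))"
    using ref_bubble_bound[where 'n='n, of k] by - (erule exE, erule conjE, rule that; assumption)
  obtain Ci where Ci: "Ci \<ge> 0" "\<forall>z. pol (CARD('n) + 1 + k) z \<longrightarrow> (\<forall>M\<ge>0. (\<forall>x\<in>elem ?R. \<bar>z x\<bar> \<le> M) \<longrightarrow>
      (\<forall>x\<in>elem ?R. \<forall>v. \<bar>dd v z x\<bar> \<le> Ci * M * norm v))"
    using inverse_inequality[OF nr, of "CARD('n) + 1 + k"] by - (erule exE, erule conjE, rule that; assumption)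
  \<comment> \<open>Inverse constant of the reference simplex times the bound \<kappa> dR for h_K
    |M^(-1) c| / |c|.\<close>
  define l where "l = Ci * (\<kappa> * dR)"
  have l: "l \<ge> 0" unfolding l_def using Ci(1) \<kappa> dR by simp
  define A where "A = bound4 (real (CARD('n) + 1)) rv l \<theta> c0 cb"
  have A: "A \<ge> 0" unfolding A_def by (rule bound_nonneg(4)[OF of_nat_0_le_iff rv c0(1) cb(1) l \<theta>])
  \<comment> \<open>The value is bounded with A and the scaled derivative with l A; the factor 1 + l
    covers both.\<close>
  show ?thesis
  proof (intro exI[of _ "(1 + l) * A"] conjI allI impI)
    show "0 \<le> (1 + l) * A" using A l by simp
    fix K :: "'n vsimplex" and \<beta> c J v x
    assume ss: "stable_simplex K \<beta> c k J"
      and \<theta>J: "\<forall>i\<in>J. \<theta> \<le> diameter (elem K) / norm c * \<bar>grd K i \<bullet> c\<bar>"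
      and mn: "mat_norm (ref_matrix K) * mat_norm (matrix_inv (ref_matrix K)) \<le> \<kappa>"
      and v: "v \<in> W1 \<beta> K" and x: "x \<in> elem K"
    interpret stable_simplex K \<beta> c k J by (rule ss)
    define \<Psi> where "\<Psi> = (\<lambda>x. matrix_inv (ref_matrix K) *v (x - K None))"
    have P: "Phi K (\<Psi> x) = x" for x unfolding \<Psi>_def by (rule Phi_surj[OF nd])
    have Pm: "x \<in> elem K \<Longrightarrow> \<Psi> x \<in> elem ?R" for x using Phi_mem(1)[OF nd, of "\<Psi> x"] by (simp add: P)
    have flow: "c0 * (z x)\<^sup>2 * vol \<le> rv * (\<Sum>i\<in>J. flux K i (\<lambda>x. z x * z x))" if z: "z \<in> perp" and x: "x \<in> elem K" for z x
    proof -
      have zp: "pol k z" using z polys_perp_pol[OF nd] by auto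
      have "c0 * (z (Phi K (\<Psi> x)))\<^sup>2 \<le> (\<Sum>i\<in>J. flux ?R i (\<lambda>x. z (Phi K x) * z (Phi K x)))"
        by (rule c0(2)[rule_format, OF J perp_Phi[OF nd z] Pm[OF x]])
      then have "c0 * (z x)\<^sup>2 * vol \<le> (\<Sum>i\<in>J. flux ?R i (\<lambda>x. z (Phi K x) * z (Phi K x))) * vol"
        using vol_pos by (simp add: P)
      also have "\<dots> = rv * (\<Sum>i\<in>J. flux K i (\<lambda>x. z x * z x))"
        using flux_Phi[OF nd pol_mult[OF zp zp]] by (simp add: sum_distrib_left sum_distrib_right rv_def mult.commute)
      finally show ?thesis .
    qed
    have bub: "cb * (t x)\<^sup>2 * vol \<le> rv * (LINT x|\<mu>. bubble K x * (t x * t x))" if t: "pol k t" and x: "x \<in> elem K" for t x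
    proof -
      have "cb * (t (Phi K (\<Psi> x)))\<^sup>2 \<le> (LINT x|lebesgue_on (cell ?R). bubble ?R x * (t (Phi K x) * t (Phi K x)))"
        by (rule cb(2)[rule_format, OF pol_Phi[OF t] Pm[OF x]])
      then have "cb * (t x)\<^sup>2 * vol \<le> (LINT x|lebesgue_on (cell ?R). bubble ?R x * (t (Phi K x) * t (Phi K x))) * vol"
        using vol_pos by (simp add: P)
      also have "\<dots> = rv * (LINT x|\<mu>. bubble K x * (t x * t x))"
        using pullback_integral[OF nd pol_continuous[OF pol_mult[OF bubble_pol[OF nd] pol_mult[OF t t]]]]
        by (simp add: bubble_Phi[OF nd] rv_def mult.commute)
      finally show ?thesis .
    qed
    have inv: "hb * \<bar>dd c z x\<bar> \<le> l * M"
      if z: "pol (CARD('n) + 1 + k) z" and M: "M \<ge> 0" "\<And>x. x \<in> elem K \<Longrightarrow> \<bar>z x\<bar> \<le> M" and x: "x \<in> elem K" for z M x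
    proof -
      let ?w = "matrix_inv (ref_matrix K) *v c"
      have "dd ?w (\<lambda>x. z (Phi K x)) (\<Psi> x) = dd c z x"
        using dd_Phi[OF pol_differentiable[OF z], of ?w K "\<Psi> x"] by (simp add: ref_matrix_inv[OF nd] P)
      moreover have "\<bar>dd ?w (\<lambda>x. z (Phi K x)) (\<Psi> x)\<bar> \<le> Ci * M * norm ?w"
        by (rule Ci(2)[rule_format, OF pol_Phi[OF z] M(1) _ Pm[OF x]]) (use M(2) Phi_mem(1)[OF nd] in auto)
      ultimately have "hb * \<bar>dd c z x\<bar> \<le> hb * (Ci * M * norm ?w)"
        using hb_pos by (intro mult_left_mono) auto
      also have "\<dots> = Ci * M * (hb * norm ?w)" by simp
      also have "\<dots> \<le> Ci * M * (\<kappa> * dR)"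
      proof (rule mult_left_mono)
        have bl: "bounded_linear ((*v) (matrix_inv (ref_matrix K)))" by (rule matrix_vector_mul_bounded_linear)
        have mi: "0 \<le> mat_norm (matrix_inv (ref_matrix K))" unfolding mat_norm_def by (rule onorm_pos_le[OF bl])
        have "hb * norm ?w \<le> hb * (mat_norm (matrix_inv (ref_matrix K)) * norm c)"
          using onorm[OF bl, of c] hb_pos by (intro mult_left_mono) (auto simp: mat_norm_def)
        also have "\<dots> = diameter (elem K) * mat_norm (matrix_inv (ref_matrix K))" using c_nonzero by (simp add: hb_def)
        also have "\<dots> \<le> (mat_norm (ref_matrix K) * dR) * mat_norm (matrix_inv (ref_matrix K))"
          unfolding dR_def by (intro mult_right_mono diameter_le_mat_norm[OF nd] mi)
        also have "\<dots> = (mat_norm (ref_matrix K) * mat_norm (matrix_inv (ref_matrix K))) * dR" by simp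
        also have "\<dots> \<le> \<kappa> * dR" using mn dR by (intro mult_right_mono) auto
        finally show "hb * norm ?w \<le> \<kappa> * dR" .
        show "0 \<le> Ci * M" using Ci(1) M(1) by simp
      qed
      finally show ?thesis by (simp add: l_def mult_ac)
    qed
    have \<Theta>: "\<theta> \<le> hb * \<bar>grd K i \<bullet> c\<bar>" if "i \<in> J" for i using \<theta>J that by (simp add: hb_def)
    let ?X = "size1 v / vol"
    have B1: "\<bar>PiKpp \<beta> k K v x\<bar> \<le> A * ?X"
      unfolding A_def by (rule PiKpp_bound(1)[OF rv c0(1) cb(1) l \<theta> \<Theta> flow bub inv v x]; (assumption | blast))
    have B2: "hb * \<bar>dd c (PiKpp \<beta> k K v) x\<bar> \<le> l * (A * ?X)"
      unfolding A_def by (rule PiKpp_bound(2)[OF rv c0(1) cb(1) l \<theta> \<Theta> flow bub inv v x]; (assumption | blast))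
    have X: "0 \<le> A * ?X" using A size1_nonneg[of v] vol_pos by (intro mult_nonneg_nonneg divide_nonneg_pos)
    have e: "(1 + l) * A * ?X = A * ?X + l * (A * ?X)" by (simp only: distrib_right mult_1_left mult.assoc)
    have L: "0 \<le> l * (A * ?X)" by (rule mult_nonneg_nonneg[OF l X])
    show "\<bar>PiKpp \<beta> k K v x\<bar> \<le> (1 + l) * A * (((LINT x|lebesgue_on (cell K). \<bar>v x\<bar>)
        + diameter (elem K) / norm c * (LINT x|lebesgue_on (cell K). \<bar>bgrad \<beta> (cell K) v x\<bar>)) / measure lebesgue (cell K))"
      unfolding hb_def[symmetric] e using B1 L by linarith
    show "diameter (elem K) / norm c * \<bar>dd c (PiKpp \<beta> k K v) x\<bar> \<le> (1 + l) * A * (((LINT x|lebesgue_on (cell K). \<bar>v x\<bar>)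
        + diameter (elem K) / norm c * (LINT x|lebesgue_on (cell K). \<bar>bgrad \<beta> (cell K) v x\<bar>)) / measure lebesgue (cell K))"
      unfolding hb_def[symmetric] e using B2 X by linarith
  qed
qed

section \<open>Inequalities for powers\<close>

lemma powr_root_powr: "(x::real) \<ge> 0 \<Longrightarrow> r > 0 \<Longrightarrow> (x powr (1 / r)) powr r = x"
  by (cases "x = 0") (simp_all add: powr_powr)

lemma Lnorm_powr: "r > 0 \<Longrightarrow> Lnorm r D v powr r = (LINT x|lebesgue_on D. \<bar>v x\<bar> powr r)"
  unfolding Lnorm_def by (rule powr_root_powr) (auto intro: Bochner_Integration.integral_nonneg)

locale conjugate_exponents =
  fixes p q :: real assumes p: "1 < p" and q: "q = p / (p - 1)"
begin

lemma q_gt_1: "1 < q" using p by (simp add: q field_simps)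

lemma conj_sum: "1 / p + 1 / q = 1" using p by (simp add: q field_simps)

lemma conj_mult: "(q - 1) * p = q" using p by (simp add: q field_simps)

lemma young: "a \<ge> 0 \<Longrightarrow> b \<ge> 0 \<Longrightarrow> a * b \<le> a powr p / p + b powr q / q"
  by (rule Youngs_inequality[OF p q_gt_1 conj_sum])

lemma product_integrable:
  assumes f: "f \<in> Lsp p D" and v: "v \<in> Lsp q D"
  shows "integrable (lebesgue_on D) (\<lambda>x. f x * v x)"
proof (rule Bochner_Integration.integrable_bound)
  show "integrable (lebesgue_on D) (\<lambda>x. \<bar>f x\<bar> powr p / p + \<bar>v x\<bar> powr q / q)"
    using f v by (auto simp: Lsp_def)
  show "(\<lambda>x. f x * v x) \<in> borel_measurable (lebesgue_on D)" using f v by (auto simp: Lsp_def)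
  show "AE x in lebesgue_on D. norm (f x * v x) \<le> norm (\<bar>f x\<bar> powr p / p + \<bar>v x\<bar> powr q / q)"
  proof (rule AE_I2)
    fix x
    have "\<bar>f x\<bar> * \<bar>v x\<bar> \<le> \<bar>f x\<bar> powr p / p + \<bar>v x\<bar> powr q / q" by (rule young) auto
    then show "norm (f x * v x) \<le> norm (\<bar>f x\<bar> powr p / p + \<bar>v x\<bar> powr q / q)" by (simp add: abs_mult)
  qed
qed

lemma powr_integral_zero:
  assumes r: "r > 0" and f: "f \<in> Lsp r D" and 0: "(LINT x|lebesgue_on D. \<bar>f x\<bar> powr r) = 0"
  shows "AE x in lebesgue_on D. f x = 0"
proof -
  have "AE x in lebesgue_on D. \<bar>f x\<bar> powr r = 0"
    using integral_nonneg_eq_0_iff_AE[of "lebesgue_on D" "\<lambda>x. \<bar>f x\<bar> powr r"] f 0 by (simp add: Lsp_def)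
  then show ?thesis by eventually_elim simp
qed

text \<open>After division by the two norms, Young's inequality is applied pointwise to a_K |F| and
  |e| / a_K, and the normalised sums add up to 1 / p + 1 / q. If one norm is zero the normalisation
  is impossible, but then one factor vanishes almost everywhere on each set.\<close>

lemma weighted_holder:
  assumes T: "finite T" and a: "\<And>K. K \<in> T \<Longrightarrow> a K > 0"
    and F: "\<And>K. K \<in> T \<Longrightarrow> F K \<in> Lsp p (D K)" and e: "\<And>K. K \<in> T \<Longrightarrow> e K \<in> Lsp q (D K)"
  shows "(\<Sum>K\<in>T. LINT x|lebesgue_on (D K). \<bar>F K x * e K x\<bar>)
    \<le> (\<Sum>K\<in>T. a K powr p * (LINT x|lebesgue_on (D K). \<bar>F K x\<bar> powr p)) powr (1 / p)
     * (\<Sum>K\<in>T. a K powr (- q) * (LINT x|lebesgue_on (D K). \<bar>e K x\<bar> powr q)) powr (1 / q)"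
    (is "?X \<le> ?A powr (1 / p) * ?B powr (1 / q)")
proof -
  have p0: "p > 0" and q0: "q > 0" using p q_gt_1 by auto
  have iF: "0 \<le> (LINT x|lebesgue_on (D K). \<bar>F K x\<bar> powr p)" and ie: "0 \<le> (LINT x|lebesgue_on (D K). \<bar>e K x\<bar> powr q)" for K
    by (auto intro: Bochner_Integration.integral_nonneg)
  have nA: "0 \<le> a K powr p * (LINT x|lebesgue_on (D K). \<bar>F K x\<bar> powr p)"
    and nB: "0 \<le> a K powr (- q) * (LINT x|lebesgue_on (D K). \<bar>e K x\<bar> powr q)" for K
    using iF ie by auto
  have A: "?A \<ge> 0" and B: "?B \<ge> 0" by (intro sum_nonneg nA nB)+
  have zero: "(LINT x|lebesgue_on (D K). \<bar>F K x * e K x\<bar>) = 0"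
    if "K \<in> T" "(AE x in lebesgue_on (D K). F K x = 0) \<or> (AE x in lebesgue_on (D K). e K x = 0)" for K
  proof -
    have "AE x in lebesgue_on (D K). \<bar>F K x * e K x\<bar> = 0"
      using that(2) by (auto elim: eventually_mono)
    then show ?thesis by (rule integral_eq_zero_AE)
  qed
  consider "?A = 0" | "?B = 0" | "?A > 0" "?B > 0" using A B by linarith
  then show ?thesis
  proof cases
    case 1
    then have "a K powr p * (LINT x|lebesgue_on (D K). \<bar>F K x\<bar> powr p) = 0" if "K \<in> T" for K
      using sum_nonneg_eq_0_iff[OF T nA] that by simp
    then have "(LINT x|lebesgue_on (D K). \<bar>F K x\<bar> powr p) = 0" if "K \<in> T" for K
      using a[OF that] that by fastforce
    then have "(LINT x|lebesgue_on (D K). \<bar>F K x * e K x\<bar>) = 0" if "K \<in> T" for K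
      using zero[OF that] powr_integral_zero[OF p0 F[OF that]] that by blast
    then show ?thesis by simp
  next
    case 2
    then have "a K powr (- q) * (LINT x|lebesgue_on (D K). \<bar>e K x\<bar> powr q) = 0" if "K \<in> T" for K
      using sum_nonneg_eq_0_iff[OF T nB] that by simp
    then have "(LINT x|lebesgue_on (D K). \<bar>e K x\<bar> powr q) = 0" if "K \<in> T" for K
      using a[OF that] that by fastforce
    then have "(LINT x|lebesgue_on (D K). \<bar>F K x * e K x\<bar>) = 0" if "K \<in> T" for K
      using zero[OF that] powr_integral_zero[OF q0 e[OF that]] that by blast
    then show ?thesis by simp
  next
    case 3
    define \<alpha> where "\<alpha> = ?A powr (1 / p)"
    define \<gamma> where "\<gamma> = ?B powr (1 / q)"
    have \<alpha>: "\<alpha> > 0" "\<alpha> powr p = ?A" and \<gamma>: "\<gamma> > 0" "\<gamma> powr q = ?B"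
      unfolding \<alpha>_def \<gamma>_def using 3 powr_root_powr[OF A p0] powr_root_powr[OF B q0] by auto
    have "(LINT x|lebesgue_on (D K). \<bar>F K x * e K x\<bar>) / (\<alpha> * \<gamma>)
        \<le> a K powr p * (LINT x|lebesgue_on (D K). \<bar>F K x\<bar> powr p) / (p * ?A)
        + a K powr (- q) * (LINT x|lebesgue_on (D K). \<bar>e K x\<bar> powr q) / (q * ?B)" if K: "K \<in> T" for K
    proof -
      have iFK: "integrable (lebesgue_on (D K)) (\<lambda>x. \<bar>F K x\<bar> powr p)" and ieK: "integrable (lebesgue_on (D K)) (\<lambda>x. \<bar>e K x\<bar> powr q)"
        using F[OF K] e[OF K] by (auto simp: Lsp_def)
      have "(LINT x|lebesgue_on (D K). \<bar>F K x * e K x\<bar> / (\<alpha> * \<gamma>))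
        \<le> (LINT x|lebesgue_on (D K). (a K powr p / (p * ?A)) * \<bar>F K x\<bar> powr p + (a K powr (- q) / (q * ?B)) * \<bar>e K x\<bar> powr q)"
      proof (rule integral_mono)
        show "integrable (lebesgue_on (D K)) (\<lambda>x. \<bar>F K x * e K x\<bar> / (\<alpha> * \<gamma>))"
          by (intro integrable_divide integrable_abs product_integrable F e K)
        show "integrable (lebesgue_on (D K)) (\<lambda>x. (a K powr p / (p * ?A)) * \<bar>F K x\<bar> powr p + (a K powr (- q) / (q * ?B)) * \<bar>e K x\<bar> powr q)"
          by (intro Bochner_Integration.integrable_add integrable_mult_right iFK ieK)
        fix x
        have aK: "a K > 0" by (rule a[OF K])
        have "\<bar>F K x * e K x\<bar> / (\<alpha> * \<gamma>) = (a K * \<bar>F K x\<bar> / \<alpha>) * (\<bar>e K x\<bar> / (a K * \<gamma>))"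
          using aK \<alpha>(1) \<gamma>(1) by (simp add: abs_mult field_simps)
        also have "\<dots> \<le> (a K * \<bar>F K x\<bar> / \<alpha>) powr p / p + (\<bar>e K x\<bar> / (a K * \<gamma>)) powr q / q"
          using aK \<alpha>(1) \<gamma>(1) by (intro young) auto
        also have "(a K * \<bar>F K x\<bar> / \<alpha>) powr p = a K powr p * \<bar>F K x\<bar> powr p / ?A"
          using aK \<alpha> by (simp add: powr_divide powr_mult)
        also have "(\<bar>e K x\<bar> / (a K * \<gamma>)) powr q = a K powr (- q) * \<bar>e K x\<bar> powr q / ?B"
          using aK \<gamma> by (simp add: powr_divide powr_mult powr_minus_divide)
        finally show "\<bar>F K x * e K x\<bar> / (\<alpha> * \<gamma>)
          \<le> (a K powr p / (p * ?A)) * \<bar>F K x\<bar> powr p + (a K powr (- q) / (q * ?B)) * \<bar>e K x\<bar> powr q"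
          by (simp add: mult.commute)
      qed
      also have "\<dots> = (a K powr p / (p * ?A)) * (LINT x|lebesgue_on (D K). \<bar>F K x\<bar> powr p)
          + (a K powr (- q) / (q * ?B)) * (LINT x|lebesgue_on (D K). \<bar>e K x\<bar> powr q)"
        using iFK ieK by simp
      finally show ?thesis by simp
    qed
    then have "(\<Sum>K\<in>T. (LINT x|lebesgue_on (D K). \<bar>F K x * e K x\<bar>) / (\<alpha> * \<gamma>))
      \<le> (\<Sum>K\<in>T. a K powr p * (LINT x|lebesgue_on (D K). \<bar>F K x\<bar> powr p) / (p * ?A)
        + a K powr (- q) * (LINT x|lebesgue_on (D K). \<bar>e K x\<bar> powr q) / (q * ?B))" by (rule sum_mono)
    then have "?X / (\<alpha> * \<gamma>) \<le> ?A / (p * ?A) + ?B / (q * ?B)"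
      by (simp only: sum.distrib sum_divide_distrib[symmetric])
    also have "\<dots> = 1" using 3 conj_sum by simp
    finally show ?thesis using \<alpha>(1) \<gamma>(1) unfolding \<alpha>_def[symmetric] \<gamma>_def[symmetric]
      by (simp add: pos_divide_le_eq)
  qed
qed

text \<open>Jensen's inequality for the power q, obtained by integrating Young's inequality for
  m^(q-1) |v| with m the mean of |v|; since (q - 1) p = q, the term in m is absorbed on the
  left.\<close>

lemma mean_power:
  assumes v: "v \<in> Lsp q D" "integrable (lebesgue_on D) v" and V: "V > 0" "\<And>a. (LINT x|lebesgue_on D. a) = a * V"
    and ic: "\<And>a::real. integrable (lebesgue_on D) (\<lambda>x. a)"
  shows "((LINT x|lebesgue_on D. \<bar>v x\<bar>) / V) powr q * V \<le> (LINT x|lebesgue_on D. \<bar>v x\<bar> powr q)"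
proof -
  define m where "m = (LINT x|lebesgue_on D. \<bar>v x\<bar>) / V"
  have m0: "m \<ge> 0" unfolding m_def using V(1) by (auto intro!: divide_nonneg_pos Bochner_Integration.integral_nonneg)
  have q1: "q > 1" by (rule q_gt_1)
  have iq: "integrable (lebesgue_on D) (\<lambda>x. \<bar>v x\<bar> powr q)" using v by (simp add: Lsp_def)
  show ?thesis
  proof (cases "m = 0")
    case True
    then show ?thesis unfolding m_def[symmetric] by (auto intro: Bochner_Integration.integral_nonneg)
  next
    case False
    then have m: "m > 0" using m0 by simp
    have mp: "(m powr (q - 1)) powr p = m powr q" by (simp add: powr_powr conj_mult)
    have mm: "m powr (q - 1) * m = m powr q" using m by (simp add: powr_diff)
    have "m powr (q - 1) * (LINT x|lebesgue_on D. \<bar>v x\<bar>) = (LINT x|lebesgue_on D. m powr (q - 1) * \<bar>v x\<bar>)" by simp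
    also have "\<dots> \<le> (LINT x|lebesgue_on D. m powr q / p + \<bar>v x\<bar> powr q / q)"
    proof (rule integral_mono)
      show "integrable (lebesgue_on D) (\<lambda>x. m powr (q - 1) * \<bar>v x\<bar>)" using v by simp
      show "integrable (lebesgue_on D) (\<lambda>x. m powr q / p + \<bar>v x\<bar> powr q / q)"
        using iq by (intro Bochner_Integration.integrable_add ic integrable_divide)
      fix x
      show "m powr (q - 1) * \<bar>v x\<bar> \<le> m powr q / p + \<bar>v x\<bar> powr q / q"
        using young[of "m powr (q - 1)" "\<bar>v x\<bar>"] by (simp add: mp)
    qed
    also have "\<dots> = m powr q / p * V + (LINT x|lebesgue_on D. \<bar>v x\<bar> powr q) / q"
      by (subst Bochner_Integration.integral_add) (use iq ic V in auto)
    also have "(LINT x|lebesgue_on D. \<bar>v x\<bar>) = m * V" using V(1) by (simp add: m_def)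
    also have "m powr (q - 1) * (m * V) = m powr q * V" by (simp add: mm mult.assoc[symmetric])
    finally have "m powr q * V * (1 - 1 / p) \<le> (LINT x|lebesgue_on D. \<bar>v x\<bar> powr q) / q"
      by (simp add: algebra_simps)
    also have "1 - 1 / p = 1 / q" using conj_sum by simp
    finally show ?thesis unfolding m_def[symmetric] using q1 by (simp add: field_simps)
  qed
qed

end

section \<open>Energy of the projection on one element\<close>

definition elem_energy :: "'n::finite field \<Rightarrow> real \<Rightarrow> 'n vsimplex \<Rightarrow> 'n scalar \<Rightarrow> real" where
  "elem_energy \<beta> q K v = elem_scale \<beta> K powr (- q) * (LINT x|lebesgue_on (cell K). \<bar>v x\<bar> powr q)
     + (LINT x|lebesgue_on (cell K). \<bar>bgrad \<beta> (cell K) v x\<bar> powr q)"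

lemma Ynorm_energy: "q > 0 \<Longrightarrow> Ynorm \<T> \<beta> q v = (\<Sum>K\<in>\<T>. elem_energy \<beta> q K v) powr (1 / q)"
  by (simp add: Ynorm_def elem_energy_def Lnorm_powr)

lemma elem_energy_nonneg: "elem_energy \<beta> q K v \<ge> 0"
  unfolding elem_energy_def
  by (intro add_nonneg_nonneg mult_nonneg_nonneg Bochner_Integration.integral_nonneg) auto

lemma elem_energy_cong:
  assumes "\<And>x. x \<in> cell K \<Longrightarrow> v x = w x" shows "elem_energy \<beta> q K v = elem_energy \<beta> q K w"
proof -
  have "weak_deriv \<beta> (cell K) v g \<longleftrightarrow> weak_deriv \<beta> (cell K) w g" for g
    by (rule weak_deriv_cong) (auto simp: assms)
  then have "bgrad \<beta> (cell K) v = bgrad \<beta> (cell K) w" by (simp add: bgrad_def)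
  moreover have "(LINT x|lebesgue_on (cell K). \<bar>v x\<bar> powr q) = (LINT x|lebesgue_on (cell K). \<bar>w x\<bar> powr q)"
    by (rule Bochner_Integration.integral_cong) (auto simp: assms)
  ultimately show ?thesis by (simp add: elem_energy_def)
qed

context stable_simplex
begin

lemma elem_scale_eq: "elem_scale \<beta> K = hb"
  by (simp add: elem_scale_def hb_def beta_on_eq)

lemma energy_comb:
  assumes q: "1 \<le> q" and v: "v \<in> Wsp q \<beta> (cell K)" and w: "w \<in> Wsp q \<beta> (cell K)"
  shows "elem_energy \<beta> q K (\<lambda>x. v x - w x) \<le> 2 powr q * (elem_energy \<beta> q K v + elem_energy \<beta> q K w)"
proof -
  note V = Wsp_bgrad[OF q v] and W = Wsp_bgrad[OF q w]
  have q0: "q > 0" using q by simp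
  have p2: "\<bar>a - b\<bar> powr q \<le> 2 powr q * (\<bar>a\<bar> powr q + \<bar>b\<bar> powr q)" for a b :: real
    using powr_add_le[OF q0, of a "- b"] by simp
  have *: "(LINT x|\<mu>. \<bar>f x - g x\<bar> powr q) \<le> 2 powr q * ((LINT x|\<mu>. \<bar>f x\<bar> powr q) + (LINT x|\<mu>. \<bar>g x\<bar> powr q))"
    if f: "f \<in> Lsp q (cell K)" and g: "g \<in> Lsp q (cell K)" for f g
  proof -
    have i: "integrable \<mu> (\<lambda>x. \<bar>f x\<bar> powr q)" "integrable \<mu> (\<lambda>x. \<bar>g x\<bar> powr q)" "integrable \<mu> (\<lambda>x. \<bar>f x - g x\<bar> powr q)"
      using f g Lsp_comb[OF q0 f g, of "-1"] by (auto simp: Lsp_def)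
    have "(LINT x|\<mu>. \<bar>f x - g x\<bar> powr q) \<le> (LINT x|\<mu>. 2 powr q * (\<bar>f x\<bar> powr q + \<bar>g x\<bar> powr q))"
      by (rule integral_mono) (use i p2 in auto)
    also have "\<dots> = 2 powr q * ((LINT x|\<mu>. \<bar>f x\<bar> powr q) + (LINT x|\<mu>. \<bar>g x\<bar> powr q))" using i by simp
    finally show ?thesis .
  qed
  have ae: "AE x in \<mu>. bg (\<lambda>x. v x - w x) x = bg v x - bg w x"
    using bgrad_comb(2)[OF V(1) W(1), of "-1"] by simp
  have m: "bg (\<lambda>x. v x - w x) \<in> borel_measurable \<mu>"
    using W1_bgrad(2)[OF bgrad_comb(1)[OF V(1) W(1), of "-1"]] by simp
  have m': "bg v \<in> borel_measurable \<mu>" "bg w \<in> borel_measurable \<mu>" using V W by (auto simp: Lsp_def)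
  have "(LINT x|\<mu>. \<bar>bg (\<lambda>x. v x - w x) x\<bar> powr q) = (LINT x|\<mu>. \<bar>bg v x - bg w x\<bar> powr q)"
  proof (rule integral_cong_AE)
    show "(\<lambda>x. \<bar>bg (\<lambda>x. v x - w x) x\<bar> powr q) \<in> borel_measurable \<mu>" using m by simp
    show "(\<lambda>x. \<bar>bg v x - bg w x\<bar> powr q) \<in> borel_measurable \<mu>" using m' by simp
    show "AE x in \<mu>. \<bar>bg (\<lambda>x. v x - w x) x\<bar> powr q = \<bar>bg v x - bg w x\<bar> powr q" using ae by eventually_elim simp
  qed
  then have "elem_energy \<beta> q K (\<lambda>x. v x - w x)
    \<le> elem_scale \<beta> K powr (- q) * (2 powr q * ((LINT x|\<mu>. \<bar>v x\<bar> powr q) + (LINT x|\<mu>. \<bar>w x\<bar> powr q)))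
      + 2 powr q * ((LINT x|\<mu>. \<bar>bg v x\<bar> powr q) + (LINT x|\<mu>. \<bar>bg w x\<bar> powr q))"
    unfolding elem_energy_def using *[OF V(2) W(2)] *[OF V(3) W(3)]
    by (intro add_mono mult_left_mono) auto
  then show ?thesis by (simp add: elem_energy_def algebra_simps)
qed

text \<open>The maximum norm bounds are integrated over the cell, and Jensen's inequality returns
  from means to L_q norms. The factor 2 arises because the function and its scaled derivative obey
  the same bound, and the power of 2 from splitting \<open>size1\<close> into its two terms.\<close>

lemma energy_bound:
  assumes pq: "conjugate_exponents p q" and C: "C \<ge> 0" and v: "v \<in> Wsp q \<beta> (cell K)"
    and B: "\<And>x. x \<in> elem K \<Longrightarrow> \<bar>PiKpp \<beta> k K v x\<bar> \<le> C * (size1 v / vol)"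
      "\<And>x. x \<in> elem K \<Longrightarrow> hb * \<bar>dd c (PiKpp \<beta> k K v) x\<bar> \<le> C * (size1 v / vol)"
  shows "elem_energy \<beta> q K (PiKpp \<beta> k K v) \<le> 2 * (2 * C) powr q * elem_energy \<beta> q K v"
proof -
  interpret conjugate_exponents p q by (rule pq)
  have q1: "1 \<le> q" and q0: "q > 0" using q_gt_1 by auto
  note V = Wsp_bgrad[OF q1 v]
  let ?P = "PiKpp \<beta> k K v"
  let ?X = "size1 v / vol"
  let ?m1 = "(LINT x|\<mu>. \<bar>v x\<bar>) / vol" and ?m2 = "(LINT x|\<mu>. \<bar>bg v x\<bar>) / vol"
  let ?I1 = "LINT x|\<mu>. \<bar>v x\<bar> powr q" and ?I2 = "LINT x|\<mu>. \<bar>bg v x\<bar> powr q"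
  have X0: "?X \<ge> 0" using size1_nonneg vol_pos by simp
  have m0: "?m1 \<ge> 0" "?m2 \<ge> 0" using vol_pos by (auto intro!: divide_nonneg_pos Bochner_Integration.integral_nonneg)
  have Xm: "?X = ?m1 + hb * ?m2" by (simp add: add_divide_distrib)
  have "?X powr q = \<bar>?m1 + hb * ?m2\<bar> powr q" using X0 Xm by simp
  also have "\<dots> \<le> 2 powr q * (\<bar>?m1\<bar> powr q + \<bar>hb * ?m2\<bar> powr q)" by (rule powr_add_le[OF q0])
  also have "\<dots> = 2 powr q * (?m1 powr q + hb powr q * ?m2 powr q)"
    using m0 hb_pos by (simp only: abs_mult abs_of_nonneg abs_of_pos powr_mult)
  finally have Xq0: "?X powr q \<le> 2 powr q * (?m1 powr q + hb powr q * ?m2 powr q)" .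
  have Xq: "?X powr q * vol \<le> 2 powr q * (?m1 powr q * vol + hb powr q * (?m2 powr q * vol))"
  proof -
    have "?X powr q * vol \<le> (2 powr q * (?m1 powr q + hb powr q * ?m2 powr q)) * vol"
      by (rule mult_right_mono[OF Xq0]) (use vol_pos in simp)
    then show ?thesis by (simp only: distrib_right mult.assoc)
  qed
  have j1: "?m1 powr q * vol \<le> ?I1"
    by (rule mean_power[OF V(2) W1_bgrad(1)[OF V(1)] vol_pos integral_const_cell cell_integrable_const[OF nd]])
  have j2: "?m2 powr q * vol \<le> ?I2"
    by (rule mean_power[OF V(3) W1_bgrad(2)[OF V(1)] vol_pos integral_const_cell cell_integrable_const[OF nd]])
  have "2 powr q * (?m1 powr q * vol + hb powr q * (?m2 powr q * vol)) \<le> 2 powr q * (?I1 + hb powr q * ?I2)"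
    by (intro mult_left_mono add_mono j1 j2) auto
  with Xq have XI: "?X powr q * vol \<le> 2 powr q * (?I1 + hb powr q * ?I2)" by linarith
  have P: "pol (CARD('n) + 1 + k) ?P" by (rule PiKpp_pol(1)[OF V(1)])
  note dP = pol_dd[OF P, of c]
  have bound: "(LINT x|\<mu>. \<bar>f x\<bar> powr q) \<le> M powr q * vol"
    if f: "f \<in> Lsp q (cell K)" and M: "\<And>x. x \<in> elem K \<Longrightarrow> \<bar>f x\<bar> \<le> M" for f M
  proof -
    have "(LINT x|\<mu>. \<bar>f x\<bar> powr q) \<le> (LINT x|\<mu>. M powr q)"
    proof (rule integral_mono)
      show "integrable \<mu> (\<lambda>x. \<bar>f x\<bar> powr q)" using f by (simp add: Lsp_def)
      show "integrable \<mu> (\<lambda>x. M powr q)" by (rule cell_integrable_const[OF nd])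
      fix x assume "x \<in> space \<mu>"
      then have "\<bar>f x\<bar> \<le> M" using M interior_subset by auto
      then show "\<bar>f x\<bar> powr q \<le> M powr q" using q0 by (intro powr_mono2) auto
    qed
    then show ?thesis by (simp only: integral_const_cell)
  qed
  have b1: "(LINT x|\<mu>. \<bar>?P x\<bar> powr q) \<le> (C * ?X) powr q * vol"
    by (rule bound[OF pol_Lsp[OF q0 P] B(1)])
  have "(LINT x|\<mu>. \<bar>dd c ?P x\<bar> powr q) \<le> (C * ?X / hb) powr q * vol"
  proof (rule bound[OF pol_Lsp[OF q0 dP]])
    fix x assume "x \<in> elem K"
    have "\<bar>dd c ?P x\<bar> * hb \<le> C * ?X" using B(2)[OF \<open>x \<in> elem K\<close>] by (simp only: mult.commute[of _ hb])
    then show "\<bar>dd c ?P x\<bar> \<le> C * ?X / hb" by (subst pos_le_divide_eq[OF hb_pos])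
  qed
  moreover have "(LINT x|\<mu>. \<bar>bg ?P x\<bar> powr q) = (LINT x|\<mu>. \<bar>dd c ?P x\<bar> powr q)"
  proof (rule integral_cong_AE)
    note Z = bgrad_pol[OF P]
    show "(\<lambda>x. \<bar>bg ?P x\<bar> powr q) \<in> borel_measurable \<mu>"
      using borel_measurable_integrable[OF W1_bgrad(2)[OF Z(1)]] by simp
    show "(\<lambda>x. \<bar>dd c ?P x\<bar> powr q) \<in> borel_measurable \<mu>"
      using continuous_imp_measurable_lebesgue_on[OF pol_continuous[OF dP]] by simp
    show "AE x in \<mu>. \<bar>bg ?P x\<bar> powr q = \<bar>dd c ?P x\<bar> powr q" using Z(2) by eventually_elim simp
  qed
  ultimately have b2: "(LINT x|\<mu>. \<bar>bg ?P x\<bar> powr q) \<le> (C * ?X / hb) powr q * vol" by simp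
  have hq: "(C * ?X / hb) powr q = hb powr (- q) * (C * ?X) powr q"
  proof -
    have "(C * ?X / hb) powr q = (C * ?X) powr q / hb powr q" by (rule powr_divide)
    then show ?thesis by (simp only: powr_minus divide_inverse mult.commute)
  qed
  have "elem_energy \<beta> q K ?P \<le> hb powr (- q) * ((C * ?X) powr q * vol) + hb powr (- q) * (C * ?X) powr q * vol"
    unfolding elem_energy_def elem_scale_eq by (intro add_mono mult_left_mono b1 b2[unfolded hq] powr_ge_zero)
  also have "\<dots> = 2 * C powr q * hb powr (- q) * (?X powr q * vol)"
    using C X0 by (simp only: powr_mult) (simp add: algebra_simps)
  also have "\<dots> \<le> 2 * C powr q * hb powr (- q) * (2 powr q * (?I1 + hb powr q * ?I2))"
    by (intro mult_left_mono XI) auto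
  also have "\<dots> = 2 * (2 * C) powr q * (hb powr (- q) * ?I1 + (hb powr (- q) * hb powr q) * ?I2)"
    using C by (simp only: powr_mult) (simp add: algebra_simps)
  also have "hb powr (- q) * hb powr q = 1" using hb_pos by (simp add: powr_minus)
  finally show ?thesis by (simp add: elem_energy_def elem_scale_eq)
qed

end

section \<open>Stability of the elements\<close>

text \<open>Zero sum makes |s| add up to twice the positive parts; if all entries were below 1 / (2
  n), with n their number, this would be less than 1.\<close>

lemma large_entry:
  fixes s :: "'a::finite \<Rightarrow> real"
  assumes 0: "(\<Sum>i\<in>UNIV. s i) = 0" and 1: "1 \<le> (\<Sum>i\<in>UNIV. \<bar>s i\<bar>)"
  shows "\<exists>i. 1 / (2 * real CARD('a)) \<le> s i"
proof (rule ccontr)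
  assume "\<not> ?thesis"
  then have lt: "s i < 1 / (2 * real CARD('a))" for i by (simp add: not_le)
  have "(\<Sum>i\<in>UNIV. \<bar>s i\<bar>) = (\<Sum>i\<in>UNIV. 2 * max (s i) 0 - s i)"
    by (rule sum.cong) (auto simp: max_def abs_if)
  also have "\<dots> = (\<Sum>i\<in>UNIV. 2 * max (s i) 0)" using 0 by (simp add: sum_subtractf)
  also have "\<dots> < (\<Sum>i\<in>(UNIV :: 'a set). 1 / real CARD('a))"
    by (rule sum_strict_mono) (use lt in \<open>auto simp: max_def field_simps\<close>)
  also have "\<dots> = 1" by simp
  finally show False using 1 by simp
qed

text \<open>For k = 1 the numbers h (\<nabla>\<lambda>_i . c) / |c| sum to zero while their absolute
  values sum to at least 1, so there are one large positive and one large negative entry, belonging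
  to two distinct facets. Otherwise the angle condition together with h |\<nabla>\<lambda>_i| \<ge>
  1 puts every facet above the threshold.\<close>

lemma stable_simplex_indices:
  fixes K :: "'n::finite vsimplex"
  assumes nd: "nondegenerate K" and b: "\<And>x. x \<in> cell K \<Longrightarrow> \<beta> x = c" and c: "c \<noteq> 0" and k: "k \<ge> 1" and \<theta>: "\<theta> > 0"
    and h: "k = 1 \<and> \<theta> = 1 / (2 * real CARD('n option)) \<or> (\<forall>i. \<theta> * norm c \<le> \<bar>c \<bullet> normal K i\<bar>)"
  shows "stable_simplex K \<beta> c k {i. \<theta> \<le> diameter (elem K) / norm c * \<bar>grd K i \<bullet> c\<bar>}"
proof
  let ?J = "{i. \<theta> \<le> diameter (elem K) / norm c * \<bar>grd K i \<bullet> c\<bar>}"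
  have d: "diameter (elem K) > 0" by (rule diameter_elem_pos[OF nd])
  show "grd K i \<bullet> c \<noteq> 0" if "i \<in> ?J" for i using that \<theta> by auto
  show "?J = UNIV \<or> k = 1 \<and> (\<exists>i\<in>?J. \<exists>j\<in>?J. i \<noteq> j)"
    using h
  proof
    assume h: "k = 1 \<and> \<theta> = 1 / (2 * real CARD('n option))"
    define s where "s = (\<lambda>i. diameter (elem K) / norm c * (grd K i \<bullet> c))"
    have s0: "(\<Sum>i\<in>UNIV. s i) = 0" unfolding s_def sum_distrib_left[symmetric] grd_sum[OF nd] by simp
    have "(\<Sum>i\<in>UNIV. \<bar>s i\<bar>) = diameter (elem K) / norm c * (\<Sum>i\<in>UNIV. \<bar>grd K i \<bullet> c\<bar>)"
      unfolding s_def using d by (simp add: abs_mult sum_distrib_left)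
    moreover have "norm c \<le> diameter (elem K) * (\<Sum>i\<in>UNIV. \<bar>grd K i \<bullet> c\<bar>)" by (rule norm_le_grd_sum[OF nd])
    ultimately have "norm c * 1 \<le> norm c * (\<Sum>i\<in>UNIV. \<bar>s i\<bar>)" using c by simp
    then have s1: "1 \<le> (\<Sum>i\<in>UNIV. \<bar>s i\<bar>)" by (rule mult_left_le_imp_le) (use c in simp)
    obtain i where i: "1 / (2 * real CARD('n option)) \<le> s i" using large_entry[OF s0 s1] by blast
    \<comment> \<open>Negation preserves both hypotheses of \<open>large_entry\<close> and so yields
      the large negative entry.\<close>
    obtain j where j: "1 / (2 * real CARD('n option)) \<le> - s j"
      using large_entry[of "\<lambda>i. - s i"] s0 s1 by (auto simp: sum_negf)
    have a: "diameter (elem K) / norm c * \<bar>grd K i \<bullet> c\<bar> = \<bar>s i\<bar>" for i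
      unfolding s_def using d by (simp add: abs_mult)
    have "i \<in> ?J" unfolding mem_Collect_eq a using i h by linarith
    moreover have "j \<in> ?J" unfolding mem_Collect_eq a using j h by linarith
    moreover have "i \<noteq> j"
    proof
      assume "i = j"
      then have "1 / (2 * real CARD('n option)) \<le> s j" using i by (simp only:)
      then have "1 / (2 * real CARD('n option)) \<le> 0" using j by linarith
      then show False using h \<theta> by linarith
    qed
    ultimately show ?thesis using h by blast
  next
    assume h: "\<forall>i. \<theta> * norm c \<le> \<bar>c \<bullet> normal K i\<bar>"
    have "\<theta> \<le> diameter (elem K) / norm c * \<bar>grd K i \<bullet> c\<bar>" for i
    proof -
      have g: "norm (grd K i) > 0" using grd_nonzero[OF nd] by simp
      have "\<theta> * norm c \<le> \<bar>grd K i \<bullet> c\<bar> / norm (grd K i)" using h by (simp add: inner_normal[OF nd])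
      then have "\<theta> * norm c * norm (grd K i) \<le> \<bar>grd K i \<bullet> c\<bar>" using g by (simp add: field_simps)
      then have "\<theta> * norm c * norm (grd K i) * diameter (elem K) \<le> \<bar>grd K i \<bullet> c\<bar> * diameter (elem K)"
        using d by (intro mult_right_mono) auto
      moreover have "\<theta> * norm c * 1 \<le> \<theta> * norm c * (norm (grd K i) * diameter (elem K))"
        using norm_grd_lower[OF nd, of i] \<theta> by (intro mult_left_mono) auto
      ultimately have "\<theta> * norm c \<le> \<bar>grd K i \<bullet> c\<bar> * diameter (elem K)" by simp
      then show ?thesis using c by (simp add: field_simps)
    qed
    then show ?thesis by auto
  qed
qed (use nd b k in auto)

section \<open>Residuals on one element\<close>

text \<open>Lebesgue measure is complete, so measurability is inherited by functions that agree
  almost everywhere.\<close>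

lemma measurable_lebesgue_on_AE:
  fixes f :: "'n::finite scalar"
  assumes D: "D \<in> sets lebesgue" and g: "g \<in> borel_measurable (lebesgue_on D)"
    and ae: "AE x in lebesgue_on D. f x = g x"
  shows "f \<in> borel_measurable (lebesgue_on D)"
proof -
  have "(\<lambda>x. indicator D x *\<^sub>R g x) \<in> borel_measurable lebesgue"
    using g D by (subst (asm) borel_measurable_restrict_space_iff) auto
  moreover have "AE x in lebesgue. indicator D x *\<^sub>R g x = indicator D x *\<^sub>R f x"
  proof -
    have "AE x in lebesgue. x \<in> D \<longrightarrow> f x = g x" using ae D by (subst (asm) AE_restrict_space_iff) auto
    then show ?thesis by eventually_elim (auto simp: indicator_def)
  qed
  ultimately have "(\<lambda>x. indicator D x *\<^sub>R f x) \<in> borel_measurable lebesgue" by (rule borel_measurable_AE)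
  then show ?thesis using D by (subst borel_measurable_restrict_space_iff) auto
qed

lemma weak_deriv_mono:
  fixes D :: "(real^'n::finite) set"
  assumes E: "open E" "E \<subseteq> D" and D: "open D" and w: "weak_deriv \<beta> D v g"
  shows "weak_deriv \<beta> E v g"
  unfolding weak_deriv_def
proof
  fix \<phi> :: "'n scalar" assume \<phi>: "\<phi> \<in> test_functions E"
  have *: "ip D f h = ip E f h" if "\<And>x. x \<notin> E \<Longrightarrow> h x = 0" for f h
  proof -
    have "indicator D x * (f x * h x) = indicator E x * (f x * h x)" for x
      using that[of x] E(2) by (auto simp: indicator_def)
    then show ?thesis unfolding ip_def using E(1) D
      by (subst (1 2) LINT_lebesgue_on) (auto intro: Bochner_Integration.integral_cong)
  qed
  have "\<phi> \<in> test_functions D" using \<phi> test_functions_mono[OF E(2)] by blast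
  then have "ip D v (\<lambda>x. frechet_derivative \<phi> (at x) (\<beta> x)) = - ip D g \<phi>" using w by (simp add: weak_deriv_def)
  moreover have "ip D v (\<lambda>x. frechet_derivative \<phi> (at x) (\<beta> x)) = ip E v (\<lambda>x. frechet_derivative \<phi> (at x) (\<beta> x))"
    by (rule *) (use test_zero_outside(2)[OF \<phi>] in \<open>simp add: dd_def\<close>)
  moreover have "ip D g \<phi> = ip E g \<phi>" by (rule *) (rule test_zero_outside(1)[OF \<phi>])
  ultimately show "ip E v (\<lambda>x. frechet_derivative \<phi> (at x) (\<beta> x)) = - ip E g \<phi>" by simp
qed

context simplex_field
begin

lemma QK_unique:
  assumes w: "w \<in> polys j" "\<And>r. r \<in> polys j \<Longrightarrow> ip (cell K) w r = ip (cell K) v r"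
  shows "QK j K v = w"
  unfolding QK_def
proof (rule the_equality)
  have spd: "spd (polys j :: 'n scalar set) (ip (cell K))"
    by (rule spd_subset[OF spd_L2[OF nd] polys_nat(1)])
  show "w \<in> polys j \<and> (\<forall>r\<in>polys j. ip (cell K) w r = ip (cell K) v r)" using w by blast
  fix y assume y: "y \<in> polys j \<and> (\<forall>r\<in>polys j. ip (cell K) y r = ip (cell K) v r)"
  let ?d = "\<lambda>x. y x + (-1) * w x"
  have d: "?d \<in> polys j" by (rule fsub_comb[OF polys_nat(2)]) (use y w in auto)
  have "ip (cell K) ?d ?d = ip (cell K) y ?d + (-1) * ip (cell K) w ?d"
    by (rule spd_comb[OF spd]) (use y w d in auto)
  also have "\<dots> = 0"
  proof -
    have "ip (cell K) y ?d = ip (cell K) v ?d" by (rule bspec[OF conjunct2[OF y] d])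
    moreover have "ip (cell K) w ?d = ip (cell K) v ?d" by (rule w(2)[OF d])
    ultimately show ?thesis by linarith
  qed
  finally have "?d = (\<lambda>x. 0)" by (rule spd_definite[OF spd d])
  then show "y = w" by (simp add: fun_eq_iff)
qed

lemma QK_props:
  assumes v: "integrable \<mu> v"
  shows "QK j K v \<in> polys j" "\<And>r. r \<in> polys j \<Longrightarrow> ip (cell K) (QK j K v) r = ip (cell K) v r"
proof -
  have spd: "spd (polys j :: 'n scalar set) (ip (cell K))"
    by (rule spd_subset[OF spd_L2[OF nd] polys_nat(1)])
  have sub: "polys j \<subseteq> Collect (pol (nat j) :: 'n scalar \<Rightarrow> bool)" by (rule polys_nat(1))
  have lin: "ip (cell K) v (\<lambda>x. f x + a * g x) = ip (cell K) v f + a * ip (cell K) v g"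
    if "f \<in> polys j" "g \<in> polys j" for f g a
  proof -
    have "pol (nat j) f" "pol (nat j) g" using that sub by blast+
    from ip_comb_left[OF this v] show ?thesis by (simp add: ip_def mult.commute)
  qed
  have "\<exists>r\<in>polys j. \<forall>z\<in>polys j. ip (cell K) z r = ip (cell K) v z"
    by (rule pol_riesz[OF sub polys_nat(2) spd]) (rule lin)
  then obtain r where r: "r \<in> polys j" "\<forall>z\<in>polys j. ip (cell K) z r = ip (cell K) v z"
    by - (erule bexE, rule that; assumption)
  have r': "ip (cell K) r z = ip (cell K) v z" if "z \<in> polys j" for z
    using bspec[OF r(2) that] spd_sym[OF spd r(1) that] by (rule trans[rotated])
  have "QK j K v = r" by (rule QK_unique[OF r(1) r'])
  then show "QK j K v \<in> polys j" "\<And>r. r \<in> polys j \<Longrightarrow> ip (cell K) (QK j K v) r = ip (cell K) v r"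
    using r(1) r' by auto
qed

end

text \<open>The contribution of one element to the residual of the pair (y, D_h z); the last term is
  positive because it enters the bilinear form with a minus sign.\<close>

definition elem_residual ::
  "'n::finite field \<Rightarrow> 'n vsimplex \<Rightarrow> 'n scalar \<Rightarrow> 'n scalar \<Rightarrow> 'n scalar \<Rightarrow> 'n functional" where
  "elem_residual \<beta> K f z y v = ip (cell K) f v - DK \<beta> K z v + ip (cell K) y (bgrad \<beta> (cell K) v)"

text \<open>z is continuous and piecewise polynomial, so it equals its polynomial on the closed
  element; y is a representative in a broken space and agrees with its polynomial only almost
  everywhere.\<close>

locale elem_problem = stable_simplex K \<beta> c k J + conjugate_exponents p q
  for K :: "'n::finite vsimplex" and \<beta> c k J p q +
  fixes f z y zp yp :: "'n scalar"
  assumes f: "f \<in> Lsp p (cell K)" and zp: "pol k zp" "\<And>x. x \<in> elem K \<Longrightarrow> z x = zp x"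
    and yp: "pol (k - 1) yp" "AE x in lebesgue_on (cell K). y x = yp x"
begin

abbreviation "R \<equiv> elem_residual \<beta> K f z y"
abbreviation "Q \<equiv> QK (max (int k - 2) 0) K f"
abbreviation "PI \<equiv> PiKpp \<beta> k K"

lemma q1: "1 \<le> q" using q_gt_1 by simp
lemma p1: "1 \<le> p" using p by simp

lemma y_Lsp: "y \<in> Lsp p (cell K)"
proof -
  have "yp \<in> Lsp p (cell K)" by (rule pol_Lsp[OF _ yp(1)]) (use p in simp)
  moreover from this have "y \<in> borel_measurable \<mu>"
    by (intro measurable_lebesgue_on_AE[OF _ _ yp(2)]) (auto simp: Lsp_def)
  ultimately show ?thesis using yp(2) by (rule Lsp_cong_AE)
qed

lemma DK_z: "DK \<beta> K z v = DK \<beta> K zp v"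
proof -
  have e: "z x = zp x" if "x \<in> cell K" for x using zp(2) that interior_subset by blast
  have "bg z = bg zp" by (rule W1_cong(2)[OF e])
  moreover have "ip (cell K) z (bg v) = ip (cell K) zp (bg v)" by (rule ip_cong) (simp add: e)
  ultimately show ?thesis by (simp add: DK_def)
qed

lemma residual_eq:
  assumes v: "v \<in> Wsp q \<beta> (cell K)"
  shows "R v = ip (cell K) f v - DK \<beta> K zp v + ip (cell K) yp (bg v)"
proof -
  note V = Wsp_bgrad[OF q1 v]
  have "ip (cell K) y (bg v) = ip (cell K) yp (bg v)"
  proof (rule ip_cong_AE)
    show "integrable \<mu> (\<lambda>x. y x * bg v x)" by (rule product_integrable[OF y_Lsp V(3)])
    show "integrable \<mu> (\<lambda>x. yp x * bg v x)" by (rule ip_mult_integrable(1)[OF yp(1) W1_bgrad(2)[OF V(1)]])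
    show "AE x in \<mu>. y x * bg v x = yp x * bg v x" using yp(2) by eventually_elim simp
  qed
  then show ?thesis by (simp add: elem_residual_def DK_z)
qed

lemma ip_comb_right':
  assumes h: "h \<in> Lsp p (cell K)" and v: "v \<in> Lsp q (cell K)" and w: "w \<in> Lsp q (cell K)"
  shows "ip (cell K) h (\<lambda>x. v x + a * w x) = ip (cell K) h v + a * ip (cell K) h w"
proof -
  note i = product_integrable[OF h v] product_integrable[OF h w]
  have "(LINT x|\<mu>. h x * (v x + a * w x)) = (LINT x|\<mu>. h x * v x + a * (h x * w x))"
    by (simp add: algebra_simps)
  also have "\<dots> = (LINT x|\<mu>. h x * v x) + a * (LINT x|\<mu>. h x * w x)"
    using i by simp
  finally show ?thesis by (simp add: ip_def)
qed

lemma residual_comb: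
  assumes v: "v \<in> Wsp q \<beta> (cell K)" and w: "w \<in> Wsp q \<beta> (cell K)"
  shows "R (\<lambda>x. v x + a * w x) = R v + a * R w"
proof -
  note V = Wsp_bgrad[OF q1 v] and W = Wsp_bgrad[OF q1 w]
  show ?thesis
    unfolding residual_eq[OF v] residual_eq[OF w] residual_eq[OF Wsp_comb[OF q1 v w]]
    unfolding ip_comb_right'[OF f V(2) W(2)] DK_comb_right[OF zp(1) V(1) W(1)] ip_bgrad_comb[OF yp(1) V(1) W(1)]
    by (simp add: algebra_simps)
qed

lemma PiKpp_Wsp: "v \<in> Wsp q \<beta> (cell K) \<Longrightarrow> PI v \<in> Wsp q \<beta> (cell K)"
  by (rule pol_Wsp[OF q1 PiKpp_pol(1)]) (rule Wsp_bgrad(1)[OF q1])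

lemma f_integrable: "integrable \<mu> f"
  by (rule Lsp_integrable[OF p1 f])

lemma Q_Lsp: "Q \<in> Lsp p (cell K)"
proof -
  have "Q \<in> Collect (pol (nat (max (int k - 2) 0)))" by (rule subsetD[OF polys_nat(1) QK_props(1)[OF f_integrable]])
  then show ?thesis using p by (intro pol_Lsp) auto
qed

lemma oscillation_Lsp: "(\<lambda>x. f x - Q x) \<in> Lsp p (cell K)"
  using Lsp_comb[OF _ f Q_Lsp, of "-1"] p by simp

text \<open>By construction of the projection \<open>v - PI v\<close> is orthogonal to the discrete parts of the residual and to \<open>Q\<close>.\<close>

lemma residual_projection:
  assumes v: "v \<in> Wsp q \<beta> (cell K)"
  shows "R v = R (PI v) + ip (cell K) (\<lambda>x. f x - Q x) (\<lambda>x. v x - PI v x)"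
proof -
  note V = Wsp_bgrad[OF q1 v]
  note P = PiKpp_Wsp[OF v]
  let ?d = "\<lambda>x. PI v x - v x"
  have d: "?d \<in> Wsp q \<beta> (cell K)" using Wsp_comb[OF q1 P v, of "-1"] by simp
  have "R ?d = R (PI v) - R v" using residual_comb[OF P v, of "-1"] by simp
  \<comment> \<open>\<open>PiKpp_DK\<close> removes the term with z, a polynomial of degree k, and
    \<open>PiKpp_gradient_orthogonal\<close> the one with y, of degree k - 1.\<close>
  moreover have "R ?d = ip (cell K) f ?d"
    by (subst residual_eq[OF d]) (simp only: PiKpp_DK[OF V(1) zp(1)] PiKpp_gradient_orthogonal[OF V(1) yp(1)] diff_0_right add_0_right)
  moreover have "ip (cell K) f ?d = ip (cell K) Q ?d - ip (cell K) (\<lambda>x. f x - Q x) (\<lambda>x. v x - PI v x)"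
  proof -
    note D = Wsp_bgrad(2)[OF q1 d]
    note i = product_integrable[OF Q_Lsp D] product_integrable[OF oscillation_Lsp D]
    have "ip (cell K) f ?d = (LINT x|\<mu>. Q x * ?d x + (f x - Q x) * ?d x)"
      unfolding ip_def by (simp add: algebra_simps)
    also have "\<dots> = ip (cell K) Q ?d + (LINT x|\<mu>. (f x - Q x) * ?d x)"
      unfolding ip_def by (rule Bochner_Integration.integral_add[OF i])
    also have "(LINT x|\<mu>. (f x - Q x) * ?d x) = (LINT x|\<mu>. - ((f x - Q x) * (v x - PI v x)))"
      by (simp add: algebra_simps)
    also have "\<dots> = - ip (cell K) (\<lambda>x. f x - Q x) (\<lambda>x. v x - PI v x)" by (simp only: ip_def integral_minus)
    finally show ?thesis by simp
  qed
  moreover have "ip (cell K) Q ?d = 0"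
    by (rule PiKpp_orthogonal[OF V(1) QK_props(1)[OF f_integrable]])
  ultimately show ?thesis by linarith
qed

lemma Q_constant:
  assumes w: "w \<in> polys 0" "AE x in \<mu>. f x = w x"
  shows "AE x in \<mu>. f x - Q x = 0"
proof -
  let ?m = "max (int k - 2) 0"
  have w': "pol 0 w" using w(1) polys_eq_pol[of 0, where 'n='n] by auto
  have "?m = int (nat ?m)" by simp
  then have "w \<in> polys ?m" using pol_mono[OF _ w'] polys_eq_pol[of "nat ?m", where 'n='n]
    by (metis le0 mem_Collect_eq)
  then have "Q = w"
  proof (rule QK_unique)
    fix r assume "r \<in> (polys ?m :: 'n scalar set)"
    then have r: "pol (nat ?m) r" using polys_nat(1) by blast
    show "ip (cell K) w r = ip (cell K) f r"
    proof (rule ip_cong_AE)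
      show "integrable \<mu> (\<lambda>x. w x * r x)" by (rule ip_mult_integrable(2)[OF r pol_integrable[OF nd w']])
      show "integrable \<mu> (\<lambda>x. f x * r x)" by (rule ip_mult_integrable(2)[OF r f_integrable])
      show "AE x in \<mu>. w x * r x = f x * r x" using w(2) by eventually_elim simp
    qed
  qed
  then show ?thesis using w(2) by (auto elim: eventually_mono)
qed

end

section \<open>Meshes\<close>

text \<open>At a point of the interior of the closure outside the domain, moving up along the axis
  of the graph leads to a point strictly above the graph but still in the closure, although no
  points of the domain are nearby. This excludes slits, so that cells of a mesh covering the closure
  lie in the domain.\<close>

lemma lipschitz_domain_interior_closure:
  fixes \<Omega> :: "(real^'n::finite) set"
  assumes "lipschitz_domain \<Omega>"
  shows "interior (closure \<Omega>) \<subseteq> \<Omega>"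
proof
  fix x assume x: "x \<in> interior (closure \<Omega>)"
  have op: "open \<Omega>" using assms by (simp add: lipschitz_domain_def)
  show "x \<in> \<Omega>"
  proof (rule ccontr)
    assume n: "x \<notin> \<Omega>"
    then have "x \<in> frontier \<Omega>" using x op interior_subset by (auto simp: frontier_def interior_open)
    then obtain U e L and \<gamma> :: "'n scalar" where U: "open U" "x \<in> U" and e: "norm e = 1"
      and L: "L-lipschitz_on {y. y \<bullet> e = 0} \<gamma>" and eq: "\<Omega> \<inter> U = {y \<in> U. y \<bullet> e < \<gamma> (y - (y \<bullet> e) *\<^sub>R e)}"
      using assms unfolding lipschitz_domain_def by meson
    have ee: "e \<bullet> e = 1" using e by (simp add: dot_square_norm)
    \<comment> \<open>Height above the graph: within U the domain is where h is negative, and h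
      grows at unit speed in direction e.\<close>
    define h where "h = (\<lambda>y. y \<bullet> e - \<gamma> (y - (y \<bullet> e) *\<^sub>R e))"
    have "continuous_on UNIV (\<lambda>y. \<gamma> (y - (y \<bullet> e) *\<^sub>R e))"
    proof (rule continuous_on_compose2[OF lipschitz_on_continuous_on[OF L]])
      show "continuous_on UNIV (\<lambda>y. y - (y \<bullet> e) *\<^sub>R e)" by (intro continuous_intros)
      show "(\<lambda>y. y - (y \<bullet> e) *\<^sub>R e) ` UNIV \<subseteq> {y. y \<bullet> e = 0}"
        by (simp add: image_subset_iff inner_diff_left ee)
    qed
    then have h: "continuous_on UNIV h" unfolding h_def by (intro continuous_intros)
    define W where "W = U \<inter> interior (closure \<Omega>)"
    have W: "open W" "x \<in> W" using U x by (auto simp: W_def)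
    have shift: "h (x + t *\<^sub>R e) = h x + t" for t
      by (simp add: h_def inner_add_left ee algebra_simps)
    have neg: "y \<in> \<Omega> \<and> y \<in> U \<longleftrightarrow> y \<in> U \<and> h y < 0" for y
      using arg_cong[OF eq, of "\<lambda>S. y \<in> S"] by (simp add: h_def)
    have hx: "h x \<ge> 0" using n U(2) neg[of x] by linarith
    have "continuous_on UNIV (\<lambda>t. x + t *\<^sub>R e)" by (intro continuous_intros)
    then have "open ((\<lambda>t. x + t *\<^sub>R e) -` W)" using W(1) by (rule open_vimage[rotated])
    then obtain d where d: "d > 0" "ball 0 d \<subseteq> (\<lambda>t. x + t *\<^sub>R e) -` W"
      using W(2) unfolding open_contains_ball by force
    define y where "y = x + (d / 2) *\<^sub>R e"
    have y: "y \<in> W" "h y > 0" using d hx by (auto simp: y_def shift subset_iff dist_norm)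
    have "open (W \<inter> h -` {0<..})" using W(1) open_vimage[OF open_greaterThan h] by (rule open_Int)
    moreover have "y \<in> closure \<Omega>" using y(1) interior_subset by (auto simp: W_def)
    moreover have "y \<in> W \<inter> h -` {0<..}" using y by simp
    ultimately have "\<Omega> \<inter> (W \<inter> h -` {0<..}) \<noteq> {}" by (metis open_Int_closure_eq_empty disjoint_iff inf_commute)
    then obtain w where "w \<in> \<Omega>" "w \<in> U" "h w > 0" by (auto simp: W_def)
    then show False using neg[of w] by linarith
  qed
qed

locale mesh =
  fixes \<Omega> :: "(real^'n::finite) set" and \<T> :: "'n vsimplex set"
  assumes lip: "lipschitz_domain \<Omega>" and conf: "conforming_mesh \<Omega> \<T>"
begin

lemma finite_mesh: "finite \<T>" using conf by (simp add: conforming_mesh_def)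

lemma mesh_nondegenerate: "K \<in> \<T> \<Longrightarrow> nondegenerate K" using conf by (simp add: conforming_mesh_def)

lemma mesh_cover: "(\<Union>K\<in>\<T>. elem K) = closure \<Omega>" using conf by (simp add: conforming_mesh_def)

lemma domain_open: "open \<Omega>" using lip by (simp add: lipschitz_domain_def)

lemma cell_subset: assumes "K \<in> \<T>" shows "cell K \<subseteq> \<Omega>"
proof -
  have "elem K \<subseteq> closure \<Omega>" using assms mesh_cover by blast
  then have "cell K \<subseteq> interior (closure \<Omega>)" by (rule interior_mono)
  then show ?thesis using lipschitz_domain_interior_closure[OF lip] by blast
qed

text \<open>Distinct vertex sets of equal size leave some vertex of K unshared. By conformity its
  barycentric coordinate vanishes on the intersection of the elements, whereas it is positive in the
  cell.\<close>

lemma cells_disjoint: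
  assumes K: "K \<in> \<T>" and K': "K' \<in> \<T>" and ne: "K \<noteq> K'"
  shows "cell K \<inter> cell K' = {}"
proof -
  note nd = mesh_nondegenerate[OF K] and nd' = mesh_nondegenerate[OF K']
  have r: "range K \<noteq> range K'" and i: "elem K \<inter> elem K' = convex hull (range K \<inter> range K')"
    using conf K K' ne by (auto simp: conforming_mesh_def)
  have "card (range K) = card (range K')"
    using nd nd' by (simp add: nondegenerate_def card_image)
  then have "\<not> range K \<subseteq> range K'" using r card_subset_eq[of "range K'" "range K"] by auto
  then obtain m where m: "K m \<notin> range K'" by blast
  have im: "range K \<inter> range K' = K ` {j. K j \<in> range K'}" by blast
  have "bary K m x = 0" if "x \<in> elem K" "x \<in> elem K'" for x
  proof -
    have "x \<in> convex hull (K ` {j. K j \<in> range K'})" using that i im by auto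
    then show ?thesis using m unfolding convex_hull_vertices[OF nd] by auto
  qed
  moreover have "bary K m x > 0" if "x \<in> cell K" for x using that unfolding cell_bary[OF nd] by auto
  moreover have "cell K \<subseteq> elem K" "cell K' \<subseteq> elem K'" by (rule interior_subset)+
  ultimately show ?thesis by fastforce
qed

lemma indicator_cell:
  "K \<in> \<T> \<Longrightarrow> x \<in> cell K \<Longrightarrow> K' \<in> \<T> \<Longrightarrow> indicator (cell K') x = (if K' = K then 1 else (0::real))"
  using cells_disjoint[of K K'] by (auto simp: indicator_def)

lemma sum_indicator_cell:
  assumes "K \<in> \<T>" "x \<in> cell K"
  shows "(\<Sum>K'\<in>\<T>. indicator (cell K') x * g K') = (g K :: real)"
proof -
  have "(\<Sum>K'\<in>\<T>. indicator (cell K') x * g K') = (\<Sum>K'\<in>\<T>. if K' = K then g K' else 0)"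
    by (rule sum.cong[OF refl]) (use indicator_cell[OF assms] in auto)
  then show ?thesis using assms(1) finite_mesh by simp
qed

text \<open>A point of the domain outside all cells lies on the frontier of an element covering it,
  and frontiers of convex sets are null.\<close>

lemma AE_partition: "AE x in lebesgue. (\<Sum>K\<in>\<T>. indicator (cell K) x) = (indicator \<Omega> x :: real)"
proof -
  have "negligible (\<Union>K\<in>\<T>. frontier (elem K))"
    using finite_mesh by (intro negligible_Union) (auto simp: elem_def intro!: negligible_convex_frontier)
  then have N: "(\<Union>K\<in>\<T>. frontier (elem K)) \<in> null_sets lebesgue" by (simp add: negligible_iff_null_sets)
  show ?thesis
  proof (rule AE_I'[OF N], rule subsetI)
    fix x :: "real^'n" assume "x \<in> {x \<in> space lebesgue. (\<Sum>K\<in>\<T>. indicator (cell K) x) \<noteq> (indicator \<Omega> x :: real)}"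
    then have x: "(\<Sum>K\<in>\<T>. indicator (cell K) x) \<noteq> (indicator \<Omega> x :: real)" by simp
    have no: "x \<notin> cell K" if K: "K \<in> \<T>" for K
    proof
      assume c: "x \<in> cell K"
      then have "x \<in> \<Omega>" using cell_subset[OF K] by blast
      then show False using x sum_indicator_cell[OF K c, of "\<lambda>_. 1"] by simp
    qed
    then have "(\<Sum>K\<in>\<T>. indicator (cell K) x) = (0::real)" by simp
    then have "x \<in> \<Omega>" using x by (auto simp: indicator_def)
    then obtain K where K: "K \<in> \<T>" "x \<in> elem K" using mesh_cover closure_subset by blast
    then have "x \<in> frontier (elem K)" using no[OF K(1)] closure_subset by (auto simp: frontier_def)
    then show "x \<in> (\<Union>K\<in>\<T>. frontier (elem K))" using K(1) by blast
  qed
qed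

lemma ip_mesh:
  assumes i: "\<And>K. K \<in> \<T> \<Longrightarrow> integrable (lebesgue_on (cell K)) (\<lambda>x. f x * v x)"
  shows "ip \<Omega> f v = (\<Sum>K\<in>\<T>. ip (cell K) f v)"
proof -
  let ?g = "\<lambda>x. \<Sum>K\<in>\<T>. indicator (cell K) x * (f x * v x)"
  have i': "integrable lebesgue (\<lambda>x. indicator (cell K) x * (f x * v x))" if "K \<in> \<T>" for K
    using i[OF that] by (simp add: integrable_lebesgue_on)
  have ig: "integrable lebesgue ?g" by (rule Bochner_Integration.integrable_sum[OF i'])
  have ae: "AE x in lebesgue. ?g x = indicator \<Omega> x * (f x * v x)"
    using AE_partition by eventually_elim (simp add: sum_distrib_right[symmetric])
  have "(\<Sum>K\<in>\<T>. ip (cell K) f v) = (\<Sum>K\<in>\<T>. LINT x|lebesgue. indicator (cell K) x * (f x * v x))"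
    unfolding ip_def by (rule sum.cong[OF refl], rule LINT_lebesgue_on) simp
  also have "\<dots> = (LINT x|lebesgue. ?g x)" by (rule Bochner_Integration.integral_sum[OF i', symmetric])
  also have "\<dots> = (LINT x|lebesgue. indicator \<Omega> x * (f x * v x))"
    by (rule integral_cong_AE[OF borel_measurable_integrable[OF ig]
          borel_measurable_AE[OF borel_measurable_integrable[OF ig] ae] ae])
  also have "\<dots> = ip \<Omega> f v" unfolding ip_def by (rule LINT_lebesgue_on[symmetric]) (use domain_open in auto)
  finally show ?thesis by simp
qed

lemma Pihpp_cell: "K \<in> \<T> \<Longrightarrow> x \<in> cell K \<Longrightarrow> Pihpp \<T> \<beta> k v x = PiKpp \<beta> k K v x"
  unfolding Pihpp_def by (rule sum_indicator_cell)

end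

section \<open>The error functional\<close>

text \<open>B controls the q-th power of the local norm. The powers add up over the elements, so the
  global norm bound is B powr (1 / q) irrespective of their number.\<close>

locale mesh_problem = mesh \<Omega> \<T> + conjugate_exponents p q
  for \<Omega> :: "(real^'n::finite) set" and \<T> p q +
  fixes \<beta> :: "'n field" and k :: nat and J :: "'n vsimplex \<Rightarrow> 'n option set" and B :: real
  assumes stable: "\<And>K. K \<in> \<T> \<Longrightarrow> stable_simplex K \<beta> (beta_on \<beta> K) k (J K)"
    and B: "B \<ge> 0" and energy: "\<And>K v. K \<in> \<T> \<Longrightarrow> v \<in> Wsp q \<beta> (cell K) \<Longrightarrow>
      elem_energy \<beta> q K (PiKpp \<beta> k K v) \<le> B * elem_energy \<beta> q K v"
begin

abbreviation "Y \<equiv> Ysp \<T> \<beta> q"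
abbreviation "N \<equiv> Ynorm \<T> \<beta> q"
abbreviation "\<P> \<equiv> Pihpp \<T> \<beta> k"
abbreviation "E \<equiv> elem_energy \<beta> q"

lemma q1: "1 \<le> q" and q0: "0 < q" using q_gt_1 by auto
lemma p0: "0 < p" using p by simp

lemma field_K: "K \<in> \<T> \<Longrightarrow> simplex_field K \<beta> (beta_on \<beta> K)"
  using stable by (simp add: stable_simplex_def)

lemma scale_pos: assumes "K \<in> \<T>" shows "elem_scale \<beta> K > 0"
proof -
  interpret stable_simplex K \<beta> "beta_on \<beta> K" k "J K" by (rule stable[OF assms])
  show ?thesis using hb_pos by (simp add: elem_scale_eq)
qed

lemma Wsp_cong:
  assumes K: "K \<in> \<T>" and v: "v \<in> Wsp q \<beta> (cell K)" and e: "\<And>x. x \<in> cell K \<Longrightarrow> w x = v x"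
  shows "w \<in> Wsp q \<beta> (cell K)"
proof -
  obtain g where g: "g \<in> Lsp q (cell K)" "weak_deriv \<beta> (cell K) v g" and vL: "v \<in> Lsp q (cell K)"
    using v by (auto simp: Wsp_def)
  have "weak_deriv \<beta> (cell K) w g" using g(2) weak_deriv_cong[of "cell K" w v g g \<beta>] e by simp
  moreover have "w \<in> Lsp q (cell K)"
  proof (rule Lsp_cong_AE[OF vL])
    show "w \<in> borel_measurable (lebesgue_on (cell K))"
      by (rule measurable_lebesgue_on_AE[of _ v]) (use vL e in \<open>auto simp: Lsp_def intro: AE_I2\<close>)
    show "AE x in lebesgue_on (cell K). w x = v x" by (rule AE_I2) (simp add: e)
  qed
  ultimately show ?thesis using g(1) by (auto simp: Wsp_def)
qed

lemma YspD: "v \<in> Y \<Longrightarrow> K \<in> \<T> \<Longrightarrow> v \<in> Wsp q \<beta> (cell K)"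
  by (simp add: Ysp_def)

lemma projection_Wsp: assumes K: "K \<in> \<T>" and v: "v \<in> Wsp q \<beta> (cell K)" shows "PiKpp \<beta> k K v \<in> Wsp q \<beta> (cell K)"
proof -
  interpret stable_simplex K \<beta> "beta_on \<beta> K" k "J K" by (rule stable[OF K])
  show ?thesis by (rule pol_Wsp[OF q1 PiKpp_pol(1)[OF Wsp_bgrad(1)[OF q1 v]]])
qed

lemma projection_Ysp: assumes v: "v \<in> Y" shows "\<P> v \<in> Y"
  unfolding Ysp_def mem_Collect_eq
proof
  fix K assume K: "K \<in> \<T>"
  show "\<P> v \<in> Wsp q \<beta> (cell K)"
    by (rule Wsp_cong[OF K projection_Wsp[OF K YspD[OF v K]] Pihpp_cell[OF K]])
qed

lemma projection_broken: assumes v: "v \<in> Y" shows "\<P> v \<in> broken \<T> (VKpp \<beta> k)"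
  unfolding broken_def mem_Collect_eq
proof (intro ballI bexI)
  fix K assume K: "K \<in> \<T>"
  interpret stable_simplex K \<beta> "beta_on \<beta> K" k "J K" by (rule stable[OF K])
  show "PiKpp \<beta> k K v \<in> VKpp \<beta> k K" by (rule PiKpp_VKpp[OF Wsp_bgrad(1)[OF q1 YspD[OF v K]]])
  show "AE x in lebesgue_on (cell K). \<P> v x = PiKpp \<beta> k K v x"
    by (rule AE_I2) (simp add: Pihpp_cell[OF K])
qed

lemma norm_energy: "N v = (\<Sum>K\<in>\<T>. E K v) powr (1 / q)"
  by (rule Ynorm_energy[OF q0])

lemma energy_sum_nonneg: "(\<Sum>K\<in>\<T>. E K v) \<ge> 0"
  by (intro sum_nonneg elem_energy_nonneg)

lemma norm_nonneg: "N v \<ge> 0" by (simp add: norm_energy)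

lemma norm_le:
  assumes C: "C \<ge> 0" and le: "\<And>K. K \<in> \<T> \<Longrightarrow> E K w \<le> C * E K v"
  shows "N w \<le> C powr (1 / q) * N v"
proof -
  have "(\<Sum>K\<in>\<T>. E K w) \<le> C * (\<Sum>K\<in>\<T>. E K v)" unfolding sum_distrib_left by (rule sum_mono[OF le])
  then have "(\<Sum>K\<in>\<T>. E K w) powr (1 / q) \<le> (C * (\<Sum>K\<in>\<T>. E K v)) powr (1 / q)"
    using q0 energy_sum_nonneg by (intro powr_mono2) auto
  then show ?thesis using C energy_sum_nonneg by (simp add: norm_energy powr_mult)
qed

lemma projection_energy: "K \<in> \<T> \<Longrightarrow> E K (\<P> v) = E K (PiKpp \<beta> k K v)"
  by (rule elem_energy_cong) (rule Pihpp_cell)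

lemma projection_norm: "v \<in> Y \<Longrightarrow> N (\<P> v) \<le> B powr (1 / q) * N v"
  by (rule norm_le[OF B]) (simp only: projection_energy energy YspD)

lemma complement_norm:
  assumes v: "v \<in> Y" shows "N (\<lambda>x. v x - \<P> v x) \<le> (2 powr q * (1 + B)) powr (1 / q) * N v"
proof (rule norm_le)
  show "0 \<le> 2 powr q * (1 + B)" using B by simp
  fix K assume K: "K \<in> \<T>"
  interpret stable_simplex K \<beta> "beta_on \<beta> K" k "J K" by (rule stable[OF K])
  have "E K (\<lambda>x. v x - \<P> v x) = E K (\<lambda>x. v x - PiKpp \<beta> k K v x)"
    by (rule elem_energy_cong) (simp add: Pihpp_cell[OF K])
  also have "\<dots> \<le> 2 powr q * (E K v + E K (PiKpp \<beta> k K v))"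
    by (rule energy_comb[OF q1 YspD[OF v K] projection_Wsp[OF K YspD[OF v K]]])
  also have "\<dots> \<le> 2 powr q * (E K v + B * E K v)"
    by (intro mult_left_mono add_left_mono energy[OF K YspD[OF v K]]) auto
  finally show "E K (\<lambda>x. v x - \<P> v x) \<le> 2 powr q * (1 + B) * E K v" by (simp add: algebra_simps)
qed

lemma norm_pos:
  assumes v: "v \<in> Y" and nz: "nonzero \<T> v" shows "N v > 0"
proof -
  obtain K where K: "K \<in> \<T>" and n: "\<not> (AE x in lebesgue_on (cell K). v x = 0)" using nz by (auto simp: nonzero_def)
  have vL: "v \<in> Lsp q (cell K)" using YspD[OF v K] by (simp add: Wsp_def)
  have "(LINT x|lebesgue_on (cell K). \<bar>v x\<bar> powr q) \<noteq> 0" using powr_integral_zero[OF q0 vL] n by blast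
  moreover have "(LINT x|lebesgue_on (cell K). \<bar>v x\<bar> powr q) \<ge> 0" by (intro Bochner_Integration.integral_nonneg) auto
  ultimately have "(LINT x|lebesgue_on (cell K). \<bar>v x\<bar> powr q) > 0" by linarith
  then have "elem_scale \<beta> K powr (- q) * (LINT x|lebesgue_on (cell K). \<bar>v x\<bar> powr q) > 0"
    using scale_pos[OF K] by simp
  moreover have "(LINT x|lebesgue_on (cell K). \<bar>bgrad \<beta> (cell K) v x\<bar> powr q) \<ge> 0"
    by (intro Bochner_Integration.integral_nonneg) auto
  ultimately have "E K v > 0" unfolding elem_energy_def by linarith
  also have "E K v \<le> (\<Sum>K\<in>\<T>. E K v)" using K finite_mesh elem_energy_nonneg by (intro member_le_sum) auto
  finally show ?thesis by (simp add: norm_energy)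
qed

lemma op_norm_le:
  assumes "\<And>v. v \<in> Y \<Longrightarrow> N (A v) \<le> M * N v" shows "op_norm \<T> \<beta> q A \<le> ereal M"
  unfolding op_norm_def
proof (rule SUP_least)
  fix v assume "v \<in> {v \<in> Y. nonzero \<T> v}"
  then show "ereal (N (A v) / N v) \<le> ereal M" using assms[of v] norm_pos[of v] by (simp add: pos_divide_le_eq)
qed

lemma op_norm_ge:
  "v \<in> Y \<Longrightarrow> nonzero \<T> v \<Longrightarrow> ereal (N (A v) / N v) \<le> op_norm \<T> \<beta> q A"
  unfolding op_norm_def by (rule SUP_upper) simp

end

locale error_problem = mesh_problem \<Omega> \<T> p q \<beta> k J B
  for \<Omega> :: "(real^'n::finite) set" and \<T> p q \<beta> k J B +
  fixes Yh :: "'n scalar set" and f u y z :: "'n scalar"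
  assumes Yh: "Yh \<subseteq> Y" "broken \<T> (VKpp \<beta> k) \<subseteq> Yh"
    and f: "f \<in> Lsp p \<Omega>" and u: "u \<in> Lsp p \<Omega>" "weak_deriv \<beta> \<Omega> u f"
    and y: "y \<in> broken \<T> (\<lambda>_. polys (int k - 1))" and z: "z \<in> Sh0 \<Omega> \<T> \<beta> k"
begin

abbreviation "r K \<equiv> elem_residual \<beta> K f z y"
definition "R v = (\<Sum>K\<in>\<T>. r K v)"
abbreviation "\<eta> \<equiv> dual_norm \<T> \<beta> q Yh R"

lemma elem_problem:
  assumes K: "K \<in> \<T>" shows "\<exists>zp yp. elem_problem K \<beta> (beta_on \<beta> K) k (J K) p q f z y zp yp"
proof -
  interpret stable_simplex K \<beta> "beta_on \<beta> K" k "J K" by (rule stable[OF K])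
  obtain zp where zp: "zp \<in> polys (int k)" "\<forall>x\<in>elem K. z x = zp x" using z K unfolding Sh0_def by blast
  obtain yp where yp: "yp \<in> polys (int k - 1)" "AE x in lebesgue_on (cell K). y x = yp x" using y K unfolding broken_def by blast
  have "pol k zp" using zp(1) by (simp add: polys_eq_pol)
  moreover have "pol (k - 1) yp" using yp(1) k polys_eq_pol[of "k - 1", where 'n='n] by (simp add: of_nat_diff)
  moreover have "f \<in> Lsp p (cell K)"
    by (rule Lsp_subset[OF f _ _ cell_subset[OF K]]) (use domain_open in auto)
  ultimately have "elem_problem K \<beta> (beta_on \<beta> K) k (J K) p q f z y zp yp"
    using zp(2) yp(2) by unfold_locales auto
  then show ?thesis by blast
qed

lemma error_elem:
  assumes K: "K \<in> \<T>" and v: "v \<in> Wsp q \<beta> (cell K)"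
  shows "integrable (lebesgue_on (cell K)) (\<lambda>x. f x * v x)"
    "DK \<beta> K u v - DK \<beta> K z v - ip (cell K) (\<lambda>x. u x - y x) (bgrad \<beta> (cell K) v) = r K v"
proof -
  obtain zp yp where "elem_problem K \<beta> (beta_on \<beta> K) k (J K) p q f z y zp yp" using elem_problem[OF K] by blast
  then interpret e: elem_problem K \<beta> "beta_on \<beta> K" k "J K" p q f z y zp yp .
  note V = e.Wsp_bgrad[OF q1 v]
  show fv: "integrable (lebesgue_on (cell K)) (\<lambda>x. f x * v x)" by (rule product_integrable[OF e.f V(2)])
  have uL: "u \<in> Lsp p (cell K)"
    by (rule Lsp_subset[OF u(1) _ _ cell_subset[OF K]]) (use domain_open in auto)
  have w: "weak_deriv \<beta> (cell K) u f"
    by (rule weak_deriv_mono[OF open_interior cell_subset[OF K] domain_open u(2)])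
  have uW: "u \<in> Wsp p \<beta> (cell K)" by (rule e.Wsp_I[OF e.p1 uL e.f w])
  note U = e.Wsp_bgrad[OF e.p1 uW]
  have ae: "AE x in lebesgue_on (cell K). bgrad \<beta> (cell K) u x = f x"
    by (rule W1_I(2)[OF W1_bgrad(1)[OF U(1)] e.f_integrable w])
  have "ip (cell K) (bgrad \<beta> (cell K) u) v = ip (cell K) f v"
    by (rule ip_cong_AE[OF product_integrable[OF U(3) V(2)] fv]) (use ae in eventually_elim, simp)
  moreover have "ip (cell K) (\<lambda>x. u x - y x) (bgrad \<beta> (cell K) v)
      = ip (cell K) u (bgrad \<beta> (cell K) v) - ip (cell K) y (bgrad \<beta> (cell K) v)"
    unfolding ip_def left_diff_distrib
    by (rule Bochner_Integration.integral_diff[OF product_integrable[OF uL V(3)] product_integrable[OF e.y_Lsp V(3)]])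
  moreover have "DK \<beta> K u v = ip (cell K) (bgrad \<beta> (cell K) u) v + ip (cell K) u (bgrad \<beta> (cell K) v)"
    by (rule DK_def)
  ultimately show "DK \<beta> K u v - DK \<beta> K z v - ip (cell K) (\<lambda>x. u x - y x) (bgrad \<beta> (cell K) v) = r K v"
    unfolding elem_residual_def by linarith
qed

lemma residual_R: assumes v: "v \<in> Y" shows "residual \<Omega> \<T> \<beta> f (y, Dh \<T> \<beta> z) v = R v"
proof -
  have "ip \<Omega> f v = (\<Sum>K\<in>\<T>. ip (cell K) f v)"
    by (rule ip_mesh) (rule error_elem(1)[OF _ YspD[OF v]])
  then show ?thesis
    by (simp add: residual_def bform_def Dh_def R_def elem_residual_def sum.distrib sum_subtractf)
qed

lemma error_R:
  assumes v: "v \<in> Y"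
  shows "bform \<T> \<beta> (\<lambda>x. u x - y x, \<lambda>v. Dh \<T> \<beta> u v - Dh \<T> \<beta> z v) v = R v"
proof -
  have "R v = (\<Sum>K\<in>\<T>. DK \<beta> K u v - DK \<beta> K z v - ip (cell K) (\<lambda>x. u x - y x) (bgrad \<beta> (cell K) v))"
    unfolding R_def by (rule sum.cong[OF refl], rule error_elem(2)[OF _ YspD[OF v], symmetric])
  then show ?thesis by (simp add: bform_def Dh_def sum_subtractf)
qed

lemma dual_norm_residual: "dual_norm \<T> \<beta> q Yh (residual \<Omega> \<T> \<beta> f (y, Dh \<T> \<beta> z)) = \<eta>"
  unfolding dual_norm_def by (rule SUP_cong[OF refl]) (use Yh(1) residual_R in auto)

lemma energy_norm_error:
  "energy_norm \<T> \<beta> q (\<lambda>x. u x - y x, \<lambda>v. Dh \<T> \<beta> u v - Dh \<T> \<beta> z v) = dual_norm \<T> \<beta> q Y R"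
  unfolding energy_norm_def dual_norm_def by (rule SUP_cong[OF refl]) (use error_R in auto)

lemma R_projection:
  assumes v: "v \<in> Y"
  shows "R v = R (\<P> v) + (\<Sum>K\<in>\<T>. ip (cell K) (\<lambda>x. f x - QK (max (int k - 2) 0) K f x) (\<lambda>x. v x - \<P> v x))"
proof -
  have "r K v = r K (\<P> v) + ip (cell K) (\<lambda>x. f x - QK (max (int k - 2) 0) K f x) (\<lambda>x. v x - \<P> v x)" if K: "K \<in> \<T>" for K
  proof -
    obtain zp yp where "elem_problem K \<beta> (beta_on \<beta> K) k (J K) p q f z y zp yp" using elem_problem[OF K] by blast
    then interpret e: elem_problem K \<beta> "beta_on \<beta> K" k "J K" p q f z y zp yp .
    note c = Pihpp_cell[OF K]
    have "ip (cell K) g (\<P> v) = ip (cell K) g (PiKpp \<beta> k K v)" for g by (rule ip_cong) (simp add: c)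
    moreover have "bgrad \<beta> (cell K) (\<P> v) = bgrad \<beta> (cell K) (PiKpp \<beta> k K v)" by (rule e.W1_cong(2)[OF c])
    ultimately have "r K (\<P> v) = r K (PiKpp \<beta> k K v)" by (simp add: elem_residual_def DK_def)
    moreover have "ip (cell K) g (\<lambda>x. v x - \<P> v x) = ip (cell K) g (\<lambda>x. v x - PiKpp \<beta> k K v x)" for g
      by (rule ip_cong) (simp add: c)
    ultimately show ?thesis using e.residual_projection[OF YspD[OF v K]] by simp
  qed
  then show ?thesis by (simp add: R_def sum.distrib)
qed

lemma difference_Ysp: assumes v: "v \<in> Y" and w: "w \<in> Y" shows "(\<lambda>x. v x + a * w x) \<in> Y"
  unfolding Ysp_def mem_Collect_eq
proof
  fix K assume K: "K \<in> \<T>"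
  interpret simplex_field K \<beta> "beta_on \<beta> K" by (rule field_K[OF K])
  show "(\<lambda>x. v x + a * w x) \<in> Wsp q \<beta> (cell K)" by (rule Wsp_comb[OF q1 YspD[OF v K] YspD[OF w K]])
qed

lemma oscillation_bound:
  assumes v: "v \<in> Y"
  shows "(\<Sum>K\<in>\<T>. ip (cell K) (\<lambda>x. f x - QK (max (int k - 2) 0) K f x) (\<lambda>x. v x - \<P> v x))
    \<le> osc \<T> \<beta> p k f * N (\<lambda>x. v x - \<P> v x)"
proof -
  let ?F = "\<lambda>K x. f x - QK (max (int k - 2) 0) K f x"
  let ?e = "\<lambda>x. v x - \<P> v x"
  have eY: "?e \<in> Y" using difference_Ysp[OF v projection_Ysp[OF v], of "-1"] by simp
  have F: "?F K \<in> Lsp p (cell K)" if K: "K \<in> \<T>" for K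
  proof -
    obtain zp yp where "elem_problem K \<beta> (beta_on \<beta> K) k (J K) p q f z y zp yp" using elem_problem[OF K] by blast
    then interpret e: elem_problem K \<beta> "beta_on \<beta> K" k "J K" p q f z y zp yp .
    show ?thesis by (rule e.oscillation_Lsp)
  qed
  have e: "?e \<in> Lsp q (cell K)" if K: "K \<in> \<T>" for K using YspD[OF eY K] by (simp add: Wsp_def)
  have "(\<Sum>K\<in>\<T>. ip (cell K) (?F K) ?e) \<le> (\<Sum>K\<in>\<T>. LINT x|lebesgue_on (cell K). \<bar>?F K x * ?e x\<bar>)"
    unfolding ip_def by (intro sum_mono order_trans[OF abs_ge_self integral_abs_bound])
  also have "\<dots> \<le> (\<Sum>K\<in>\<T>. elem_scale \<beta> K powr p * (LINT x|lebesgue_on (cell K). \<bar>?F K x\<bar> powr p)) powr (1 / p)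
     * (\<Sum>K\<in>\<T>. elem_scale \<beta> K powr (- q) * (LINT x|lebesgue_on (cell K). \<bar>?e x\<bar> powr q)) powr (1 / q)"
    by (rule weighted_holder[OF finite_mesh scale_pos F e])
  also have "\<dots> \<le> osc \<T> \<beta> p k f * N ?e"
  proof (rule mult_mono)
    show "(\<Sum>K\<in>\<T>. elem_scale \<beta> K powr p * (LINT x|lebesgue_on (cell K). \<bar>?F K x\<bar> powr p)) powr (1 / p) \<le> osc \<T> \<beta> p k f"
      unfolding osc_def Lnorm_powr[OF p0] by (rule order_refl)
    have "(\<Sum>K\<in>\<T>. elem_scale \<beta> K powr (- q) * (LINT x|lebesgue_on (cell K). \<bar>?e x\<bar> powr q)) \<le> (\<Sum>K\<in>\<T>. E K ?e)"
      unfolding elem_energy_def by (intro sum_mono) (simp add: Bochner_Integration.integral_nonneg)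
    then show "(\<Sum>K\<in>\<T>. elem_scale \<beta> K powr (- q) * (LINT x|lebesgue_on (cell K). \<bar>?e x\<bar> powr q)) powr (1 / q) \<le> N ?e"
      unfolding norm_energy using q0
      by (intro powr_mono2) (auto intro!: sum_nonneg mult_nonneg_nonneg Bochner_Integration.integral_nonneg)
  qed (auto simp: osc_def)
  finally show ?thesis .
qed

lemma estimator_le_error: "\<eta> \<le> dual_norm \<T> \<beta> q Y R"
  unfolding dual_norm_def by (rule SUP_subset_mono) (use Yh(1) in auto)

text \<open>In the extended reals inequalities may be multiplied by the estimator only once its sign
  is known, and a supremum over an empty set would be negative infinity. The constants 1 and -1 are
  admissible test functions, and the residual is nonnegative at one of them.\<close>

lemma estimator_nonneg: assumes ne: "\<T> \<noteq> {}" shows "\<eta> \<ge> 0"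
proof -
  have const: "(\<lambda>x. a) \<in> broken \<T> (VKpp \<beta> k)" for a :: real
    unfolding broken_def mem_Collect_eq
  proof (intro ballI bexI)
    fix K assume K: "K \<in> \<T>"
    interpret stable_simplex K \<beta> "beta_on \<beta> K" k "J K" by (rule stable[OF K])
    have z0: "(\<lambda>x. 0) \<in> (polys j :: 'n scalar set)" for j by (rule fsub_zero[OF polys_nat(2)])
    have "(\<lambda>x. 0) \<in> perp" using z0 by (simp add: polys_perp_def ip_def)
    then have "(\<lambda>x. 0) \<in> VK \<beta> k K" using z0[of "int k - 2"] unfolding VK_def by force
    moreover have "(\<lambda>x. a) \<in> (polys 0 :: 'n scalar set)" using polys_eq_pol[of 0, where 'n='n] pol_const by auto
    ultimately show "(\<lambda>x. a) \<in> VKpp \<beta> k K"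
      unfolding VKpp_def mem_Collect_eq by (intro exI[of _ "\<lambda>x. 0"] exI[of _ "\<lambda>x. a"] exI[of _ 0]) auto
  qed simp
  have Yh1: "(\<lambda>x. a) \<in> Yh" for a using const Yh(2) by blast
  then have Y1: "(\<lambda>x. a) \<in> Y" for a using Yh(1) by blast
  have nz: "nonzero \<T> (\<lambda>x. a)" if "a \<noteq> 0" for a
  proof -
    obtain K where K: "K \<in> \<T>" using ne by blast
    interpret simplex_field K \<beta> "beta_on \<beta> K" by (rule field_K[OF K])
    have "\<not> (AE x in lebesgue_on (cell K). a = 0)"
    proof
      assume "AE x in lebesgue_on (cell K). a = 0"
      then have "(LINT x|lebesgue_on (cell K). a) = 0" by (rule integral_eq_zero_AE)
      then show False unfolding integral_const_cell using vol_pos that by simp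
    qed
    then show ?thesis using K by (auto simp: nonzero_def)
  qed
  have "r K (\<lambda>x. -1) = - r K (\<lambda>x. 1)" if K: "K \<in> \<T>" for K
  proof -
    obtain zp yp where "elem_problem K \<beta> (beta_on \<beta> K) k (J K) p q f z y zp yp" using elem_problem[OF K] by blast
    then interpret e: elem_problem K \<beta> "beta_on \<beta> K" k "J K" p q f z y zp yp .
    \<comment> \<open>The constant -1 is written as 1 + (-2) * 1 to fit the combination
      rule.\<close>
    show ?thesis using e.residual_comb[OF YspD[OF Y1 K] YspD[OF Y1 K], of 1 "-2" 1] by simp
  qed
  then have neg: "R (\<lambda>x. -1) = - R (\<lambda>x. 1)" by (simp add: R_def sum_negf)
  have ge: "0 \<le> \<eta>" if "R (\<lambda>x. a) \<ge> 0" "a \<noteq> 0" for a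
  proof -
    have "0 \<le> ereal (R (\<lambda>x. a) / N (\<lambda>x. a))" using that(1) norm_nonneg by simp
    also have "\<dots> \<le> \<eta>" unfolding dual_norm_def by (rule SUP_upper) (simp add: Yh1 nz that(2))
    finally show ?thesis .
  qed
  show ?thesis using ge[of 1] ge[of "-1"] neg by fastforce
qed

text \<open>The residual of v splits into that of its projection, which is an admissible test
  function for the estimator, and the oscillation term. Dividing each part by the norm of v and
  inserting the norm of the projected function, or of its complement, produces the operator
  norms.\<close>

lemma error_le:
  "dual_norm \<T> \<beta> q Y R \<le> op_norm \<T> \<beta> q \<P> * \<eta> + op_norm \<T> \<beta> q (\<lambda>v x. v x - \<P> v x) * ereal (osc \<T> \<beta> p k f)"
  (is "_ \<le> ?P * \<eta> + ?I * ereal ?o")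
  unfolding dual_norm_def[of \<T> \<beta> q Y]
proof (rule SUP_least)
  fix v assume "v \<in> {v \<in> Y. nonzero \<T> v}"
  then have v: "v \<in> Y" and nz: "nonzero \<T> v" by auto
  have Nv: "N v > 0" by (rule norm_pos[OF v nz])
  have eta: "\<eta> \<ge> 0" by (rule estimator_nonneg) (use nz in \<open>auto simp: nonzero_def\<close>)
  have P: "ereal (N (\<P> v) / N v) \<le> ?P" by (rule op_norm_ge[OF v nz])
  have I: "ereal (N (\<lambda>x. v x - \<P> v x) / N v) \<le> ?I" by (rule op_norm_ge[OF v nz, of "\<lambda>v x. v x - \<P> v x"])
  have P0: "0 \<le> ereal (N (\<P> v) / N v)" using norm_nonneg Nv by simp
  have o: "0 \<le> ereal ?o" by (simp add: osc_def)
  have 1: "ereal (R (\<P> v) / N v) \<le> ?P * \<eta>"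
  proof (cases "nonzero \<T> (\<P> v)")
    case True
    have PY: "\<P> v \<in> Yh" using projection_broken[OF v] Yh(2) by blast
    have NP: "N (\<P> v) > 0" by (rule norm_pos[OF projection_Ysp[OF v] True])
    have "ereal (R (\<P> v) / N v) = ereal (N (\<P> v) / N v) * ereal (R (\<P> v) / N (\<P> v))" using NP by simp
    also have "\<dots> \<le> ereal (N (\<P> v) / N v) * \<eta>"
      by (rule ereal_mult_left_mono[OF _ P0], unfold dual_norm_def, rule SUP_upper) (simp add: PY True)
    also have "\<dots> \<le> ?P * \<eta>" by (rule ereal_mult_right_mono[OF P eta])
    finally show ?thesis .
  next
    \<comment> \<open>A projection that vanishes almost everywhere is excluded from the supremum.
      The residual depends on the equivalence class only, so it is zero there.\<close>
    case False
    have "r K (\<P> v) = 0" if K: "K \<in> \<T>" for K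
    proof -
      obtain zp yp where "elem_problem K \<beta> (beta_on \<beta> K) k (J K) p q f z y zp yp" using elem_problem[OF K] by blast
      then interpret e: elem_problem K \<beta> "beta_on \<beta> K" k "J K" p q f z y zp yp .
      have ae: "AE x in lebesgue_on (cell K). \<P> v x = 0" using False K by (auto simp: nonzero_def)
      have z0: "ip (cell K) g (\<P> v) = 0" for g
        unfolding ip_def by (rule integral_eq_zero_AE) (use ae in eventually_elim, simp)
      note W = YspD[OF projection_Ysp[OF v] K]
      have w0: "weak_deriv \<beta> (cell K) (\<P> v) (\<lambda>x. 0)"
      proof -
        have "ip (cell K) (\<P> v) g = 0" for g
          unfolding ip_def by (rule integral_eq_zero_AE) (use ae in eventually_elim, simp)
        then show ?thesis unfolding weak_deriv_def by (simp add: ip_def)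
      qed
      have b: "AE x in lebesgue_on (cell K). bgrad \<beta> (cell K) (\<P> v) x = 0"
        by (rule W1_I(2)[OF W1_bgrad(1)[OF e.Wsp_bgrad(1)[OF q1 W]] _ w0]) simp
      have "ip (cell K) g (bgrad \<beta> (cell K) (\<P> v)) = 0" for g
        unfolding ip_def by (rule integral_eq_zero_AE) (use b in eventually_elim, simp)
      then show ?thesis by (simp add: elem_residual_def DK_def z0)
    qed
    then have "R (\<P> v) = 0" by (simp add: R_def)
    moreover have "0 \<le> ?P * \<eta>" using order_trans[OF P0 P] eta by (rule ereal_0_le_mult)
    ultimately show ?thesis by (simp add: zero_ereal_def)
  qed
  have 2: "ereal (?o * N (\<lambda>x. v x - \<P> v x) / N v) \<le> ?I * ereal ?o"
    using ereal_mult_right_mono[OF I o] by (simp add: mult.commute)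
  have "R v \<le> R (\<P> v) + ?o * N (\<lambda>x. v x - \<P> v x)"
    using R_projection[OF v] oscillation_bound[OF v] by linarith
  then have "R v / N v \<le> (R (\<P> v) + ?o * N (\<lambda>x. v x - \<P> v x)) / N v"
    using Nv by (intro divide_right_mono) auto
  then have "ereal (R v / N v) \<le> ereal (R (\<P> v) / N v) + ereal (?o * N (\<lambda>x. v x - \<P> v x) / N v)"
    by (simp add: add_divide_distrib)
  also have "\<dots> \<le> ?P * \<eta> + ?I * ereal ?o" by (rule add_mono[OF 1 2])
  finally show "ereal (R v / N v) \<le> ?P * \<eta> + ?I * ereal ?o" .
qed

lemma osc_piecewise_constant:
  assumes c: "f \<in> broken \<T> (\<lambda>_. polys 0)" shows "osc \<T> \<beta> p k f = 0"
proof -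
  have "Lnorm p (cell K) (\<lambda>x. f x - QK (max (int k - 2) 0) K f x) = 0" if K: "K \<in> \<T>" for K
  proof -
    obtain zp yp where "elem_problem K \<beta> (beta_on \<beta> K) k (J K) p q f z y zp yp" using elem_problem[OF K] by blast
    then interpret e: elem_problem K \<beta> "beta_on \<beta> K" k "J K" p q f z y zp yp .
    obtain w where w: "w \<in> polys 0" "AE x in lebesgue_on (cell K). f x = w x" using c K unfolding broken_def by blast
    have "AE x in lebesgue_on (cell K). f x - QK (max (int k - 2) 0) K f x = 0" by (rule e.Q_constant[OF w])
    then have "AE x in lebesgue_on (cell K). \<bar>f x - QK (max (int k - 2) 0) K f x\<bar> powr p = 0"
      by eventually_elim simp
    then show ?thesis unfolding Lnorm_def by (subst integral_eq_zero_AE) auto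
  qed
  then show ?thesis by (simp add: osc_def)
qed

end

section \<open>Uniformity of the constants\<close>

text \<open>Naming the property with element, field and function quantified inside allows a choice
  by \<open>SOME\<close> that depends on the dimension, k, \<theta> and \<kappa> alone.\<close>

definition projection_bound :: "'n::finite itself \<Rightarrow> nat \<Rightarrow> real \<Rightarrow> real \<Rightarrow> real \<Rightarrow> bool" where
  "projection_bound _ k \<theta> \<kappa> C \<longleftrightarrow> C \<ge> 0 \<and> (\<forall>(K :: 'n vsimplex) \<beta> c J v x. stable_simplex K \<beta> c k J \<longrightarrow>
    (\<forall>i\<in>J. \<theta> \<le> diameter (elem K) / norm c * \<bar>grd K i \<bullet> c\<bar>) \<longrightarrow>
    mat_norm (ref_matrix K) * mat_norm (matrix_inv (ref_matrix K)) \<le> \<kappa> \<longrightarrow> v \<in> W1 \<beta> K \<longrightarrow> x \<in> elem K \<longrightarrow>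
    \<bar>PiKpp \<beta> k K v x\<bar> \<le> C * (((LINT x|lebesgue_on (cell K). \<bar>v x\<bar>)
        + diameter (elem K) / norm c * (LINT x|lebesgue_on (cell K). \<bar>bgrad \<beta> (cell K) v x\<bar>)) / measure lebesgue (cell K)) \<and>
    diameter (elem K) / norm c * \<bar>dd c (PiKpp \<beta> k K v) x\<bar> \<le> C * (((LINT x|lebesgue_on (cell K). \<bar>v x\<bar>)
        + diameter (elem K) / norm c * (LINT x|lebesgue_on (cell K). \<bar>bgrad \<beta> (cell K) v x\<bar>)) / measure lebesgue (cell K)))"

lemma projection_bound_exists:
  "k \<ge> 1 \<Longrightarrow> \<theta> > 0 \<Longrightarrow> \<kappa> \<ge> 0 \<Longrightarrow> \<exists>C. projection_bound TYPE('n::finite) k \<theta> \<kappa> C"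
  unfolding projection_bound_def using PiKpp_uniform_bound[where 'n='n] by (simp only: Bex_def)

text \<open>For \<open>k = 1\<close> the barycentric gradients alone give two facets on which the flow is not tangential.\<close>

definition flow_angle :: "'n::finite itself \<Rightarrow> nat \<Rightarrow> real \<Rightarrow> real" where
  "flow_angle _ k \<theta> = (if k = 1 then 1 / (2 * real CARD('n option)) else \<theta>)"

definition energy_const :: "'n::finite itself \<Rightarrow> nat \<Rightarrow> real \<Rightarrow> real \<Rightarrow> real \<Rightarrow> real" where
  "energy_const T k q \<theta> \<kappa> = 2 * (2 * (SOME C. projection_bound T k (flow_angle T k \<theta>) \<kappa> C)) powr q"

text \<open>The first entry bounds the projection; the second bounds its complement through the
  estimate of |a + b|^q by 2^q (|a|^q + |b|^q). With the maximum both assertions hold for one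
  constant, the second with an extra summand 1 to spare.\<close>

definition stability_const :: "'n::finite itself \<Rightarrow> nat \<Rightarrow> real \<Rightarrow> real \<Rightarrow> real \<Rightarrow> real" where
  "stability_const T k q \<theta> \<kappa> = max (energy_const T k q \<theta> \<kappa> powr (1 / q))
     ((2 powr q * (1 + energy_const T k q \<theta> \<kappa>)) powr (1 / q))"

lemma mesh_problem_of_mesh:
  fixes \<Omega> :: "(real^'n::finite) set"
  assumes k: "k \<ge> 1" and p: "1 < p" "q = p / (p - 1)" and \<kappa>: "\<kappa> > 0" and \<theta>: "\<theta> > 0"
    and lip: "lipschitz_domain \<Omega>" and conf: "conforming_mesh \<Omega> \<T>"
    and shape: "\<forall>K\<in>\<T>. mat_norm (ref_matrix K) * mat_norm (matrix_inv (ref_matrix K)) \<le> \<kappa>"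
    and adm: "admissible_field \<T> \<beta>"
    and angle: "k = 1 \<or> (\<forall>K\<in>\<T>. \<forall>i. \<bar>beta_on \<beta> K \<bullet> normal K i\<bar> \<ge> \<theta> * norm (beta_on \<beta> K))"
  shows "\<exists>J. mesh_problem \<Omega> \<T> p q \<beta> k J (energy_const TYPE('n) k q \<theta> \<kappa>)"
proof -
  define t where "t = flow_angle TYPE('n) k \<theta>"
  have t: "t > 0" using \<theta> by (auto simp: t_def flow_angle_def)
  define C where "C = (SOME C. projection_bound TYPE('n) k t \<kappa> C)"
  have C: "projection_bound TYPE('n) k t \<kappa> C"
    unfolding C_def by (rule someI_ex[OF projection_bound_exists[OF k t]]) (use \<kappa> in simp)
  have eC: "energy_const TYPE('n) k q \<theta> \<kappa> = 2 * (2 * C) powr q" by (simp add: energy_const_def C_def t_def)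
  \<comment> \<open>All facets above the threshold are taken; \<open>stable_simplex_indices\<close>
    shows that there are enough of them.\<close>
  define J where "J = (\<lambda>K :: 'n vsimplex. {i. t \<le> diameter (elem K) / norm (beta_on \<beta> K) * \<bar>grd K i \<bullet> beta_on \<beta> K\<bar>})"
  interpret mesh \<Omega> \<T> by unfold_locales (rule lip conf)+
  interpret conjugate_exponents p q by unfold_locales (rule p)+
  have st: "stable_simplex K \<beta> (beta_on \<beta> K) k (J K)" if K: "K \<in> \<T>" for K
  proof -
    note nd = mesh_nondegenerate[OF K]
    obtain c where c: "c \<noteq> 0" "\<forall>x\<in>cell K. \<beta> x = c" using adm K unfolding admissible_field_def by blast
    interpret simplex_field K \<beta> c using nd c(2) by unfold_locales auto
    have h: "k = 1 \<and> t = 1 / (2 * real CARD('n option)) \<or> (\<forall>i. t * norm c \<le> \<bar>c \<bullet> normal K i\<bar>)"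
    proof (cases "k = 1")
      case True
      then show ?thesis by (simp only: t_def flow_angle_def if_True simp_thms)
    next
      case False
      then have "\<forall>i. \<theta> * norm (beta_on \<beta> K) \<le> \<bar>beta_on \<beta> K \<bullet> normal K i\<bar>" using angle K by blast
      then show ?thesis using False unfolding beta_on_eq by (simp add: t_def flow_angle_def)
    qed
    show ?thesis unfolding J_def beta_on_eq
      by (rule stable_simplex_indices[OF nd beta c(1) k t h])
  qed
  have "mesh_problem \<Omega> \<T> p q \<beta> k J (energy_const TYPE('n) k q \<theta> \<kappa>)"
  proof (intro mesh_problem.intro mesh_problem_axioms.intro mesh_axioms conjugate_exponents_axioms)
    show "K \<in> \<T> \<Longrightarrow> stable_simplex K \<beta> (beta_on \<beta> K) k (J K)" for K by (rule st)
    show "0 \<le> energy_const TYPE('n) k q \<theta> \<kappa>" by (simp add: eC)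
    fix K v assume K: "K \<in> \<T>" and v: "v \<in> Wsp q \<beta> (cell K)"
    interpret stable_simplex K \<beta> "beta_on \<beta> K" k "J K" by (rule st[OF K])
    have J: "\<forall>i\<in>J K. t \<le> diameter (elem K) / norm (beta_on \<beta> K) * \<bar>grd K i \<bullet> beta_on \<beta> K\<bar>" by (simp add: J_def)
    have vW: "v \<in> W1 \<beta> K" by (rule Wsp_bgrad(1)[OF _ v]) (use q_gt_1 in simp)
    have bnd: "\<bar>PiKpp \<beta> k K v x\<bar> \<le> C * (size1 v / vol)"
      "hb * \<bar>dd (beta_on \<beta> K) (PiKpp \<beta> k K v) x\<bar> \<le> C * (size1 v / vol)" if x: "x \<in> elem K" for x
      using C st[OF K] J bspec[OF shape K] vW x unfolding projection_bound_def hb_def by blast+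
    show "elem_energy \<beta> q K (PiKpp \<beta> k K v) \<le> energy_const TYPE('n) k q \<theta> \<kappa> * elem_energy \<beta> q K v"
      unfolding eC
      by (rule energy_bound[OF conjugate_exponents_axioms _ v bnd]) (use C in \<open>simp_all add: projection_bound_def\<close>)
  qed
  then show ?thesis by (rule exI[of _ J])
qed

theorem theorem8p1:
  shows "\<exists>C :: nat \<Rightarrow> real \<Rightarrow> real \<Rightarrow> real \<Rightarrow> real.
    (\<forall>q \<theta> \<theta>' \<kappa>0. C 1 q \<theta> \<kappa>0 = C 1 q \<theta>' \<kappa>0) \<and>
    (\<forall>(k::nat) (p::real) (q::real) (\<theta>0::real) (\<kappa>0::real)
      (\<Omega> :: (real ^ 'n::finite) set) (\<T> :: 'n vsimplex set) (\<beta> :: 'n field)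
      (Yh :: 'n scalar set) (f :: 'n scalar) (u :: 'n scalar) (uh :: 'n scalar) (\<mu>h :: 'n functional).
      k \<ge> 1 \<and> 1 < p \<and> q = p / (p - 1) \<and> \<kappa>0 > 0 \<and> 0 < \<theta>0 \<and> \<theta>0 \<le> 1 \<and>
      lipschitz_domain \<Omega> \<and> polyhedral \<Omega> \<and> conforming_mesh \<Omega> \<T> \<and>
      (\<forall>K\<in>\<T>. mat_norm (ref_matrix K) * mat_norm (matrix_inv (ref_matrix K)) \<le> \<kappa>0) \<and>
      admissible_field \<T> \<beta> \<and> flow_condition_i \<Omega> \<T> \<beta> \<and> flow_condition_ii \<Omega> \<T> \<beta> \<and>
      (k = 1 \<or> (\<forall>K\<in>\<T>. \<forall>i. \<bar>beta_on \<beta> K \<bullet> normal K i\<bar> \<ge> \<theta>0 * norm (beta_on \<beta> K))) \<and>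
      finite_dim_subspace \<T> (Ysp \<T> \<beta> q) Yh \<and>
      broken \<T> (VK \<beta> k) \<subseteq> Yh \<and> broken \<T> (VKpp \<beta> k) \<subseteq> Yh \<and>
      f \<in> Lsp p \<Omega> \<and> u \<in> W0sp \<Omega> \<T> \<beta> p \<and> weak_deriv \<beta> \<Omega> u f \<and>
      is_minimizer \<Omega> \<T> \<beta> q k Yh f (uh, \<mu>h)
      \<longrightarrow>
      (let \<eta> = dual_norm \<T> \<beta> q Yh (residual \<Omega> \<T> \<beta> f (uh, \<mu>h));
           err = energy_norm \<T> \<beta> q (\<lambda>x. u x - uh x, \<lambda>v. Dh \<T> \<beta> u v - \<mu>h v);
           nPi = op_norm \<T> \<beta> q (Pihpp \<T> \<beta> k);
           nIPi = op_norm \<T> \<beta> q (\<lambda>v x. v x - Pihpp \<T> \<beta> k v x)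
       in \<eta> \<le> err \<and> err \<le> nPi * \<eta> + nIPi * ereal (osc \<T> \<beta> p k f) \<and>
          nPi \<le> ereal (C k q \<theta>0 \<kappa>0) \<and> nIPi \<le> ereal (1 + C k q \<theta>0 \<kappa>0) \<and>
          (f \<in> broken \<T> (\<lambda>_. polys 0) \<longrightarrow> osc \<T> \<beta> p k f = 0)))"
proof (intro exI[of _ "stability_const TYPE('n)"] conjI allI impI, goal_cases)
  \<comment> \<open>For k = 1 the parameter \<theta> enters through \<open>flow_angle\<close> alone,
    which is then a function of the dimension.\<close>
  case (1 q \<theta> \<theta>' \<kappa>0)
  then show ?case by (simp add: stability_const_def energy_const_def flow_angle_def)
next
  case (2 k p q \<theta>0 \<kappa>0 \<Omega> \<T> \<beta> Yh f u uh \<mu>h)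
  then have h: "k \<ge> 1" "1 < p" "q = p / (p - 1)" "\<kappa>0 > 0" "0 < \<theta>0" "lipschitz_domain \<Omega>" "conforming_mesh \<Omega> \<T>"
    "\<forall>K\<in>\<T>. mat_norm (ref_matrix K) * mat_norm (matrix_inv (ref_matrix K)) \<le> \<kappa>0"
    "admissible_field \<T> \<beta>" "k = 1 \<or> (\<forall>K\<in>\<T>. \<forall>i. \<bar>beta_on \<beta> K \<bullet> normal K i\<bar> \<ge> \<theta>0 * norm (beta_on \<beta> K))"
    and fin: "finite_dim_subspace \<T> (Ysp \<T> \<beta> q) Yh" and sub: "broken \<T> (VKpp \<beta> k) \<subseteq> Yh"
    and f: "f \<in> Lsp p \<Omega>" and u: "u \<in> W0sp \<Omega> \<T> \<beta> p" "weak_deriv \<beta> \<Omega> u f"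
    and m: "is_minimizer \<Omega> \<T> \<beta> q k Yh f (uh, \<mu>h)" by - (elim conjE; assumption)+
  let ?B = "energy_const TYPE('n) k q \<theta>0 \<kappa>0"
  let ?C = "stability_const TYPE('n) k q \<theta>0 \<kappa>0"
  obtain J where "mesh_problem \<Omega> \<T> p q \<beta> k J ?B" using mesh_problem_of_mesh[OF h] by blast
  then interpret mesh_problem \<Omega> \<T> p q \<beta> k J ?B .
  have "(uh, \<mu>h) \<in> Xh \<Omega> \<T> \<beta> k" using m by (simp add: is_minimizer_def)
  then obtain z where uh: "uh \<in> broken \<T> (\<lambda>_. polys (int k - 1))" and z: "z \<in> Sh0 \<Omega> \<T> \<beta> k" and \<mu>: "\<mu>h = Dh \<T> \<beta> z"
    unfolding Xh_def by blast
  interpret error_problem \<Omega> \<T> p q \<beta> k J ?B Yh f u uh z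
  proof
    show "Yh \<subseteq> Ysp \<T> \<beta> q" using fin unfolding finite_dim_subspace_def by blast
    show "u \<in> Lsp p \<Omega>" using u(1) by (simp add: W0sp_def Wsp_def)
  qed (rule sub f u(2) uh z)+
  have "op_norm \<T> \<beta> q (Pihpp \<T> \<beta> k) \<le> ereal ?C"
  proof (rule op_norm_le)
    fix v assume v: "v \<in> Y"
    have "N (\<P> v) \<le> ?B powr (1 / q) * N v" by (rule projection_norm[OF v])
    also have "\<dots> \<le> ?C * N v" by (intro mult_right_mono norm_nonneg) (simp add: stability_const_def)
    finally show "N (\<P> v) \<le> ?C * N v" .
  qed
  moreover have "op_norm \<T> \<beta> q (\<lambda>v x. v x - Pihpp \<T> \<beta> k v x) \<le> ereal (1 + ?C)"
  proof (rule op_norm_le)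
    fix v assume v: "v \<in> Y"
    have "N (\<lambda>x. v x - \<P> v x) \<le> (2 powr q * (1 + ?B)) powr (1 / q) * N v" by (rule complement_norm[OF v])
    also have "\<dots> \<le> (1 + ?C) * N v" by (intro mult_right_mono norm_nonneg) (simp add: stability_const_def)
    finally show "N (\<lambda>x. v x - \<P> v x) \<le> (1 + ?C) * N v" .
  qed
  ultimately show ?case
    unfolding Let_def \<mu> dual_norm_residual energy_norm_error
    using estimator_le_error error_le osc_piecewise_constant by blast
qed

end
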